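(* Let $\zeta\in[0,2)$ and $\rho\in(0,1/\zeta)$, with the convention $1/0:=\infty$. Let $L=(L_t)_{t\in\mathbb{R}}$ be a two-sided mean zero Lévy process with no Gaussian component and with a Lévy density $\kappa$ satisfying $\kappa(x)\le|x|^{-1-\zeta}$ for all $x\in[-1,1]$ (with $x\neq0$) and $\kappa(x)\le|x|^{-3}$ for all $x\in\mathbb{R}$ with $|x|>1$. Let $(X_t)_{t\in\mathbb{R}}$ be the linear fractional Lévy noise $$X_t=Y_t-Y_{t-1},\qquad Y_t=\int_{-\infty}^t\Big\{(t-s)_+^{-\rho}-(-s)_+^{-\rho}\Big\}\,dL_s .$$ Let $f\in C_b^2(\mathbb{R})$, $V_n=n^{-1/2}\sum_{t=1}^n(f(X_t)-\mathbb{E}[f(X_1)])$, $v_n=\sqrt{\mathrm{var}(V_n)}$, suppose that $v^2=\sum_{j\in\mathbb{Z}}\mathrm{cov}(f(X_0),f(X_j))$ satisfies $v^2>0$, and let $Z\sim\mathcal{N}(0,1)$. Then for all $\epsilon>0$ there is a constant $C>0$ not depending on $n$ such that, for all $n\in\mathbb{N}$ with $v_n>0$, $$d_W(v_n^{-1}V_n,Z)\le C\begin{cases}n^{-1/2} & \text{if }\rho>\frac12,\\ n^{-\rho+\epsilon} & \text{if }\rho\le\frac12,\end{cases}$$ and $$d_K(v_n^{-1}V_n,Z)\le C\begin{cases}n^{-1/2} & \text{if }\rho>1,\\ n^{-\rho/2+\epsilon} & \text{if }\rho\le1.\end{cases}$$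
   Context: $C_b^2(\mathbb{R})$ is the space of twice continuously differentiable $f:\mathbb{R}\to\mathbb{R}$ with $f,f',f''$ bounded. $x_+^a$ is $x^a$ for $x>0$ and $0$ for $x\le0$. A Lévy density is a density of the Lévy measure with respect to Lebesgue measure. Stochastic integrals of deterministic functions with respect to $L$ are understood in the usual sense of Rajput and Rosiński; $L_0=0$ a.s. The Wasserstein distance is $d_W(F,G)=\sup_h|\mathbb{E}[h(F)]-\mathbb{E}[h(G)]|$, the supremum being over all functions $h:\mathbb{R}\to\mathbb{R}$ that are Lipschitz with constant at most $1$. The Kolmogorov distance is $d_K(F,G)=\sup_{x\in\mathbb{R}}|\mathbb{P}(F\le x)-\mathbb{P}(G\le x)|$. *)

theory Defs
  imports "HOL-Probability.Probability"
begin

definition cadlag :: "(real \<Rightarrow> real) \<Rightarrow> bool" where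
  "cadlag x \<longleftrightarrow>
     (\<forall>t. (x \<longlongrightarrow> x t) (at_right t)) \<and> (\<forall>t. \<exists>l. (x \<longlongrightarrow> l) (at_left t))"

definition tendsto_in_prob :: "'a measure \<Rightarrow> (nat \<Rightarrow> 'a \<Rightarrow> real) \<Rightarrow> ('a \<Rightarrow> real) \<Rightarrow> bool" where
  "tendsto_in_prob M Z W \<longleftrightarrow>
     (\<forall>n. Z n \<in> borel_measurable M) \<and> W \<in> borel_measurable M \<and>
     (\<forall>e>0. (\<lambda>n. measure M {\<omega> \<in> space M. \<bar>Z n \<omega> - W \<omega>\<bar> > e}) \<longlonglongrightarrow> 0)"

definition two_sided_levy_process :: "'a measure \<Rightarrow> (real \<Rightarrow> 'a \<Rightarrow> real) \<Rightarrow> bool" where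
  "two_sided_levy_process M L \<longleftrightarrow>
     prob_space M \<and>
     (\<forall>t. L t \<in> borel_measurable M) \<and>
     (AE \<omega> in M. L 0 \<omega> = 0) \<and>
     (\<forall>(t :: nat \<Rightarrow> real) n. strict_mono t \<longrightarrow>
        prob_space.indep_vars M (\<lambda>_. borel) (\<lambda>i \<omega>. L (t (Suc i)) \<omega> - L (t i) \<omega>) {..<n}) \<and>
     (\<forall>s t h. s \<le> t \<longrightarrow>
        distr M borel (\<lambda>\<omega>. L (t + h) \<omega> - L (s + h) \<omega>) = distr M borel (\<lambda>\<omega>. L t \<omega> - L s \<omega>)) \<and>
     (\<forall>t e. e > 0 \<longrightarrow>
        ((\<lambda>s. measure M {\<omega> \<in> space M. \<bar>L s \<omega> - L t \<omega>\<bar> > e}) \<longlongrightarrow> 0) (at t)) \<and>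
     (AE \<omega> in M. cadlag (\<lambda>t. L t \<omega>))"

definition levy_measure :: "real measure \<Rightarrow> bool" where
  "levy_measure \<nu> \<longleftrightarrow>
     sets \<nu> = sets borel \<and> emeasure \<nu> {0} = 0 \<and>
     (\<integral>\<^sup>+ x. ennreal (min 1 (x\<^sup>2)) \<partial>\<nu>) < \<infinity>"

definition levy_exponent :: "real \<Rightarrow> real \<Rightarrow> real measure \<Rightarrow> real \<Rightarrow> complex" where
  "levy_exponent b s2 \<nu> u =
     \<i> * of_real (u * b) - of_real (s2 * u\<^sup>2 / 2)
     + (\<integral>x. (iexp (u * x) - 1 - \<i> * of_real (u * x) * indicator {-1..1} x) \<partial>\<nu>)"

text \<open>The characteristic triplet (drift relative to the truncation at 1, Gaussian variance,
  Levy measure), given by the Levy-Khintchine representation of the law at time 1.\<close>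

definition has_levy_triplet ::
    "'a measure \<Rightarrow> (real \<Rightarrow> 'a \<Rightarrow> real) \<Rightarrow> real \<Rightarrow> real \<Rightarrow> real measure \<Rightarrow> bool" where
  "has_levy_triplet M L b s2 \<nu> \<longleftrightarrow>
     s2 \<ge> 0 \<and> levy_measure \<nu> \<and>
     (\<forall>u. char (distr M borel (L 1)) u = exp (levy_exponent b s2 \<nu> u))"

text \<open>The integral follows Rajput and Rosinski, with the bounded Borel sets as the delta-ring on
  which the random measure is defined.\<close>

definition bounded_borel :: "real set set" where
  "bounded_borel = {A \<in> sets borel. bounded A}"

definition independently_scattered :: "'a measure \<Rightarrow> (real set \<Rightarrow> 'a \<Rightarrow> real) \<Rightarrow> bool" where
  "independently_scattered M \<Lambda> \<longleftrightarrow>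
     (\<forall>A \<in> bounded_borel. \<Lambda> A \<in> borel_measurable M) \<and>
     (\<forall>A :: nat \<Rightarrow> real set. range A \<subseteq> bounded_borel \<and> disjoint_family A \<longrightarrow>
        prob_space.indep_vars M (\<lambda>_. borel) (\<lambda>n. \<Lambda> (A n)) UNIV \<and>
        ((\<Union>n. A n) \<in> bounded_borel \<longrightarrow>
           (AE \<omega> in M. (\<lambda>n. \<Lambda> (A n) \<omega>) sums \<Lambda> (\<Union>n. A n) \<omega>)))"

definition levy_random_measure ::
    "'a measure \<Rightarrow> (real \<Rightarrow> 'a \<Rightarrow> real) \<Rightarrow> (real set \<Rightarrow> 'a \<Rightarrow> real) \<Rightarrow> bool" where
  "levy_random_measure M L \<Lambda> \<longleftrightarrow>
     independently_scattered M \<Lambda> \<and>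
     (\<forall>s t. s \<le> t \<longrightarrow> (AE \<omega> in M. \<Lambda> {s<..t} \<omega> = L t \<omega> - L s \<omega>))"

definition simple_integrand :: "(real \<Rightarrow> real) \<Rightarrow> bool" where
  "simple_integrand \<phi> \<longleftrightarrow> simple_function borel \<phi> \<and> bounded {s. \<phi> s \<noteq> 0}"

definition simple_integral ::
    "(real set \<Rightarrow> 'a \<Rightarrow> real) \<Rightarrow> real set \<Rightarrow> (real \<Rightarrow> real) \<Rightarrow> 'a \<Rightarrow> real" where
  "simple_integral \<Lambda> A \<phi> \<omega> = (\<Sum>y \<in> range \<phi> - {0}. y * \<Lambda> (A \<inter> \<phi> -` {y}) \<omega>)"

text \<open>\<^term>\<open>W\<close> is a version of the integral of \<^term>\<open>g\<close> over \<^term>\<open>A\<close>; in particular \<^term>\<open>g\<close> is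
  integrable on the whole line. The control measure of the random measure induced by a Levy process
  is a constant multiple of Lebesgue measure. The random measure is determined by \<^term>\<open>L\<close> up to null
  sets, so the integral does not depend on its choice.\<close>

definition has_levy_integral ::
    "'a measure \<Rightarrow> (real \<Rightarrow> 'a \<Rightarrow> real) \<Rightarrow> real set \<Rightarrow> (real \<Rightarrow> real) \<Rightarrow> ('a \<Rightarrow> real) \<Rightarrow> bool" where
  "has_levy_integral M L A g W \<longleftrightarrow>
     g \<in> borel_measurable borel \<and> A \<in> sets borel \<and>
     (\<exists>\<Lambda> \<phi>. levy_random_measure M L \<Lambda> \<and>
        (\<forall>n :: nat. simple_integrand (\<phi> n)) \<and>
        (AE s in lborel. (\<lambda>n. \<phi> n s) \<longlonglongrightarrow> g s) \<and>
        (\<forall>B \<in> sets borel. \<exists>U. tendsto_in_prob M (\<lambda>n. simple_integral \<Lambda> B (\<phi> n)) U) \<and>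
        tendsto_in_prob M (\<lambda>n. simple_integral \<Lambda> A (\<phi> n)) W)"

definition pos_powr :: "real \<Rightarrow> real \<Rightarrow> real" where
  "pos_powr x a = (if x > 0 then x powr a else 0)"

text \<open>The kernel vanishes for \<open>s \<ge> max t 0\<close>. For \<open>t < 0\<close> its second term is nonzero on
  \<open>(t, 0)\<close>, and that part belongs to the integral: without it the increments of
  \<^term>\<open>Y\<close> would not be stationary. Hence the upper limit \<open>max t 0\<close>, which is \<open>t\<close> for \<open>t \<ge> 0\<close>.\<close>

definition linear_fractional_levy_motion ::
    "'a measure \<Rightarrow> (real \<Rightarrow> 'a \<Rightarrow> real) \<Rightarrow> real \<Rightarrow> (real \<Rightarrow> 'a \<Rightarrow> real) \<Rightarrow> bool" where
  "linear_fractional_levy_motion M L \<rho> Y \<longleftrightarrow>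
     (\<forall>t. has_levy_integral M L {..max t 0}
            (\<lambda>s. pos_powr (t - s) (- \<rho>) - pos_powr (- s) (- \<rho>)) (Y t))"

definition C2_bounded :: "(real \<Rightarrow> real) \<Rightarrow> bool" where
  "C2_bounded f \<longleftrightarrow>
     (\<exists>f' f''. (\<forall>x. (f has_real_derivative f' x) (at x)) \<and>
        (\<forall>x. (f' has_real_derivative f'' x) (at x)) \<and> continuous_on UNIV f'' \<and>
        bounded (range f) \<and> bounded (range f') \<and> bounded (range f''))"

definition covariance :: "'a measure \<Rightarrow> ('a \<Rightarrow> real) \<Rightarrow> ('a \<Rightarrow> real) \<Rightarrow> real" where
  "covariance M F G = (\<integral>\<omega>. (F \<omega> - (\<integral>\<omega>. F \<omega> \<partial>M)) * (G \<omega> - (\<integral>\<omega>. G \<omega> \<partial>M)) \<partial>M)"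

text \<open>The two random variables may live on different probability spaces.\<close>

definition wasserstein_dist ::
    "'a measure \<Rightarrow> ('a \<Rightarrow> real) \<Rightarrow> 'b measure \<Rightarrow> ('b \<Rightarrow> real) \<Rightarrow> ennreal" where
  "wasserstein_dist M F N G =
     (SUP h \<in> {h :: real \<Rightarrow> real. 1-lipschitz_on UNIV h}.
        ennreal \<bar>(\<integral>\<omega>. h (F \<omega>) \<partial>M) - (\<integral>\<omega>. h (G \<omega>) \<partial>N)\<bar>)"

definition kolmogorov_dist ::
    "'a measure \<Rightarrow> ('a \<Rightarrow> real) \<Rightarrow> 'b measure \<Rightarrow> ('b \<Rightarrow> real) \<Rightarrow> real" where
  "kolmogorov_dist M F N G =
     (SUP x. \<bar>measure M {\<omega> \<in> space M. F \<omega> \<le> x} - measure N {\<omega> \<in> space N. G \<omega> \<le> x}\<bar>)"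

end

theory Submission
 imports Defs "HOL-Real_Asymp.Real_Asymp"
begin

text \<open>
Write the noise as a moving average \<open>X t = \<integral> g (t - s) dL s\<close> and cut the time axis into unit blocks.
The contributions \<open>\<xi> j t\<close> of the blocks \<open>j\<close> to \<open>X t\<close> are independent in \<open>j\<close>, and since the Levy measure has
moments of every order \<open>q\<close> between \<open>max 1 \<zeta>\<close> and \<open>2\<close> while \<open>g u\<close> decays like \<open>u powr (- 1 - \<rho>)\<close>, the
\<open>q\<close>-th moment of \<open>\<xi> j t\<close> is at most a constant times \<open>\<bar>t - j\<bar> powr (- (1 + \<rho>) * q)\<close>.
The sum \<open>W = (\<Sum>t. f (X t))\<close> is therefore a function of independent coordinates. As \<open>f\<close> has two bounded
derivatives, replacing the coordinates \<open>i\<close> and \<open>j\<close> by independent copies changes \<open>W\<close> in first order by at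
most \<open>\<Sum>t. h t j\<close> and in second order by at most \<open>\<Sum>t. h t i * h t j\<close>, up to a constant, where
\<open>h t j = min 1 \<bar>\<xi> j t - \<xi>' j t\<bar>\<close>. The truncation at \<open>1\<close> is what makes high moments available although \<open>L\<close>
may have only moments below \<open>2\<close>: for \<open>p \<ge> q\<close> one has \<open>h powr p \<le> h powr q\<close>, so that the \<open>p\<close>-norms of
\<open>h t j\<close> are summable in \<open>j\<close> and in \<open>t\<close> as soon as \<open>p < (1 + \<rho>) * q\<close>. With \<open>q\<close> close to \<open>2\<close> every \<open>p < 2 + 2 * \<rho>\<close>
is possible.

Stein's method for functions of independent coordinates turns such a \<open>p\<close> into a rate. Covariances are
expanded by exchanging one coordinate after the other (\<open>covariance_telescope\<close>), and the fluctuation of the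
resulting Stein kernel is controlled with the Efron--Stein inequality. For \<open>p \<le> 3\<close> the Wasserstein
distance of the normalised sum to the normal law is of order \<open>n powr (1 - p / 2)\<close>
(\<open>wasserstein_stein_bound\<close>, \<open>wasserstein_rate\<close>), and for \<open>3 \<le> p \<le> 4\<close> the Kolmogorov distance is of order
\<open>n powr (- (p - 2) / 4)\<close> (\<open>kolmogorov_stein_bound\<close>, \<open>kolmogorov_rate\<close>). Taking \<open>p = 3\<close> and \<open>p = 4\<close>, or \<open>p\<close> just
below \<open>2 + 2 * \<rho>\<close> where these values are too large, gives all the rates of the theorem except the one for the
Kolmogorov distance when \<open>\<rho> \<le> 1 / 2\<close>; there no \<open>p \<ge> 3\<close> is admissible, but the square root of the Wasserstein
rate is already the rate wanted (\<open>kolmogorov_le_wasserstein\<close>).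

Two points connect this with the process at hand. The integral defining \<open>X\<close> is a limit of integrals of
simple functions, about which only convergence in probability is known. \<open>SI_null\<close> shows that such limits do
not depend on the approximating sequence; hence the same simple kernels, translated, approximate \<open>X t\<close> for
every \<open>t\<close> (\<open>noise_approx\<close>). For a simple kernel finitely many blocks matter and the preceding paragraphs
apply, and the bounds survive the passage to the limit (\<open>normal_bounds_limit\<close>). The same approximation shows
that \<open>X\<close> is stationary, so the variance of \<open>W\<close> is a sum of symmetric partial sums of the series of
covariances, and positivity of that series makes it grow linearly (\<open>variance_lower\<close>).
\<close>

abbreviation (input) limseq :: "(nat => 'a::topological_space) => 'a => bool" (infix "---->" 60) where
 "X ----> l == X \<longlonglongrightarrow> l"

abbreviation (input) abs_moment :: "'a measure => real => ('a => real) => ennreal" where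
 "abs_moment M q Z == nn_integral M (%w. ennreal (abs (Z w) powr q))"

lemmas bochner_sum = Bochner_Integration.integral_sum
 and bochner_add = Bochner_Integration.integral_add
 and bochner_diff = Bochner_Integration.integral_diff
 and bochner_cong = Bochner_Integration.integral_cong
 and bochner_nonneg = Bochner_Integration.integral_nonneg
 and bochner_bound = Bochner_Integration.integrable_bound
 and bochner_cmult = Bochner_Integration.integral_mult_right_zero
 and bochner_int_add = Bochner_Integration.integrable_add
 and bochner_int_diff = Bochner_Integration.integrable_diff
 and bochner_int_sum = Bochner_Integration.integrable_sum

section \<open>The normal tail and Stein's equation\<close>

abbreviation gauss :: "real => real" where "gauss \<equiv> std_normal_density"

abbreviation (input) gauss_mean :: "(real => real) => real" where
 "gauss_mean h == (LINT x|lborel. h x*gauss x)"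

definition upper_tail :: "(real => real) => real => real" where
 "upper_tail k w = (LINT x|lborel. indicator {w<..} x * k x)"

lemma integrable_restrict_tail:
 fixes k :: "real => real"
 assumes "integrable lborel k"
 shows "integrable lborel (%x. indicator {w<..} x * k x)"
 using integrable_mult_indicator[OF _ assms, of "{w<..}"] by simp

lemma upper_tail_add:
 assumes "integrable lborel k" "integrable lborel l"
 shows "upper_tail (%x. k x + l x) w = upper_tail k w + upper_tail l w"
 unfolding upper_tail_def distrib_left
 by (rule bochner_add integrable_restrict_tail assms)+

lemma upper_tail_cmult: "upper_tail (%x. c * k x) w = c*upper_tail k w"
 unfolding upper_tail_def mult.left_commute[of _ c] by simp

lemma upper_tail_mono:
 assumes "integrable lborel k" "integrable lborel l" "!!x. x > w ==> k x <= l x"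
 shows "upper_tail k w <= upper_tail l w"
 unfolding upper_tail_def
 by (intro integral_mono integrable_restrict_tail assms) (auto simp: indicator_def assms(3))

lemma upper_tail_nonneg:
 assumes "!!x. x > w ==> 0 <= k x"
 shows "0 <= upper_tail k w"
 unfolding upper_tail_def
 by (intro bochner_nonneg) (auto simp: indicator_def assms)

lemma upper_tail_deriv:
 assumes "integrable lborel k" "continuous_on UNIV k"
 shows "(upper_tail k has_real_derivative - k w) (at w)"
proof -
 have eq: "upper_tail k u = upper_tail k (w - 1) - (LBINT y=w-1..u. k y)" if "u \<in> {w-1..w+1}" for u
 proof -
 have *: "upper_tail k u = (LBINT y=ereal u..\<infinity>. k y)" for u
 unfolding upper_tail_def interval_integral_to_infinity_eq set_lebesgue_integral_def by simp
 have "(LBINT y=ereal (w-1)..ereal u. k y) + (LBINT y=ereal u..\<infinity>. k y) = (LBINT y=ereal (w-1)..\<infinity>. k y)"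
 proof (rule interval_integral_sum)
 have "min (ereal (w - 1)) (min (ereal u) \<infinity>) = ereal (w-1)" "max (ereal (w - 1)) (max (ereal u) \<infinity>) = \<infinity>"
 using that by (auto simp: min_def max_def)
 then show "interval_lebesgue_integrable lborel (min (ereal (w - 1)) (min (ereal u) \<infinity>))
 (max (ereal (w - 1)) (max (ereal u) \<infinity>)) k"
 using integrable_restrict_tail[OF assms(1), of "w-1"]
 by (simp only: interval_integrable_to_infinity_eq set_integrable_def real_scaleR_def)
 qed
 then show ?thesis unfolding*by linarith
 qed
 have "((%u. LBINT y=w-1..u. k y) has_vector_derivative k w) (at w within {w-1..w+1})"
 by (rule interval_integral_FTC2) (simp_all add: continuous_on_subset[OF assms(2)])
 then have "((%u. LBINT y=w-1..u. k y) has_real_derivative k w) (at w)"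
 by (simp add: has_real_derivative_iff_has_vector_derivative at_within_Icc_at)
 then have "((%u. upper_tail k (w - 1) - (LBINT y=w-1..u. k y)) has_real_derivative - k w) (at w)"
 by (auto intro!: derivative_eq_intros)
 then show ?thesis
 by (rule has_field_derivative_transform_within_open[where S="{w-1<..<w+1}"])
 (auto intro!: eq[symmetric])
qed

lemma upper_tail_tendsto_0:
 assumes "integrable lborel k"
 shows "(upper_tail k \<longlongrightarrow> 0) at_top"
proof -
 have "((%w. LINT x|lborel. indicator {w<..} x * k x) \<longlongrightarrow> (\<integral>(x::real). 0 \<partial>lborel)) at_top"
 proof (rule integral_dominated_convergence_at_top[where w="%x. abs (k x)"])
 have [measurable]: "k \<in> borel_measurable borel" using assms by (simp add: integrable_iff_bounded)
 show "(%x. indicator {t<..} x * k x) \<in> borel_measurable lborel" for t by measurable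
 show "AE x in lborel. ((%w. indicator {w<..} x * k x) \<longlongrightarrow> 0) at_top"
 proof (rule AE_I2)
 fix x :: real
 have "eventually (%w. indicator {w<..} x * k x = 0) at_top"
 using eventually_ge_at_top[of x] by eventually_elim (auto simp: indicator_def)
 then show "((%w. indicator {w<..} x * k x) \<longlongrightarrow> 0) at_top"
 by (simp add: tendsto_eventually)
 qed
 show "\<forall>\<^sub>F t in at_top. AE x in lborel. norm (indicator {t<..} x * k x) <= abs (k x)"
 by (intro always_eventually allI AE_I2) (simp add: indicator_def)
 qed (use assms in simp_all)
 then show ?thesis by (simp add: upper_tail_def[abs_def])
qed

lemma gauss_deriv: "(gauss has_real_derivative - x*gauss x) (at x)"
 unfolding std_normal_density_def[abs_def]
 by (auto intro!: derivative_eq_intros simp: field_simps)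

lemma gauss_pos: "gauss x > 0" by (simp add: normal_density_pos)

lemma gauss_continuous: "continuous_on A gauss"
 by (meson DERIV_isCont continuous_at_imp_continuous_on gauss_deriv)

lemma gauss_integrable_1: "integrable lborel (%x. x*gauss x)"
 using integrable_std_normal_moment[of 1] by (simp add: mult.commute)

lemma gauss_integrable_2: "integrable lborel (%x. x^2*gauss x)"
 using integrable_std_normal_moment[of 2] by (simp add: mult.commute)

lemma upper_tail_gauss_1: "upper_tail (%x. x*gauss x) w = gauss w"
proof -
 let ?D = "%w. upper_tail (%x. x*gauss x) w - gauss w"
 have "(?D has_real_derivative 0) (at w)" for w
 by (auto intro!: derivative_eq_intros upper_tail_deriv gauss_integrable_1 gauss_deriv
 continuous_intros gauss_continuous)
 then have c: "?D x = ?D w" for x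
 using DERIV_isconst_all[of ?D x w] by blast
 have "(gauss \<longlongrightarrow> 0) at_top"
 unfolding std_normal_density_def[abs_def] by real_asymp
 then have "(?D \<longlongrightarrow> 0 - 0) at_top"
 by (intro tendsto_diff upper_tail_tendsto_0 gauss_integrable_1)
 moreover have "(?D \<longlongrightarrow> ?D w) at_top"
 by (intro tendsto_eventually always_eventually allI c)
 ultimately have "?D w = 0" using tendsto_unique[of at_top ?D] by fastforce
 then show ?thesis by simp
qed

lemma upper_tail_gauss_2: "upper_tail (%x. x^2*gauss x) w = w*gauss w + upper_tail gauss w"
proof -
 let ?D = "%w. upper_tail (%x. x^2*gauss x) w - (w*gauss w + upper_tail gauss w)"
 have "(?D has_real_derivative 0) (at w)" for w
 by (rule derivative_eq_intros upper_tail_deriv gauss_integrable_2 gauss_deriv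
 continuous_intros gauss_continuous refl integrable_normal_density zero_less_one)+ (simp add: power2_eq_square)
 then have c: "?D x = ?D w" for x
 using DERIV_isconst_all[of ?D x w] by blast
 have "((%w. w*gauss w) \<longlongrightarrow> 0) at_top"
 unfolding std_normal_density_def[abs_def] by real_asymp
 then have "(?D \<longlongrightarrow> 0 - (0 + 0)) at_top"
 by (intro tendsto_diff tendsto_add upper_tail_tendsto_0 gauss_integrable_2) auto
 moreover have "(?D \<longlongrightarrow> ?D w) at_top"
 by (intro tendsto_eventually always_eventually allI c)
 ultimately have "?D w = 0" using tendsto_unique[of at_top ?D] by fastforce
 then show ?thesis by simp
qed

text \<open>The Mills ratio. Both solutions of Stein's equation below are expressed by it, because it is the bounded
 solution of \<open>m' w = w * m w - 1\<close> on the right half-line.\<close>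

definition mills :: "real => real" where "mills w = upper_tail gauss w/gauss w"

lemma upper_tail_gauss_eq: "upper_tail gauss w = gauss w*mills w"
 using gauss_pos[of w] by (simp add: mills_def)

lemma mills_nonneg: "mills w >= 0"
 unfolding mills_def by (intro divide_nonneg_pos upper_tail_nonneg gauss_pos) auto

lemma upper_tail_gauss_diff: "upper_tail (%x. (x - w)*gauss x) w = gauss w*(1 - w*mills w)"
proof -
 have "upper_tail (%x. (x - w)*gauss x) w = upper_tail (%x. x*gauss x + (-w)*gauss x) w"
 by (simp add: algebra_simps)
 also have "... = gauss w - w*upper_tail gauss w"
 by (subst upper_tail_add) (auto simp: gauss_integrable_1 upper_tail_gauss_1 upper_tail_cmult[of "-w" gauss, simplified])
 finally show ?thesis by (simp add: upper_tail_gauss_eq algebra_simps)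
qed

lemma mills_le: "w*mills w <= 1"
proof -
 have "0 <= gauss w*(1 - w*mills w)"
 unfolding upper_tail_gauss_diff[symmetric] by (rule upper_tail_nonneg) auto
 then show ?thesis using gauss_pos[of w] by (simp add: zero_le_mult_iff)
qed

lemma mills_ge: "w <= mills w*(1 + w^2)"
proof -
 have "0 <= upper_tail (%x. (x - w)^2*gauss x) w"
 by (rule upper_tail_nonneg) auto
 also have "(%x. (x - w)^2*gauss x) = (%x. x^2*gauss x + ((-2*w)*(x*gauss x) + w^2*gauss x))"
 by (auto simp: power2_eq_square algebra_simps)
 also have "upper_tail ... w = w*gauss w + upper_tail gauss w + ((-2*w)*gauss w + w^2*upper_tail gauss w)"
 apply (subst upper_tail_add)
 apply (auto simp: gauss_integrable_1 gauss_integrable_2 simp del: mult_minus_left)[2]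
 apply (subst upper_tail_add)
 apply (auto simp: gauss_integrable_1 gauss_integrable_2 simp del: mult_minus_left)[2]
 apply (simp only: upper_tail_cmult upper_tail_gauss_1 upper_tail_gauss_2)
 done
 also have "... = gauss w*(mills w*(1 + w^2) - w)"
 by (simp add: upper_tail_gauss_eq power2_eq_square algebra_simps)
 finally show ?thesis using gauss_pos[of w] by (simp add: zero_le_mult_iff)
qed

lemma upper_tail_gauss_le_1: "upper_tail gauss w <= 1"
proof -
 have "upper_tail gauss w <= (LINT x|lborel. gauss x)"
 unfolding upper_tail_def by (intro integral_mono integrable_restrict_tail) (auto simp: indicator_def)
 then show ?thesis by simp
qed

lemma upper_tail_uminus:
 assumes "integrable lborel k"
 shows "upper_tail (%x. k (- x)) w = (LINT x|lborel. k x) - upper_tail k (- w)"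
proof -
 have "upper_tail (%x. k (- x)) w = (LINT x|lborel. indicator {w<..} (-x) * k x)"
 unfolding upper_tail_def
 by (subst lborel_integral_real_affine[of "-1" _ 0]) auto
 also have "... = (LINT x|lborel. k x - indicator {-w<..} x * k x)"
 by (rule integral_cong_AE)
 (use assms AE_lborel_singleton[of "-w"] in \<open>auto simp: indicator_def elim!: eventually_mono\<close>)
 finally show ?thesis
 unfolding upper_tail_def by (simp add: assms integrable_restrict_tail)
qed

lemma gauss_uminus: "gauss (- w) = gauss w" by (simp add: std_normal_density_def)

lemma upper_tail_gauss_uminus: "upper_tail gauss (- w) = 1 - upper_tail gauss w"
 using upper_tail_uminus[of gauss "-w"] by (simp add: gauss_uminus)

lemma mills_deriv: "(mills has_real_derivative w*mills w - 1) (at w)"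
proof -
 have "(mills has_real_derivative
 (- gauss w*gauss w - upper_tail gauss w*(- w*gauss w))/(gauss w*gauss w)) (at w)"
 unfolding mills_def[abs_def]
 using gauss_pos[of w]
 by (intro DERIV_divide upper_tail_deriv gauss_deriv[THEN DERIV_cong] gauss_continuous) auto
 moreover have "(- gauss w*gauss w - upper_tail gauss w*(- w*gauss w))/(gauss w*gauss w) = w*mills w - 1"
 using gauss_pos[of w] by (simp add: mills_def divide_simps) (simp add: algebra_simps)
 ultimately show ?thesis by simp
qed

lemma mills_le_gauss_1:
 assumes "w >= 0" shows "mills w <= 1 + 1/gauss 1"
proof (cases "w <= 1")
 case True
 have "gauss 1 <= gauss w"
 unfolding std_normal_density_def using True assms by (auto simp: power_le_one divide_right_mono)
 then have "mills w <= 1/gauss 1"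
 unfolding mills_def using upper_tail_gauss_le_1[of w] gauss_pos[of 1] gauss_pos[of w]
 by (intro frac_le) (auto intro!: upper_tail_nonneg)
 then show ?thesis by simp
next
 case False
 then have "1*mills w <= w*mills w" by (intro mult_right_mono mills_nonneg) auto
 moreover have "0 <= 1/gauss 1" using gauss_pos[of 1] by simp
 ultimately show ?thesis using mills_le[of w] by linarith
qed

lemma gauss_abs_moment: "gauss_mean abs <= 1" "integrable lborel (%x. abs x*gauss x)"
proof -
 show i: "integrable lborel (%x. abs x*gauss x)"
 using integrable_std_normal_moment_abs[of 1] by (simp add: mult.commute)
 have "gauss_mean abs <= (LINT x|lborel. (1 + x^2)/2*gauss x)"
 proof (rule integral_mono[OF i])
 show "integrable lborel (%x. (1 + x^2)/2*gauss x)"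
 using gauss_integrable_2 integrable_normal_density[of 1 0]
 by (auto simp: add_divide_distrib distrib_right)
 fix x :: real
 have "0 <= (abs x - 1)^2" by simp
 then have "abs x <= (1 + x^2)/2" by (simp add: power2_eq_square algebra_simps)
 then show "abs x*gauss x <= (1 + x^2)/2*gauss x" by (intro mult_right_mono) auto
 qed
 also have "(LINT x|lborel. (1 + x^2)/2*gauss x) = (1 + 1)/2"
 proof -
 have "(LINT x|lborel. x^2*gauss x) = 1"
 using integral_std_normal_moment_even[of 1] by (simp add: mult.commute)
 then show ?thesis
 using gauss_integrable_2 integrable_normal_density[of 1 0]
 by (simp add: add_divide_distrib distrib_right)
 qed
 finally show "gauss_mean abs <= 1" by simp
qed

text \<open>A Lipschitz function may be unbounded, so its integrability against the normal density and its distance from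
 its mean have to be bounded before Stein's equation can be solved.\<close>

lemma lipschitz_growth:
 fixes h :: "real => real"
 assumes "!!x y. abs (h x - h y) <= abs (x - y)"
 shows "integrable lborel (%x. h x*gauss x)" "abs (h w - gauss_mean h) <= abs w + 1"
 "continuous_on A h"
proof -
 have "1-lipschitz_on UNIV h"
 by (rule lipschitz_onI) (use assms in \<open>auto simp: dist_real_def\<close>)
 then show c: "continuous_on A h" for A
 by (rule continuous_on_subset[OF lipschitz_on_continuous_on]) simp
 have [measurable]: "h \<in> borel_measurable borel" by (rule borel_measurable_continuous_onI[OF c])
 have i0: "integrable lborel (%x. (abs (h 0) + abs x)*gauss x)"
 using gauss_abs_moment(2) integrable_normal_density[of 1 0] by (simp add: distrib_right)
 show i: "integrable lborel (%x. h x*gauss x)"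
 proof (rule bochner_bound[OF i0])
 have "abs (h x) <= abs (h 0) + abs x" for x using assms[of x 0] by auto
 then show "AE x in lborel. norm (h x*gauss x) <= norm ((abs (h 0) + abs x)*gauss x)"
 by (intro AE_I2) (auto simp: abs_mult intro!: mult_right_mono)
 qed simp
 have "h w - gauss_mean h = (LINT x|lborel. (h w - h x)*gauss x)"
 using i integrable_normal_density[of 1 0] by (simp add: left_diff_distrib)
 also have "abs ... <= (LINT x|lborel. abs w*gauss x + abs x*gauss x)"
 proof (rule order.trans[OF integral_abs_bound], rule integral_mono)
 show "integrable lborel (%x. abs ((h w - h x)*gauss x))"
 using i integrable_normal_density[of 1 0] by (intro integrable_abs) (simp add: left_diff_distrib)
 show "integrable lborel (%x. abs w*gauss x + abs x*gauss x)"
 using gauss_abs_moment(2) integrable_normal_density[of 1 0] by auto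
 fix x
 have "abs (h w - h x) <= abs w + abs x" using assms[of w x] by linarith
 then show "abs ((h w - h x)*gauss x) <= abs w*gauss x + abs x*gauss x"
 by (simp add: abs_mult flip: distrib_right) (intro mult_right_mono; simp)
 qed
 also have "... <= abs w + 1"
 using gauss_abs_moment integrable_normal_density[of 1 0] by simp
 finally show "abs (h w - gauss_mean h) <= abs w + 1" .
qed

text \<open>The solution of \<open>\<phi>' w - w * \<phi> w = h w - c\<close>, where \<open>c\<close> is the normal mean
 of \<open>h\<close>, written as an integral over the right tail; this form is stable for \<open>w \<ge>
 0\<close>.\<close>

definition stein_tail :: "(real => real) => real => real" where
 "stein_tail h w = - upper_tail (%x. (h x - gauss_mean h)*gauss x) w/gauss w"

text \<open>On the right half-line the tail integral is dominated by Mills ratios. The left half-line follows by the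
 reflection \<open>x \<rightarrow> - x\<close>, so the bounds are needed for \<open>w \<ge> 0\<close> only.\<close>

lemma
 fixes h :: "real => real"
 assumes "!!x y. abs (h x - h y) <= abs (x - y)"
 defines "c \<equiv> (gauss_mean h)"
 shows stein_tail_deriv: "(stein_tail h has_real_derivative w * stein_tail h w + h w - c) (at w)"
 and stein_tail_uminus: "stein_tail (%x. h (-x)) w = - stein_tail h (-w)"
 and stein_tail_bounds: "w >= 0 ==> abs (stein_tail h w) <= 3 + 1/gauss 1"
 "w >= 0 ==> abs (w * stein_tail h w + h w - c) <= 3"
 "w >= 0 ==> abs (w*(w * stein_tail h w + h w - c)) <= 3"
proof -
 note hi = lipschitz_growth[OF assms(1), folded c_def]
 have hc [measurable]: "h \<in> borel_measurable borel" by (rule borel_measurable_continuous_onI[OF hi(3)])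
 let ?k = "%x. (h x - c)*gauss x"
 have ik: "integrable lborel ?k"
 using hi(1) integrable_normal_density[of 1 0] by (simp add: left_diff_distrib)
 have ck: "continuous_on UNIV ?k" by (intro continuous_intros hi(3) gauss_continuous)
 have "(stein_tail h has_real_derivative
 ((- (- ?k w))*gauss w - (- upper_tail ?k w)*(- w*gauss w))/(gauss w*gauss w)) (at w)"
 unfolding stein_tail_def[abs_def] c_def[symmetric]
 using gauss_pos[of w] ik ck
 by (intro DERIV_divide DERIV_minus upper_tail_deriv gauss_deriv[THEN DERIV_cong]) auto
 moreover have "((- (- ?k w))*gauss w - (- upper_tail ?k w)*(- w*gauss w))/(gauss w*gauss w)
 = w * stein_tail h w + h w - c"
 unfolding stein_tail_def c_def[symmetric]
 using gauss_pos[of w] by (simp add: divide_simps) (simp add: algebra_simps)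
 ultimately show "(stein_tail h has_real_derivative w * stein_tail h w + h w - c) (at w)" by simp
 have c': "(LINT y|lborel. h (- y)*gauss y) = c"
 unfolding c_def
 by (subst lborel_integral_real_affine[of "-1" _ 0]) (auto simp: gauss_uminus)
 have "upper_tail (%x. ?k (- x)) w = (LINT x|lborel. ?k x) - upper_tail ?k (- w)"
 by (rule upper_tail_uminus[OF ik])
 also have "(LINT x|lborel. ?k x) = 0"
 using hi(1) integrable_normal_density[of 1 0] by (simp add: left_diff_distrib c_def[symmetric])
 finally show "stein_tail (%x. h (-x)) w = - stein_tail h (-w)"
 unfolding stein_tail_def c' c_def[symmetric] by (simp add: gauss_uminus)
 define r where "r = upper_tail (%x. (h x - h w)*gauss x) w/gauss w"
 define m where "m = mills w"
 have m0: "0 <= m" by (simp add: m_def mills_nonneg)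
 have "upper_tail ?k w = upper_tail (%x. (h x - h w)*gauss x + (h w - c)*gauss x) w"
 by (simp add: algebra_simps)
 also have "... = upper_tail (%x. (h x - h w)*gauss x) w + (h w - c)*upper_tail gauss w"
 unfolding upper_tail_cmult[symmetric]
 by (rule upper_tail_add) (use hi(1) integrable_normal_density[of 1 0] in \<open>simp_all add: left_diff_distrib\<close>)
 finally have st: "stein_tail h w = - (h w - c)*m - r"
 unfolding stein_tail_def c_def[symmetric] m_def mills_def r_def
 using gauss_pos[of w] by (simp add: divide_simps) (simp add: algebra_simps)
 have i1: "integrable lborel (%x. (h x - h w)*gauss x)" "integrable lborel (%x. (x - w)*gauss x)"
 "integrable lborel (%x. - ((x - w)*gauss x))"
 using hi(1) integrable_normal_density[of 1 0] gauss_integrable_1 by (simp_all add: left_diff_distrib)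
 have b: "abs (h x - h w) <= x - w" if "x > w" for x using assms(1)[of x w] that by simp
 have "upper_tail (%x. (h x - h w)*gauss x) w <= upper_tail (%x. (x - w)*gauss x) w"
 by (rule upper_tail_mono[OF i1(1,2)]) (auto intro!: mult_right_mono dest!: b)
 moreover have "upper_tail (%x. - ((x - w)*gauss x)) w <= upper_tail (%x. (h x - h w)*gauss x) w"
 proof (rule upper_tail_mono[OF i1(3,1)])
 fix x assume "w < x"
 from b[OF this] have "(w - x)*gauss x <= (h x - h w)*gauss x" by (intro mult_right_mono) auto
 then show "- ((x - w)*gauss x) <= (h x - h w)*gauss x" by (simp add: algebra_simps)
 qed
 moreover have "upper_tail (%x. - ((x - w)*gauss x)) w = - upper_tail (%x. (x - w)*gauss x) w"
 using upper_tail_cmult[of "-1"] by simp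
 ultimately have "abs (upper_tail (%x. (h x - h w)*gauss x) w) <= gauss w*(1 - w*m)"
 unfolding upper_tail_gauss_diff m_def by linarith
 then have r: "abs r <= 1 - w*m"
 using gauss_pos[of w] by (simp add: r_def field_simps abs_divide)
 assume w: "w >= 0"
 have hw: "abs (h w - c) <= w + 1" using hi(2)[of w] w by simp
 have wm: "0 <= w*m" "w*m <= 1" using w m0 mills_le[of w] by (auto simp: m_def)
 have m1: "(1 - w*m)*(1 + w^2) <= 1"
 proof -
 have "w*w <= w*(m*(1 + w^2))" using mills_ge[of w] w by (intro mult_left_mono) (auto simp: m_def)
 then show ?thesis by (simp add: power2_eq_square algebra_simps)
 qed
 have "abs (stein_tail h w) <= abs (h w - c)*m + abs r"
 proof -
 have "abs (- (h w - c)*m - r) <= abs (- (h w - c)*m) + abs r" by (rule abs_triangle_ineq4)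
 also have "abs (- (h w - c)*m) = abs (h w - c)*m" using m0 by (simp only: abs_mult abs_minus abs_of_nonneg)
 finally show ?thesis unfolding st .
 qed
 also have "... <= (w + 1)*m + (1 - w*m)" using hw r m0 by (intro add_mono mult_right_mono) auto
 also have "... = m + 1" by (simp add: algebra_simps)
 also have "... <= 3 + 1/gauss 1" using mills_le_gauss_1[OF w] by (simp add: m_def)
 finally show "abs (stein_tail h w) <= 3 + 1/gauss 1" .
 have d: "w * stein_tail h w + h w - c = (h w - c)*(1 - w*m) - w*r"
 unfolding st by (simp add: algebra_simps)
 have "abs (w * stein_tail h w + h w - c) <= abs (h w - c)*(1 - w*m) + w * abs r"
 proof -
 have "abs ((h w - c)*(1 - w*m) - w*r) <= abs ((h w - c)*(1 - w*m)) + abs (w*r)"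
 by (rule abs_triangle_ineq4)
 then show ?thesis unfolding d abs_mult using w wm by simp
 qed
 also have "... <= (w + 1)*(1 - w*m) + w*(1 - w*m)"
 using hw r wm w by (intro add_mono mult_right_mono mult_left_mono) auto
 finally have d1: "abs (w * stein_tail h w + h w - c) <= (2*w + 1)*(1 - w*m)"
 by (simp add: algebra_simps)
 have ww: "2*w + 1 <= 3*(1 + w^2)" "w*(2*w + 1) <= 3*(1 + w^2)"
 proof -
 have "0 <= (w - 1)^2" by simp
 then have *: "2*w <= 1 + w^2" by (simp add: power2_eq_square algebra_simps)
 show "2*w + 1 <= 3*(1 + w^2)" using*zero_le_power2[of w] by (simp only: distrib_left)
 show "w*(2*w + 1) <= 3*(1 + w^2)"
 using*w zero_le_power2[of w] by (simp add: distrib_left power2_eq_square)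
 qed
 have "(2*w + 1)*(1 - w*m) <= (3*(1 + w^2))*(1 - w*m)"
 using ww wm by (intro mult_right_mono) auto
 also have "... = 3*((1 - w*m)*(1 + w^2))" by simp
 also have "... <= 3" using m1 by linarith
 finally show "abs (w * stein_tail h w + h w - c) <= 3" using d1 by simp
 have "abs (w*(w * stein_tail h w + h w - c)) <= w*((2*w + 1)*(1 - w*m))"
 unfolding abs_mult using d1 w by (intro mult_mono) auto
 also have "... = (w*(2*w + 1))*(1 - w*m)" by simp
 also have "... <= (3*(1 + w^2))*(1 - w*m)"
 using ww wm by (intro mult_right_mono) auto
 also have "... = 3*((1 - w*m)*(1 + w^2))" by simp
 also have "... <= 3" using m1 by linarith
 finally show "abs (w*(w * stein_tail h w + h w - c)) <= 3" .
qed

definition stein_const :: real where "stein_const = 7 + 1/gauss 1"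

text \<open>Differentiating Stein's equation once shows that \<open>\<phi>''\<close> is bounded, which is the Lipschitz
 bound on \<open>\<phi>'\<close>. This is where \<open>h\<close> has to be differentiable; Lipschitz
 functions are smoothed later.\<close>

lemma stein_solution_lipschitz:
 fixes h h' :: "real => real"
 assumes "!!x. (h has_real_derivative h' x) (at x)" "!!x. abs (h' x) <= 1"
 obtains ph ph' where "!!w. (ph has_real_derivative ph' w) (at w)"
 "!!w. ph' w - w*ph w = h w - gauss_mean h"
 "!!w. abs (ph' w) <= stein_const" "!!u w. abs (ph' u - ph' w) <= stein_const * abs (u - w)"
proof -
 define c where "c = gauss_mean h"
 have lip: "abs (h x - h y) <= abs (x - y)" for x y
 using field_differentiable_bound[of UNIV h h' 1 x y, OF convex_UNIV assms(1)] assms(2) by simp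
 have lip': "abs (h (-x) - h (-y)) <= abs (x - y)" for x y
 using lip[of "-x" "-y"] by simp
 have c': "(LINT y|lborel. h (- y)*gauss y) = c"
 unfolding c_def by (subst lborel_integral_real_affine[of "-1" _ 0]) (auto simp: gauss_uminus)
 define ph where "ph = stein_tail h"
 define ph' where "ph' w = w*ph w + h w - c" for w
 have d: "(ph has_real_derivative ph' w) (at w)" for w
 unfolding ph_def ph'_def c_def by (rule stein_tail_deriv[OF lip])
 have b: "abs (ph w) <= 3 + 1/gauss 1 & abs (ph' w) <= 3 & abs (w*ph' w) <= 3" for w
 proof (cases "w >= 0")
 case True
 then show ?thesis
 using stein_tail_bounds[OF lip True] unfolding ph_def ph'_def c_def by simp
 next
 case False
 then have w: "- w >= 0" by simp
 have "stein_tail (%x. h (-x)) (-w) = - stein_tail h w"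
 using stein_tail_uminus[OF lip, of "-w"] by simp
 then show ?thesis
 using stein_tail_bounds[of "%x. h (-x)", OF lip' w] unfolding ph_def ph'_def c' by simp
 qed
 have d2: "(ph' has_real_derivative (ph w + w*ph' w + h' w)) (at w)" for w
 unfolding ph'_def by (rule derivative_eq_intros d assms(1) refl)+ (simp add: ph'_def)
 have bb: "abs (ph w + w*ph' w + h' w) <= stein_const" for w
 using b[of w] assms(2)[of w] unfolding stein_const_def by linarith
 have b1: "abs (ph' u - ph' w) <= stein_const * abs (u - w)" for u w
 using field_differentiable_bound[of UNIV ph' "%w. ph w + w*ph' w + h' w" stein_const u w, OF convex_UNIV d2]
 by (simp add: bb)
 have b2: "abs (ph' w) <= stein_const" for w
 proof -
 have "0 <= 1/gauss 1" using gauss_pos[of 1] by simp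
 then show ?thesis using b[of w] unfolding stein_const_def by linarith
 qed
 have b3: "ph' w - w*ph w = h w - gauss_mean h" for w
 by (simp add: ph'_def c_def)
 show ?thesis
 proof (rule that)
 show "(ph has_real_derivative ph' w) (at w)" for w by (rule d)
 qed (fact b3 b2 b1)+
qed

lemma upper_tail_gauss_antimono: "u <= w ==> upper_tail gauss w <= upper_tail gauss u"
 unfolding upper_tail_def
 by (intro integral_mono integrable_restrict_tail) (auto simp: indicator_def)

lemma upper_tail_gauss_nonneg: "0 <= upper_tail gauss w"
 by (rule upper_tail_nonneg) simp

text \<open>Monotonicity of \<open>w * mills w\<close> carries over to \<open>w\<close> times the solution for an
 indicator, which is the fact behind the error bound \<open>stein_ind_taylor\<close>.\<close>

lemma mills_mult_mono:
 assumes "u <= w" shows "u*mills u <= w*mills w"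
proof (rule DERIV_nonneg_imp_nondecreasing[OF assms])
 fix v
 have "((%v. v * mills v) has_real_derivative (1*mills v + (v * mills v - 1) * v)) (at v)"
 by (rule DERIV_mult DERIV_ident mills_deriv)+
 moreover have "0 <= 1*mills v + (v * mills v - 1) * v"
 using mills_ge[of v] by (simp add: algebra_simps power2_eq_square)
 ultimately show "\<exists>y. ((%v. v * mills v) has_real_derivative y) (at v) & 0 <= y" by blast
qed

text \<open>The bounded solution of Stein's equation for the indicator of \<open>{..x}\<close>.\<close>

definition stein_ind :: "real => real => real" where
 "stein_ind x w = (if w <= x then mills (- w)*upper_tail gauss x
 else mills w*(1 - upper_tail gauss x))"

text \<open>The derivative of the solution away from \<open>x\<close>; at \<open>x\<close> the equation itself serves as
 its definition.\<close>

definition stein_ind_deriv :: "real => real => real" where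
 "stein_ind_deriv x w = w * stein_ind x w + indicator {..x} w - (1 - upper_tail gauss x)"

text \<open>The derivative is the sum of the increasing function \<open>w * stein_ind x w\<close> and a decreasing step.
 Their difference, formed here up to a constant, is increasing and bounded, and it measures the oscillation
 of the derivative.\<close>

definition stein_ind_osc :: "real => real => real" where
 "stein_ind_osc x w = w * stein_ind x w - indicator {..x} w"

lemma mills_uminus_eq: "mills (- w) = (1 - upper_tail gauss w)/gauss w"
 by (simp add: mills_def upper_tail_gauss_uminus gauss_uminus)

lemma stein_ind_eq_right: "w >= x ==> stein_ind x w = mills w*(1 - upper_tail gauss x)"
 by (auto simp: stein_ind_def mills_uminus_eq) (simp add: mills_def)

lemma stein_ind_continuous: "continuous_on UNIV (stein_ind x)"
proof -
 have m: "continuous_on S mills" for S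
 by (meson DERIV_isCont continuous_at_imp_continuous_on mills_deriv)
 have "continuous_on ({..x} \<union> {x..}) (%w. if w <= x then mills (- w)*upper_tail gauss x
 else mills w*(1 - upper_tail gauss x))"
 proof (rule continuous_on_If)
 fix w assume "w \<in> {..x}" "\<not> w <= x"
 then show "mills (- w)*upper_tail gauss x = mills w*(1 - upper_tail gauss x)" by simp
 next
 fix w assume "w \<in> {x..}" "w <= x"
 then have "w = x" by simp
 then show "mills (- w)*upper_tail gauss x = mills w*(1 - upper_tail gauss x)"
 unfolding mills_uminus_eq by (simp add: mills_def)
 qed (intro continuous_intros continuous_on_compose2[OF m[of UNIV]]; simp)+
 moreover have "{..x} \<union> {x..} = UNIV" by auto
 ultimately show ?thesis unfolding stein_ind_def[abs_def] by simp
qed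

lemma stein_ind_has_deriv:
 assumes "w ~= x" shows "(stein_ind x has_real_derivative stein_ind_deriv x w) (at w)"
proof (cases "w < x")
 case True
 have "((%w. mills (- w)) has_real_derivative (((- w)*mills (- w) - 1)*(-1))) (at w)"
 by (rule DERIV_chain2[OF mills_deriv]) (auto intro!: derivative_eq_intros)
 then have "((%w. mills (- w)*upper_tail gauss x) has_real_derivative
 (((- w)*mills (- w) - 1)*(-1))*upper_tail gauss x) (at w)"
 by (rule DERIV_cmult_right)
 then have "(stein_ind x has_real_derivative (((- w)*mills (- w) - 1)*(-1))*upper_tail gauss x) (at w)"
 by (rule has_field_derivative_transform_within_open[where S="{..<x}"])
 (use True in \<open>auto simp: stein_ind_def\<close>)
 then show ?thesis using True by (simp add: stein_ind_deriv_def stein_ind_def algebra_simps)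
next
 case False
 have "((%w. mills w*(1 - upper_tail gauss x)) has_real_derivative
 (w*mills w - 1)*(1 - upper_tail gauss x)) (at w)"
 by (rule DERIV_cmult_right[OF mills_deriv])
 then have "(stein_ind x has_real_derivative (w*mills w - 1)*(1 - upper_tail gauss x)) (at w)"
 by (rule has_field_derivative_transform_within_open[where S="{x<..}"])
 (use False assms in \<open>auto simp: stein_ind_def\<close>)
 then show ?thesis using False assms by (simp add: stein_ind_deriv_def stein_ind_def algebra_simps)
qed

lemma stein_ind_mono:
 assumes "u <= w" shows "u * stein_ind x u <= w * stein_ind x w"
proof -
 let ?T = "upper_tail gauss x"
 have left: "u * stein_ind x u <= w * stein_ind x w" if "u <= w" "w <= x" for u w
 proof -
 have "- w*mills (- w) <= - u*mills (- u)" using mills_mult_mono[of "-w" "-u"] that by simp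
 then have "(u*mills (- u))*?T <= (w*mills (- w))*?T"
 by (intro mult_right_mono upper_tail_gauss_nonneg) simp
 then show ?thesis using that by (simp add: stein_ind_def mult.assoc)
 qed
 have right: "u * stein_ind x u <= w * stein_ind x w" if "u <= w" "x <= u" for u w
 proof -
 have "(u*mills u)*(1 - ?T) <= (w*mills w)*(1 - ?T)"
 using that upper_tail_gauss_le_1[of x] by (intro mult_right_mono mills_mult_mono) auto
 then show ?thesis using that by (simp add: stein_ind_eq_right mult.assoc)
 qed
 show ?thesis
 using left[of u w] right[of u w] left[of u x] right[of x w] assms by linarith
qed

lemma stein_ind_mult_bound: "abs (w * stein_ind x w) <= 1"
proof -
 have T: "0 <= upper_tail gauss v" "upper_tail gauss v <= 1" for v
 by (auto simp: upper_tail_gauss_nonneg upper_tail_gauss_le_1)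
 have m: "abs (w*mills (abs w)) <= 1"
 using mills_le[of "abs w"] mills_nonneg[of "abs w"] by (simp add: abs_mult)
 have "0 <= stein_ind x w"
 unfolding stein_ind_def using T[of x] by (auto intro!: mult_nonneg_nonneg mills_nonneg)
 moreover have "stein_ind x w <= mills (abs w)"
 proof (cases "w <= x")
 case True
 show ?thesis
 proof (cases "w <= 0")
 case t: True
 then show ?thesis using True T[of x] mills_nonneg[of "-w"]
 by (simp add: stein_ind_def mult_left_le)
 next
 case False
 have "mills (- w)*upper_tail gauss x <= mills (- w)*upper_tail gauss w"
 using True by (intro mult_left_mono mills_nonneg upper_tail_gauss_antimono)
 also have "... = (1 - upper_tail gauss w)*mills w"
 unfolding mills_uminus_eq by (simp add: mills_def)
 also have "... <= mills w" using T[of w] mills_nonneg[of w] by (simp add: mult_left_le_one_le)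
 finally show ?thesis using True False by (simp add: stein_ind_def)
 qed
 next
 case False
 show ?thesis
 proof (cases "w >= 0")
 case t: True
 then show ?thesis using False T[of x] mills_nonneg[of "w"]
 by (simp add: stein_ind_def mult_left_le)
 next
 case w: False
 have "mills w*(1 - upper_tail gauss x) <= mills w*(1 - upper_tail gauss w)"
 using False by (intro mult_left_mono mills_nonneg diff_left_mono upper_tail_gauss_antimono) auto
 also have "... = upper_tail gauss w*mills (- w)"
 unfolding mills_uminus_eq by (simp add: mills_def)
 also have "... <= mills (- w)" using T[of w] mills_nonneg[of "-w"] by (simp add: mult_left_le_one_le)
 finally show ?thesis using w False by (simp add: stein_ind_def)
 qed
 qed
 ultimately have "abs w * stein_ind x w <= abs w*mills (abs w)" "0 <= abs w * stein_ind x w"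
 by (auto intro: mult_left_mono)
 with m show ?thesis using \<open>0 <= stein_ind x w\<close> mills_nonneg[of "abs w"] by (simp add: abs_mult)
qed

lemma stein_ind_deriv_bound: "abs (stein_ind_deriv x w) <= 2"
proof -
 have "abs (indicator {..x} w - (1 - upper_tail gauss x)) <= (1::real)"
 using upper_tail_gauss_nonneg[of x] upper_tail_gauss_le_1[of x] by (auto simp: indicator_def)
 with stein_ind_mult_bound[of w x] show ?thesis unfolding stein_ind_deriv_def by linarith
qed

lemma stein_ind_osc_bound: "abs (stein_ind_osc x w) <= 2"
proof -
 have "abs (indicator {..x} w) <= (1::real)" by (auto simp: indicator_def)
 with stein_ind_mult_bound[of w x] show ?thesis unfolding stein_ind_osc_def by linarith
qed

text \<open>The solution for an indicator has a kink, so the mean value theorem has to tolerate one exceptional point.\<close>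

lemma mvt_bounds_except_one:
 fixes ph D :: "real => real"
 assumes "u < w" "continuous_on UNIV ph" "!!s. s ~= x ==> (ph has_real_derivative D s) (at s)"
 and "!!s. u < s ==> s < w ==> lo <= D s & D s <= hi"
 shows "lo*(w - u) <= ph w - ph u & ph w - ph u <= hi*(w - u)"
proof -
 have piece: "lo*(b - a) <= ph b - ph a & ph b - ph a <= hi*(b - a)"
 if ab: "u <= a" "a <= b" "b <= w" and x: "x <= a | b <= x" for a b
 proof (cases "a < b")
 case True
 have "\<exists>l z. a < z & z < b & (ph has_real_derivative l) (at z) & ph b - ph a = (b - a)*l"
 proof (rule MVT[OF True])
 show "continuous_on {a..b} ph" using assms(2) by (rule continuous_on_subset) simp
 fix z assume "a < z" "z < b"
 then have "z ~= x" using x by auto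
 then show "ph differentiable at z" using assms(3) real_differentiable_def by blast
 qed
 then obtain l z where z: "a < z" "z < b" "(ph has_real_derivative l) (at z)" "ph b - ph a = (b - a)*l"
 by blast
 have "z ~= x" using z x by auto
 then have "l = D z" using assms(3) z(3) DERIV_unique by blast
 then have "lo <= l" "l <= hi" using assms(4)[of z] z ab by auto
 then show ?thesis unfolding z(4) using True by (simp add: mult.commute mult_left_mono)
 qed (use ab in simp)
 show ?thesis
 proof (cases "u <= x & x <= w")
 case True
 then show ?thesis using piece[of u x] piece[of x w] by (simp add: algebra_simps)
 next
 case False
 then show ?thesis using piece[of u w] assms(1) by auto
 qed
qed

lemma stein_ind_lipschitz: "abs (stein_ind x w - stein_ind x u) <= 2 * abs (w - u)"
proof -
 have *: "abs (stein_ind x w - stein_ind x u) <= 2 * abs (w - u)" if "u < w" for u w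
 proof -
 have "- 2*(w - u) <= stein_ind x w - stein_ind x u & stein_ind x w - stein_ind x u <= 2*(w - u)"
 proof (rule mvt_bounds_except_one[OF that stein_ind_continuous stein_ind_has_deriv])
 show "- 2 <= stein_ind_deriv x s & stein_ind_deriv x s <= 2" for s
 using stein_ind_deriv_bound[of x s] by (simp add: abs_le_iff)
 qed
 then show ?thesis using that by (simp add: abs_le_iff)
 qed
 then show ?thesis using *[of u w] *[of w u] by (cases u w rule: linorder_cases) (auto simp: abs_minus_commute)
qed

text \<open>The derivative is an increasing plus a decreasing function, so the error of the first-order expansion is at
 most the increment \<open>a\<close> times the increment of the difference of the two. Unlike a bound by
 \<open>a^2\<close> this one is linear in a bounded monotone function of the endpoint, and the antisymmetry
 under exchanging a coordinate with its copy makes its expectation a covariance.\<close>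

lemma stein_ind_taylor:
 "abs (stein_ind x w - stein_ind x (w - a) - a * stein_ind_deriv x w)
 <= a*(stein_ind_osc x w - stein_ind_osc x (w - a))"
proof -
 define p where "p v = v * stein_ind x v" for v
 define i where "i v = (indicator {..x} v - (1 - upper_tail gauss x) :: real)" for v
 have D: "stein_ind_deriv x v = p v + i v" for v by (simp add: stein_ind_deriv_def p_def i_def)
 have O: "stein_ind_osc x v - stein_ind_osc x u = p v - p u - (i v - i u)" for u v
 by (simp add: stein_ind_osc_def p_def i_def)
 have pm: "u <= v ==> p u <= p v" for u v by (simp add: p_def stein_ind_mono)
 have im: "u <= v ==> i v <= i u" for u v by (auto simp: i_def indicator_def)
 have main: "(p u + i v)*(v - u) <= stein_ind x v - stein_ind x u & stein_ind x v - stein_ind x u <= (p v + i u)*(v - u)"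
 if "u < v" for u v
 proof (rule mvt_bounds_except_one[OF that stein_ind_continuous stein_ind_has_deriv])
 fix s assume "u < s" "s < v"
 then show "p u + i v <= stein_ind_deriv x s & stein_ind_deriv x s <= p v + i u"
 unfolding D using pm[of u s] pm[of s v] im[of u s] im[of s v] by auto
 qed
 have mono: "a*p (w - a) <= a*p w" "a*i w <= a*i (w - a)"
 using pm[of "w - a" w] pm[of w "w - a"] im[of "w - a" w] im[of w "w - a"]
 by (cases "a >= 0"; simp add: mult_left_mono mult_left_mono_neg)+
 have bd: "a*p (w - a) + a*i w <= stein_ind x w - stein_ind x (w - a)
 & stein_ind x w - stein_ind x (w - a) <= a*p w + a*i (w - a)"
 proof (cases "a > 0")
 case True
 then show ?thesis using main[of "w - a" w] by (simp add: algebra_simps)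
 next
 case False
 then show ?thesis using main[of w "w - a"] by (cases "a = 0") (simp_all add: algebra_simps)
 qed
 have e: "a*(p w + i w) = a*p w + a*i w"
 "a*(p w - p (w - a) - (i w - i (w - a))) = a*p w - a*p (w - a) - (a*i w - a*i (w - a))"
 by (simp_all add: algebra_simps)
 show ?thesis unfolding O D e using bd mono by linarith
qed

lemma stein_ind_equation:
 "stein_ind_deriv x w - w * stein_ind x w = indicator {..x} w - (1 - upper_tail gauss x)"
 by (simp add: stein_ind_deriv_def)

lemma stein_ind_measurable [measurable]:
 "stein_ind x \<in> borel_measurable borel" "stein_ind_deriv x \<in> borel_measurable borel"
 "stein_ind_osc x \<in> borel_measurable borel"
proof -
 show [measurable]: "stein_ind x \<in> borel_measurable borel"
 by (rule borel_measurable_continuous_onI[OF stein_ind_continuous])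
 show "stein_ind_deriv x \<in> borel_measurable borel" "stein_ind_osc x \<in> borel_measurable borel"
 unfolding stein_ind_deriv_def[abs_def] stein_ind_osc_def[abs_def] by measurable
qed

section \<open>Bounded functions of independent coordinates\<close>

text \<open>Everything in the part on independent coordinates is bounded and measurable. Bundling the two properties
 makes integrability a matter of structural rules.\<close>

definition bdd_meas :: "'a measure => ('a => real) => bool" where
 "bdd_meas M f \<longleftrightarrow> f \<in> borel_measurable M & (\<exists>B. \<forall>x\<in>space M. abs (f x) <= B)"

lemma bdd_measI: "f \<in> borel_measurable M ==> (!!x. x \<in> space M ==> abs (f x) <= B) ==> bdd_meas M f"
 by (auto simp: bdd_meas_def)

lemma bdd_meas_measurable [measurable_dest]: "bdd_meas M f ==> f \<in> borel_measurable M"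
 by (simp add: bdd_meas_def)

lemma bdd_meas_const [simp, intro]: "bdd_meas M (%x. c)"
 by (auto simp: bdd_meas_def)

lemma bdd_meas_add [intro]:
 assumes "bdd_meas M f" "bdd_meas M g" shows "bdd_meas M (%x. f x + g x)"
proof -
 from assms obtain A B where "!!x. x \<in> space M ==> abs (f x) <= A" "!!x. x \<in> space M ==> abs (g x) <= B"
 unfolding bdd_meas_def by blast
 then show ?thesis using assms
 by (intro bdd_measI[where B="A + B"]) (auto simp: bdd_meas_def intro: order.trans[OF abs_triangle_ineq add_mono])
qed

lemma bdd_meas_mult [intro]:
 assumes "bdd_meas M f" "bdd_meas M g" shows "bdd_meas M (%x. f x*g x)"
proof -
 from assms obtain A B where AB: "!!x. x \<in> space M ==> abs (f x) <= A" "!!x. x \<in> space M ==> abs (g x) <= B"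
 unfolding bdd_meas_def by blast
 show ?thesis using assms
 proof (intro bdd_measI[where B="A*B"])
 fix x assume "x \<in> space M"
 with AB[of x] show "abs (f x*g x) <= A*B" unfolding abs_mult by (intro mult_mono) auto
 qed (auto simp: bdd_meas_def)
qed

lemma bdd_meas_uminus [intro]: "bdd_meas M f ==> bdd_meas M (%x. - f x)"
 by (auto simp: bdd_meas_def)

lemma bdd_meas_diff [intro]:
 "bdd_meas M f ==> bdd_meas M g ==> bdd_meas M (%x. f x - g x)"
 using bdd_meas_add[of M f "%x. - g x"] bdd_meas_uminus[of M g] by simp

lemma bdd_meas_abs [intro]: "bdd_meas M f ==> bdd_meas M (%x. abs (f x))"
 by (auto simp: bdd_meas_def)

lemma bdd_meas_power [intro]: "bdd_meas M f ==> bdd_meas M (%x. f x ^ n)"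
 by (induction n) auto

lemma bdd_meas_min [intro]:
 assumes "bdd_meas M f" "bdd_meas M g" shows "bdd_meas M (%x. min (f x) (g x))"
proof -
 have "(%x. min (f x) (g x)) = (%x. (1/2)*((f x + g x) - abs (f x - g x)))"
 by (auto simp: min_def abs_real_def field_simps)
 moreover have "bdd_meas M (%x. (1/2)*((f x + g x) - abs (f x - g x)))"
 by (intro bdd_meas_mult bdd_meas_add bdd_meas_diff bdd_meas_abs bdd_meas_const assms)
 ultimately show ?thesis by metis
qed

lemma bdd_meas_sum [intro]:
 "(!!i. i \<in> I ==> bdd_meas M (f i)) ==> bdd_meas M (%x. \<Sum>i\<in>I. f i x)"
 by (induction I rule: infinite_finite_induct) auto

lemma bdd_meas_comp: "bdd_meas M f ==> T \<in> measurable L M ==> bdd_meas L (%x. f (T x))"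
 unfolding bdd_meas_def by (auto dest: measurable_space)

lemma (in finite_measure) bdd_meas_integrable: "bdd_meas M f ==> integrable M f"
proof -
 assume "bdd_meas M f"
 then obtain B where "f \<in> borel_measurable M" "!!x. x \<in> space M ==> norm (f x) <= B" by (auto simp: bdd_meas_def)
 then show ?thesis by (intro integrable_const_bound[of _ B] AE_I2)
qed

lemma (in prob_space) bdd_meas_integral_bound:
 assumes "bdd_meas M f" "!!x. x \<in> space M ==> abs (f x) <= g x" "bdd_meas M g"
 shows "abs (integral\<^sup>L M f) <= integral\<^sup>L M g"
proof -
 have "abs (integral\<^sup>L M f) <= (LINT x|M. abs (f x))" by (rule integral_abs_bound)
 also have "... <= integral\<^sup>L M g"
 by (intro integral_mono bdd_meas_integrable) (use assms in auto)
 finally show ?thesis .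
qed

lemma bdd_meas_fst_snd:
 "bdd_meas M f ==> bdd_meas (M \<Otimes>\<^sub>M L) (%z. f (fst z))"
 "bdd_meas L g ==> bdd_meas (M \<Otimes>\<^sub>M L) (%z. g (snd z))"
 by (auto intro: bdd_meas_comp)

lemma bdd_meas_integral_snd:
 assumes "prob_space L" "bdd_meas (M \<Otimes>\<^sub>M L) f"
 shows "bdd_meas M (%x. LINT y|L. f (x, y))"
proof -
 interpret L: prob_space L by fact
 from assms obtain B where B: "!!z. z \<in> space (M \<Otimes>\<^sub>M L) ==> abs (f z) <= B" unfolding bdd_meas_def by blast
 have [measurable]: "f \<in> borel_measurable (M \<Otimes>\<^sub>M L)" using assms(2) by (rule bdd_meas_measurable)
 show ?thesis
 proof (rule bdd_measI[where B=B])
 show "(%x. LINT y|L. f (x, y)) \<in> borel_measurable M" by measurable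
 fix x assume x: "x \<in> space M"
 have "abs (LINT y|L. f (x, y)) <= (LINT y|L. B)"
 proof (rule L.bdd_meas_integral_bound)
 show "bdd_meas L (%y. f (x, y))"
 by (rule bdd_meas_comp[OF assms(2)]) (use x in measurable)
 qed (use x B in \<open>auto simp: space_pair_measure\<close>)
 then show "abs (LINT y|L. f (x, y)) <= B" by (simp add: L.prob_space)
 qed
qed

definition mix :: "nat => (nat => 's) => (nat => 's) => nat => 's" where
 "mix k x y i = (if i < k then y i else x i)"

abbreviation (input) upd :: "'i => ('i => 's) \<times> ('i => 's) => 'i => 's" where
 "upd j z == (fst z)(j := snd z j)"

text \<open>The measure \<open>P\<close> is the law of the coordinates and \<open>PP\<close> adds an independent copy.\<close>

locale indep_coords =
 fixes N :: nat and mu :: "nat => 's measure"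
 assumes prob_coord: "!!j. prob_space (mu j)"
begin

abbreviation P :: "(nat => 's) measure" where "P \<equiv> PiM {..<N} mu"
abbreviation PP :: "((nat => 's) \<times> (nat => 's)) measure" where "PP \<equiv> P \<Otimes>\<^sub>M P"
abbreviation (input) P3 where "P3 == PP \<Otimes>\<^sub>M P"
abbreviation (input) mu2 where "mu2 j == mu j \<Otimes>\<^sub>M mu j"
abbreviation (input) bdd2 where "bdd2 j g == bdd_meas (mu2 j) (%z. g (fst z) (snd z))"
abbreviation II :: "((nat => 's) => (nat => 's) => real) => real" where "II g \<equiv> LINT z|PP. g (fst z) (snd z)"
abbreviation bddPP :: "((nat => 's) => (nat => 's) => real) => bool" where "bddPP g \<equiv> bdd_meas PP (%z. g (fst z) (snd z))"

sublocale product_prob_space mu "{..<N}"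
 by (intro product_prob_spaceI prob_coord)

sublocale P: prob_space P
 by (rule prob_space_PiM) (rule prob_coord)

sublocale PP: pair_prob_space P P ..

lemmas PPi = PP.bdd_meas_integrable

lemma prob_PP: "prob_space PP" by (rule PP.prob_space_axioms)

lemma coord_measurable [measurable]: "j < N ==> (%x. x j) \<in> measurable P (mu j)"
 by (rule measurable_component_singleton) simp

lemma upd_measurable [measurable (raw)]:
 assumes "j < N" "f \<in> measurable L P" "h \<in> measurable L (mu j)"
 shows "(%z. (f z)(j := h z)) \<in> measurable L P"
 using assms by (intro measurable_fun_upd[where J="{..<N}"]) auto

lemma mix_measurable [measurable (raw)]:
 assumes "f \<in> measurable L P" "g \<in> measurable L P"
 shows "(%z. mix k (f z) (g z)) \<in> measurable L P"
proof (rule measurable_PiM_single')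
 fix i assume i: "i \<in> {..<N}"
 then have [measurable]: "(%z. f z i) \<in> measurable L (mu i)" "(%z. g z i) \<in> measurable L (mu i)"
 using assms by (auto intro: measurable_compose[OF _ measurable_component_singleton])
 show "(%z. mix k (f z) (g z) i) \<in> measurable L (mu i)"
 by (cases "i < k") (simp_all add: mix_def)
next
 show "(%z i. mix k (f z) (g z) i) \<in> space L \<rightarrow> (\<Pi>\<^sub>E i\<in>{..<N}. space (mu i))"
 using measurable_space[OF assms(1)] measurable_space[OF assms(2)]
 by (auto simp: space_PiM PiE_def Pi_def extensional_def mix_def)
qed

definition swap :: "nat => (nat => 's) \<times> (nat => 's) => (nat => 's) \<times> (nat => 's)" where
 "swap j z = ((fst z)(j := snd z j), (snd z)(j := fst z j))"

lemma swap_measurable [measurable]: "j < N ==> swap j \<in> measurable PP PP"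
 unfolding swap_def[abs_def] by measurable

lemma nn_integral_coord:
 assumes "j < N" "f \<in> borel_measurable P"
 shows "nn_integral P (%x. f x) = nn_integral (PiM ({..<N} - {j}) mu) (%x. nn_integral (mu j) (%u. f (x(j := u))))"
proof -
 have e: "insert j ({..<N} - {j}) = {..<N}" using assms(1) by auto
 show ?thesis
 using product_nn_integral_insert[of "{..<N} - {j}" j f] assms(2) unfolding e by simp
qed

text \<open>Exchanging one coordinate with its copy preserves the joint law. All symmetrisations below rest on this.\<close>

lemma distr_swap: assumes j: "j < N" shows "distr PP PP (swap j) = PP"
proof -
 let ?Q = "PiM ({..<N} - {j}) mu"
 interpret M: prob_space "mu j" by (rule prob_coord)
 interpret Q: prob_space ?Q by (rule prob_space_PiM) (rule prob_coord)
 interpret QM: pair_sigma_finite ?Q "mu j" ..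
 interpret MM: pair_sigma_finite "mu j" "mu j" ..
 have upd [measurable (raw)]: "(%z. (g z)(j := h z)) \<in> measurable L P"
 if "g \<in> measurable L ?Q" "h \<in> measurable L (mu j)" for g h and L :: "'x measure"
 using that j by (intro measurable_fun_upd[where J="{..<N} - {j}"]) auto
 have key: "nn_integral PP (%z. f z) = nn_integral ?Q (%x'. \<integral>\<^sup>+u. \<integral>\<^sup>+v. \<integral>\<^sup>+y'. f (x'(j := u), y'(j := v)) \<partial>?Q \<partial>mu j \<partial>mu j)"
 if f [measurable]: "f \<in> borel_measurable PP" for f
 proof -
 have "nn_integral PP (%z. f z) = nn_integral P (%x. \<integral>\<^sup>+y. f (x, y) \<partial>P)"
 by (rule P.nn_integral_fst[symmetric, OF f])
 also have "... = nn_integral P (%x. nn_integral ?Q (%y'. \<integral>\<^sup>+v. f (x, y'(j := v)) \<partial>mu j))"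
 by (intro nn_integral_cong nn_integral_coord[OF j]) measurable
 also have "... = nn_integral P (%x. nn_integral (mu j) (%v. \<integral>\<^sup>+y'. f (x, y'(j := v)) \<partial>?Q))"
 by (intro nn_integral_cong QM.Fubini'[symmetric]) measurable
 also have "... = nn_integral ?Q (%x'. \<integral>\<^sup>+u. \<integral>\<^sup>+v. \<integral>\<^sup>+y'. f (x'(j := u), y'(j := v)) \<partial>?Q \<partial>mu j \<partial>mu j)"
 by (rule nn_integral_coord[OF j]) measurable
 finally show ?thesis .
 qed
 have eq: "nn_integral PP (%z. f (swap j z)) = nn_integral PP (%z. f z)" if f [measurable]: "f \<in> borel_measurable PP" for f
 proof -
 have "nn_integral PP (%z. f (swap j z)) = nn_integral ?Q (%x'. \<integral>\<^sup>+u. \<integral>\<^sup>+v. \<integral>\<^sup>+y'. f (x'(j := v), y'(j := u)) \<partial>?Q \<partial>mu j \<partial>mu j)"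
 using j by (subst key) (simp_all add: swap_def)
 also have "... = nn_integral ?Q (%x'. \<integral>\<^sup>+v. \<integral>\<^sup>+u. \<integral>\<^sup>+y'. f (x'(j := v), y'(j := u)) \<partial>?Q \<partial>mu j \<partial>mu j)"
 by (intro nn_integral_cong MM.Fubini') measurable
 also have "... = nn_integral PP (%z. f z)" by (rule key[symmetric]) measurable
 finally show ?thesis .
 qed
 show ?thesis
 proof (rule measure_eqI)
 fix A assume A: "A \<in> sets (distr PP PP (swap j))"
 then have [measurable]: "A \<in> sets PP" by simp
 have "emeasure (distr PP PP (swap j)) A = nn_integral (distr PP PP (swap j)) (%z. indicator A z)"
 using A by simp
 also have "... = nn_integral PP (%z. indicator A (swap j z))"
 using j by (subst nn_integral_distr) auto
 also have "... = emeasure PP A"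
 by (subst eq) auto
 finally show "emeasure (distr PP PP (swap j)) A = emeasure PP A" .
 qed simp
qed

lemma integral_swap:
 fixes f :: "_ => real"
 assumes "j < N" "f \<in> borel_measurable PP"
 shows "(LINT z|PP. f (swap j z)) = (LINT z|PP. f z)"
 using integral_distr[of "swap j" PP PP f] assms by (simp add: distr_swap)

text \<open>The partially replaced vector has the original law, since it is obtained by successive exchanges.\<close>

lemma distr_mix: "distr PP PP (%z. (mix k (fst z) (snd z), mix k (snd z) (fst z))) = PP"
proof (induction k)
 case 0
 have "(%z :: (nat => 's) \<times> (nat => 's). (mix 0 (fst z) (snd z), mix 0 (snd z) (fst z))) = (%z. z)"
 by (auto simp: mix_def fun_eq_iff)
 then show ?case by (simp only: distr_id2)
next
 case (Suc k)
 let ?m = "%k z. (mix k (fst z) (snd z), mix k (snd z) (fst z))"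
 have [measurable]: "?m k \<in> measurable PP PP" for k by measurable
 show ?case
 proof (cases "k < N")
 case True
 have "?m (Suc k) = swap k \<circ> ?m k" by (auto simp: mix_def swap_def fun_eq_iff)
 then have "distr PP PP (?m (Suc k)) = distr (distr PP PP (?m k)) PP (swap k)"
 using True by (simp add: distr_distr)
 then show ?thesis using True by (simp add: Suc distr_swap)
 next
 case False
 have "mix (Suc k) x y = mix k x y" if "x \<in> space P" "y \<in> space P" for x y
 using that False by (auto simp: mix_def fun_eq_iff space_PiM PiE_def extensional_def less_Suc_eq)
 then have "distr PP PP (?m (Suc k)) = distr PP PP (?m k)"
 by (intro distr_cong) (auto simp: space_pair_measure)
 then show ?thesis using Suc by simp
 qed
qed

lemma integral_PP_prod:
 assumes "bdd_meas P f" "bdd_meas P g"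
 shows "(II (%x y. f x*g y)) = (LINT x|P. f x)*(LINT x|P. g x)"
proof -
 have b: "bddPP (%x y. f x*g y)"
 by (intro bdd_meas_mult bdd_meas_fst_snd assms)
 have "(II (%x y. f x*g y)) = (LINT x|P. LINT y|P. f x*g y)"
 using PP.integral_fst'[of "%z. f (fst z)*g (snd z)"] PPi[OF b] by simp
 then show ?thesis by simp
qed

lemma integral_PP_fst:
 assumes "bdd_meas P f" shows "(II (%x y. f x)) = (LINT x|P. f x)"
 using integral_PP_prod[OF assms, of "%_. 1"] by (simp add: P.prob_space)

text \<open>The covariance is the expectation of \<open>U x * (V x - V y)\<close>. Interpolating between
 \<open>x\<close> and \<open>y\<close> one coordinate at a time and symmetrising each step by exchanging
 that coordinate with its copy makes both factors differences in that coordinate, at the cost of the factor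
 \<open>1/2\<close>.\<close>

lemma covariance_telescope:
 assumes U: "bdd_meas P U" and V: "bdd_meas P V"
 shows "(LINT x|P. U x*V x) - (LINT x|P. U x)*(LINT x|P. V x) =
 (1/2)*(\<Sum>j<N. LINT z|PP. (U (fst z) - U (upd j z)) *
 (V (mix j (fst z) (snd z)) - V (mix (Suc j) (fst z) (snd z))))"
proof -
 have bU [intro]: "bddPP (%x y. U x)" by (rule bdd_meas_fst_snd[OF U])
 have bU' [intro]: "bddPP (%x y. U (x(j := y j)))" if "j < N" for j
 by (rule bdd_meas_comp[OF U]) (use that in measurable)
 have bV [intro]: "bddPP (%x y. V (mix k x y))" for k
 by (rule bdd_meas_comp[OF V]) measurable
 have "(LINT x|P. U x*V x) - (LINT x|P. U x)*(LINT x|P. V x) =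
 (II (%x y. U x*V x)) - (II (%x y. U x*V y))"
 using integral_PP_prod[OF U V] integral_PP_fst[OF bdd_meas_mult[OF U V]] by simp
 also have "... = (II (%x y. U x*(V (mix 0 x y) - V (mix N x y))))"
 proof (subst bochner_diff[symmetric])
 show "integrable PP (%z. U (fst z)*V (fst z))" "integrable PP (%z. U (fst z)*V (snd z))"
 by (intro PPi bdd_meas_mult bdd_meas_fst_snd U V)+
 show "(II (%x y. U x*V x - U x*V y)) =
 (II (%x y. U x*(V (mix 0 x y) - V (mix N x y))))"
 proof (rule bochner_cong[OF refl])
 fix z assume z: "z \<in> space PP"
 have "mix 0 (fst z) (snd z) = fst z" "mix N (fst z) (snd z) = snd z"
 using z by (auto simp: mix_def fun_eq_iff space_pair_measure space_PiM PiE_def extensional_def)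
 then show "U (fst z)*V (fst z) - U (fst z)*V (snd z) =
 U (fst z)*(V (mix 0 (fst z) (snd z)) - V (mix N (fst z) (snd z)))"
 by (simp add: right_diff_distrib)
 qed
 qed
 also have "... = (II (%x y. (\<Sum>j<N. U x*(V (mix j x y) - V (mix (Suc j) x y)))))"
 by (simp add: sum_distrib_left[symmetric] sum_lessThan_telescope'[of "%j. V (mix j _ _)"])
 also have "... = (\<Sum>j<N. LINT z|PP. U (fst z)*(V (mix j (fst z) (snd z)) - V (mix (Suc j) (fst z) (snd z))))"
 by (rule bochner_sum) (intro PPi bdd_meas_mult bdd_meas_diff bU bV)
 also have "... = (\<Sum>j<N. (1/2)*(II (%x y. (U x - U (x(j := y j))) *
 (V (mix j x y) - V (mix (Suc j) x y)))))"
 proof (rule sum.cong[OF refl])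
 fix j assume "j \<in> {..<N}"
 then have j: "j < N" by simp
 let ?D = "%z. V (mix j (fst z) (snd z)) - V (mix (Suc j) (fst z) (snd z))"
 have sw: "mix j (fst (swap j z)) (snd (swap j z)) = mix (Suc j) (fst z) (snd z)"
 "mix (Suc j) (fst (swap j z)) (snd (swap j z)) = mix j (fst z) (snd z)" for z
 by (auto simp: swap_def mix_def fun_eq_iff less_Suc_eq)
 have "(LINT z|PP. U (fst z)*?D z) = (LINT z|PP. U (fst (swap j z))*?D (swap j z))"
 by (rule integral_swap[OF j, symmetric]) (intro bdd_meas_measurable bdd_meas_mult bdd_meas_diff bU bV)
 also have "... = (LINT z|PP. - (U (upd j z)*?D z))"
 unfolding sw by (simp add: swap_def algebra_simps)
 also have "... = - (LINT z|PP. U (upd j z)*?D z)" by simp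
 finally have 1: "(LINT z|PP. U (fst z)*?D z) = - (LINT z|PP. U (upd j z)*?D z)" .
 have "(LINT z|PP. (U (fst z) - U (upd j z))*?D z) =
 (LINT z|PP. U (fst z)*?D z) - (LINT z|PP. U (upd j z)*?D z)"
 unfolding left_diff_distrib
 by (rule bochner_diff) (use j in \<open>intro PPi bdd_meas_mult bdd_meas_diff bU bV bU'; simp\<close>)+
 with 1 show "(LINT z|PP. U (fst z)*?D z) = (1/2)*(LINT z|PP. (U (fst z) - U (upd j z))*?D z)"
 by simp
 qed
 finally show ?thesis by (simp add: sum_distrib_left)
qed

text \<open>The case \<open>U = V\<close> of the covariance expansion, with Cauchy--Schwarz in each term: the two
 differences have the same second moment.\<close>

lemma efron_stein:
 assumes V: "bdd_meas P V"
 shows "(LINT x|P. (V x)^2) - (LINT x|P. V x)^2 \<le>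
 (1/2)*(\<Sum>j<N. LINT z|PP. (V (fst z) - V (upd j z))^2)"
proof -
 define A where "A j z = V (fst z) - V (upd j z)" for j z
 define B where "B j z = V (mix j (fst z) (snd z)) - V (mix (Suc j) (fst z) (snd z))" for j z
 have bA: "bdd_meas PP (A j)" if "j < N" for j
 unfolding A_def[abs_def]
 by (intro bdd_meas_diff bdd_meas_comp[OF V]) (use that in measurable)
 have bB: "bdd_meas PP (B j)" for j
 unfolding B_def[abs_def] by (intro bdd_meas_diff bdd_meas_comp[OF V]) measurable
 have "(LINT z|PP. A j z*B j z) <= (LINT z|PP. (A j z)^2)" if j: "j \<in> {..<N}" for j
 proof -
 have jN: "j < N" using j by simp
 note bAB = bA[OF jN] bB
 have i2: "integrable PP (%z. (A j z)^2)" "integrable PP (%z. (B j z)^2)"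
 by (intro PPi bdd_meas_power bAB)+
 have "(LINT z|PP. A j z*B j z) <= (LINT z|PP. (1/2)*(A j z)^2 + (1/2)*(B j z)^2)"
 proof (rule integral_mono)
 fix z
 have "0 <= (A j z - B j z)^2" by simp
 then show "A j z*B j z <= (1/2)*(A j z)^2 + (1/2)*(B j z)^2"
 by (simp add: power2_eq_square algebra_simps)
 qed (intro PPi bdd_meas_mult bdd_meas_add bdd_meas_power bdd_meas_const bAB)+
 also have "... = (1/2)*(LINT z|PP. (A j z)^2) + (1/2)*(LINT z|PP. (B j z)^2)"
 using i2 by simp
 also have "(LINT z|PP. (B j z)^2) = (LINT z|PP. (A j z)^2)"
 proof -
 let ?m = "%z. (mix j (fst z) (snd z), mix j (snd z) (fst z))"
 have m: "?m \<in> measurable PP PP" by measurable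
 have "(LINT z|PP. (A j z)^2) = (LINT z|distr PP PP ?m. (A j z)^2)" by (simp only: distr_mix)
 also have "... = (LINT z|PP. (A j (?m z))^2)"
 by (rule integral_distr[OF m]) (intro bdd_meas_measurable bdd_meas_power bAB)
 also have "... = (LINT z|PP. (B j z)^2)"
 proof -
 have "(mix j (fst z) (snd z))(j := mix j (snd z) (fst z) j) = mix (Suc j) (fst z) (snd z)"
 for z :: "(nat => 's) \<times> (nat => 's)"
 by (auto simp: mix_def fun_eq_iff less_Suc_eq)
 then show ?thesis by (simp only: A_def B_def fst_conv snd_conv)
 qed
 finally show ?thesis by simp
 qed
 finally show ?thesis by simp
 qed
 then have "(\<Sum>j<N. LINT z|PP. A j z*B j z) <= (\<Sum>j<N. LINT z|PP. (A j z)^2)"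
 by (intro sum_mono)
 then show ?thesis
 using covariance_telescope[OF V V] unfolding A_def B_def by (simp only: power2_eq_square)
qed

definition E2 :: "nat => ('s => 's => real) => real" where
 "E2 j g = (II (%x y. g (x j) (y j)))"

lemma integral_PP_iter:
 assumes "bdd_meas PP f"
 shows "(LINT z|PP. f z) = (LINT x|P. LINT y|P. f (x, y))"
 using PP.integral_fst'[of f] PPi[OF assms] by simp

end

section \<open>Stein's method: the Wasserstein distance\<close>

lemma bdd_meas_continuous_comp:
 fixes ph :: "real => real"
 assumes "bdd_meas M F" "continuous_on UNIV ph"
 shows "bdd_meas M (%x. ph (F x))"
proof -
 from assms(1) obtain B where B: "!!x. x \<in> space M ==> abs (F x) <= B" by (auto simp: bdd_meas_def)
 have [measurable]: "F \<in> borel_measurable M" "ph \<in> borel_measurable borel"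
 using assms by (auto intro: bdd_meas_measurable borel_measurable_continuous_onI)
 have "bounded (ph ` {-B..B})"
 by (intro compact_imp_bounded compact_continuous_image continuous_on_subset[OF assms(2)]) auto
 then obtain C where C: "\<forall>u\<in>{-B..B}. abs (ph u) <= C" by (auto simp: bounded_iff)
 show ?thesis
 proof (rule bdd_measI[where B=C])
 fix x assume "x \<in> space M"
 from B[OF this] have "F x \<in> {-B..B}" by (simp add: abs_le_iff)
 with C show "abs (ph (F x)) <= C" by blast
 qed simp
qed

text \<open>The size of the third-order error of an expansion: cubic for small increments, but only quadratic for large
 ones, because the derivatives involved are bounded as well as Lipschitz.\<close>

definition kap :: "real => real" where "kap s = s^2*min 1 s"

text \<open>Products of increments taken at independent copies are reduced to a single increment.\<close>

lemma kap_split: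
 assumes "0 <= a" "0 <= b" shows "min 1 a*b^2 <= kap a + kap b"
proof (cases "b <= a")
 case True
 then have "min 1 a*b^2 <= min 1 a * a^2" using assms by (intro mult_left_mono power_mono) auto
 then show ?thesis using assms by (simp add: kap_def mult.commute add_increasing2)
next
 case False
 then have "min 1 a*b^2 <= min 1 b*b^2" by (intro mult_right_mono) auto
 then show ?thesis using assms by (simp add: kap_def mult.commute add_increasing)
qed

lemma kap_dominates:
 assumes "0 <= x" "x <= s" "0 <= y" "y <= s"
 shows "x*min 1 x*y <= kap s"
proof -
 have "x*min 1 x <= s*min 1 s" by (rule mult_mono) (use assms in auto)
 then have "x*min 1 x*y <= s*min 1 s * s" by (rule mult_mono) (use assms in auto)
 then show ?thesis by (simp add: kap_def power2_eq_square mult_ac)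
qed

text \<open>A standardised function \<open>F\<close> of independent coordinates whose first and second differences are
 controlled by \<open>h t j\<close>, the influence of coordinate \<open>j\<close> on the \<open>t\<close>-th
 summand.\<close>

locale smooth_functional = indep_coords N mu
 for N :: nat and mu :: "nat => 's measure" +
 fixes n :: nat and h :: "nat => nat => 's => 's => real" and c :: real and F :: "(nat => 's) => real"
 assumes h_meas: "!!t j. t < n ==> j < N ==> (%z. h t j (fst z) (snd z)) \<in> borel_measurable (mu2 j)"
 and h_nonneg: "!!t j x y. 0 <= h t j x y" and h_le_1: "!!t j x y. h t j x y <= 1"
 and h_sym: "!!t j x y. h t j x y = h t j y x"
 and c_nonneg: "0 <= c"
 and F_bdd: "bdd_meas P F"
 and F_mean: "(LINT x|P. F x) = 0" and F_var: "(LINT x|P. (F x)^2) = 1"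
 and F_diff: "!!z j u. j < N ==> abs (F z - F (z(j := u))) <= c*(\<Sum>t<n. h t j (z j) u)"
 and F_diff2: "!!z i j u w. i < N ==> j < N ==> i ~= j ==>
 abs (F z - F (z(i := u)) - (F (z(j := w)) - F (z(i := u, j := w)))) <= c*(\<Sum>t<n. h t i (z i) u*h t j (z j) w)"
begin

definition S :: "nat => 's => 's => real" where "S j x y = (\<Sum>t<n. h t j x y)"

text \<open>The two differences of \<open>F\<close> that the covariance expansion produces for coordinate
 \<open>j\<close>: at the original point and on the interpolating path.\<close>

definition a :: "nat => (nat => 's) => (nat => 's) => real" where
 "a j x y = F x - F (x(j := y j))"

definition b :: "nat => (nat => 's) => (nat => 's) => real" where
 "b j x y = F (mix j x y) - F (mix (Suc j) x y)"

lemma S_nonneg: "0 <= S j x y" unfolding S_def by (intro sum_nonneg h_nonneg)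

lemma S_sym: "S j x y = S j y x" unfolding S_def by (subst h_sym) (rule refl)

lemma cS_nonneg: "0 <= c*S j x y" by (intro mult_nonneg_nonneg c_nonneg S_nonneg)

lemma bdd_h:
 assumes "t < n" "j < N" "f \<in> measurable L (mu j)" "g \<in> measurable L (mu j)"
 shows "bdd_meas L (%z. h t j (f z) (g z))"
proof (rule bdd_measI[where B=1])
 show "(%z. h t j (f z) (g z)) \<in> borel_measurable L"
 using measurable_compose[OF measurable_Pair[OF assms(3,4)] h_meas[OF assms(1,2)]] by simp
 show "abs (h t j (f z) (g z)) <= 1" for z using h_nonneg[of t j "f z" "g z"] h_le_1[of t j "f z" "g z"] by simp
qed

lemma bdd_S:
 assumes "j < N" "f \<in> measurable L (mu j)" "g \<in> measurable L (mu j)"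
 shows "bdd_meas L (%z. S j (f z) (g z))"
 unfolding S_def by (intro bdd_meas_sum bdd_h assms) simp

lemma F_comp: "T \<in> measurable L P ==> bdd_meas L (%z. F (T z))"
 by (rule bdd_meas_comp[OF F_bdd])

lemma bdd_a:
 assumes "j < N" "f \<in> measurable L P" "g \<in> measurable L P"
 shows "bdd_meas L (%z. a j (f z) (g z))"
 unfolding a_def
 using assms by (intro bdd_meas_diff F_comp upd_measurable measurable_compose[OF assms(3) coord_measurable])

lemma bdd_b:
 assumes "f \<in> measurable L P" "g \<in> measurable L P"
 shows "bdd_meas L (%z. b j (f z) (g z))"
 unfolding b_def using assms by (intro bdd_meas_diff F_comp mix_measurable)

lemma in_space_upd: "x \<in> space P ==> j < N ==> u \<in> space (mu j) ==> x(j := u) \<in> space P"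
 by (auto simp: space_PiM PiE_def Pi_def extensional_def)

lemma in_space_mix: "x \<in> space P ==> y \<in> space P ==> mix j x y \<in> space P"
 by (auto simp: space_PiM PiE_def Pi_def extensional_def mix_def)

lemma coord_in_space: "x \<in> space P ==> j < N ==> x j \<in> space (mu j)"
 by (auto simp: space_PiM)

lemma mix_Suc_upd: "mix (Suc j) x y = (mix j x y)(j := y j)"
 by (auto simp: mix_def fun_eq_iff less_Suc_eq)

lemma a_bound: "j < N ==> abs (a j x y) <= c*S j (x j) (y j)"
 unfolding a_def S_def by (rule F_diff)

lemma b_bound: "j < N ==> abs (b j x y) <= c*S j (x j) (y j)"
 using F_diff[of j "mix j x y" "y j"] unfolding b_def S_def mix_Suc_upd by (simp add: mix_def)

lemma a_diff_fst:
 assumes "j < N" "i < N" "i ~= j"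
 shows "abs (a j x y - a j (x(i := u)) y) <= c*(\<Sum>t<n. h t i (x i) u*h t j (x j) (y j))"
 using F_diff2[OF assms(2,1,3), of x u "y j"] assms(3) by (simp add: a_def)

lemma a_snd: "i ~= j ==> a j x (y(i := u)) = a j x y" by (simp add: a_def)

lemma b_diff_fst:
 assumes "j < N" "i < N" "i ~= j"
 shows "abs (b j x y - b j (x(i := u)) y) <= c*(\<Sum>t<n. h t i (x i) u*h t j (x j) (y j))"
proof (cases "i < j")
 case True
 then have "mix k (x(i := u)) y = mix k x y" if "k >= j" for k
 using that by (auto simp: mix_def fun_eq_iff)
 then have "b j (x(i := u)) y = b j x y" by (simp add: b_def)
 then show ?thesis using c_nonneg h_nonneg by (auto intro!: mult_nonneg_nonneg sum_nonneg)
next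
 case False
 let ?m = "mix j x y"
 have e: "mix j (x(i := u)) y = ?m(i := u)" "?m i = x i" "?m j = x j"
 using False assms(3) by (auto simp: mix_def fun_eq_iff)
 have "b j x y - b j (x(i := u)) y = F ?m - F (?m(i := u)) - (F (?m(j := y j)) - F (?m(i := u, j := y j)))"
 unfolding b_def mix_Suc_upd e by simp
 then show ?thesis
 using F_diff2[OF assms(2,1,3), of ?m u "y j"] by (simp add: e)
qed

lemma b_diff_snd:
 assumes "j < N" "i < N" "i ~= j"
 shows "abs (b j x y - b j x (y(i := u))) <= c*(\<Sum>t<n. h t i (y i) u*h t j (x j) (y j))"
proof (cases "i < j")
 case False
 then have "mix k x (y(i := u)) = mix k x y" if "k <= Suc j" for k
 using that assms(3) by (auto simp: mix_def fun_eq_iff)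
 then have "b j x (y(i := u)) = b j x y" by (simp add: b_def)
 then show ?thesis using c_nonneg h_nonneg by (auto intro!: mult_nonneg_nonneg sum_nonneg)
next
 case True
 let ?m = "mix j x y"
 have e: "mix j x (y(i := u)) = ?m(i := u)" "?m i = y i" "?m j = x j" "(y(i := u)) j = y j"
 using True assms(3) by (auto simp: mix_def fun_eq_iff)
 have "b j x y - b j x (y(i := u)) = F ?m - F (?m(i := u)) - (F (?m(j := y j)) - F (?m(i := u, j := y j)))"
 unfolding b_def mix_Suc_upd e by simp
 then show ?thesis
 using F_diff2[OF assms(2,1,3), of ?m u "y j"] by (simp add: e)
qed

lemma a_swap: "a j (fst (swap j z)) (snd (swap j z)) = - a j (fst z) (snd z)"
 by (simp add: a_def swap_def)

lemma b_swap: "b j (fst (swap j z)) (snd (swap j z)) = - b j (fst z) (snd z)"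
proof -
 have "mix j (fst (swap j z)) (snd (swap j z)) = mix (Suc j) (fst z) (snd z)"
 "mix (Suc j) (fst (swap j z)) (snd (swap j z)) = mix j (fst z) (snd z)"
 by (auto simp: swap_def mix_def fun_eq_iff less_Suc_eq)
 then show ?thesis by (simp add: b_def)
qed

text \<open>Since \<open>F\<close> is centred, \<open>E (F * \<phi> F)\<close> is a covariance. The differences of
 \<open>\<phi> F\<close> are close to \<open>\<phi>' F * a j\<close>, so the left side is close to \<open>E
 (\<phi>' F)\<close> times \<open>1\<close> provided the sum of the products \<open>a j * b j\<close> is
 nearly constant.\<close>

lemma stein_identity:
 assumes "continuous_on UNIV ph"
 shows "(LINT x|P. F x*ph (F x)) =
 (1/2)*(\<Sum>j<N. LINT z|PP. (ph (F (fst z)) - ph (F (upd j z)))*b j (fst z) (snd z))"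
 using covariance_telescope[OF bdd_meas_continuous_comp[OF F_bdd assms] F_bdd] F_mean
 by (simp add: b_def mult.commute)

text \<open>The sum of the products has mean \<open>2\<close>; only its fluctuation remains to be controlled.\<close>

lemma var_identity: "1 = (1/2)*(\<Sum>j<N. LINT z|PP. a j (fst z) (snd z)*b j (fst z) (snd z))"
 using stein_identity[of "%x. x"] F_var by (simp add: a_def power2_eq_square)


definition rh :: "nat => (nat => 's) => real" where
 "rh j x = (LINT y|P. a j x y*b j x y)"

text \<open>The average of the products over the copy and over the \<open>j\<close>-th coordinate. Without the
 \<open>j\<close>-th coordinate its dependence on any other coordinate is of second order, so its sum over
 \<open>j\<close> has a small variance.\<close>

definition That :: "nat => (nat => 's) => real" where
 "That j x = (LINT w|P. rh j (x(j := w j)))"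

lemma bdd_ab: "j < N ==> bddPP (%x y. a j x y*b j x y)"
 by (intro bdd_meas_mult bdd_a bdd_b) auto

lemma bdd_rho: assumes "j < N" shows "bdd_meas P (rh j)"
 using bdd_meas_integral_snd[OF P.prob_space_axioms bdd_ab[OF assms]] unfolding rh_def[abs_def] by simp

lemma bdd_That: assumes "j < N" shows "bdd_meas P (That j)"
proof -
 have "bddPP (%x y. rh j (x(j := y j)))"
 by (rule bdd_meas_comp[OF bdd_rho[OF assms]]) (use assms in measurable)
 from bdd_meas_integral_snd[OF P.prob_space_axioms this] show ?thesis
 unfolding That_def[abs_def] by simp
qed

text \<open>Resampling coordinate \<open>j\<close> inside \<open>That j\<close> can be moved to the other factor by
 exchanging the coordinate with its copy.\<close>

lemma integral_psi_That:
 assumes j: "j < N" and psi: "bdd_meas P ps"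
 shows "(LINT x|P. ps x*That j x) = (II (%x y. ps (x(j := y j))*rh j x))"
proof -
 have m: "(%z. (fst z)(j := snd z j)) \<in> measurable PP P" using j by measurable
 have b1: "bddPP (%x y. ps x*rh j (x(j := y j)))"
 by (intro bdd_meas_mult bdd_meas_fst_snd psi bdd_meas_comp[OF bdd_rho[OF j] m])
 have b2: "bddPP (%x y. ps (x(j := y j))*rh j x)"
 by (intro bdd_meas_mult bdd_meas_fst_snd bdd_rho j bdd_meas_comp[OF psi m])
 have "(LINT x|P. ps x*That j x) = (LINT x|P. LINT w|P. ps x*rh j (x(j := w j)))"
 by (simp add: That_def)
 also have "... = (II (%x y. ps x*rh j (x(j := y j))))"
 using integral_PP_iter[OF b1] by simp
 also have "... = (LINT z|PP. ps (fst (swap j z))*rh j ((fst (swap j z))(j := snd (swap j z) j)))"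
 by (rule integral_swap[OF j, symmetric]) (rule bdd_meas_measurable[OF b1])
 finally show ?thesis by (simp add: swap_def)
qed

lemma integral_psi_ab:
 assumes j: "j < N" and psi: "bdd_meas P ps"
 shows "(II (%x y. ps x*(a j x y*b j x y))) = (II (%x y. ps x*rh j x))"
proof -
 have "bddPP (%x y. ps x*(a j x y*b j x y))"
 by (intro bdd_meas_mult bdd_meas_fst_snd psi bdd_ab[OF j])
 from integral_PP_iter[OF this]
 have "(II (%x y. ps x*(a j x y*b j x y))) = (LINT x|P. ps x*rh j x)"
 by (simp add: rh_def)
 also have "... = (II (%x y. ps x*rh j x))"
 by (rule integral_PP_fst[symmetric]) (intro bdd_meas_mult psi bdd_rho j)
 finally show ?thesis .
qed

lemma bdd_cS: "j < N ==> f \<in> measurable L (mu j) ==> g \<in> measurable L (mu j) ==> bdd_meas L (%z. c*S j (f z) (g z))"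
 by (intro bdd_meas_mult bdd_meas_const bdd_S)

lemma bdd_kap: "bdd_meas L f ==> bdd_meas L (%z. kap (f z))"
 unfolding kap_def by (intro bdd_meas_mult bdd_meas_power bdd_meas_min bdd_meas_const)

lemma coord_fst [measurable]: "j < N ==> (%z. fst z j) \<in> measurable PP (mu j)"
 by (rule measurable_compose[OF measurable_fst coord_measurable])

lemma coord_snd [measurable]: "j < N ==> (%z. snd z j) \<in> measurable PP (mu j)"
 by (rule measurable_compose[OF measurable_snd coord_measurable])

lemma PP_bound:
 assumes "bdd_meas PP f" "bdd_meas PP g" "!!x y. x \<in> space P ==> y \<in> space P ==> abs (f (x, y)) <= g (x, y)"
 shows "abs (LINT z|PP. f z) <= (LINT z|PP. g z)"
 by (rule PP.bdd_meas_integral_bound) (use assms in \<open>auto simp: space_pair_measure\<close>)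

text \<open>Resampling coordinate \<open>j\<close> in \<open>\<psi>\<close> costs one more increment, so the products
 may be replaced by their averages up to a third-order error.\<close>

lemma replace_by_That:
 assumes j: "j < N" and psi: "bdd_meas P ps" and "0 <= K"
 and lip: "!!x u. abs (ps x - ps (x(j := u))) <= K*min 1 (c*S j (x j) u)"
 shows "abs ((II (%x y. ps x*(a j x y*b j x y))) - (LINT x|P. ps x*That j x))
 <= 2*K*E2 j (%x y. kap (c*S j x y))"
proof -
 have m: "(%z. (fst z)(j := snd z j)) \<in> measurable PP P" using j by measurable
 note mj = coord_measurable[OF j] coord_fst[OF j] coord_snd[OF j]
 let ?s = "%x y. c*S j (x j) (y j)"
 have bs: "bddPP (%x y. ?s x y)" by (intro bdd_cS j mj)
 define k where "k x = (LINT y|P. kap (?s x y))" for x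
 define m1 where "m1 x = (LINT w|P. min 1 (?s x w))" for x
 define s2 where "s2 x = (LINT y|P. (?s x y)^2)" for x
 have bk: "bdd_meas P k" "bdd_meas P s2"
 unfolding k_def[abs_def] s2_def[abs_def]
 using bdd_meas_integral_snd[OF P.prob_space_axioms bdd_kap[OF bs]]
 bdd_meas_integral_snd[OF P.prob_space_axioms bdd_meas_power[OF bs, of 2]] by simp_all
 have bsx: "bdd_meas P (%y. ?s x y)" if "x \<in> space P" for x
 by (intro bdd_cS j mj) (use coord_in_space[OF that j] in simp)
 have rho: "abs (rh j x) <= s2 x" if x: "x \<in> space P" for x
 unfolding rh_def s2_def
 proof (rule P.bdd_meas_integral_bound)
 show "bdd_meas P (%y. a j x y*b j x y)" by (intro bdd_meas_mult bdd_a bdd_b j) (use x in auto)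
 show "abs (a j x y*b j x y) <= (?s x y)^2" if "y \<in> space P" for y
 unfolding abs_mult power2_eq_square by (intro mult_mono a_bound b_bound cS_nonneg j) auto
 qed (intro bdd_meas_power bsx x)
 have ms: "m1 x * s2 x <= 2 * k x" if x: "x \<in> space P" for x
 proof -
 have b1: "bddPP (%x' y'. min 1 (?s x x')*(?s x y')^2)"
 by (rule bdd_meas_mult[OF bdd_meas_min[OF bdd_meas_const bdd_meas_fst_snd(1)[OF bsx[OF x]]]
 bdd_meas_power[OF bdd_meas_fst_snd(2)[OF bsx[OF x]]]])
 have bk': "bdd_meas P (%y. kap (?s x y))" by (intro bdd_kap bsx x)
 have b2: "bddPP (%x' y'. kap (?s x x'))" "bddPP (%x' y'. kap (?s x y'))"
 using bdd_meas_fst_snd[OF bk'] by auto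
 have "m1 x * s2 x = (II (%x' y'. min 1 (?s x x')*(?s x y')^2))"
 unfolding m1_def s2_def
 using integral_PP_prod[of "%w. min 1 (?s x w)" "%y. (?s x y)^2"] bsx[OF x] by (simp add: bdd_meas_min bdd_meas_power)
 also have "... <= (II (%x' y'. kap (?s x x') + kap (?s x y')))"
 by (intro integral_mono PPi b1 bdd_meas_add b2 kap_split cS_nonneg)
 also have "... = (II (%x' y'. kap (?s x x'))) + (II (%x' y'. kap (?s x y')))"
 by (intro bochner_add PPi b2)
 also have "... = k x + k x"
 using integral_PP_prod[OF bk', of "%_. 1"] integral_PP_prod[OF _ bk', of "%_. 1"]
 by (simp add: k_def P.prob_space)
 finally show ?thesis by simp
 qed
 have bK: "bddPP (%x y. K*min 1 (?s x y) * s2 x)"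
 by (rule bdd_meas_mult[OF bdd_meas_mult[OF bdd_meas_const bdd_meas_min[OF bdd_meas_const bs]]
 bdd_meas_fst_snd(1)[OF bk(2)]])
 have bd: "bddPP (%x y. (ps x - ps (x(j := y j)))*rh j x)"
 by (intro bdd_meas_mult bdd_meas_diff bdd_meas_fst_snd psi bdd_rho j bdd_meas_comp[OF psi m])
 have bi: "bddPP (%x y. ps x*rh j x)" "bddPP (%x y. ps (x(j := y j))*rh j x)"
 by (intro bdd_meas_mult bdd_meas_fst_snd psi bdd_rho j bdd_meas_comp[OF psi m])+
 have eq1: "(II (%x y. ps x*(a j x y*b j x y))) - (LINT x|P. ps x*That j x)
 = (II (%x y. (ps x - ps (x(j := y j)))*rh j x))"
 unfolding integral_psi_ab[OF j psi] integral_psi_That[OF j psi] left_diff_distrib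
 by (intro bochner_diff[symmetric] PPi bi)
 have "abs (LINT z|PP. (ps (fst z) - ps (upd j z))*rh j (fst z))
 <= (II (%x y. K*min 1 (?s x y) * s2 x))"
 proof (rule PP_bound[OF bd bK], goal_cases)
 case (1 x y)
 have "abs (ps x - ps (x(j := y j))) * abs (rh j x) <= K*min 1 (?s x y) * s2 x"
 by (rule mult_mono[OF lip rho[OF 1(1)]])
 (rule mult_nonneg_nonneg[OF \<open>0 <= K\<close>], simp add: cS_nonneg, simp)
 then show ?case by (simp only: abs_mult fst_conv snd_conv)
 qed
 also have "... = (LINT x|P. K*(m1 x * s2 x))"
 unfolding integral_PP_iter[OF bK] by (simp add: m1_def mult.assoc mult.left_commute)
 also have "... <= (LINT x|P. K*(2 * k x))"
 proof (rule integral_mono)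
 have bm1: "bdd_meas P m1" unfolding m1_def[abs_def]
 using bdd_meas_integral_snd[OF P.prob_space_axioms bdd_meas_min[OF bdd_meas_const bs]] by simp
 show "integrable P (%x. K*(m1 x * s2 x))" "integrable P (%x. K*(2 * k x))"
 by (intro P.bdd_meas_integrable bdd_meas_mult bdd_meas_const bk bm1)+
 qed (use ms \<open>0 <= K\<close> in \<open>auto intro: mult_left_mono\<close>)
 also have "... = 2*K*(LINT x|P. k x)" by simp
 also have "(LINT x|P. k x) = E2 j (%x y. kap (c*S j x y))"
 unfolding E2_def k_def integral_PP_iter[OF bdd_kap[OF bs]] by simp
 finally show ?thesis unfolding eq1 .
qed


lemma mult_diff_bound:
 fixes p q p' q' :: real
 assumes "abs (p - p') <= H" "abs (q - q') <= H'" "abs p' <= s" "abs q <= s"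
 shows "abs (p * q - p' * q') <= (H + H') * s"
proof -
 have "p * q - p' * q' = (p - p') * q + p'*(q - q')" by (simp add: algebra_simps)
 also have "abs ... <= abs (p - p') * abs q + abs p' * abs (q - q')"
 by (metis abs_mult abs_triangle_ineq)
 also have "... <= H * s + s*H'" using assms by (intro add_mono mult_mono) auto
 finally show ?thesis by (simp add: algebra_simps)
qed

abbreviation hS :: "nat => nat => 's => 's => real" where
 "hS t j x y \<equiv> h t j x y*S j x y"

lemma ab_diff_fst:
 assumes "j < N" "i < N" "i ~= j"
 shows "abs (a j x y*b j x y - a j (x(i := u)) y*b j (x(i := u)) y)
 <= 2*c^2*(\<Sum>t<n. h t i (x i) u*hS t j (x j) (y j))"
proof -
 let ?H = "c*(\<Sum>t<n. h t i (x i) u*h t j (x j) (y j))"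
 have "abs (a j x y*b j x y - a j (x(i := u)) y*b j (x(i := u)) y) <= (?H + ?H)*(c*S j (x j) (y j))"
 using a_bound[OF assms(1), of "x(i := u)" y] assms(3)
 by (intro mult_diff_bound a_diff_fst b_diff_fst b_bound assms) auto
 also have "... = 2*c^2*(\<Sum>t<n. h t i (x i) u*hS t j (x j) (y j))"
 by (simp add: power2_eq_square sum_distrib_left sum_distrib_right algebra_simps)
 finally show ?thesis .
qed

lemma bdd_hS:
 assumes "t < n" "j < N" "f \<in> measurable L (mu j)" "g \<in> measurable L (mu j)"
 shows "bdd_meas L (%z. hS t j (f z) (g z))"
 by (intro bdd_meas_mult bdd_h bdd_S assms)

lemma hS_nonneg: "0 <= hS t j x y" by (intro mult_nonneg_nonneg h_nonneg S_nonneg)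

text \<open>A change of coordinate \<open>i\<close> affects the products for \<open>j \<noteq> i\<close> only through
 second differences of \<open>F\<close>, and the product for \<open>j = i\<close> not at all.\<close>

lemma That_diff:
 assumes x: "x \<in> space P" and j: "j < N" and i: "i < N" and u: "u \<in> space (mu i)"
 shows "abs (That j x - That j (x(i := u))) <= 2*c^2*(\<Sum>t<n. h t i (x i) u*E2 j (hS t j))"
proof (cases "i = j")
 case True
 have "That j (x(i := u)) = That j x" by (simp add: That_def True)
 moreover have "0 <= E2 j (hS t j)" for t unfolding E2_def
 by (intro bochner_nonneg hS_nonneg)
 ultimately show ?thesis using h_nonneg by (auto intro!: mult_nonneg_nonneg sum_nonneg)
next
 case False
 let ?B = "%w y. 2*c^2*(\<Sum>t<n. h t i (x i) u*hS t j (w j) (y j))"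
 note mj = coord_measurable[OF j] coord_fst[OF j] coord_snd[OF j]
 have upd: "(%w. x(j := w j)) \<in> measurable P P" "(%w. x(i := u, j := w j)) \<in> measurable P P"
 using x in_space_upd[OF x i u] j by measurable
 have bB: "bddPP (%x y. ?B x y)"
 by (intro bdd_meas_mult bdd_meas_const bdd_meas_sum bdd_hS j mj) simp
 have bBw: "bdd_meas P (%y. ?B w y)" if "w \<in> space P" for w
 by (intro bdd_meas_mult bdd_meas_const bdd_meas_sum bdd_hS j mj) (use coord_in_space[OF that j] in simp_all)
 have in1: "abs (rh j (x(j := w j)) - rh j (x(i := u, j := w j))) <= (LINT y|P. ?B w y)" if w: "w \<in> space P" for w
 proof -
 let ?x = "x(j := w j)" let ?x' = "x(i := u, j := w j)"
 have sp: "?x \<in> space P" "?x' \<in> space P"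
 by (intro in_space_upd x j i u coord_in_space w)+
 have eq: "?x' = ?x(i := u)" using False by (auto simp: fun_eq_iff)
 have b1: "bdd_meas P (%y. a j ?x y*b j ?x y)" "bdd_meas P (%y. a j ?x' y*b j ?x' y)"
 by (intro bdd_meas_mult bdd_a bdd_b j; use sp in simp)+
 have "rh j ?x - rh j ?x' = (LINT y|P. a j ?x y*b j ?x y - a j ?x' y*b j ?x' y)"
 unfolding rh_def by (intro bochner_diff[symmetric] P.bdd_meas_integrable b1)
 moreover have "abs (LINT y|P. a j ?x y*b j ?x y - a j ?x' y*b j ?x' y) <= (LINT y|P. ?B w y)"
 proof (rule P.bdd_meas_integral_bound[OF bdd_meas_diff[OF b1] _ bBw[OF w]])
 show "abs (a j ?x y*b j ?x y - a j ?x' y*b j ?x' y) <= ?B w y" for y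
 using ab_diff_fst[OF j i False, of ?x y u] False unfolding eq by simp
 qed
 ultimately show ?thesis by simp
 qed
 have br: "bdd_meas P (%w. rh j (x(j := w j)))" "bdd_meas P (%w. rh j (x(i := u, j := w j)))"
 by (rule bdd_meas_comp[OF bdd_rho[OF j]], rule upd)+
 have "That j x - That j (x(i := u)) = (LINT w|P. rh j (x(j := w j)) - rh j (x(i := u, j := w j)))"
 unfolding That_def by (intro bochner_diff[symmetric] P.bdd_meas_integrable br)
 moreover have "abs (LINT w|P. rh j (x(j := w j)) - rh j (x(i := u, j := w j))) <= (LINT w|P. LINT y|P. ?B w y)"
 proof (rule P.bdd_meas_integral_bound[OF bdd_meas_diff[OF br]])
 fix w assume "w \<in> space P"
 then show "abs (rh j (x(j := w j)) - rh j (x(i := u, j := w j))) <= (LINT y|P. ?B w y)" by (rule in1)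
 qed (use bdd_meas_integral_snd[OF P.prob_space_axioms bB] in \<open>simp only: fst_conv snd_conv\<close>)
 moreover have "(LINT w|P. LINT y|P. ?B w y) = (II (%x y. ?B x y))"
 unfolding integral_PP_iter[OF bB] by (simp only: fst_conv snd_conv)
 moreover have "(II (%x y. ?B x y)) = 2*c^2*(\<Sum>t<n. h t i (x i) u*E2 j (hS t j))"
 proof -
 have "(II (%x y. ?B x y)) = 2*c^2*(II (%x' y'. (\<Sum>t<n. h t i (x i) u*hS t j (x' j) (y' j))))"
 by (rule bochner_cmult)
 also have "(II (%x' y'. (\<Sum>t<n. h t i (x i) u*hS t j (x' j) (y' j))))
 = (\<Sum>t<n. LINT z|PP. h t i (x i) u*hS t j (fst z j) (snd z j))"
 by (intro bochner_sum PPi bdd_meas_mult bdd_meas_const bdd_hS[unfolded mult.assoc] bdd_h bdd_S j mj) simp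
 also have "... = (\<Sum>t<n. h t i (x i) u*E2 j (hS t j))" by (simp add: E2_def)
 finally show ?thesis .
 qed
 ultimately show ?thesis by (simp only:)
qed

lemma E2_cong: "(!!x y. f x y = g x y) ==> E2 j f = E2 j g" by (simp add: E2_def)

lemma sum_E2_S2:
 assumes B1: "!!t. t < n ==> (\<Sum>j<N. E2 j (hS t j)) <= B1"
 shows "(\<Sum>j<N. E2 j (%x y. (S j x y)^2)) <= real n*B1"
proof -
 have "E2 j (%x y. (S j x y)^2) = (\<Sum>t<n. E2 j (hS t j))" if j: "j < N" for j
 proof -
 note mj = coord_fst[OF j] coord_snd[OF j]
 have "E2 j (%x y. (S j x y)^2) = (II (%x y. (\<Sum>t<n. hS t j (x j) (y j))))"
 unfolding E2_def power2_eq_square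
 by (subst (1) S_def) (simp add: sum_distrib_right)
 also have "... = (\<Sum>t<n. E2 j (hS t j))" unfolding E2_def
 by (intro bochner_sum PPi bdd_hS j mj) simp
 finally show ?thesis .
 qed
 then have "(\<Sum>j<N. E2 j (%x y. (S j x y)^2)) = (\<Sum>j<N. \<Sum>t<n. E2 j (hS t j))" by simp
 also have "... = (\<Sum>t<n. \<Sum>j<N. E2 j (hS t j))" by (rule sum.swap)
 also have "... <= (\<Sum>t<n. B1)" by (intro sum_mono B1) simp
 finally show ?thesis by simp
qed

text \<open>For a Stein solution with Lipschitz derivative: expand \<open>\<phi> F\<close> to first order in each
 coordinate, replace the products of increments by their averages \<open>That j\<close>, and bound the
 covariance of \<open>\<phi>' F\<close> with half of the sum of these averages by the covariance expansion
 once more. Here the first two steps cost third-order errors and the last one the square of the row sums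
 \<open>B1\<close>.\<close>

lemma wasserstein_stein_bound:
 assumes d: "!!w. (ph has_real_derivative ph' w) (at w)"
 and K: "!!w. abs (ph' w) <= K" "!!u w. abs (ph' u - ph' w) <= K * abs (u - w)"
 and B1: "!!t. t < n ==> (\<Sum>j<N. E2 j (hS t j)) <= B1"
 shows "abs ((LINT x|P. ph' (F x)) - (LINT x|P. F x*ph (F x)))
 <= 3*K*(\<Sum>j<N. E2 j (%x y. kap (c*S j x y))) + K*c^3*real n*B1^2"
proof -
 have K0: "0 <= K" using K(1)[of 0] by linarith
 have c1: "continuous_on UNIV ph"
 by (meson DERIV_isCont continuous_at_imp_continuous_on d)
 have c2: "continuous_on UNIV ph'"
 proof -
 have "K-lipschitz_on UNIV ph'"
 by (rule lipschitz_onI) (use K K0 in \<open>auto simp: dist_real_def\<close>)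
 then show ?thesis by (rule lipschitz_on_continuous_on)
 qed
 define ps where "ps x = ph' (F x)" for x
 have psi: "bdd_meas P ps" unfolding ps_def[abs_def] by (rule bdd_meas_continuous_comp[OF F_bdd c2])
 have bphi: "bdd_meas P (%x. ph (F x))" by (rule bdd_meas_continuous_comp[OF F_bdd c1])
 have lip: "abs (ph' u - ph' w) <= 2*K*min 1 (abs (u - w))" for u w
 proof -
 have "abs (ph' u - ph' w) <= 2*K" using K(1)[of u] K(1)[of w] by linarith
 moreover have "abs (ph' u - ph' w) <= 2*K * abs (u - w)"
 using K(2)[of u w] mult_nonneg_nonneg[OF K0, of "abs (u - w)"] by linarith
 ultimately show ?thesis by (simp add: min_def)
 qed
 have taylor: "abs (ph w - ph u - (w - u)*ph' w) <= 2*K*(abs (w - u)*min 1 (abs (w - u)))" for u w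
 proof -
 have mvt: "\<exists>s. abs (s - w) <= abs (w - u) & ph w - ph u = (w - u)*ph' s"
 proof (cases u w rule: linorder_cases)
 case less
 from MVT2[OF this, of ph ph'] d obtain s where "u < s" "s < w" "ph w - ph u = (w - u)*ph' s" by blast
 then show ?thesis by (intro exI[of _ s]) auto
 next
 case greater
 from MVT2[OF this, of ph ph'] d obtain s where "w < s" "s < u" "ph u - ph w = (u - w)*ph' s" by blast
 then show ?thesis by (intro exI[of _ s]) (auto simp: algebra_simps)
 qed auto
 then obtain s where s: "abs (s - w) <= abs (w - u)" "ph w - ph u = (w - u)*ph' s" by blast
 have "ph w - ph u - (w - u)*ph' w = (w - u)*(ph' s - ph' w)" by (simp add: s(2) algebra_simps)
 also have "abs ... <= abs (w - u)*(2*K*min 1 (abs (s - w)))" unfolding abs_mult by (intro mult_left_mono lip) auto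
 also have "... <= abs (w - u)*(2*K*min 1 (abs (w - u)))" using s(1) K0 by (intro mult_left_mono) auto
 finally show ?thesis by (simp add: mult_ac)
 qed
 let ?k = "%j. E2 j (%x y. kap (c*S j x y))"
 have upd: "(%z. (fst z)(j := snd z j)) \<in> measurable PP P" if "j < N" for j using that by measurable
 have bab: "bddPP (%x y. ps x*(a j x y*b j x y))" if "j < N" for j
 by (rule bdd_meas_mult[OF bdd_meas_fst_snd(1)[OF psi] bdd_ab[OF that]])
 have bphib: "bddPP (%x y. (ph (F x) - ph (F (x(j := y j))))*b j x y)" if "j < N" for j
 by (intro bdd_meas_mult bdd_meas_diff bdd_meas_fst_snd(1)[OF bphi] bdd_meas_comp[OF bphi] upd that bdd_b) auto
 have step1: "abs ((II (%x y. (ph (F x) - ph (F (x(j := y j))))*b j x y))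
 - (II (%x y. ps x*(a j x y*b j x y)))) <= 2*K*?k j" if j: "j < N" for j
 proof -
 note mj = coord_fst[OF j] coord_snd[OF j]
 have bk: "bddPP (%x y. 2*K * kap (c*S j (x j) (y j)))"
 by (intro bdd_meas_mult bdd_meas_const bdd_kap bdd_S j mj)
 have "(II (%x y. (ph (F x) - ph (F (x(j := y j))))*b j x y))
 - (II (%x y. ps x*(a j x y*b j x y)))
 = (II (%x y. (ph (F x) - ph (F (x(j := y j))))*b j x y
 - ps x*(a j x y*b j x y)))"
 by (intro bochner_diff[symmetric] PPi bphib bab j)
 moreover have "abs (LINT z|PP. (ph (F (fst z)) - ph (F (upd j z)))*b j (fst z) (snd z)
 - ps (fst z)*(a j (fst z) (snd z)*b j (fst z) (snd z)))
 <= (II (%x y. 2*K * kap (c*S j (x j) (y j))))"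
 proof (rule PP_bound[OF bdd_meas_diff[OF bphib[OF j] bab[OF j]] bk], goal_cases)
 case (1 x y)
 let ?s = "c*S j (x j) (y j)"
 have A: "F x - F (x(j := y j)) = a j x y" by (simp add: a_def)
 have eq: "(ph (F x) - ph (F (x(j := y j))))*b j x y - ps x*(a j x y*b j x y)
 = (ph (F x) - ph (F (x(j := y j))) - a j x y*ph' (F x))*b j x y"
 by (simp add: ps_def algebra_simps)
 have "abs (ph (F x) - ph (F (x(j := y j))) - a j x y*ph' (F x)) <= 2*K*(abs (a j x y)*min 1 (abs (a j x y)))"
 using taylor[of "F x" "F (x(j := y j))"] unfolding A .
 then have "abs (ph (F x) - ph (F (x(j := y j))) - a j x y*ph' (F x)) * abs (b j x y)
 <= (2*K*(abs (a j x y)*min 1 (abs (a j x y)))) * abs (b j x y)"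
 by (rule mult_right_mono) simp
 also have "... = 2*K*(abs (a j x y)*min 1 (abs (a j x y)) * abs (b j x y))" by (simp only: mult.assoc)
 also have "... <= 2*K * kap ?s"
 by (rule mult_left_mono[OF kap_dominates[OF abs_ge_zero a_bound[OF j] abs_ge_zero b_bound[OF j]]]) (use K0 in simp)
 finally show ?case
 by (simp only: fst_conv snd_conv eq abs_mult)
 qed
 ultimately show ?thesis by (simp add: E2_def)
 qed
 have step2: "abs ((II (%x y. ps x*(a j x y*b j x y))) - (LINT x|P. ps x*That j x))
 <= 2*(2*K)*?k j" if j: "j < N" for j
 proof (rule replace_by_That[OF j psi])
 fix x u
 have "abs (ps x - ps (x(j := u))) <= 2*K*min 1 (abs (F x - F (x(j := u))))" unfolding ps_def by (rule lip)
 also have "... <= 2*K*min 1 (c*S j (x j) u)"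
 using F_diff[OF j, of x u] K0 unfolding S_def by (intro mult_left_mono) auto
 finally show "abs (ps x - ps (x(j := u))) <= 2*K*min 1 (c*S j (x j) u)" .
 qed (use K0 in simp)
 define T where "T x = (1/2)*(\<Sum>j<N. That j x)" for x
 have bT: "bdd_meas P T" unfolding T_def[abs_def]
 by (intro bdd_meas_mult bdd_meas_const bdd_meas_sum bdd_That) simp
 have intT: "(LINT x|P. g x*T x) = (1/2)*(\<Sum>j<N. LINT x|P. g x*That j x)" if g: "bdd_meas P g" for g
 proof -
 have "(LINT x|P. g x*T x) = (LINT x|P. (1/2)*(\<Sum>j<N. g x*That j x))"
 by (simp add: T_def sum_distrib_left mult.left_commute)
 also have "... = (1/2)*(LINT x|P. (\<Sum>j<N. g x*That j x))" by (rule bochner_cmult)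
 also have "(LINT x|P. (\<Sum>j<N. g x*That j x)) = (\<Sum>j<N. LINT x|P. g x*That j x)"
 by (intro bochner_sum P.bdd_meas_integrable bdd_meas_mult g bdd_That) simp
 finally show ?thesis .
 qed
 have T1: "(LINT x|P. T x) = 1"
 proof -
 have "(LINT x|P. 1*That j x) = (II (%x y. a j x y*b j x y))" if "j < N" for j
 using integral_psi_That[OF that bdd_meas_const[of P 1]] integral_psi_ab[OF that bdd_meas_const[of P 1]] by simp
 then show ?thesis using intT[of "%_. 1"] var_identity by simp
 qed
 have step4: "abs ((LINT x|P. ps x*T x) - (LINT x|P. ps x)) <= (1/2)*(\<Sum>i<N. 2*K*c^3*B1*E2 i (%x y. (S i x y)^2))"
 proof -
 have B10: "0 <= B1" if "n > 0"
 proof -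
 have "0 <= (\<Sum>j<N. E2 j (hS 0 j))" unfolding E2_def
 by (intro sum_nonneg bochner_nonneg hS_nonneg)
 then show ?thesis using B1[OF that] by simp
 qed
 have Td: "abs (T z - T (z(i := u))) <= c^2*B1*S i (z i) u" if z: "z \<in> space P" and i: "i < N" and u: "u \<in> space (mu i)" for z i u
 proof -
 have "abs (T z - T (z(i := u))) = (1/2) * abs (\<Sum>j<N. That j z - That j (z(i := u)))"
 unfolding T_def sum_subtractf right_diff_distrib[symmetric] abs_mult by simp
 also have "... <= (1/2)*(\<Sum>j<N. 2*c^2*(\<Sum>t<n. h t i (z i) u*E2 j (hS t j)))"
 by (intro mult_left_mono order.trans[OF sum_abs] sum_mono That_diff z i u) auto
 also have "... = c^2*(\<Sum>t<n. h t i (z i) u*(\<Sum>j<N. E2 j (hS t j)))"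
 by (subst sum_distrib_left[symmetric], subst sum.swap) (simp add: sum_distrib_left)
 also have "... <= c^2*(\<Sum>t<n. h t i (z i) u*B1)"
 by (intro mult_left_mono sum_mono B1 h_nonneg) auto
 also have "... = c^2*B1*S i (z i) u" unfolding S_def by (simp only: sum_distrib_right[symmetric]) (simp only: mult_ac)
 finally show ?thesis .
 qed
 have e: "(LINT x|P. ps x*T x) - (LINT x|P. ps x) = (1/2)*(\<Sum>i<N. LINT z|PP. (ps (fst z) - ps (upd i z)) *
 (T (mix i (fst z) (snd z)) - T (mix (Suc i) (fst z) (snd z))))"
 using covariance_telescope[OF psi bT] T1 by simp
 have "abs (LINT z|PP. (ps (fst z) - ps (upd i z))*(T (mix i (fst z) (snd z)) - T (mix (Suc i) (fst z) (snd z))))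
 <= 2*K*c^3*B1*E2 i (%x y. (S i x y)^2)" if i: "i < N" for i
 proof -
 note mj = coord_fst[OF i] coord_snd[OF i]
 have "abs (LINT z|PP. (ps (fst z) - ps (upd i z))*(T (mix i (fst z) (snd z)) - T (mix (Suc i) (fst z) (snd z))))
 <= (II (%x y. 2*K*c^3*B1*(S i (x i) (y i))^2))"
 proof (rule PP_bound, goal_cases)
 case 1 show "bddPP (%x y. (ps x - ps (x(i := y i)))*(T (mix i x y) - T (mix (Suc i) x y)))"
 by (intro bdd_meas_mult bdd_meas_diff bdd_meas_fst_snd(1)[OF psi] bdd_meas_comp[OF psi] bdd_meas_comp[OF bT] upd i mix_measurable) auto
 next
 case 2 show "bddPP (%x y. 2*K*c^3*B1*(S i (x i) (y i))^2)"
 by (intro bdd_meas_mult bdd_meas_const bdd_meas_power bdd_S i mj)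
 next
 case (3 x y)
 let ?S = "S i (x i) (y i)"
 have m: "mix i x y i = x i" by (simp add: mix_def)
 have "abs (ps x - ps (x(i := y i))) <= K * abs (F x - F (x(i := y i)))" unfolding ps_def by (rule K(2))
 also have "... <= K*(c*?S)"
 using F_diff[OF i, of x "y i"] K0 unfolding S_def by (intro mult_left_mono) auto
 also have "... <= 2*K*(c*?S)"
 using K0 cS_nonneg[of i "x i" "y i"] mult_nonneg_nonneg[of K "c*?S"] by linarith
 finally have 1: "abs (ps x - ps (x(i := y i))) <= 2*K*(c*?S)" .
 have 2: "abs (T (mix i x y) - T (mix (Suc i) x y)) <= c^2*B1*?S"
 using Td[OF in_space_mix[OF 3(1,2)] i coord_in_space[OF 3(2) i], of i] unfolding mix_Suc_upd m .
 have "abs (ps x - ps (x(i := y i))) * abs (T (mix i x y) - T (mix (Suc i) x y)) <= (2*K*(c*?S))*(c^2*B1*?S)"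
 by (rule mult_mono[OF 1 2]) (use K0 cS_nonneg[of i "x i" "y i"] in simp_all)
 also have "... = 2*K*c^3*B1*?S^2" by (simp add: power2_eq_square power3_eq_cube)
 finally show ?case by (simp only: abs_mult fst_conv snd_conv)
 qed
 then show ?thesis by (simp add: E2_def)
 qed
 then show ?thesis unfolding e
 by (simp only: abs_mult) (intro mult_mono order.trans[OF sum_abs] sum_mono, auto)
 qed
 have step5: "(1/2)*(\<Sum>i<N. 2*K*c^3*B1*E2 i (%x y. (S i x y)^2)) <= K*c^3*real n*B1^2"
 proof (cases "n = 0")
 case True
 have S0: "S i x y = 0" for i x y unfolding S_def unfolding True by simp
 have "(1/2)*(\<Sum>i<N. 2*K*c^3*B1*E2 i (%x y. (S i x y)^2)) = 0"
 by (simp add: S0 E2_def)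
 moreover have "K*c^3*real n*B1^2 = 0" using True by simp
 ultimately show ?thesis by linarith
 next
 case False
 have "0 <= (\<Sum>j<N. E2 j (hS 0 j))" unfolding E2_def
 by (intro sum_nonneg bochner_nonneg hS_nonneg)
 then have B10: "0 <= B1" using B1[of 0] False by simp
 have "(1/2)*(\<Sum>i<N. 2*K*c^3*B1*E2 i (%x y. (S i x y)^2)) = K*c^3*B1*(\<Sum>i<N. E2 i (%x y. (S i x y)^2))"
 by (simp add: sum_distrib_left mult.assoc)
 also have "... <= K*c^3*B1*(real n*B1)"
 using K0 c_nonneg B10 by (intro mult_left_mono sum_E2_S2 B1) auto
 finally show ?thesis by (simp add: power2_eq_square mult_ac)
 qed
 let ?X = "%j. LINT z|PP. (ph (F (fst z)) - ph (F (upd j z)))*b j (fst z) (snd z)"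
 have fin: "abs ((\<Sum>j<N. ?X j) - (\<Sum>j<N. LINT x|P. ps x*That j x)) <= (\<Sum>j<N. 6*K*?k j)"
 unfolding sum_subtractf[symmetric]
 proof (rule order.trans[OF sum_abs sum_mono])
 fix j assume "j \<in> {..<N}"
 then have j: "j < N" by simp
 show "abs (?X j - (LINT x|P. ps x*That j x)) <= 6*K*?k j"
 using step1[OF j] step2[OF j] by linarith
 qed
 have "(LINT x|P. F x*ph (F x)) = (1/2)*(\<Sum>j<N. ?X j)" by (rule stein_identity[OF c1])
 moreover have "(LINT x|P. ps x*T x) = (1/2)*(\<Sum>j<N. LINT x|P. ps x*That j x)" by (rule intT[OF psi])
 ultimately have "abs ((LINT x|P. F x*ph (F x)) - (LINT x|P. ps x*T x)) <= (1/2)*(\<Sum>j<N. 6*K*?k j)"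
 using fin by linarith
 also have "... = 3*K*(\<Sum>j<N. ?k j)" by (simp add: sum_distrib_left mult.assoc)
 finally show ?thesis using step4 step5 unfolding ps_def[symmetric] by linarith
qed

end

section \<open>Stein's method: the Kolmogorov distance\<close>

lemma bdd_meas_Fubini:
 assumes "prob_space A" "prob_space B" "bdd_meas (A \<Otimes>\<^sub>M B) (%z. f (fst z) (snd z))"
 shows "(LINT x|A. LINT y|B. f x y) = (LINT y|B. LINT x|A. f x y)"
proof -
 interpret A: prob_space A by fact
 interpret B: prob_space B by fact
 interpret AB: pair_prob_space A B ..
 have "(%(x, y). f x y) = (%z. f (fst z) (snd z))" by auto
 then have "integrable (A \<Otimes>\<^sub>M B) (%(x, y). f x y)"
 using AB.bdd_meas_integrable[OF assms(3)] by (simp only:)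
 from AB.Fubini_integral[OF this] show ?thesis by (rule sym)
qed

context indep_coords
begin

text \<open>A coordinate is independent of a function that does not depend on it; the exchange of coordinates gives this
 without decomposing the product measure.\<close>

lemma integral_coord_prod:
 assumes j: "j < N" and f: "bdd_meas (mu j) f" and g: "bdd_meas P g"
 and indep: "!!x u. x \<in> space P ==> u \<in> space (mu j) ==> g (x(j := u)) = g x"
 shows "(LINT x|P. f (x j)*g x) = (LINT x|P. f (x j))*(LINT x|P. g x)"
proof -
 have fj: "bdd_meas P (%x. f (x j))" by (rule bdd_meas_comp[OF f coord_measurable[OF j]])
 have bfg: "bdd_meas P (%x. f (x j)*g x)" by (rule bdd_meas_mult[OF fj g])
 have "(LINT x|P. f (x j)*g x) = (II (%x y. f (x j)*g x))"
 by (rule integral_PP_fst[OF bfg, symmetric])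
 also have "... = (LINT z|PP. f (fst (swap j z) j)*g (fst (swap j z)))"
 by (rule integral_swap[OF j, symmetric]) (rule bdd_meas_measurable[OF bdd_meas_fst_snd(1)[OF bfg]])
 also have "... = (II (%x y. g x*f (y j)))"
 proof (rule bochner_cong[OF refl])
 fix z assume "z \<in> space PP"
 then have "fst z \<in> space P" "snd z \<in> space P" by (auto simp: space_pair_measure)
 moreover from this(2) have "snd z j \<in> space (mu j)" by (rule measurable_space[OF coord_measurable[OF j]])
 ultimately show "f (fst (swap j z) j)*g (fst (swap j z)) = g (fst z)*f (snd z j)"
 by (simp add: swap_def indep)
 qed
 also have "... = (LINT x|P. g x)*(LINT x|P. f (x j))" by (rule integral_PP_prod[OF g fj])
 finally show ?thesis by simp
qed


lemma bdd_pair_coord: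
 assumes "j < N" "bdd2 j A" "f \<in> measurable L (mu j)" "g \<in> measurable L (mu j)"
 shows "bdd_meas L (%z. A (f z) (g z))"
 using bdd_meas_comp[OF assms(2) measurable_Pair[OF assms(3,4)]] by simp

lemma bdd_partial:
 assumes j: "j < N" and A: "bdd2 j A"
 shows "bdd_meas (mu j) (%u. LINT y|P. A u (y j))"
proof -
 have "bdd_meas (mu j \<Otimes>\<^sub>M P) (%z. A (fst z) (snd z j))"
 by (rule bdd_pair_coord[OF j A]) (use j in measurable)
 from bdd_meas_integral_snd[OF P.prob_space_axioms this] show ?thesis by simp
qed

lemma E2_iter:
 assumes j: "j < N" and A: "bdd2 j A"
 shows "E2 j A = (LINT x|P. (LINT y|P. A (x j) (y j)))"
proof -
 have "bddPP (%x y. A (x j) (y j))"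
 by (rule bdd_pair_coord[OF j A]) (use j in measurable)
 from integral_PP_iter[OF this] show ?thesis by (simp add: E2_def)
qed

lemma E2_prod:
 assumes j: "j < N" "l < N" "j ~= l"
 and A: "bdd2 j A"
 and B: "bdd_meas (mu l \<Otimes>\<^sub>M mu l) (%z. B (fst z) (snd z))"
 shows "(II (%x y. A (x j) (y j)*B (x l) (y l))) = E2 j A*E2 l B"
proof -
 have bA: "bddPP (%x y. A (x j) (y j))"
 by (rule bdd_pair_coord[OF j(1) A]) (use j in measurable)
 have bB: "bddPP (%x y. B (x l) (y l))"
 by (rule bdd_pair_coord[OF j(2) B]) (use j in measurable)
 have inner: "(LINT y|P. A (x j) (y j)*B (x l) (y l)) = (LINT y|P. A (x j) (y j))*(LINT y|P. B (x l) (y l))"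
 if x: "x \<in> space P" for x
 proof (rule integral_coord_prod[OF j(1)])
 have xs: "x j \<in> space (mu j)" "x l \<in> space (mu l)"
 using x j by (auto intro: measurable_space[OF coord_measurable])
 show "bdd_meas (mu j) (%u. A (x j) u)" by (rule bdd_pair_coord[OF j(1) A]) (use xs in measurable)
 show "bdd_meas P (%y. B (x l) (y l))" by (rule bdd_pair_coord[OF j(2) B]) (use xs j in measurable)
 qed (use j in simp)
 have bbA: "bdd_meas (mu j) (%u. LINT y|P. A u (y j))" by (rule bdd_partial[OF j(1) A])
 have bbB: "bdd_meas P (%x. LINT y|P. B (x l) (y l))"
 by (rule bdd_meas_comp[OF bdd_partial[OF j(2) B] coord_measurable[OF j(2)]])
 have "(II (%x y. A (x j) (y j)*B (x l) (y l))) = (LINT x|P. LINT y|P. A (x j) (y j)*B (x l) (y l))"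
 using integral_PP_iter[OF bdd_meas_mult[OF bA bB]] by simp
 also have "... = (LINT x|P. (LINT y|P. A (x j) (y j))*(LINT y|P. B (x l) (y l)))"
 by (rule bochner_cong[OF refl]) (rule inner)
 also have "... = (LINT x|P. (LINT y|P. A (x j) (y j)))*(LINT x|P. (LINT y|P. B (x l) (y l)))"
 by (rule integral_coord_prod[OF j(1) bbA bbB]) (use j in simp)
 finally show ?thesis unfolding E2_iter[OF j(1) A] E2_iter[OF j(2) B] .
qed

lemma E2_prod_triple:
 assumes i: "i < N"
 and A: "bdd2 i A"
 and G: "bddPP (%x y. G x y)"
 and indep: "!!x y u. x \<in> space P ==> y \<in> space P ==> u \<in> space (mu i) ==> G (x(i := u)) y = G x y"
 shows "(II (%x' y'. LINT y|P. A (x' i) (y' i)*G x' y)) = E2 i A*(II (%x y. G x y))"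
proof -
 let ?g = "%x. LINT y|P. G x y"
 have bg: "bdd_meas P ?g" using bdd_meas_integral_snd[OF P.prob_space_axioms G] by simp
 have bA: "bddPP (%x y. A (x i) (y i))"
 by (rule bdd_pair_coord[OF i A]) (use i in measurable)
 have bAg: "bddPP (%x y. A (x i) (y i)*?g x)"
 by (rule bdd_meas_mult[OF bA bdd_meas_fst_snd(1)[OF bg]])
 have gind: "?g (x(i := u)) = ?g x" if "x \<in> space P" "u \<in> space (mu i)" for x u
 by (rule bochner_cong[OF refl]) (rule indep, use that in auto)
 have "(II (%x' y'. LINT y|P. A (x' i) (y' i)*G x' y)) = (II (%x y. A (x i) (y i)*?g x))" by simp
 also have "... = (LINT x|P. (LINT w|P. A (x i) (w i))*?g x)"
 unfolding integral_PP_iter[OF bAg] by simp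
 also have "... = (LINT x|P. (LINT w|P. A (x i) (w i)))*(LINT x|P. ?g x)"
 by (rule integral_coord_prod[OF i bdd_partial[OF i A] bg gind])
 also have "(LINT x|P. ?g x) = (II (%x y. G x y))" using integral_PP_iter[OF G] by simp
 finally show ?thesis unfolding E2_iter[OF i A] .
qed

text \<open>A function of both copies is a function of twice as many independent coordinates. Conditioning on one copy
 and applying the Efron--Stein inequality to each of them avoids setting up that larger product.\<close>

lemma efron_stein_PP:
 assumes Q: "bddPP (%x y. Q x y)"
 shows "(II (%x y. (Q x y)^2)) - (II (%x y. Q x y))^2 \<le>
 (1/2)*(\<Sum>i<N. LINT z|PP. (LINT y|P. (Q (fst z) y - Q (upd i z) y)^2)) +
 (1/2)*(\<Sum>i<N. LINT z|PP. (LINT x|P. (Q x (fst z) - Q x (upd i z))^2))"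
proof -
 define m where "m y = (LINT x|P. Q x y)" for y
 define Dx where "Dx i z y = (Q (fst z) y - Q (upd i z) y)^2" for i z y
 define Dy where "Dy i z x = (Q x (fst z) - Q x (upd i z))^2" for i z x
 have Qc: "bdd_meas L (%z. Q (f z) (g z))" if "f \<in> measurable L P" "g \<in> measurable L P" for L :: "'b measure" and f g
 using bdd_meas_comp[OF Q measurable_Pair[OF that]] by simp
 have bQ2: "bddPP (%x y. (Q y x)^2)" "bddPP (%x y. (Q x y)^2)"
 "bddPP (%x y. Q y x)"
 by (intro bdd_meas_power Qc measurable_fst measurable_snd)+
 have bm: "bdd_meas P m" using bdd_meas_integral_snd[OF P.prob_space_axioms bQ2(3)] by (simp add: m_def[abs_def])
 have bDx: "bdd_meas P3 (%w. Dx i (fst w) (snd w))"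
 and bDx': "bdd_meas (P \<Otimes>\<^sub>M PP) (%w. Dx i (snd w) (fst w))"
 and bDy: "bdd_meas P3 (%w. Dy i (fst w) (snd w))" if i: "i < N" for i
 unfolding Dx_def Dy_def
 by (intro bdd_meas_power bdd_meas_diff Qc; use i in measurable)+
 have Dswap: "(LINT y|P. LINT z|PP. Dx i z y) = (LINT z|PP. LINT y|P. Dx i z y)" if "i < N" for i
 by (rule bdd_meas_Fubini[OF P.prob_space_axioms prob_PP bDx'[OF that]])
 have bDxi: "bdd_meas P (%y. LINT z|PP. Dx i z y)" if "i < N" for i
 using bdd_meas_integral_snd[OF prob_PP bDx'[OF that]] by simp
 have bQi: "bdd_meas P (%y. LINT x|P. (Q x y)^2)"
 using bdd_meas_integral_snd[OF P.prob_space_axioms bQ2(1)] by simp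
 have in1: "(LINT x|P. (Q x y)^2) <= (m y)^2 + (1/2)*(\<Sum>i<N. LINT z|PP. Dx i z y)" if y: "y \<in> space P" for y
 proof -
 have "bdd_meas P (%x. Q x y)" by (rule Qc) (use y in simp_all)
 from efron_stein[OF this] show ?thesis unfolding m_def Dx_def by linarith
 qed
 have "(II (%x y. (Q x y)^2)) = (LINT y|P. LINT x|P. (Q x y)^2)"
 using integral_PP_iter[OF bQ2(2)] bdd_meas_Fubini[OF P.prob_space_axioms P.prob_space_axioms, of "%x y. (Q x y)^2"] bQ2(2) by simp
 also have "... <= (LINT y|P. (m y)^2 + (1/2)*(\<Sum>i<N. LINT z|PP. Dx i z y))"
 proof (rule integral_mono[OF P.bdd_meas_integrable[OF bQi] P.bdd_meas_integrable in1])
 show "bdd_meas P (%y. (m y)^2 + (1/2)*(\<Sum>i<N. LINT z|PP. Dx i z y))"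
 by (intro bdd_meas_add bdd_meas_power bm bdd_meas_mult bdd_meas_const bdd_meas_sum bDxi) simp
 qed
 also have "... = (LINT y|P. (m y)^2) + (LINT y|P. (1/2)*(\<Sum>i<N. LINT z|PP. Dx i z y))"
 by (intro bochner_add P.bdd_meas_integrable bdd_meas_power bm bdd_meas_mult bdd_meas_const bdd_meas_sum bDxi) simp
 also have "(LINT y|P. (1/2)*(\<Sum>i<N. LINT z|PP. Dx i z y)) = (1/2)*(LINT y|P. (\<Sum>i<N. LINT z|PP. Dx i z y))"
 by (rule bochner_cmult)
 also have "(LINT y|P. (\<Sum>i<N. LINT z|PP. Dx i z y)) = (\<Sum>i<N. \<integral>y. \<integral>z. Dx i z y \<partial>PP \<partial>P)"
 by (intro bochner_sum P.bdd_meas_integrable bDxi) simp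
 also have "... = (\<Sum>i<N. \<integral>z. \<integral>y. Dx i z y \<partial>P \<partial>PP)"
 by (intro sum.cong refl Dswap) simp
 finally have 1: "(II (%x y. (Q x y)^2)) <= (LINT y|P. (m y)^2) + (1/2)*(\<Sum>i<N. \<integral>z. \<integral>y. Dx i z y \<partial>P \<partial>PP)" .
 have 2: "(LINT y|P. (m y)^2) - (LINT y|P. m y)^2 <= (1/2)*(\<Sum>i<N. LINT z|PP. (m (fst z) - m (upd i z))^2)"
 by (rule efron_stein[OF bm])
 have 3: "(II (%x y. (m x - m (x(i := y i)))^2)) <= (LINT z|PP. LINT x|P. Dy i z x)" if i: "i < N" for i
 proof (rule integral_mono)
 show "integrable PP (%z. (m (fst z) - m (upd i z))^2)"
 by (intro PPi bdd_meas_power bdd_meas_diff bdd_meas_comp[OF bm]; use i in measurable)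
 show "integrable PP (%z. LINT x|P. Dy i z x)"
 using PPi[OF bdd_meas_integral_snd[OF P.prob_space_axioms bDy[OF i]]] by simp
 fix z assume z: "z \<in> space PP"
 have sp: "fst z \<in> space P" "(fst z)(i := snd z i) \<in> space P"
 using z i by (auto simp: space_pair_measure space_PiM PiE_def Pi_def extensional_def)
 let ?D = "%x. Q x (fst z) - Q x (upd i z)"
 have bD: "bdd_meas P ?D" by (intro bdd_meas_diff Qc) (use sp in simp_all)
 have "m (fst z) - m (upd i z) = (LINT x|P. ?D x)"
 unfolding m_def
 by (intro bochner_diff[symmetric] P.bdd_meas_integrable Qc) (use sp in simp_all)
 moreover have "(LINT x|P. ?D x)^2 <= (LINT x|P. (?D x)^2)"
 proof -
 have i2: "integrable P ?D" "integrable P (%x. (?D x)^2)"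
 by (intro P.bdd_meas_integrable bdd_meas_power bD)+
 have "0 <= P.variance ?D" by (rule P.variance_positive)
 then show ?thesis using P.variance_eq[OF i2] by linarith
 qed
 ultimately show "(m (fst z) - m (upd i z))^2 <= (LINT x|P. Dy i z x)" unfolding Dy_def by (simp only:)
 qed
 have 4: "(LINT y|P. m y) = (II (%x y. Q x y))"
 unfolding m_def using integral_PP_iter[OF Q] bdd_meas_Fubini[OF P.prob_space_axioms P.prob_space_axioms Q] by simp
 have 5: "(\<Sum>i<N. LINT z|PP. (m (fst z) - m (upd i z))^2) <= (\<Sum>i<N. \<integral>z. \<integral>x. Dy i z x \<partial>P \<partial>PP)"
 by (rule sum_mono) (rule 3, simp)
 show ?thesis using 1 2 5 unfolding 4 Dx_def[symmetric] Dy_def[symmetric] by linarith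
qed

end

lemma square_sum3_le:
 fixes u v w d :: real
 assumes "abs d <= u + v + w" shows "d^2 <= 3*u^2 + (3 * v^2 + 3*w^2)"
proof -
 have "d^2 <= (u + v + w)^2" using assms by (simp add: abs_le_square_iff[symmetric])
 also have "... <= 3*u^2 + (3 * v^2 + 3*w^2)"
 proof -
 have "0 <= (u - v)^2 + (v - w)^2 + (w - u)^2" by simp
 then show ?thesis by (simp add: power2_eq_square algebra_simps)
 qed
 finally show ?thesis .
qed

lemma (in prob_space) bdd_meas_integral_abs_le_sqrt:
 assumes "bdd_meas M f" shows "(LINT x|M. abs (f x)) <= sqrt (LINT x|M. (f x)^2)"
proof (rule real_le_rsqrt)
 have i: "integrable M (%x. abs (f x))" "integrable M (%x. (abs (f x))\<^sup>2)"
 by (intro bdd_meas_integrable bdd_meas_abs bdd_meas_power assms)+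
 have "0 <= variance (%x. abs (f x))" by (rule variance_positive)
 then show "(LINT x|M. abs (f x))^2 <= (LINT x|M. (f x)^2)" using variance_eq[OF i] by simp
qed

context smooth_functional
begin

lemma bdd_hS_pair: "t < n ==> j < N ==> bdd2 j (hS t j)"
 by (rule bdd_hS) simp_all

text \<open>The row sum without the coordinate \<open>i\<close>: removing \<open>i\<close> makes it independent of what
 happens at \<open>i\<close>.\<close>

definition G :: "nat => nat => (nat => 's) => (nat => 's) => real" where
 "G i t x y = (\<Sum>j\<in>{..<N} - {i}. hS t j (x j) (y j))"

lemma bdd_G:
 assumes "t < n" "f \<in> measurable L P" "g \<in> measurable L P"
 shows "bdd_meas L (%z. G i t (f z) (g z))"
 unfolding G_def
 by (intro bdd_meas_sum bdd_hS assms(1) measurable_compose[OF assms(2) coord_measurable] measurable_compose[OF assms(3) coord_measurable]) auto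

lemma E2_nonneg: "(!!x y. 0 <= g x y) ==> 0 <= E2 j g"
 unfolding E2_def by (intro bochner_nonneg) simp

lemma E2_mono:
 assumes "j < N" "bdd2 j f" "bdd2 j g"
 "!!x y. f x y <= g x y"
 shows "E2 j f <= E2 j g"
 unfolding E2_def
 by (intro integral_mono PPi bdd_pair_coord[OF assms(1,2)] bdd_pair_coord[OF assms(1,3)]
 coord_fst coord_snd assms)

text \<open>The product of two row sums splits into independent pairs, giving \<open>B1^2\<close>, and a diagonal, which
 is where the bound \<open>B2\<close> on third moments enters.\<close>

lemma E_GG:
 assumes t: "t < n" "t' < n"
 and B1: "!!t. t < n ==> (\<Sum>j<N. E2 j (hS t j)) <= B1"
 and B2: "!!t. t < n ==> (\<Sum>j<N. E2 j (%x y. h t j x y*(S j x y)^2)) <= B2"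
 shows "(II (%x y. G i t x y*G i t' x y)) <= B1^2 + B2"
proof -
 let ?I = "{..<N} - {i}"
 let ?e = "%j l. LINT z|PP. hS t j (fst z j) (snd z j)*hS t' l (fst z l) (snd z l)"
 have b: "bddPP (%x y. hS t j (x j) (y j)*hS t' l (x l) (y l))" if "j < N" "l < N" for j l
 by (intro bdd_meas_mult[OF bdd_hS bdd_hS] t that coord_fst coord_snd)
 have "(II (%x y. G i t x y*G i t' x y))
 = (II (%x y. (\<Sum>j\<in>?I. \<Sum>l\<in>?I. hS t j (x j) (y j)*hS t' l (x l) (y l))))"
 by (simp only: G_def sum_product)
 also have "... = (\<Sum>j\<in>?I. LINT z|PP. (\<Sum>l\<in>?I. hS t j (fst z j) (snd z j)*hS t' l (fst z l) (snd z l)))"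
 by (intro bochner_sum PPi bdd_meas_sum b) auto
 also have "... = (\<Sum>j\<in>?I. \<Sum>l\<in>?I. ?e j l)"
 by (intro sum.cong[OF refl] bochner_sum PPi b) auto
 also have "... <= (\<Sum>j\<in>?I. \<Sum>l\<in>?I. E2 j (hS t j)*E2 l (hS t' l) + (if l = j then E2 j (%x y. h t j x y*(S j x y)^2) else 0))"
 proof (intro sum_mono)
 fix j l assume jl: "j \<in> ?I" "l \<in> ?I"
 show "?e j l <= E2 j (hS t j)*E2 l (hS t' l) + (if l = j then E2 j (%x y. h t j x y*(S j x y)^2) else 0)"
 proof (cases "l = j")
 case True
 have "?e j j = E2 j (%x y. hS t j x y*hS t' j x y)" by (simp only: E2_def)
 also have "... <= E2 j (%x y. h t j x y*(S j x y)^2)"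
 proof (rule E2_mono)
 show "hS t j x y*hS t' j x y <= h t j x y*(S j x y)^2" for x y
 proof -
 have "hS t j x y*(h t' j x y*S j x y) <= hS t j x y*(1*S j x y)"
 by (intro mult_left_mono mult_right_mono h_le_1 S_nonneg hS_nonneg)
 then show ?thesis by (simp add: power2_eq_square mult_ac)
 qed
 qed (use jl t in \<open>auto intro!: bdd_meas_mult bdd_h bdd_S bdd_meas_power\<close>)
 also have "... <= E2 j (hS t j)*E2 j (hS t' j) + E2 j (%x y. h t j x y*(S j x y)^2)"
 using E2_nonneg[of "hS t j" j] E2_nonneg[of "hS t' j" j] hS_nonneg by simp
 finally show ?thesis using True by simp
 next
 case False
 then have "?e j l = E2 j (hS t j)*E2 l (hS t' l)"
 using jl t by (intro E2_prod bdd_hS_pair) auto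
 then show ?thesis using False by simp
 qed
 qed
 also have "... = (\<Sum>j\<in>?I. E2 j (hS t j))*(\<Sum>l\<in>?I. E2 l (hS t' l)) + (\<Sum>j\<in>?I. E2 j (%x y. h t j x y*(S j x y)^2))"
 by (simp add: sum.distrib sum_product)
 also have "... <= B1*B1 + B2"
 proof -
 have s: "(\<Sum>j\<in>?I. E2 j (hS t j)) <= B1" if "t < n" for t
 by (rule order.trans[OF sum_mono2 B1[OF that]]) (auto intro!: E2_nonneg hS_nonneg)
 have s2: "(\<Sum>j\<in>?I. E2 j (%x y. h t j x y*(S j x y)^2)) <= B2"
 by (rule order.trans[OF sum_mono2 B2[OF t(1)]]) (auto intro!: E2_nonneg mult_nonneg_nonneg h_nonneg)
 have nn: "0 <= (\<Sum>j\<in>?I. E2 j (hS t j))" for t by (intro sum_nonneg E2_nonneg hS_nonneg)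
 show ?thesis
 using s[OF t(1)] s[OF t(2)] s2 nn[of t] nn[of t'] by (intro add_mono mult_mono) auto
 qed
 finally show ?thesis by (simp add: power2_eq_square)
qed

text \<open>The influence of coordinate \<open>i\<close> on the sum of the \<open>q j\<close> has two sources: the term
 \<open>q i\<close> itself, which is only bounded in size, and the terms with \<open>j \<noteq> i\<close>,
 which change by second differences.\<close>

lemma variance_half:
 fixes q :: "nat => (nat => 's) => (nat => 's) => real" and r :: "nat => 's => 's => real"
 assumes bq: "!!j. j < N ==> bddPP (%x y. q j x y)"
 and br: "!!j. j < N ==> bdd2 j (r j)"
 and qr: "!!j x y. j < N ==> abs (q j x y) <= r j (x j) (y j)"
 and qd: "!!i j x y u. i < N ==> j < N ==> i ~= j ==>
 abs (q j x y - q j (x(i := u)) y) <= K*(\<Sum>t<n. h t i (x i) u*hS t j (x j) (y j))"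
 and B1: "!!t. t < n ==> (\<Sum>j<N. E2 j (hS t j)) <= B1"
 and B2: "!!t. t < n ==> (\<Sum>j<N. E2 j (%x y. h t j x y*(S j x y)^2)) <= B2"
 and i: "i < N"
 shows "(II (%x' y'. (LINT y|P. ((\<Sum>j<N. q j x' y) - (\<Sum>j<N. q j (x'(i := y' i)) y))^2)))
 <= 6*E2 i (%x y. (r i x y)^2) + 3*K^2*(B1^2 + B2)*E2 i (%x y. (S i x y)^2)"
proof -
 define D where "D z y = (\<Sum>j<N. q j (fst z) y) - (\<Sum>j<N. q j (upd i z) y)" for z y
 define u where "u z y = r i (fst z i) (y i)" for z :: "(nat => 's) \<times> (nat => 's)" and y
 define v where "v z y = r i (snd z i) (y i)" for z :: "(nat => 's) \<times> (nat => 's)" and y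
 define w where "w z y = K*(\<Sum>t<n. h t i (fst z i) (snd z i)*G i t (fst z) y)" for z y
 have pt: "abs (D z y) <= u z y + v z y + w z y" for z y
 proof -
 let ?d = "%j. q j (fst z) y - q j (upd i z) y"
 have "D z y = ?d i + (\<Sum>j\<in>{..<N}-{i}. ?d j)"
 unfolding D_def sum_subtractf[symmetric] using i by (simp add: sum.remove)
 moreover have "abs (?d i) <= u z y + v z y"
 using qr[OF i, of "fst z" y] qr[OF i, of "(fst z)(i := snd z i)" y] unfolding u_def v_def by simp
 moreover have "abs (\<Sum>j\<in>{..<N}-{i}. ?d j) <= (\<Sum>j\<in>{..<N}-{i}. K*(\<Sum>t<n. h t i (fst z i) (snd z i)*hS t j (fst z j) (y j)))"
 using i by (intro order.trans[OF sum_abs sum_mono] qd) auto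
 moreover have "(\<Sum>j\<in>{..<N}-{i}. K*(\<Sum>t<n. h t i (fst z i) (snd z i)*hS t j (fst z j) (y j))) = w z y"
 unfolding w_def G_def by (subst sum_distrib_left[symmetric], subst sum.swap) (simp only: sum_distrib_left)
 ultimately show ?thesis by linarith
 qed
 have mz: "(%p. fst (fst p)) \<in> measurable P3 P" "(%p. snd (fst p)) \<in> measurable P3 P"
 "(%p. snd p) \<in> measurable P3 P" by measurable
 note mzi = measurable_compose[OF mz(1) coord_measurable[OF i]] measurable_compose[OF mz(2) coord_measurable[OF i]]
 measurable_compose[OF mz(3) coord_measurable[OF i]]
 have qc: "bdd_meas L (%p. q j (f p) (g p))" if "j < N" "f \<in> measurable L P" "g \<in> measurable L P" for j L f g
 using bdd_meas_comp[OF bq[OF that(1)] measurable_Pair[OF that(2,3)]] by simp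
 have bD: "bdd_meas P3 (%p. (D (fst p) (snd p))^2)"
 unfolding D_def by (intro bdd_meas_power bdd_meas_diff bdd_meas_sum qc mz upd_measurable mzi i) auto
 have bu: "bdd_meas P3 (%p. (u (fst p) (snd p))^2)"
 and bv: "bdd_meas P3 (%p. (v (fst p) (snd p))^2)"
 unfolding u_def v_def by (intro bdd_meas_power bdd_pair_coord[OF i br[OF i]] mzi)+
 have bw: "bdd_meas P3 (%p. (w (fst p) (snd p))^2)"
 unfolding w_def by (intro bdd_meas_power bdd_meas_mult bdd_meas_const bdd_meas_sum bdd_h bdd_G mzi mz i) auto
 interpret PPP: pair_prob_space PP P ..
 have iter: "(LINT p|P3. f (fst p) (snd p)) = (LINT z|PP. LINT y|P. f z y)"
 if "bdd_meas P3 (%p. f (fst p) (snd p))" for f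
 using PPP.integral_fst'[of "%p. f (fst p) (snd p)"] PPP.bdd_meas_integrable[OF that] by simp
 have Iu: "(LINT z|PP. LINT y|P. (u z y)^2) = E2 i (%x y. (r i x y)^2)"
 proof -
 have br2: "bdd2 i (%x y. (r i x y)^2)" by (intro bdd_meas_power br i)
 have b: "bdd_meas P (%x. LINT y|P. (r i (x i) (y i))^2)"
 by (rule bdd_meas_comp[OF bdd_partial[OF i br2] coord_measurable[OF i]])
 show ?thesis unfolding u_def E2_iter[OF i br2] by (rule integral_PP_fst[OF b])
 qed
 have Iv: "(LINT z|PP. LINT y|P. (v z y)^2) = E2 i (%x y. (r i x y)^2)"
 proof -
 have br2: "bdd2 i (%x y. (r i x y)^2)" by (intro bdd_meas_power br i)
 have b: "bdd_meas P (%x. LINT y|P. (r i (x i) (y i))^2)"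
 by (rule bdd_meas_comp[OF bdd_partial[OF i br2] coord_measurable[OF i]])
 show ?thesis unfolding v_def E2_iter[OF i br2]
 using integral_PP_prod[OF bdd_meas_const[of P 1] b] by (simp add: P.prob_space)
 qed
 have Iw: "(LINT z|PP. LINT y|P. (w z y)^2) <= K^2*((B1^2 + B2)*E2 i (%x y. (S i x y)^2))"
 proof -
 define A where "A t t' x y = h t i x y*h t' i x y" for t t' x y
 define GG where "GG t t' x y = G i t x y*G i t' x y" for t t' x y
 have bA: "bdd2 i (%x y. A t t' x y)" if "t < n" "t' < n" for t t'
 unfolding A_def by (intro bdd_meas_mult bdd_h that i) auto
 have bGG: "bddPP (%x y. GG t t' x y)" if "t < n" "t' < n" for t t'
 unfolding GG_def by (intro bdd_meas_mult bdd_G that) auto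
 have bAG: "bdd_meas P3 (%p. A t t' (fst (fst p) i) (snd (fst p) i)*GG t t' (fst (fst p)) (snd p))"
 if "t < n" "t' < n" for t t'
 unfolding A_def GG_def by (intro bdd_meas_mult bdd_h bdd_G mz mzi that i)
 have ind: "GG t t' (x(i := u)) y = GG t t' x y" for t t' x y u
 proof -
 have "G i t (x(i := u)) y = G i t x y" for t unfolding G_def by (intro sum.cong) (auto)
 then show ?thesis by (simp add: GG_def)
 qed
 have sq: "(w z y)^2 = K^2*(\<Sum>t<n. \<Sum>t'<n. A t t' (fst z i) (snd z i)*GG t t' (fst z) y)" for z y
 unfolding w_def power_mult_distrib power2_eq_square[of "sum _ _"] sum_product A_def GG_def
 by (simp only: mult_ac)
 have bs: "bdd_meas P3 (%p. \<Sum>t<n. \<Sum>t'<n. A t t' (fst (fst p) i) (snd (fst p) i)*GG t t' (fst (fst p)) (snd p))"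
 by (intro bdd_meas_sum bAG) auto
 have "(LINT z|PP. LINT y|P. (w z y)^2) = (LINT p|P3. (w (fst p) (snd p))^2)"
 by (rule iter[OF bw, symmetric])
 also have "... = K^2*(LINT p|P3. (\<Sum>t<n. \<Sum>t'<n. A t t' (fst (fst p) i) (snd (fst p) i)*GG t t' (fst (fst p)) (snd p)))"
 unfolding sq by (rule bochner_cmult)
 also have "(LINT p|P3. (\<Sum>t<n. \<Sum>t'<n. A t t' (fst (fst p) i) (snd (fst p) i)*GG t t' (fst (fst p)) (snd p)))
 = (\<Sum>t<n. LINT p|P3. (\<Sum>t'<n. A t t' (fst (fst p) i) (snd (fst p) i)*GG t t' (fst (fst p)) (snd p)))"
 by (intro bochner_sum PPP.bdd_meas_integrable bdd_meas_sum bAG) auto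
 also have "... = (\<Sum>t<n. \<Sum>t'<n. LINT p|P3. A t t' (fst (fst p) i) (snd (fst p) i)*GG t t' (fst (fst p)) (snd p))"
 by (intro sum.cong[OF refl] bochner_sum PPP.bdd_meas_integrable bAG) auto
 also have "... = (\<Sum>t<n. \<Sum>t'<n. E2 i (A t t')*(II (%x y. GG t t' x y)))"
 proof (intro sum.cong[OF refl])
 fix t t' assume "t \<in> {..<n}" "t' \<in> {..<n}"
 then have t: "t < n" "t' < n" by auto
 show "(LINT p|P3. A t t' (fst (fst p) i) (snd (fst p) i)*GG t t' (fst (fst p)) (snd p))
 = E2 i (A t t')*(II (%x y. GG t t' x y))"
 using iter[OF bAG[OF t]] E2_prod_triple[OF i bA[OF t] bGG[OF t] ind] by simp
 qed
 finally have eqW: "(LINT z|PP. LINT y|P. (w z y)^2) = K^2*(\<Sum>t<n. \<Sum>t'<n. E2 i (A t t')*(II (%x y. GG t t' x y)))" .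
 have "(\<Sum>t<n. \<Sum>t'<n. E2 i (A t t')*(II (%x y. GG t t' x y))) <= (\<Sum>t<n. \<Sum>t'<n. E2 i (A t t')*(B1^2 + B2))"
 proof (rule sum_mono, rule sum_mono)
 fix t t' assume "t \<in> {..<n}" "t' \<in> {..<n}"
 then have t: "t < n" "t' < n" by auto
 have "0 <= E2 i (A t t')" unfolding A_def by (intro E2_nonneg mult_nonneg_nonneg h_nonneg)
 moreover have "(II (%x y. GG t t' x y)) <= B1^2 + B2"
 unfolding GG_def by (rule E_GG[OF t B1 B2])
 ultimately show "E2 i (A t t')*(II (%x y. GG t t' x y)) <= E2 i (A t t')*(B1^2 + B2)"
 by (rule mult_left_mono[rotated])
 qed
 also have "... = (B1^2 + B2)*(\<Sum>t<n. \<Sum>t'<n. E2 i (A t t'))"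
 unfolding sum_distrib_right[symmetric] by (rule mult.commute)
 also have "(\<Sum>t<n. \<Sum>t'<n. E2 i (A t t')) = E2 i (%x y. (S i x y)^2)"
 proof -
 have bAP: "bddPP (%x y. A t t' (x i) (y i))" if "t < n" "t' < n" for t t'
 by (rule bdd_pair_coord[OF i bA[OF that] coord_fst[OF i] coord_snd[OF i]])
 have "E2 i (%x y. (S i x y)^2) = (II (%x y. (\<Sum>t<n. \<Sum>t'<n. A t t' (x i) (y i))))"
 unfolding E2_def S_def power2_eq_square sum_product A_def ..
 also have "... = (\<Sum>t<n. LINT z|PP. (\<Sum>t'<n. A t t' (fst z i) (snd z i)))"
 by (intro bochner_sum PPi bdd_meas_sum bAP) auto
 also have "... = (\<Sum>t<n. \<Sum>t'<n. E2 i (A t t'))"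
 unfolding E2_def by (intro sum.cong[OF refl] bochner_sum PPi bAP) auto
 finally show ?thesis ..
 qed
 finally show ?thesis unfolding eqW by (rule mult_left_mono) simp
 qed
 have "(LINT p|P3. (D (fst p) (snd p))^2) <= (LINT p|P3. 3*(u (fst p) (snd p))^2 + (3*(v (fst p) (snd p))^2 + 3*(w (fst p) (snd p))^2))"
 proof (rule integral_mono)
 show "integrable P3 (%p. (D (fst p) (snd p))^2)" by (rule PPP.bdd_meas_integrable[OF bD])
 show "integrable P3 (%p. 3*(u (fst p) (snd p))^2 + (3*(v (fst p) (snd p))^2 + 3*(w (fst p) (snd p))^2))"
 by (intro PPP.bdd_meas_integrable bdd_meas_add bdd_meas_mult[OF bdd_meas_const] bu bv bw)
 show "(D (fst p) (snd p))^2 <= 3*(u (fst p) (snd p))^2 + (3*(v (fst p) (snd p))^2 + 3*(w (fst p) (snd p))^2)" for p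
 by (intro square_sum3_le pt)
 qed
 also have "... = 3*(LINT p|P3. (u (fst p) (snd p))^2) + (3*(LINT p|P3. (v (fst p) (snd p))^2)
 + 3*(LINT p|P3. (w (fst p) (snd p))^2))"
 using PPP.bdd_meas_integrable[OF bu] PPP.bdd_meas_integrable[OF bv] PPP.bdd_meas_integrable[OF bw] by simp
 also have "... <= 6*E2 i (%x y. (r i x y)^2) + 3*(K^2*((B1^2 + B2)*E2 i (%x y. (S i x y)^2)))"
 unfolding iter[OF bu] iter[OF bv] iter[OF bw] Iu Iv using Iw by linarith
 finally show ?thesis unfolding iter[OF bD] unfolding D_def by (simp only: mult.assoc)
qed

end

context smooth_functional
begin

lemma variance_bound:
 fixes q :: "nat => (nat => 's) => (nat => 's) => real" and r :: "nat => 's => 's => real"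
 assumes bq: "!!j. j < N ==> bddPP (%x y. q j x y)"
 and br: "!!j. j < N ==> bdd2 j (r j)"
 and r_sym: "!!j x y. r j x y = r j y x"
 and qr: "!!j x y. j < N ==> abs (q j x y) <= r j (x j) (y j)"
 and qd: "!!i j x y u. i < N ==> j < N ==> i ~= j ==>
 abs (q j x y - q j (x(i := u)) y) <= K*(\<Sum>t<n. h t i (x i) u*hS t j (x j) (y j))"
 and qd': "!!i j x y u. i < N ==> j < N ==> i ~= j ==>
 abs (q j x y - q j x (y(i := u))) <= K*(\<Sum>t<n. h t i (y i) u*hS t j (x j) (y j))"
 and B1: "!!t. t < n ==> (\<Sum>j<N. E2 j (hS t j)) <= B1"
 and B2: "!!t. t < n ==> (\<Sum>j<N. E2 j (%x y. h t j x y*(S j x y)^2)) <= B2"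
 shows "(II (%x y. (\<Sum>j<N. q j x y)^2)) - (II (%x y. (\<Sum>j<N. q j x y)))^2
 <= (\<Sum>i<N. 6*E2 i (%x y. (r i x y)^2) + 3*K^2*(B1^2 + B2)*E2 i (%x y. (S i x y)^2))"
proof -
 let ?e = "%i. 6*E2 i (%x y. (r i x y)^2) + 3*K^2*(B1^2 + B2)*E2 i (%x y. (S i x y)^2)"
 let ?A = "%i. LINT z|PP. (LINT y|P. ((\<Sum>j<N. q j (fst z) y) - (\<Sum>j<N. q j (upd i z) y))^2)"
 let ?B = "%i. LINT z|PP. (LINT x|P. ((\<Sum>j<N. q j x (fst z)) - (\<Sum>j<N. q j x (upd i z)))^2)"
 have A: "?A i <= ?e i" if i: "i < N" for i
 by (rule variance_half[OF bq br qr qd B1 B2 i])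
 have B: "?B i <= ?e i" if i: "i < N" for i
 proof (rule variance_half[where q="%j x y. q j y x", OF _ br _ _ B1 B2 i])
 show "bddPP (%x y. q j y x)" if "j < N" for j
 using bdd_meas_comp[OF bq[OF that] measurable_Pair[OF measurable_snd measurable_fst]] by simp
 show "abs (q j y x) <= r j (x j) (y j)" if "j < N" for j x y
 using qr[OF that, of y x] r_sym[of j "x j" "y j"] by simp
 show "abs (q j y x - q j y (x(i := u))) <= K*(\<Sum>t<n. h t i (x i) u*hS t j (x j) (y j))"
 if "i < N" "j < N" "i ~= j" for i j x y u
 proof -
 have "hS t j (x j) (y j) = hS t j (y j) (x j)" for t by (subst h_sym, subst S_sym) (rule refl)
 then show ?thesis using qd'[OF that] by (simp only:)
 qed
 qed
 have bQ: "bddPP (%x y. \<Sum>j<N. q j x y)" by (intro bdd_meas_sum bq) simp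
 have "(\<Sum>i<N. ?A i) <= (\<Sum>i<N. ?e i)" by (rule sum_mono) (rule A, simp)
 moreover have "(\<Sum>i<N. ?B i) <= (\<Sum>i<N. ?e i)" by (rule sum_mono) (rule B, simp)
 moreover note efron_stein_PP[of "%x y. \<Sum>j<N. q j x y", OF bQ]
 ultimately show ?thesis by linarith
qed

text \<open>For an indicator the derivative of the Stein solution is not Lipschitz, and large increments are treated
 separately so that the variance of the remaining products is finite with fourth moments of truncated
 increments only.\<close>

definition cut :: "nat => 's => 's => real" where "cut j x y = (if c*S j x y <= 1 then 1 else 0)"

lemma chi_range: "0 <= cut j x y" "cut j x y <= 1" "cut j x y*cut j x y = cut j x y"
 by (auto simp: cut_def)

lemma chi_sym: "cut j x y = cut j y x"
 unfolding cut_def by (subst S_sym) (rule refl)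

lemma bdd_chi:
 assumes "j < N" "f \<in> measurable L (mu j)" "g \<in> measurable L (mu j)"
 shows "bdd_meas L (%z. cut j (f z) (g z))"
proof (rule bdd_measI[where B=1])
 have [measurable]: "(%z. c*S j (f z) (g z)) \<in> borel_measurable L"
 by (rule bdd_meas_measurable[OF bdd_cS[OF assms]])
 show "(%z. cut j (f z) (g z)) \<in> borel_measurable L" unfolding cut_def by measurable
qed (auto simp: cut_def)

definition small :: "nat => 's => 's => real" where "small j x y = cut j x y*(c*S j x y)^2"
definition large :: "nat => 's => 's => real" where "large j x y = (1 - cut j x y)*(c*S j x y)^2"

lemma bdd_small: "j < N ==> f \<in> measurable L (mu j) ==> g \<in> measurable L (mu j) ==> bdd_meas L (%z. small j (f z) (g z))"
 unfolding small_def by (intro bdd_meas_mult bdd_meas_power bdd_chi bdd_cS)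

lemma bdd_large: "j < N ==> f \<in> measurable L (mu j) ==> g \<in> measurable L (mu j) ==> bdd_meas L (%z. large j (f z) (g z))"
 unfolding large_def by (intro bdd_meas_mult bdd_meas_diff bdd_meas_const bdd_meas_power bdd_chi bdd_cS)

definition Wvar :: "real => real => real" where
 "Wvar B1 B2 = (\<Sum>i<N. 6*E2 i (%x y. (small i x y)^2) + 3*(2*c^2)^2*(B1^2 + B2)*E2 i (%x y. (S i x y)^2))"

text \<open>The second variant, with \<open>\<bar>b j\<bar>\<close> in place of \<open>b j\<close>, is the sum that
 arises from the expansion error \<open>stein_ind_taylor\<close>. Both are treated together as the absolute
 value does not increase differences.\<close>

lemma variance_chi_ab:
 fixes d :: "nat => (nat => 's) => (nat => 's) => real"
 assumes d: "d = b | d = (%j x y. abs (b j x y))"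
 and B1: "!!t. t < n ==> (\<Sum>j<N. E2 j (hS t j)) <= B1"
 and B2: "!!t. t < n ==> (\<Sum>j<N. E2 j (%x y. h t j x y*(S j x y)^2)) <= B2"
 defines "Q \<equiv> (%x y. \<Sum>j<N. cut j (x j) (y j)*(a j x y*d j x y))"
 shows "bddPP (%x y. Q x y)"
 "(II (%x y. (Q x y)^2)) - (II (%x y. Q x y))^2 <= Wvar B1 B2"
proof -
 have d_bound: "abs (d j x y) <= c*S j (x j) (y j)" if "j < N" for j x y
 using d b_bound[OF that] by auto
 have d_le: "abs (d j x y - d j x' y') <= abs (b j x y - b j x' y')" for j x y x' y' using d by auto
 have bd: "bddPP (%x y. d j x y)" if "j < N" for j
 using d bdd_b[OF measurable_fst measurable_snd] by (auto intro!: bdd_meas_abs)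
 let ?q = "%j x y. cut j (x j) (y j)*(a j x y*d j x y)"
 have bq: "bddPP (%x y. ?q j x y)" if j: "j < N" for j
 by (rule bdd_meas_mult[OF bdd_chi[OF j coord_fst[OF j] coord_snd[OF j]] bdd_meas_mult[OF bdd_a[OF j measurable_fst measurable_snd] bd[OF j]]])
 show "bddPP (%x y. Q x y)" unfolding Q_def by (intro bdd_meas_sum bq) simp
 have prod_diff: "abs (?q j x y - ?q j x' y') <= 2*c^2*(\<Sum>t<n. h t i u v * hS t j (x j) (y j))"
 if "x j = x' j" "y j = y' j" "j < N"
 "abs (a j x y - a j x' y') <= c*(\<Sum>t<n. h t i u v * h t j (x j) (y j))"
 "abs (b j x y - b j x' y') <= c*(\<Sum>t<n. h t i u v * h t j (x j) (y j))" for i j x y x' y' u v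
 proof -
 let ?H = "c*(\<Sum>t<n. h t i u v * h t j (x j) (y j))"
 have "abs (a j x y*d j x y - a j x' y'*d j x' y') <= (?H + ?H)*(c*S j (x j) (y j))"
 using a_bound[OF that(3), of x' y'] that(1,2) d_bound[OF that(3), of x y] order.trans[OF d_le that(5)] that(4)
 by (intro mult_diff_bound) auto
 also have "... = 2*c^2*(\<Sum>t<n. h t i u v * hS t j (x j) (y j))"
 by (simp add: power2_eq_square sum_distrib_left sum_distrib_right algebra_simps)
 finally have le: "abs (a j x y*d j x y - a j x' y'*d j x' y') <= 2*c^2*(\<Sum>t<n. h t i u v * hS t j (x j) (y j))" .
 have "?q j x y - ?q j x' y' = cut j (x j) (y j)*(a j x y*d j x y - a j x' y'*d j x' y')"
 using that(1,2) by (simp add: right_diff_distrib)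
 then have "abs (?q j x y - ?q j x' y') = cut j (x j) (y j) * abs (a j x y*d j x y - a j x' y'*d j x' y')"
 using chi_range(1) by (simp only: abs_mult abs_of_nonneg)
 also have "... <= abs (a j x y*d j x y - a j x' y'*d j x' y')"
 by (rule mult_left_le_one_le) (auto simp: chi_range)
 finally show ?thesis using le by linarith
 qed
 show "(II (%x y. (Q x y)^2)) - (II (%x y. Q x y))^2 <= Wvar B1 B2"
 unfolding Q_def Wvar_def
 proof (rule variance_bound[where q="?q" and r=small, OF bq _ _ _ _ _ B1 B2])
 show "bdd2 j (small j)" if "j < N" for j
 by (rule bdd_small[OF that]) auto
 show "small j x y = small j y x" for j x y
 unfolding small_def by (subst chi_sym, subst S_sym) (rule refl)
 show "abs (?q j x y) <= small j (x j) (y j)" if "j < N" for j x y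
 proof -
 have "abs (a j x y) * abs (d j x y) <= (c*S j (x j) (y j))^2"
 unfolding power2_eq_square by (rule mult_mono[OF a_bound[OF that] d_bound[OF that] cS_nonneg abs_ge_zero])
 then have "cut j (x j) (y j)*(abs (a j x y) * abs (d j x y)) <= small j (x j) (y j)"
 unfolding small_def by (rule mult_left_mono) (rule chi_range)
 then show ?thesis by (simp only: abs_mult abs_of_nonneg[OF chi_range(1)])
 qed
 show "abs (?q j x y - ?q j (x(i := u)) y) <= 2*c^2*(\<Sum>t<n. h t i (x i) u*hS t j (x j) (y j))"
 if "i < N" "j < N" "i ~= j" for i j x y u
 proof (rule prod_diff)
 show "x j = (x(i := u)) j" using that(3) by simp
 show "abs (a j x y - a j (x(i := u)) y) <= c*(\<Sum>t<n. h t i (x i) u*h t j (x j) (y j))"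
 by (rule a_diff_fst[OF that(2,1,3)])
 show "abs (b j x y - b j (x(i := u)) y) <= c*(\<Sum>t<n. h t i (x i) u*h t j (x j) (y j))"
 by (rule b_diff_fst[OF that(2,1,3)])
 qed (rule refl that)+
 show "abs (?q j x y - ?q j x (y(i := u))) <= 2*c^2*(\<Sum>t<n. h t i (y i) u*hS t j (x j) (y j))"
 if "i < N" "j < N" "i ~= j" for i j x y u
 proof (rule prod_diff)
 show "abs (a j x y - a j x (y(i := u))) <= c*(\<Sum>t<n. h t i (y i) u*h t j (x j) (y j))"
 using that(3) c_nonneg by (simp add: a_snd) (intro mult_nonneg_nonneg sum_nonneg h_nonneg; simp add: h_nonneg)
 show "abs (b j x y - b j x (y(i := u))) <= c*(\<Sum>t<n. h t i (y i) u*h t j (x j) (y j))"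
 by (rule b_diff_snd[OF that(2,1,3)])
 show "y j = (y(i := u)) j" using that(3) by simp
 qed (rule refl that)+
 qed
qed

text \<open>The expansion error of \<open>stein_ind_taylor\<close> contributes, in each coordinate, \<open>cut * a *
 \<bar>b\<bar>\<close> times the increment of the bounded function \<open>g\<close>. The prefactor is
 antisymmetric under exchanging the coordinate with its copy, so its mean vanishes and the whole
 contribution is twice the expectation of \<open>g F\<close> times a centred sum \<open>K\<close>, hence at
 most the standard deviation of \<open>K\<close> up to a constant. The quadratic term is handled in the same
 way by the standard deviation of the sum \<open>Q\<close> of the truncated products. No smoothing of the
 indicator is needed, which is what preserves the rate.\<close>

lemma kolmogorov_stein_bound:
 assumes B1: "!!t. t < n ==> (\<Sum>j<N. E2 j (hS t j)) <= B1"
 and B2: "!!t. t < n ==> (\<Sum>j<N. E2 j (%x y. h t j x y*(S j x y)^2)) <= B2"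
 shows "abs ((LINT x|P. indicator {..v} (F x)) - (1 - upper_tail gauss v))
 <= 4*(\<Sum>j<N. E2 j (large j)) + 4 * sqrt (Wvar B1 B2)"
proof -
 define ph where "ph = stein_ind v"
 define D where "D x = stein_ind_deriv v (F x)" for x
 define g where "g x = stein_ind_osc v (F x)" for x
 have Fm [measurable]: "F \<in> borel_measurable P" by (rule bdd_meas_measurable[OF F_bdd])
 have cphi: "continuous_on UNIV ph" unfolding ph_def by (rule stein_ind_continuous)
 have bphi: "bdd_meas P (%x. ph (F x))" by (rule bdd_meas_continuous_comp[OF F_bdd cphi])
 have bD: "bdd_meas P D" unfolding D_def by (rule bdd_measI[where B=2]) (auto simp: stein_ind_deriv_bound)
 have bg: "bdd_meas P g" unfolding g_def by (rule bdd_measI[where B=2]) (auto simp: stein_ind_osc_bound)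
 have bFphi: "bdd_meas P (%x. F x*ph (F x))" by (intro bdd_meas_mult F_bdd bphi)
 define Q where "Q x y = (\<Sum>j<N. cut j (x j) (y j)*(a j x y*b j x y))" for x y
 define K where "K x y = (\<Sum>j<N. cut j (x j) (y j)*(a j x y * abs (b j x y)))" for x y
 note VQ = variance_chi_ab[of b, OF _ B1 B2, simplified, folded Q_def]
 note VK = variance_chi_ab[of "%j x y. abs (b j x y)", OF _ B1 B2, simplified, folded K_def]
 note mj = coord_fst coord_snd
 let ?cut = "%j z. cut j (fst z j) (snd z j)"
 let ?a = "%j z. a j (fst z) (snd z)"
 let ?b = "%j z. b j (fst z) (snd z)"
 let ?L = "%j z. large j (fst z j) (snd z j)"
 have upd: "(%z. (fst z)(j := snd z j)) \<in> measurable PP P" if "j < N" for j using that by measurable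
 have bchi: "bdd_meas PP (?cut j)" if "j < N" for j by (intro bdd_chi that mj)
 have ba: "bdd_meas PP (?a j)" if "j < N" for j by (intro bdd_a that measurable_fst measurable_snd)
 have bb: "bdd_meas PP (?b j)" for j by (intro bdd_b measurable_fst measurable_snd)
 have bL: "bdd_meas PP (?L j)" if "j < N" for j by (intro bdd_large that mj)
 have bDf: "bddPP (%x y. D x)" by (rule bdd_meas_fst_snd(1)[OF bD])
 have bgf: "bddPP (%x y. g x)" by (rule bdd_meas_fst_snd(1)[OF bg])
 have bgj: "bddPP (%x y. g (x(j := y j)))" if "j < N" for j by (rule bdd_meas_comp[OF bg upd[OF that]])
 have bDab: "bdd_meas PP (%z. D (fst z)*(?a j z*?b j z))" if "j < N" for j
 by (intro bdd_meas_mult bDf ba bb that)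
 have bX: "bdd_meas PP (%z. (ph (F (fst z)) - ph (F (upd j z)))*?b j z)" if "j < N" for j
 by (intro bdd_meas_mult[OF bdd_meas_diff[OF bdd_meas_fst_snd(1)[OF bphi] bdd_meas_comp[OF bphi upd]]] bb that)
 have large_b: "(1 - cut j (x j) (y j))*(abs (a j x y) * abs (b j x y)) <= large j (x j) (y j)"
 if "j < N" for j x y
 proof -
 have "abs (a j x y) * abs (b j x y) <= (c*S j (x j) (y j))^2"
 unfolding power2_eq_square by (rule mult_mono[OF a_bound[OF that] b_bound[OF that] cS_nonneg abs_ge_zero])
 then show ?thesis unfolding large_def by (rule mult_left_mono) (simp add: chi_range)
 qed
 define p where "p j z = ?cut j z*(?a j z * abs (?b j z))" for j z
 have bp: "bdd_meas PP (p j)" if "j < N" for j unfolding p_def by (intro bdd_meas_mult bdd_meas_abs bchi ba bb that)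
 have psw: "p j (swap j z) = - p j z" for j z
 proof -
 have "fst (swap j z) j = snd z j" "snd (swap j z) j = fst z j" by (auto simp: swap_def)
 then show ?thesis unfolding p_def a_swap b_swap using chi_sym[of j "fst z j" "snd z j"] by simp
 qed
 \<comment> \<open>the expansion error of one coordinate\<close>
 have step: "abs ((LINT z|PP. (ph (F (fst z)) - ph (F (upd j z)))*?b j z) - (LINT z|PP. D (fst z)*(?a j z*?b j z)))
 <= 2*(LINT z|PP. g (fst z)*p j z) + 4*E2 j (large j)" if j: "j < N" for j
 proof -
 have bpg: "bdd_meas PP (%z. p j z*g (fst z))" "bdd_meas PP (%z. p j z*g (upd j z))"
 by (intro bdd_meas_mult bp bgf bgj j)+
 have bR: "bdd_meas PP (%z. p j z*(g (fst z) - g (upd j z)) + 4*?L j z)"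
 by (intro bdd_meas_add bdd_meas_mult[OF bp bdd_meas_diff[OF bgf bgj]] bdd_meas_mult[OF bdd_meas_const bL] j)
 have eq: "(LINT z|PP. (ph (F (fst z)) - ph (F (upd j z)))*?b j z) - (LINT z|PP. D (fst z)*(?a j z*?b j z))
 = (LINT z|PP. (ph (F (fst z)) - ph (F (upd j z)))*?b j z - D (fst z)*(?a j z*?b j z))"
 by (intro bochner_diff[symmetric] PPi bX bDab j)
 have le: "abs (LINT z|PP. (ph (F (fst z)) - ph (F (upd j z)))*?b j z - D (fst z)*(?a j z*?b j z))
 <= (LINT z|PP. p j z*(g (fst z) - g (upd j z)) + 4*?L j z)"
 proof (rule PP_bound[OF bdd_meas_diff[OF bX[OF j] bDab[OF j]] bR], goal_cases)
 case (1 x y)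
 let ?A = "a j x y" let ?B = "b j x y" let ?X = "cut j (x j) (y j)"
 let ?T = "ph (F x) - ph (F (x(j := y j))) - ?A*D x"
 have FA: "F (x(j := y j)) = F x - ?A" by (simp add: a_def)
 have T1: "abs ?T <= ?A*(g x - g (x(j := y j)))"
 unfolding ph_def D_def g_def FA by (rule stein_ind_taylor)
 have T2: "abs ?T <= 4 * abs ?A"
 proof -
 have "abs (ph (F x) - ph (F (x(j := y j)))) <= 2 * abs ?A"
 unfolding ph_def FA using stein_ind_lipschitz[of v "F x" "F x - ?A"] by simp
 moreover have "abs (?A*D x) <= abs ?A*2"
 unfolding abs_mult D_def by (intro mult_left_mono stein_ind_deriv_bound) simp
 ultimately show ?thesis by linarith
 qed
 have "abs ?T * abs ?B = ?X*(abs ?T * abs ?B) + (1 - ?X)*(abs ?T * abs ?B)" by (simp add: left_diff_distrib)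
 also have "... <= ?X*((?A*(g x - g (x(j := y j)))) * abs ?B) + (1 - ?X)*((4 * abs ?A) * abs ?B)"
 using chi_range[of j "x j" "y j"] T1 T2 by (intro add_mono mult_left_mono mult_right_mono) auto
 also have "... <= ?X*((?A*(g x - g (x(j := y j)))) * abs ?B) + 4*large j (x j) (y j)"
 using large_b[OF j] by (simp add: mult_ac)
 finally have main: "abs ?T * abs ?B <= ?X*(?A * abs ?B)*(g x - g (x(j := y j))) + 4*large j (x j) (y j)"
 by (simp only: mult_ac)
 have e: "(ph (F x) - ph (F (x(j := y j))))*?B - D x*(?A*?B) = ?T*?B" by (simp add: algebra_simps)
 show ?case
 using main by (simp only: fst_conv snd_conv e abs_mult p_def)
 qed
 have "(LINT z|PP. p j z*g (upd j z)) = (LINT z|PP. p j (swap j z)*g ((fst (swap j z))(j := snd (swap j z) j)))"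
 by (rule integral_swap[OF j, symmetric]) (rule bdd_meas_measurable[OF bpg(2)])
 also have "... = (LINT z|PP. - (p j z*g (fst z)))" unfolding psw by (simp add: swap_def)
 also have "... = - (LINT z|PP. p j z*g (fst z))" by simp
 finally have sw: "(LINT z|PP. p j z*g (upd j z)) = - (LINT z|PP. p j z*g (fst z))" .
 have "(LINT z|PP. p j z*(g (fst z) - g (upd j z)) + 4*?L j z)
 = (LINT z|PP. p j z*g (fst z) - p j z*g (upd j z) + 4*?L j z)" by (simp only: right_diff_distrib)
 also have "... = (LINT z|PP. p j z*g (fst z)) - (LINT z|PP. p j z*g (upd j z)) + 4*E2 j (large j)"
 using PPi[OF bpg(1)] PPi[OF bpg(2)] PPi[OF bL[OF j]]
 by (simp add: E2_def)
 also have "... = 2*(LINT z|PP. g (fst z)*p j z) + 4*E2 j (large j)"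
 unfolding sw by (simp add: mult.commute)
 finally show ?thesis using le unfolding eq by linarith
 qed
 have sum_gp: "(\<Sum>j<N. LINT z|PP. g (fst z)*p j z) = (II (%x y. g x*K x y))"
 unfolding K_def sum_distrib_left p_def[symmetric]
 by (intro bochner_sum[symmetric] PPi bdd_meas_mult bgf bp) auto
 have K0: "(II (%x y. K x y)) = 0"
 proof -
 have "(LINT z|PP. p j z) = 0" if j: "j < N" for j
 proof -
 have "(LINT z|PP. p j z) = - (LINT z|PP. p j z)"
 using integral_swap[OF j bdd_meas_measurable[OF bp[OF j]]] unfolding psw by simp
 then show ?thesis by simp
 qed
 moreover have "(II (%x y. K x y)) = (\<Sum>j<N. LINT z|PP. p j z)"
 unfolding K_def p_def[symmetric]
 by (intro bochner_sum PPi bp) auto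
 ultimately show ?thesis by simp
 qed
 have gK: "(II (%x y. g x*K x y)) <= 2 * sqrt (Wvar B1 B2)"
 proof -
 have "abs (LINT z|PP. g (fst z)*K (fst z) (snd z)) <= (II (%x y. 2 * abs (K x y)))"
 proof (rule PP_bound)
 show "bddPP (%x y. g x*K x y)" "bddPP (%x y. 2 * abs (K x y))"
 by (intro bdd_meas_mult bgf VK(1) bdd_meas_const bdd_meas_abs)+
 show "abs (g (fst (x, y))*K (fst (x, y)) (snd (x, y))) <= 2 * abs (K (fst (x, y)) (snd (x, y)))" for x y
 unfolding abs_mult fst_conv g_def by (rule mult_right_mono[OF stein_ind_osc_bound]) simp
 qed
 moreover have "(II (%x y. abs (K x y))) <= sqrt (Wvar B1 B2)"
 by (rule order.trans[OF PP.bdd_meas_integral_abs_le_sqrt[OF VK(1)]]) (use VK(2) K0 in simp)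
 ultimately show ?thesis by simp
 qed
 have "0 <= (II (%x y. (K x y)^2))" by (rule bochner_nonneg) simp
 then have "0 <= Wvar B1 B2" using VK(2) unfolding K0 power2_eq_square[of 0] by linarith
 then have sqrt_nonneg: "0 <= sqrt (Wvar B1 B2)" by (rule real_sqrt_ge_zero)
 \<comment> \<open>the quadratic term\<close>
 have Tj: "abs ((LINT z|PP. ps (fst z)*(?a j z*?b j z)) - (LINT z|PP. ps (fst z)*(?cut j z*(?a j z*?b j z)))) <= B*E2 j (large j)"
 if j: "j < N" and psi: "bdd_meas P ps" and B: "!!x. abs (ps x) <= B" for j ps B
 proof -
 note bf = bdd_meas_fst_snd(1)[OF psi]
 have b1: "bdd_meas PP (%z. ps (fst z)*(?a j z*?b j z))" "bdd_meas PP (%z. ps (fst z)*(?cut j z*(?a j z*?b j z)))"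
 by (intro bdd_meas_mult bf ba bb bchi j)+
 have eq: "(LINT z|PP. ps (fst z)*(?a j z*?b j z)) - (LINT z|PP. ps (fst z)*(?cut j z*(?a j z*?b j z)))
 = (LINT z|PP. ps (fst z)*(?a j z*?b j z) - ps (fst z)*(?cut j z*(?a j z*?b j z)))"
 by (intro bochner_diff[symmetric] PPi b1)
 have "abs (LINT z|PP. ps (fst z)*(?a j z*?b j z) - ps (fst z)*(?cut j z*(?a j z*?b j z))) <= (LINT z|PP. B*?L j z)"
 proof (rule PP_bound[OF bdd_meas_diff[OF b1] bdd_meas_mult[OF bdd_meas_const bL[OF j]]], goal_cases)
 case (1 x y)
 let ?X = "cut j (x j) (y j)"
 have e: "ps x*(a j x y*b j x y) - ps x*(?X*(a j x y*b j x y)) = ps x*((1 - ?X)*(a j x y*b j x y))"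
 by (simp add: algebra_simps)
 have "abs (ps x)*((1 - ?X)*(abs (a j x y) * abs (b j x y))) <= B*large j (x j) (y j)"
 using B[of x] large_b[OF j] chi_range[of j "x j" "y j"] by (intro mult_mono) auto
 moreover have "abs (1 - ?X) = 1 - ?X" using chi_range[of j "x j" "y j"] by simp
 ultimately show ?case
 by (simp only: fst_conv snd_conv e abs_mult)
 qed
 then show ?thesis unfolding eq by (simp add: E2_def)
 qed
 have sumQ: "(\<Sum>j<N. LINT z|PP. ps (fst z)*(?cut j z*(?a j z*?b j z))) = (II (%x y. ps x*Q x y))"
 if psi: "bdd_meas P ps" for ps
 unfolding Q_def sum_distrib_left
 by (intro bochner_sum[symmetric] PPi bdd_meas_mult bdd_meas_fst_snd(1)[OF psi] bchi ba bb) auto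
 have TjS: "abs ((\<Sum>j<N. LINT z|PP. ps (fst z)*(?a j z*?b j z)) - (II (%x y. ps x*Q x y))) <= B*(\<Sum>j<N. E2 j (large j))"
 if psi: "bdd_meas P ps" and B: "!!x. abs (ps x) <= B" for ps B
 unfolding sumQ[OF psi, symmetric] sum_subtractf[symmetric] sum_distrib_left
 by (rule order.trans[OF sum_abs sum_mono]) (rule Tj[OF _ psi B], simp)
 define La where "La = (\<Sum>j<N. E2 j (large j))"
 define mQ where "mQ = (II (%x y. Q x y))"
 have m1: "abs (2 - mQ) <= La"
 using TjS[OF bdd_meas_const[of P 1], of 1] var_identity by (simp add: mQ_def La_def)
 have m2: "abs ((\<Sum>j<N. LINT z|PP. D (fst z)*(?a j z*?b j z)) - (II (%x y. D x*Q x y))) <= 2*La"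
 unfolding La_def by (rule TjS[OF bD]) (simp add: D_def stein_ind_deriv_bound)
 have bQc: "bddPP (%x y. Q x y - mQ)" by (intro bdd_meas_diff VQ(1) bdd_meas_const)
 have m3: "abs ((II (%x y. D x*Q x y)) - mQ*(LINT x|P. D x)) <= 2 * sqrt (Wvar B1 B2)"
 proof -
 have b1: "bddPP (%x y. D x*Q x y)" "bddPP (%x y. D x*mQ)"
 by (intro bdd_meas_mult bDf VQ(1) bdd_meas_const)+
 have "mQ*(LINT x|P. D x) = (II (%x y. D x*mQ))" using integral_PP_fst[OF bD] by simp
 then have eq: "(II (%x y. D x*Q x y)) - mQ*(LINT x|P. D x) = (II (%x y. D x*(Q x y - mQ)))"
 unfolding right_diff_distrib
 by (simp add: bochner_diff[OF PPi[OF b1(1)] PPi[OF b1(2)]])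
 have "abs (LINT z|PP. D (fst z)*(Q (fst z) (snd z) - mQ)) <= (II (%x y. 2 * abs (Q x y - mQ)))"
 proof (rule PP_bound)
 show "bddPP (%x y. D x*(Q x y - mQ))" "bddPP (%x y. 2 * abs (Q x y - mQ))"
 by (intro bdd_meas_mult[OF bDf bQc] bdd_meas_mult[OF bdd_meas_const bdd_meas_abs[OF bQc]])+
 show "abs (D (fst (x, y))*(Q (fst (x, y)) (snd (x, y)) - mQ)) <= 2 * abs (Q (fst (x, y)) (snd (x, y)) - mQ)" for x y
 unfolding abs_mult fst_conv D_def by (rule mult_right_mono[OF stein_ind_deriv_bound]) simp
 qed
 moreover have "(II (%x y. abs (Q x y - mQ))) <= sqrt (Wvar B1 B2)"
 proof (rule order.trans[OF PP.bdd_meas_integral_abs_le_sqrt[OF bQc]])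
 have i: "integrable PP (%z. Q (fst z) (snd z))" "integrable PP (%z. (Q (fst z) (snd z))^2)"
 by (intro PPi bdd_meas_power VQ(1))+
 show "sqrt (II (%x y. (Q x y - mQ)^2)) <= sqrt (Wvar B1 B2)"
 using VQ(2) PP.variance_eq[OF i] unfolding mQ_def real_sqrt_le_iff by (simp only:)
 qed
 ultimately show ?thesis unfolding eq by simp
 qed
 have m4: "abs (LINT x|P. D x) <= 2"
 proof -
 have "abs (LINT x|P. D x) <= (LINT x|P. 2)"
 by (rule P.bdd_meas_integral_bound[OF bD _ bdd_meas_const]) (simp add: D_def stein_ind_deriv_bound)
 then show ?thesis by (simp add: P.prob_space)
 qed
 have m5: "abs ((\<Sum>j<N. LINT z|PP. D (fst z)*(?a j z*?b j z)) - 2*(LINT x|P. D x)) <= 4*La + 2 * sqrt (Wvar B1 B2)"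
 proof -
 have "abs ((mQ - 2)*(LINT x|P. D x)) <= La*2"
 unfolding abs_mult using m1 m4 by (intro mult_mono) auto
 then have "abs (mQ*(LINT x|P. D x) - 2*(LINT x|P. D x)) <= La*2" by (simp only: left_diff_distrib)
 then show ?thesis using m2 m3 by linarith
 qed
 let ?X = "%j. LINT z|PP. (ph (F (fst z)) - ph (F (upd j z)))*?b j z"
 let ?Y = "%j. LINT z|PP. D (fst z)*(?a j z*?b j z)"
 have m6: "abs ((\<Sum>j<N. ?X j) - (\<Sum>j<N. ?Y j)) <= 4 * sqrt (Wvar B1 B2) + 4*La"
 proof -
 have "abs ((\<Sum>j<N. ?X j) - (\<Sum>j<N. ?Y j)) <= (\<Sum>j<N. 2*(LINT z|PP. g (fst z)*p j z) + 4*E2 j (large j))"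
 unfolding sum_subtractf[symmetric] by (rule order.trans[OF sum_abs sum_mono]) (rule step, simp)
 also have "... = 2*(II (%x y. g x*K x y)) + 4*La"
 unfolding sum.distrib sum_distrib_left[symmetric] sum_gp La_def by (rule refl)
 finally show ?thesis using gK by linarith
 qed
 have "(LINT x|P. F x*ph (F x)) = (1/2)*(\<Sum>j<N. ?X j)" by (rule stein_identity[OF cphi])
 then have "abs ((LINT x|P. D x) - (LINT x|P. F x*ph (F x))) <= 4*La + 4 * sqrt (Wvar B1 B2)"
 using m5 m6 sqrt_nonneg by linarith
 moreover have "(LINT x|P. indicator {..v} (F x)) - (1 - upper_tail gauss v) = (LINT x|P. D x) - (LINT x|P. F x*ph (F x))"
 proof -
 have bi: "bdd_meas P (%x. indicator {..v} (F x))"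
 by (rule bdd_measI[where B=1]) (auto simp: indicator_def)
 have "(LINT x|P. D x) - (LINT x|P. F x*ph (F x)) = (LINT x|P. D x - F x*ph (F x))"
 by (intro bochner_diff[symmetric] P.bdd_meas_integrable bD bFphi)
 also have "... = (LINT x|P. indicator {..v} (F x) - (1 - upper_tail gauss v))"
 by (simp only: D_def ph_def stein_ind_equation)
 also have "... = (LINT x|P. indicator {..v} (F x)) - (1 - upper_tail gauss v)"
 using P.bdd_meas_integrable[OF bi] by (simp add: P.prob_space)
 finally show ?thesis by simp
 qed
 ultimately show ?thesis unfolding La_def by simp
qed

end

section \<open>Rates from summable weights\<close>

lemma power_mean_le:
 fixes w y :: "'i => real"
 assumes "finite I" "!!i. i \<in> I ==> 0 <= w i" "!!i. i \<in> I ==> 0 <= y i" "(\<Sum>i\<in>I. w i) = 1" "p > 1"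
 shows "(\<Sum>i\<in>I. w i*y i) powr p <= (\<Sum>i\<in>I. w i*y i powr p)"
proof -
 define s where "s = (\<Sum>i\<in>I. w i*y i)"
 have s0: "0 <= s" unfolding s_def by (intro sum_nonneg mult_nonneg_nonneg assms)
 have pq: "p/(p - 1) > 1" "1/p + 1/(p/(p - 1)) = 1" "(p - 1)*(p/(p - 1)) = p" using assms(5) by (auto simp: field_simps)
 have pw: "(s powr (p - 1)) powr (p/(p - 1)) = s powr p" by (simp only: powr_powr pq(3))
 have Y: "y i * s powr (p - 1) <= y i powr p/p + s powr p/(p/(p - 1))" if "i \<in> I" for i
 using Youngs_inequality[OF assms(5) pq(1,2) assms(3)[OF that], of "s powr (p - 1)"] unfolding pw by simp
 have "s powr p = s * s powr (p - 1)" using s0 by (cases "s = 0") (simp_all add: powr_mult_base)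
 also have "... = (\<Sum>i\<in>I. w i*(y i * s powr (p - 1)))" unfolding s_def by (simp add: sum_distrib_right mult_ac)
 also have "... <= (\<Sum>i\<in>I. w i*(y i powr p/p + s powr p/(p/(p - 1))))"
 by (intro sum_mono mult_left_mono Y assms)
 also have "... = (\<Sum>i\<in>I. w i*y i powr p)/p + s powr p/(p/(p - 1))"
 by (simp add: distrib_left sum.distrib sum_divide_distrib[symmetric] sum_distrib_right[symmetric] assms(4))
 finally have "s powr p <= (\<Sum>i\<in>I. w i*y i powr p)/p + s powr p*(1 - 1/p)"
 using assms(5) by (simp add: field_simps)
 then have "s powr p/p <= (\<Sum>i\<in>I. w i*y i powr p)/p" by (simp add: algebra_simps)
 then show ?thesis using assms(5) unfolding s_def by (simp add: divide_le_cancel)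
qed

lemma mixed_moment_le:
 fixes y s :: real
 assumes "0 <= y" "0 <= s" "0 <= e" "1 + e <= p"
 shows "y * s powr e <= 1 + y powr p + s powr p"
proof -
 define m where "m = max y s"
 have m: "0 <= m" "y <= m" "s <= m" using assms by (auto simp: m_def)
 have mp: "m powr p <= y powr p + s powr p" unfolding m_def by (auto simp: max_def)
 have "y * s powr e <= m*m powr e" using assms m by (intro mult_mono powr_mono2) auto
 also have "... = m powr (1 + e)" using m(1) by (cases "m = 0") (simp_all add: powr_mult_base)
 also have "... <= 1 + m powr p"
 proof (cases "m <= 1")
 case True
 then have "m powr (1 + e) <= 1" using m assms by (intro powr_le1) auto
 then show ?thesis by (simp add: add_increasing2)
 next
 case False
 then have "m powr (1 + e) <= m powr p" using assms by (intro powr_mono) auto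
 then show ?thesis by simp
 qed
 finally show ?thesis using mp by simp
qed

lemma bdd_meas_powr:
 assumes "bdd_meas M f" "!!x. x \<in> space M ==> 0 <= f x" "0 <= e"
 shows "bdd_meas M (%x. f x powr e)"
proof -
 from assms(1) obtain B where B: "!!x. x \<in> space M ==> abs (f x) <= B" by (auto simp: bdd_meas_def)
 have [measurable]: "f \<in> borel_measurable M" by (rule bdd_meas_measurable[OF assms(1)])
 show ?thesis
 proof (rule bdd_measI[where B="B powr e"])
 fix x assume "x \<in> space M"
 then show "abs (f x powr e) <= B powr e" using B[of x] assms(2)[of x] assms(3) by (auto intro!: powr_mono2)
 qed measurable
qed

lemma kap_le_powr:
 assumes "0 <= s" "2 <= p" "p <= 3" shows "kap s <= s powr p"
proof (cases "s <= 1")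
 case True
 have "kap s = s powr 3" using True assms by (cases "s = 0") (auto simp: kap_def powr_numeral power2_eq_square power3_eq_cube)
 also have "... <= s powr p" using True assms by (intro powr_mono') auto
 finally show ?thesis .
next
 case False
 then have "kap s = s powr 2" by (auto simp: kap_def powr_numeral)
 also have "... <= s powr p" using False assms by (intro powr_mono) auto
 finally show ?thesis .
qed

text \<open>A common bound for all row sums of mixed moments: normalising \<open>h t j\<close> by its weight leaves
 moments of order \<open>p\<close> that are at most \<open>1 + (1 + A powr p)\<close>, and summing the
 weights gives the factor \<open>A\<close>.\<close>

definition moment_const :: "real => real => real" where
 "moment_const A p = A*(2 + A powr p)"

definition wass_const :: "real => real => real => real" where
 "wass_const A p L = stein_const*(3*L powr p*moment_const A p + L ^ 3*(moment_const A p)^2)"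

definition kol_const :: "real => real => real => real" where
 "kol_const A p L = (let B = moment_const A p in
 4*L powr p*B + 4 * sqrt (6*L powr p*B + 12*L ^ 4*(B^2 + B)*B))"

text \<open>The weights bound the \<open>p\<close>-norms of the influences. Summability over rows and over columns is
 all that is used about them, so the constants below do not depend on \<open>n\<close> or \<open>N\<close>.\<close>

locale smooth_functional_moments = smooth_functional +
 fixes al :: "nat => nat => real" and A p L :: real
 assumes alpha_pos: "!!t j. 0 < al t j"
 and alpha_moment: "!!t j. t < n ==> j < N ==> E2 j (%x y. h t j x y powr p) <= al t j powr p"
 and alpha_row: "!!t. t < n ==> (\<Sum>j<N. al t j) <= A"
 and alpha_col: "!!j. j < N ==> (\<Sum>t<n. al t j) <= A"
 and A_nonneg: "0 <= A" and p2: "2 <= p" and n_pos: "0 < n"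
 and L_pos: "0 < L" and c_le: "c <= L/sqrt n"
begin

abbreviation BB :: real where "BB \<equiv> moment_const A p"

lemma bdd_h_pair: "t < n ==> j < N ==> bdd2 j (h t j)"
 by (intro bdd_h) auto

lemma bdd_S_pair: "j < N ==> bdd2 j (S j)"
 by (intro bdd_S) auto

lemma bdd_S_powr_pair: "j < N ==> 0 <= e ==> bdd2 j (%x y. S j x y powr e)"
 by (rule bdd_meas_powr[OF bdd_S_pair]) (auto simp: S_nonneg)

lemma E2_cmult: "E2 j (%x y. k*g x y) = k*E2 j g"
 unfolding E2_def by simp

lemma E2_sum:
 assumes "j < N" "!!t. t \<in> I ==> bdd2 j (g t)"
 shows "E2 j (%x y. \<Sum>t\<in>I. g t x y) = (\<Sum>t\<in>I. E2 j (g t))"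
 unfolding E2_def
 by (intro bochner_sum PPi bdd_pair_coord[OF assms(1,2)] coord_fst coord_snd assms(1))

lemma E2_add:
 assumes "j < N" "bdd2 j f" "bdd2 j g"
 shows "E2 j (%x y. f x y + g x y) = E2 j f + E2 j g"
 unfolding E2_def
 by (intro bochner_add PPi bdd_pair_coord[OF assms(1,2)] bdd_pair_coord[OF assms(1,3)] coord_fst coord_snd assms(1))

lemma E2_one: "E2 j (%x y. 1) = 1" unfolding E2_def by (simp add: PP.prob_space)

lemma bdd_y_pair: "t < n ==> j < N ==> bdd2 j (%x y. (h t j x y/al t j) powr p)"
 by (rule bdd_meas_powr) (use p2 in \<open>auto simp: divide_inverse h_nonneg less_imp_le[OF alpha_pos] intro!: bdd_meas_mult bdd_h_pair\<close>)

lemma E2_y: assumes "t < n" "j < N" shows "E2 j (%x y. (h t j x y/al t j) powr p) <= 1"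
proof -
 have "(h t j x y/al t j) powr p = (1/al t j powr p)*h t j x y powr p" for x y
 using h_nonneg[of t j x y] alpha_pos[of t j] by (simp add: powr_divide)
 then have "E2 j (%x y. (h t j x y/al t j) powr p) = (1/al t j powr p)*E2 j (%x y. h t j x y powr p)"
 by (simp only: E2_cmult)
 also have "... <= (1/al t j powr p)*al t j powr p"
 by (intro mult_left_mono alpha_moment assms) simp
 also have "... = 1" using alpha_pos[of t j] by simp
 finally show ?thesis .
qed

text \<open>Jensen's inequality with the weights of the column, which are chosen so that each normalised summand has
 \<open>p\<close>-th moment at most one.\<close>

lemma E2_S_powr: assumes j: "j < N" shows "E2 j (%x y. S j x y powr p) <= A powr p"
proof -
 define A' where "A' = (\<Sum>t<n. al t j)"
 have A': "0 < A'" unfolding A'_def using n_pos by (intro sum_pos alpha_pos) auto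
 have pt: "S j x y powr p <= (\<Sum>t<n. A' powr (p - 1)*al t j*(h t j x y/al t j) powr p)" for x y
 proof -
 have e: "S j x y = A'*(\<Sum>t<n. (al t j/A')*(h t j x y/al t j))"
 unfolding S_def sum_distrib_left using A' alpha_pos less_imp_neq[OF alpha_pos] by (intro sum.cong) (auto simp: field_simps)
 have "(\<Sum>t<n. (al t j/A')*(h t j x y/al t j)) powr p <= (\<Sum>t<n. (al t j/A')*(h t j x y/al t j) powr p)"
 proof (rule power_mean_le)
 show "(\<Sum>t<n. al t j/A') = 1" using A' by (simp add: sum_divide_distrib[symmetric] A'_def[symmetric])
 qed (use A' p2 in \<open>auto simp: less_imp_le[OF alpha_pos] h_nonneg\<close>)
 then have "A' powr p*(\<Sum>t<n. (al t j/A')*(h t j x y/al t j)) powr p <= A' powr p*(\<Sum>t<n. (al t j/A')*(h t j x y/al t j) powr p)"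
 by (rule mult_left_mono) simp
 moreover have "S j x y powr p = A' powr p*(\<Sum>t<n. (al t j/A')*(h t j x y/al t j)) powr p"
 unfolding e by (rule powr_mult)
 moreover have "A' powr p*(\<Sum>t<n. (al t j/A')*(h t j x y/al t j) powr p) = (\<Sum>t<n. A' powr (p - 1)*al t j*(h t j x y/al t j) powr p)"
 unfolding sum_distrib_left using A' by (intro sum.cong) (auto simp: powr_diff)
 ultimately show ?thesis by simp
 qed
 have "E2 j (%x y. S j x y powr p) <= E2 j (%x y. \<Sum>t<n. A' powr (p - 1)*al t j*(h t j x y/al t j) powr p)"
 by (rule E2_mono[OF j _ _ pt]) (use p2 j in \<open>auto intro!: bdd_S_powr_pair bdd_meas_sum bdd_meas_mult bdd_meas_const bdd_y_pair\<close>)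
 also have "... = (\<Sum>t<n. A' powr (p - 1)*al t j*E2 j (%x y. (h t j x y/al t j) powr p))"
 by (subst E2_sum[OF j]) (use j in \<open>auto intro!: bdd_meas_mult[OF bdd_meas_const bdd_y_pair] simp: E2_cmult\<close>)
 also have "... <= (\<Sum>t<n. A' powr (p - 1)*al t j*1)"
 by (intro sum_mono mult_left_mono E2_y j) (auto simp: less_imp_le[OF alpha_pos])
 also have "... = A' powr p"
 unfolding mult_1_right sum_distrib_left[symmetric] A'_def[symmetric] using A' by (simp add: powr_diff)
 also have "... <= A powr p" using A' alpha_col[OF j] p2 by (intro powr_mono2) (auto simp: A'_def)
 finally show ?thesis .
qed

lemma E2_h_S_powr:
 assumes t: "t < n" and j: "j < N" and e: "0 <= e" "1 + e <= p"
 shows "E2 j (%x y. h t j x y*S j x y powr e) <= al t j*(2 + A powr p)"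
proof -
 let ?y = "%x y. (h t j x y/al t j) powr p"
 have a: "0 < al t j" by (rule alpha_pos)
 have pt: "h t j x y*S j x y powr e <= al t j*(1 + ?y x y + S j x y powr p)" for x y
 proof -
 have "(h t j x y/al t j)*S j x y powr e <= 1 + ?y x y + S j x y powr p"
 using a h_nonneg S_nonneg e by (intro mixed_moment_le) auto
 then have "al t j*((h t j x y/al t j)*S j x y powr e) <= al t j*(1 + ?y x y + S j x y powr p)"
 using a by (intro mult_left_mono) auto
 then show ?thesis using a by simp
 qed
 note bm = bdd_meas_const bdd_y_pair[OF t j] bdd_S_powr_pair[OF j]
 have "E2 j (%x y. h t j x y*S j x y powr e) <= E2 j (%x y. al t j*(1 + ?y x y + S j x y powr p))"
 by (rule E2_mono[OF j _ _ pt]) (use p2 e in \<open>intro bdd_meas_mult bdd_meas_add bdd_h_pair t j bm; simp\<close>)+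
 also have "... = al t j*(1 + E2 j ?y + E2 j (%x y. S j x y powr p))"
 unfolding E2_cmult E2_add[OF j bdd_meas_add[OF bm(1,2)] bm(3)[OF order.trans[OF _ p2]], simplified]
 E2_add[OF j bm(1,2)] E2_one by (rule refl)
 also have "... <= al t j*(1 + 1 + A powr p)"
 using a by (intro mult_left_mono add_mono E2_y E2_S_powr t j) auto
 finally show ?thesis by simp
qed

lemma row_sum_le:
 assumes t: "t < n" and e: "0 <= e" "1 + e <= p"
 shows "(\<Sum>j<N. E2 j (%x y. h t j x y*S j x y powr e)) <= BB"
proof -
 have "(\<Sum>j<N. E2 j (%x y. h t j x y*S j x y powr e)) <= (\<Sum>j<N. al t j*(2 + A powr p))"
 by (intro sum_mono E2_h_S_powr t e) auto
 also have "... = (\<Sum>j<N. al t j)*(2 + A powr p)" by (simp only: sum_distrib_right)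
 also have "... <= A*(2 + A powr p)" by (intro mult_right_mono alpha_row t) (simp add: add_nonneg_nonneg)
 finally show ?thesis by (simp only: moment_const_def)
qed

lemma BB_nonneg: "0 <= BB" unfolding moment_const_def using A_nonneg by (simp add: add_nonneg_nonneg)

lemma B1: "t < n ==> (\<Sum>j<N. E2 j (hS t j)) <= BB"
 using row_sum_le[of t 1] p2 S_nonneg by simp

lemma B2: assumes "3 <= p" "t < n" shows "(\<Sum>j<N. E2 j (%x y. h t j x y*(S j x y)^2)) <= BB"
proof -
 have "S j x y powr 2 = (S j x y)^2" for j x y
 using S_nonneg[of j x y] by (cases "S j x y = 0") (simp_all add: powr_numeral)
 then show ?thesis using row_sum_le[of t 2] assms by simp
qed

lemma sum_S_powr: "(\<Sum>j<N. E2 j (%x y. S j x y powr p)) <= real n*BB"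
proof -
 have "E2 j (%x y. S j x y powr p) = (\<Sum>t<n. E2 j (%x y. h t j x y*S j x y powr (p - 1)))" if j: "j < N" for j
 proof -
 have "S j x y powr p = (\<Sum>t<n. h t j x y*S j x y powr (p - 1))" for x y
 proof -
 have "S j x y powr p = S j x y*S j x y powr (p - 1)"
 using S_nonneg[of j x y] by (cases "S j x y = 0") (simp_all add: powr_mult_base)
 also have "... = (\<Sum>t<n. h t j x y*S j x y powr (p - 1))"
 by (subst (1) S_def) (rule sum_distrib_right)
 finally show ?thesis .
 qed
 then have "E2 j (%x y. S j x y powr p) = E2 j (%x y. \<Sum>t<n. h t j x y*S j x y powr (p - 1))" by (rule E2_cong)
 also have "... = (\<Sum>t<n. E2 j (%x y. h t j x y*S j x y powr (p - 1)))"
 by (rule E2_sum[OF j]) (use p2 j in \<open>auto intro!: bdd_meas_mult bdd_h_pair bdd_S_powr_pair\<close>)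
 finally show ?thesis .
 qed
 then have "(\<Sum>j<N. E2 j (%x y. S j x y powr p)) = (\<Sum>j<N. \<Sum>t<n. E2 j (%x y. h t j x y*S j x y powr (p - 1)))"
 by (intro sum.cong) auto
 also have "... = (\<Sum>t<n. \<Sum>j<N. E2 j (%x y. h t j x y*S j x y powr (p - 1)))" by (rule sum.swap)
 also have "... <= (\<Sum>t<n. BB)" using p2 by (intro sum_mono row_sum_le) auto
 finally show ?thesis by simp
qed

lemma sum_cS_powr: "(\<Sum>j<N. E2 j (%x y. (c*S j x y) powr p)) <= L powr p*BB*n powr (1 - p/2)"
proof -
 have "(\<Sum>j<N. E2 j (%x y. (c*S j x y) powr p)) = c powr p*(\<Sum>j<N. E2 j (%x y. S j x y powr p))"
 unfolding sum_distrib_left by (intro sum.cong refl) (simp add: powr_mult c_nonneg S_nonneg E2_cmult)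
 also have "... <= (L/sqrt n) powr p*(real n*BB)"
 using c_nonneg c_le p2 BB_nonneg by (intro mult_mono sum_S_powr powr_mono2 sum_nonneg E2_nonneg) auto
 also have "(L/sqrt n) powr p*(real n*BB) = L powr p*BB*n powr (1 - p/2)"
 proof -
 have "sqrt n powr p = n powr (p/2)" using n_pos by (simp add: powr_half_sqrt[symmetric] powr_powr)
 then have "(L/sqrt n) powr p = L powr p/n powr (p/2)" using L_pos by (simp add: powr_divide)
 then show ?thesis using n_pos by (simp add: powr_diff)
 qed
 finally show ?thesis .
qed

text \<open>Since \<open>c \<le> L / sqrt n\<close>, the third-order error is of order \<open>n * n powr (- p /
 2)\<close> and the variance term is of order \<open>n powr (- 1/2)\<close>, which is smaller as \<open>p
 \<le> 3\<close>.\<close>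

lemma wasserstein_rate:
 assumes d: "!!w. (ph has_real_derivative ph' w) (at w)"
 and K: "!!w. abs (ph' w) <= K" "!!u w. abs (ph' u - ph' w) <= K * abs (u - w)" and p3: "p <= 3"
 shows "abs ((LINT x|P. ph' (F x)) - (LINT x|P. F x*ph (F x))) <= K*(3*L powr p*BB + L ^ 3*BB^2)*n powr (1 - p/2)"
proof -
 have K0: "0 <= K" using K(1)[of 0] by linarith
 have "(\<Sum>j<N. E2 j (%x y. kap (c*S j x y))) <= (\<Sum>j<N. E2 j (%x y. (c*S j x y) powr p))"
 proof (intro sum_mono E2_mono)
 fix j assume "j \<in> {..<N}"
 then show "j < N" "bdd2 j (%x y. kap (c*S j x y))"
 "bdd2 j (%x y. (c*S j x y) powr p)"
 using p2 by (auto intro!: bdd_kap bdd_meas_powr bdd_meas_mult bdd_S_pair simp: cS_nonneg)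
 show "kap (c*S j x y) <= (c*S j x y) powr p" for x y by (rule kap_le_powr[OF cS_nonneg p2 p3])
 qed
 also note sum_cS_powr
 finally have 1: "3*K*(\<Sum>j<N. E2 j (%x y. kap (c*S j x y))) <= 3*K*(L powr p*BB*n powr (1 - p/2))"
 using K0 by (intro mult_left_mono) auto
 have "c ^ 3*real n <= L ^ 3*n powr (1 - p/2)"
 proof -
 have "c ^ 3*real n <= (L/sqrt n) ^ 3*real n" using c_nonneg c_le by (intro mult_right_mono power_mono) auto
 also have "... = L ^ 3*n powr (- 1/2)"
 proof -
 have "sqrt n ^ 3 = n * sqrt n" using n_pos by (simp add: power3_eq_cube)
 then show ?thesis using n_pos by (simp add: power_divide powr_minus_divide powr_half_sqrt)
 qed
 also have "... <= L ^ 3*n powr (1 - p/2)" using n_pos p3 L_pos by (intro mult_left_mono powr_mono) auto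
 finally show ?thesis .
 qed
 then have "K*BB^2*(c ^ 3*real n) <= K*BB^2*(L ^ 3*n powr (1 - p/2))" using K0 by (intro mult_left_mono) auto
 then have 2: "K*c ^ 3*real n*BB^2 <= K*BB^2*(L ^ 3*n powr (1 - p/2))" by (simp only: mult_ac)
 have "3*K*(L powr p*BB*n powr (1 - p/2)) + K*BB^2*(L ^ 3*n powr (1 - p/2)) = K*(3*L powr p*BB + L ^ 3*BB^2)*n powr (1 - p/2)"
 by (simp add: algebra_simps)
 then show ?thesis using wasserstein_stein_bound[OF d K B1] 1 2 by linarith
qed

text \<open>The truncated fourth moments are at most the \<open>p\<close>-th ones, so the variance is of order \<open>n
 powr (1 - p / 2)\<close>; its square root dominates.\<close>

lemma kolmogorov_rate:
 assumes p3: "3 <= p" "p <= 4"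
 shows "abs ((LINT x|P. indicator {..v} (F x)) - (1 - upper_tail gauss v)) <= kol_const A p L*n powr (- (p - 2)/4)"
proof -
 let ?r = "n powr (1 - p/2)"
 have n1: "1 <= real n" using n_pos by simp
 have bp: "bdd2 j (%x y. (c*S j x y) powr p)" if "j < N" for j
 using p2 that by (auto intro!: bdd_meas_powr bdd_meas_mult bdd_S_pair simp: cS_nonneg)
 have large: "(\<Sum>j<N. E2 j (large j)) <= L powr p*BB*?r"
 proof (rule order.trans[OF sum_mono sum_cS_powr], rule E2_mono)
 fix j assume "j \<in> {..<N}"
 then show j: "j < N" by simp
 show "bdd2 j (large j)" by (rule bdd_large[OF j]) auto
 show "bdd2 j (%x y. (c*S j x y) powr p)" by (rule bp[OF j])
 show "large j x y <= (c*S j x y) powr p" for x y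
 proof (cases "c*S j x y <= 1")
 case False
 then have "(c*S j x y)^2 = (c*S j x y) powr 2" by (simp add: powr_numeral)
 also have "... <= (c*S j x y) powr p" using False p2 by (intro powr_mono) auto
 finally show ?thesis using False by (simp add: large_def cut_def)
 qed (simp add: large_def cut_def)
 qed
 have small: "(\<Sum>j<N. E2 j (%x y. (small j x y)^2)) <= L powr p*BB*?r"
 proof (rule order.trans[OF sum_mono sum_cS_powr], rule E2_mono)
 fix j assume "j \<in> {..<N}"
 then show j: "j < N" by simp
 show "bdd2 j (%x y. (small j x y)^2)" by (intro bdd_meas_power bdd_small[OF j]) auto
 show "bdd2 j (%x y. (c*S j x y) powr p)" by (rule bp[OF j])
 show "(small j x y)^2 <= (c*S j x y) powr p" for x y
 proof (cases "c*S j x y <= 1 & c*S j x y ~= 0")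
 case True
 then have s: "0 < c*S j x y" using cS_nonneg[of j x y] by linarith
 have "(small j x y)^2 = (c*S j x y) powr 4" using True s by (simp add: small_def cut_def powr_numeral power_mult[symmetric])
 also have "... <= (c*S j x y) powr p" using True s p3 by (intro powr_mono') auto
 finally show ?thesis .
 next
 case False
 then show ?thesis by (auto simp: small_def cut_def)
 qed
 qed
 have S2: "(\<Sum>j<N. E2 j (%x y. (S j x y)^2)) <= real n*BB" by (rule sum_E2_S2[OF B1])
 have "Wvar BB BB = 6*(\<Sum>j<N. E2 j (%x y. (small j x y)^2)) + 12*c ^ 4*(BB^2 + BB)*(\<Sum>j<N. E2 j (%x y. (S j x y)^2))"
 unfolding Wvar_def sum.distrib sum_distrib_left by (simp add: power_mult_distrib power_mult[symmetric])
 also have "... <= 6*(L powr p*BB*?r) + 12*(L/sqrt n) ^ 4*(BB^2 + BB)*(real n*BB)"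
 using small S2 c_nonneg c_le BB_nonneg
 by (intro add_mono mult_mono power_mono mult_nonneg_nonneg sum_nonneg E2_nonneg) auto
 also have "12*(L/sqrt n) ^ 4*(BB^2 + BB)*(real n*BB) <= (12*L ^ 4*(BB^2 + BB)*BB)*?r"
 proof -
 have "(L/sqrt n) ^ 4*real n = L ^ 4*n powr (- 1)"
 proof -
 have "sqrt n ^ 4 = real n ^ 2" by (metis real_sqrt_pow2 of_nat_0_le_iff power_mult mult_2_right numeral_Bit0 power_even_eq)
 then show ?thesis using n_pos by (simp add: power_divide powr_minus_divide power2_eq_square)
 qed
 also have "... <= L ^ 4*?r" using n1 p3 by (intro mult_left_mono powr_mono) auto
 finally have "(L/sqrt n) ^ 4*real n <= L ^ 4*?r" .
 then have "(12*(BB^2 + BB)*BB)*((L/sqrt n) ^ 4*real n) <= (12*(BB^2 + BB)*BB)*(L ^ 4*?r)"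
 using BB_nonneg by (intro mult_left_mono) auto
 then show ?thesis by (simp only: mult_ac)
 qed
 finally have W: "Wvar BB BB <= (6*L powr p*BB + 12*L ^ 4*(BB^2 + BB)*BB)*?r"
 by (simp add: algebra_simps)
 have rr: "sqrt ?r = n powr (- (p - 2)/4)" using n_pos by (simp add: powr_half_sqrt[symmetric] powr_powr field_simps)
 have "sqrt (Wvar BB BB) <= sqrt ((6*L powr p*BB + 12*L ^ 4*(BB^2 + BB)*BB)*?r)" using W by simp
 also have "... = sqrt (6*L powr p*BB + 12*L ^ 4*(BB^2 + BB)*BB)*n powr (- (p - 2)/4)"
 by (simp add: real_sqrt_mult rr)
 finally have 1: "sqrt (Wvar BB BB) <= sqrt (6*L powr p*BB + 12*L ^ 4*(BB^2 + BB)*BB)*n powr (- (p - 2)/4)" .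
 have "?r <= n powr (- (p - 2)/4)" using n1 p3 by (intro powr_mono) auto
 then have "L powr p*BB*?r <= L powr p*BB*n powr (- (p - 2)/4)" using BB_nonneg by (intro mult_left_mono) auto
 then have 2: "(\<Sum>j<N. E2 j (large j)) <= L powr p*BB*n powr (- (p - 2)/4)" using large by linarith
 have 3: "abs ((LINT x|P. indicator {..v} (F x)) - (1 - upper_tail gauss v)) <= 4*(\<Sum>j<N. E2 j (large j)) + 4 * sqrt (Wvar BB BB)"
 by (rule kolmogorov_stein_bound[OF B1 B2[OF p3(1)]])
 have "kol_const A p L*n powr (- (p - 2)/4) = 4*(L powr p*BB*n powr (- (p - 2)/4)) +
 4*(sqrt (6*L powr p*BB + 12*L ^ 4*(BB^2 + BB)*BB)*n powr (- (p - 2)/4))"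
 unfolding kol_const_def Let_def by (simp only: distrib_right mult.assoc)
 then show ?thesis using 1 2 3 by linarith
qed

end

lemma lipschitz_smoothing:
 fixes h :: "real => real"
 assumes lip: "!!x y. abs (h x - h y) <= abs (x - y)" and "de > 0"
 obtains k k' where "!!x. (k has_real_derivative k' x) (at x)" "!!x. abs (k' x) <= 1" "!!x. abs (k x - h x) <= de"
proof -
 have c: "continuous_on A h" for A by (rule lipschitz_growth(3)[OF lip])
 obtain H where H: "!!x. (H has_real_derivative h x) (at x)"
 proof -
 define H where "H u = (LBINT y=0..u. h y)" for u :: real
 have "(H has_real_derivative h x) (at x)" for x
 proof -
 have "((%u. LBINT y=(0::real)..u. h y) has_vector_derivative h x) (at x within {-abs x-1..abs x+1})"
 by (rule interval_integral_FTC2) (auto intro: c)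
 then show ?thesis
 unfolding H_def by (simp add: has_real_derivative_iff_has_vector_derivative at_within_Icc_at zero_ereal_def)
 qed
 then show ?thesis using that by blast
 qed
 define k where "k x = (H (x + de) - H x)/de" for x
 have "(k has_real_derivative (h (x + de) - h x)/de) (at x)" for x
 proof -
 have "((%x. H (x + de)) has_real_derivative h (x + de)*1) (at x)"
 by (rule DERIV_chain2[OF H]) (auto intro!: derivative_eq_intros)
 then show ?thesis unfolding k_def[abs_def]
 by (intro DERIV_cdivide DERIV_diff H) simp
 qed
 moreover have "abs ((h (x + de) - h x)/de) <= 1" for x
 using lip[of "x + de" x] \<open>de > 0\<close> by (simp add: abs_divide)
 moreover have "abs (k x - h x) <= de" for x
 proof -
 obtain z where z: "x < z" "z < x + de" "H (x + de) - H x = (x + de - x)*h z"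
 using MVT2[of x "x + de" H h] H \<open>de > 0\<close> by auto
 have "k x = h z" using z(3) \<open>de > 0\<close> by (simp add: k_def)
 then show ?thesis using lip[of z x] z by simp
 qed
 ultimately show ?thesis by (rule that)
qed

lemma abs_diff_powr_le:
 fixes a b :: real
 assumes "0 <= q" shows "abs (a - b) powr q <= 2 powr q*(abs a powr q + abs b powr q)"
proof -
 have "abs (a - b) powr q <= (2*max (abs a) (abs b)) powr q" using assms by (intro powr_mono2) auto
 also have "... = 2 powr q*max (abs a) (abs b) powr q" by (rule powr_mult)
 also have "... <= 2 powr q*(abs a powr q + abs b powr q)" by (intro mult_left_mono) (auto simp: max_def)
 finally show ?thesis .
qed

text \<open>What the method needs of a function with two bounded derivatives, in terms of differences: boundedness lets
 the influences be truncated at one.\<close>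

definition smooth_bounded :: "real => (real => real) => bool" where
 "smooth_bounded K f \<longleftrightarrow> continuous_on UNIV f & (\<forall>u. abs (f u) <= K) \<and>
 (\<forall>u v. abs (f u - f v) <= K*min 1 (abs (u - v))) \<and>
 (\<forall>z u v. abs (f z - f (z + u) - (f (z + v) - f (z + u + v))) <= K*(min 1 (abs u)*min 1 (abs v)))"

text \<open>The two distances to the standard normal law, as uniform bounds. Writing probabilities as integrals of
 indicators makes both of them statements about expectations of functions of \<open>F\<close>.\<close>

definition wasserstein_le :: "'a measure => ('a => real) => real => bool" where
 "wasserstein_le M F B \<longleftrightarrow> (\<forall>g. (\<forall>x y. abs (g x - g y) <= abs (x - y)) --> abs ((LINT w|M. g (F w)) - gauss_mean g) <= B)"

definition kolmogorov_le :: "'a measure => ('a => real) => real => bool" where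
 "kolmogorov_le M F B \<longleftrightarrow> (\<forall>x. abs ((LINT w|M. indicator {..x} (F w)) - (1 - upper_tail gauss x)) <= B)"

text \<open>One predicate for both regimes of the exponent \<open>p\<close>. It depends on the law of \<open>F\<close>
 only, and it is closed under almost sure limits of bounded variables.\<close>

definition normal_bounds :: "'a measure => ('a => real) => nat => real => real => bool" where
 "normal_bounds M F n p C \<longleftrightarrow> (p <= 3 --> wasserstein_le M F (C*n powr (1 - p/2))) \<and>
 (3 <= p & p <= 4 --> kolmogorov_le M F (C*n powr (- (p - 2)/4)))"

definition clt_const :: "real => real => real => real" where
 "clt_const A p L = max (wass_const A p L) (kol_const A p L)"

lemma distance_le_mono:
 "wasserstein_le M F B ==> B <= B' ==> wasserstein_le M F B'" "kolmogorov_le M F B ==> B <= B' ==> kolmogorov_le M F B'"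
 unfolding wasserstein_le_def kolmogorov_le_def by (meson order.trans)+

lemma normal_bounds_transfer:
 assumes E: "!!k :: real => real. k \<in> borel_measurable borel ==> (LINT w|M. k (F w)) = (LINT w|N. k (G w))"
 and b: "normal_bounds N G n p C"
 shows "normal_bounds M F n p C"
proof -
 have "(LINT w|M. g (F w)) = (LINT w|N. g (G w))" if "\<forall>x y. abs (g x - g y) <= abs (x - y)" for g :: "real => real"
 by (intro E borel_measurable_continuous_onI lipschitz_growth(3)) (use that in blast)
 then have "wasserstein_le M F B = wasserstein_le N G B" for B unfolding wasserstein_le_def by (auto cong: imp_cong)
 moreover have "kolmogorov_le M F B = kolmogorov_le N G B" for B unfolding kolmogorov_le_def by (simp add: E)
 ultimately show ?thesis using b by (simp add: normal_bounds_def)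
qed

text \<open>Sums of \<open>f\<close> over a moving average with independent coordinates. The weights refer to moments of
 order \<open>q\<close> of the summands but bound their truncation in order \<open>p\<close>; a weight of at
 least one carries no condition, because the truncated increment is at most one.\<close>

locale moving_average = indep_coords N mu
 for N :: nat and mu :: "nat => 's measure" +
 fixes n :: nat and G :: "nat => nat => 's => real" and f :: "real => real"
 and K c0 p q A :: real and al :: "nat => nat => real"
 assumes G_meas: "!!t j. t < n ==> j < N ==> G t j \<in> borel_measurable (mu j)"
 and f: "smooth_bounded K f" and K_pos: "0 < K" and c0_pos: "0 < c0" and n_pos: "0 < n"
 and p2: "2 <= p" and q: "0 <= q" "q <= p"
 and alpha_pos: "!!t j. 0 < al t j"
 and alpha_moment: "!!t j. t < n ==> j < N ==> al t j >= 1 \<or>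
 nn_integral (mu j) (%x. ennreal (abs (G t j x) powr q)) <= ennreal (al t j powr p/2 powr (q + 1))"
 and alpha_row: "!!t. t < n ==> (\<Sum>j<N. al t j) <= A"
 and alpha_col: "!!j. j < N ==> (\<Sum>t<n. al t j) <= A"
 and A_nonneg: "0 <= A"
begin

definition X :: "nat => (nat => 's) => real" where "X t x = (\<Sum>j<N. G t j (x j))"
definition W :: "(nat => 's) => real" where "W x = (\<Sum>t<n. f (X t x))"
definition m :: real where "m = (LINT x|P. W x)"
definition V :: real where "V = (LINT x|P. (W x - m)^2)"
definition F :: "(nat => 's) => real" where "F x = (W x - m)/sqrt V"

definition h :: "nat => nat => 's => 's => real" where "h t j u v = min 1 (abs (G t j u - G t j v))"

lemma X_meas [measurable]: "t < n ==> X t \<in> borel_measurable P"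
 unfolding X_def
 by (intro borel_measurable_sum measurable_compose[OF coord_measurable G_meas]) auto

lemma bdd_W: "bdd_meas P W"
 unfolding W_def
proof (intro bdd_meas_sum)
 fix t assume t: "t \<in> {..<n}"
 have [measurable]: "f \<in> borel_measurable borel"
 using f unfolding smooth_bounded_def by (intro borel_measurable_continuous_onI) blast
 have [measurable]: "X t \<in> borel_measurable P" using t by (intro X_meas) simp
 show "bdd_meas P (%x. f (X t x))"
 by (rule bdd_measI[where B=K]) (use f in \<open>auto simp: smooth_bounded_def\<close>)
qed

lemma X_upd: assumes "j < N" shows "X t (x(j := u)) = X t x + (G t j u - G t j (x j))"
proof -
 have "X t (x(j := u)) = G t j u + (\<Sum>i\<in>{..<N}-{j}. G t i (x i))"
 unfolding X_def using assms by (subst sum.remove[of _ j]) auto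
 moreover have "X t x = G t j (x j) + (\<Sum>i\<in>{..<N}-{j}. G t i (x i))"
 unfolding X_def using assms by (subst sum.remove[of _ j]) auto
 ultimately show ?thesis by simp
qed

lemma W_diff: assumes "j < N" shows "abs (W x - W (x(j := u))) <= K*(\<Sum>t<n. h t j (x j) u)"
proof -
 have "abs (W x - W (x(j := u))) <= (\<Sum>t<n. abs (f (X t x) - f (X t (x(j := u)))))"
 unfolding W_def sum_subtractf[symmetric] by (rule sum_abs)
 also have "... <= (\<Sum>t<n. K*h t j (x j) u)"
 proof (rule sum_mono)
 fix t
 have "abs (f (X t x) - f (X t (x(j := u)))) <= K*min 1 (abs (X t x - X t (x(j := u))))"
 using f by (simp add: smooth_bounded_def)
 then show "abs (f (X t x) - f (X t (x(j := u)))) <= K*h t j (x j) u"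
 unfolding X_upd[OF assms] h_def by (simp add: abs_minus_commute)
 qed
 finally show ?thesis by (simp only: sum_distrib_left)
qed

lemma W_diff2:
 assumes "i < N" "j < N" "i ~= j"
 shows "abs (W x - W (x(i := u)) - (W (x(j := w)) - W (x(i := u, j := w)))) <= K*(\<Sum>t<n. h t i (x i) u*h t j (x j) w)"
proof -
 have "W x - W (x(i := u)) - (W (x(j := w)) - W (x(i := u, j := w)))
 = (\<Sum>t<n. f (X t x) - f (X t (x(i := u))) - (f (X t (x(j := w))) - f (X t (x(i := u, j := w)))))"
 unfolding W_def by (simp only: sum_subtractf)
 then have "abs (W x - W (x(i := u)) - (W (x(j := w)) - W (x(i := u, j := w))))
 <= (\<Sum>t<n. abs (f (X t x) - f (X t (x(i := u))) - (f (X t (x(j := w))) - f (X t (x(i := u, j := w))))))"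
 by (simp only: sum_abs)
 also have "... <= (\<Sum>t<n. K*(h t i (x i) u*h t j (x j) w))"
 proof (rule sum_mono)
 fix t
 let ?a = "G t i u - G t i (x i)" let ?b = "G t j w - G t j (x j)"
 have e: "X t (x(i := u)) = X t x + ?a" "X t (x(j := w)) = X t x + ?b" "X t (x(i := u, j := w)) = X t x + ?a + ?b"
 using assms by (simp_all add: X_upd)
 have "abs (f (X t x) - f (X t x + ?a) - (f (X t x + ?b) - f (X t x + ?a + ?b))) <= K*(min 1 (abs ?a)*min 1 (abs ?b))"
 using f by (simp add: smooth_bounded_def)
 then show "abs (f (X t x) - f (X t (x(i := u))) - (f (X t (x(j := w))) - f (X t (x(i := u, j := w))))) <= K*(h t i (x i) u*h t j (x j) w)"
 unfolding e h_def abs_minus_commute[of "G t i (x i)"] abs_minus_commute[of "G t j (x j)"] .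
 qed
 finally show ?thesis by (simp only: sum_distrib_left)
qed

lemma distr_coord: "j < N ==> distr P (mu j) (%x. x j) = mu j"
 using PiM_component[of j] by simp

text \<open>Truncation trades the exponent: \<open>min 1 u powr p \<le> u powr q\<close> for \<open>q \<le> p\<close>.\<close>

lemma h_moment:
 assumes t: "t < n" and j: "j < N"
 shows "E2 j (%x y. h t j x y powr p) <= al t j powr p"
proof -
 have Gm [measurable]: "G t j \<in> borel_measurable (mu j)" by (rule G_meas[OF t j])
 have m1 [measurable]: "(%z. G t j (fst z j)) \<in> borel_measurable PP" "(%z. G t j (snd z j)) \<in> borel_measurable PP"
 using j by (auto intro!: measurable_compose[OF _ Gm] measurable_compose[OF measurable_fst coord_measurable]
 measurable_compose[OF measurable_snd coord_measurable])
 have h01: "0 <= h t j x y" "h t j x y <= 1" for x y by (auto simp: h_def)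
 have bh: "bddPP (%x y. h t j (x j) (y j) powr p)"
 proof (rule bdd_measI[where B=1])
 show "(%z. h t j (fst z j) (snd z j) powr p) \<in> borel_measurable PP" unfolding h_def by measurable
 show "abs (h t j (fst z j) (snd z j) powr p) <= 1" for z using h01 p2 by (auto intro!: powr_le1)
 qed
 from alpha_moment[OF t j] show ?thesis
 proof
 assume a1: "al t j >= 1"
 have "E2 j (%x y. h t j x y powr p) <= (LINT z|PP. 1)"
 unfolding E2_def using h01 p2 by (intro integral_mono PPi bh bdd_meas_const powr_le1) auto
 also have "... = 1" by (simp add: PP.prob_space)
 also have "... <= al t j powr p" using a1 p2 by (intro ge_one_powr_ge_zero) auto
 finally show ?thesis .
 next
 assume am: "nn_integral (mu j) (%x. ennreal (abs (G t j x) powr q)) <= ennreal (al t j powr p/2 powr (q + 1))"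
 have I1: "nn_integral P (%x. ennreal (abs (G t j (x j)) powr q)) = nn_integral (mu j) (%x. ennreal (abs (G t j x) powr q))"
 proof -
 have gm: "(%x. ennreal (abs (G t j x) powr q)) \<in> borel_measurable (mu j)" by measurable
 have "nn_integral (mu j) (%x. ennreal (abs (G t j x) powr q)) = nn_integral (distr P (mu j) (%x. x j)) (%x. ennreal (abs (G t j x) powr q))"
 by (simp only: distr_coord[OF j])
 also have "... = nn_integral P (%x. ennreal (abs (G t j (x j)) powr q))"
 by (rule nn_integral_distr[OF coord_measurable[OF j]]) (use gm in simp)
 finally show ?thesis by (rule sym)
 qed
 have IPP: "nn_integral PP (%z. ennreal (abs (G t j (fst z j)) powr q)) = nn_integral P (%x. ennreal (abs (G t j (x j)) powr q))"
 "nn_integral PP (%z. ennreal (abs (G t j (snd z j)) powr q)) = nn_integral P (%x. ennreal (abs (G t j (x j)) powr q))"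
 by (subst P.nn_integral_fst[symmetric], measurable, simp add: P.emeasure_space_1)+
 have "ennreal (E2 j (%x y. h t j x y powr p)) = nn_integral PP (%z. ennreal (h t j (fst z j) (snd z j) powr p))"
 unfolding E2_def by (rule nn_integral_eq_integral[symmetric]) (auto intro: PPi bh)
 also have "... <= nn_integral PP (%z. ennreal (2 powr q)*(ennreal (abs (G t j (fst z j)) powr q) + ennreal (abs (G t j (snd z j)) powr q)))"
 proof (rule nn_integral_mono)
 fix z :: "(nat => 's) \<times> (nat => 's)"
 let ?a = "G t j (fst z j)"
 let ?b = "G t j (snd z j)"
 have "h t j (fst z j) (snd z j) powr p <= h t j (fst z j) (snd z j) powr q"
 using h01[of "fst z j" "snd z j"] q by (cases "h t j (fst z j) (snd z j) = 0") (auto intro!: powr_mono')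
 also have "... <= abs (?a - ?b) powr q" using h01 q by (intro powr_mono2) (auto simp: h_def)
 also have "... <= 2 powr q*(abs ?a powr q + abs ?b powr q)" by (rule abs_diff_powr_le[OF q(1)])
 finally have "ennreal (h t j (fst z j) (snd z j) powr p) <= ennreal (2 powr q*(abs ?a powr q + abs ?b powr q))"
 by (rule ennreal_leI)
 then show "ennreal (h t j (fst z j) (snd z j) powr p) <= ennreal (2 powr q)*(ennreal (abs ?a powr q) + ennreal (abs ?b powr q))"
 by (simp add: ennreal_mult)
 qed
 also have "... = ennreal (2 powr q)*(nn_integral (mu j) (%x. ennreal (abs (G t j x) powr q)) + nn_integral (mu j) (%x. ennreal (abs (G t j x) powr q)))"
 by (subst nn_integral_cmult, measurable, subst nn_integral_add, measurable, simp add: IPP I1)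
 also have "... <= ennreal (2 powr q)*(ennreal (al t j powr p/2 powr (q + 1)) + ennreal (al t j powr p/2 powr (q + 1)))"
 by (intro mult_left_mono add_mono am) auto
 also have "... = ennreal (al t j powr p)"
 by (simp add: ennreal_plus[symmetric] ennreal_mult[symmetric] powr_add del: ennreal_plus)
 finally show ?thesis by simp
 qed
qed

lemma moments:
 assumes V: "real n*c0^2 <= V"
 shows "smooth_functional_moments N mu n h (K/sqrt V) F al A p (K/c0)"
proof -
 have Vpos: "0 < V" using V n_pos c0_pos by (meson mult_pos_pos of_nat_0_less_iff order_less_le_trans zero_less_power)
 have bF: "bdd_meas P F" unfolding F_def divide_inverse
 by (intro bdd_meas_mult bdd_meas_diff bdd_W bdd_meas_const)
 have intW: "integrable P W" by (rule P.bdd_meas_integrable[OF bdd_W])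
 have Fd: "F x - F y = (W x - W y)/sqrt V" for x y by (simp add: F_def diff_divide_distrib)
 show ?thesis
 proof (unfold_locales)
 show "(%z. h t j (fst z) (snd z)) \<in> borel_measurable (mu2 j)" if "t < n" "j < N" for t j
 proof -
 have [measurable]: "G t j \<in> borel_measurable (mu j)" by (rule G_meas[OF that])
 show ?thesis unfolding h_def by measurable
 qed
 show "(LINT x|P. F x) = 0" unfolding F_def using intW by (simp add: m_def P.prob_space)
 show "(LINT x|P. (F x)^2) = 1"
 unfolding F_def using Vpos by (simp add: power_divide V_def[symmetric])
 show "abs (F z - F (z(j := u))) <= K/sqrt V*(\<Sum>t<n. h t j (z j) u)" if "j < N" for z j u
 using W_diff[OF that, of z u] Vpos unfolding Fd by (simp add: abs_divide divide_right_mono)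
 show "abs (F z - F (z(i := u)) - (F (z(j := w)) - F (z(i := u, j := w)))) <= K/sqrt V*(\<Sum>t<n. h t i (z i) u*h t j (z j) w)"
 if "i < N" "j < N" "i ~= j" for z i j u w
 proof -
 have "F z - F (z(i := u)) - (F (z(j := w)) - F (z(i := u, j := w))) = (W z - W (z(i := u)) - (W (z(j := w)) - W (z(i := u, j := w))))/sqrt V"
 unfolding Fd by (simp add: diff_divide_distrib)
 then show ?thesis using W_diff2[OF that, of z u w] Vpos by (simp add: abs_divide divide_right_mono)
 qed
 show "E2 j (%x y. h t j x y powr p) <= al t j powr p" if "t < n" "j < N" for t j by (rule h_moment[OF that])
 show "K/sqrt V <= K/c0/sqrt n"
 proof -
 have "sqrt (real n*c0^2) <= sqrt V" using V by simp
 then have "c0 * sqrt n <= sqrt V" using c0_pos by (simp add: real_sqrt_mult mult.commute)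
 then have "K/sqrt V <= K/(c0 * sqrt n)" using K_pos c0_pos n_pos Vpos by (intro divide_left_mono) auto
 then show ?thesis by simp
 qed
 show "h t j x y = h t j y x" for t j x y by (simp add: h_def abs_minus_commute)
 qed (use bF K_pos c0_pos Vpos alpha_pos alpha_row alpha_col A_nonneg p2 n_pos in \<open>auto simp: h_def\<close>)
qed

text \<open>Stein's equation is available for differentiable functions, and averaging over short intervals extends the
 bound to all Lipschitz functions.\<close>

lemma ma_wasserstein:
 assumes V: "real n*c0^2 <= V" and p3: "p <= 3"
 shows "wasserstein_le P F (wass_const A p (K/c0)*n powr (1 - p/2))"
 unfolding wasserstein_le_def
proof (intro allI impI)
 fix g :: "real => real" assume lip0: "\<forall>x y. abs (g x - g y) <= abs (x - y)"
 note lip = lip0[rule_format]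
 interpret smooth_functional_moments N mu n h "K/sqrt V" F al A p "K/c0" by (rule moments[OF V])
 let ?B = "wass_const A p (K/c0)*n powr (1 - p/2)"
 have main: "abs ((LINT x|P. k (F x)) - gauss_mean k) <= ?B"
 if k: "!!x. (k has_real_derivative k' x) (at x)" "!!x. abs (k' x) <= 1" for k k'
 proof -
 obtain ph ph' where phi: "!!w. (ph has_real_derivative ph' w) (at w)"
 "!!w. ph' w - w*ph w = k w - gauss_mean k"
 "!!w. abs (ph' w) <= stein_const" "!!u w. abs (ph' u - ph' w) <= stein_const * abs (u - w)"
 by (rule stein_solution_lipschitz[of k k', OF k], rule that)
 have c: "continuous_on UNIV k" "continuous_on UNIV ph"
 by (meson DERIV_isCont continuous_at_imp_continuous_on k(1) phi(1))+
 have b: "bdd_meas P (%x. k (F x))" "bdd_meas P (%x. ph (F x))"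
 by (rule bdd_meas_continuous_comp[OF F_bdd c(1)], rule bdd_meas_continuous_comp[OF F_bdd c(2)])
 have e: "ph' (F x) = F x*ph (F x) + k (F x) - gauss_mean k" for x
 using phi(2)[of "F x"] by simp
 have b2: "bdd_meas P (%x. F x*ph (F x))" by (rule bdd_meas_mult[OF F_bdd b(2)])
 have "(LINT x|P. ph' (F x)) = (LINT x|P. F x*ph (F x)) + (LINT x|P. k (F x)) - gauss_mean k"
 unfolding e using P.bdd_meas_integrable[OF b2] P.bdd_meas_integrable[OF b(1)] by (simp add: P.prob_space)
 moreover have "abs ((LINT x|P. ph' (F x)) - (LINT x|P. F x*ph (F x))) <= ?B"
 using wasserstein_rate[OF phi(1,3,4) p3] by (simp add: wass_const_def)
 ultimately show ?thesis by simp
 qed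
 have cg: "continuous_on UNIV g" by (rule lipschitz_growth(3)[OF lip])
 show "abs ((LINT x|P. g (F x)) - gauss_mean g) <= ?B"
 proof (rule field_le_epsilon)
 fix e :: real assume "0 < e"
 then have d: "e/2 > 0" by simp
 obtain k k' where k: "!!x. (k has_real_derivative k' x) (at x)" "!!x. abs (k' x) <= 1" "!!x. abs (k x - g x) <= e/2"
 by (rule lipschitz_smoothing[OF lip d]) blast
 have ck: "continuous_on UNIV k" by (meson DERIV_isCont continuous_at_imp_continuous_on k(1))
 have lipk: "abs (k x - k y) <= abs (x - y)" for x y
 using field_differentiable_bound[of UNIV k k' 1 x y, OF convex_UNIV k(1)] k(2) by simp
 have b: "bdd_meas P (%x. k (F x))" "bdd_meas P (%x. g (F x))"
 by (rule bdd_meas_continuous_comp[OF F_bdd ck], rule bdd_meas_continuous_comp[OF F_bdd cg])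
 have "(LINT x|P. k (F x)) - (LINT x|P. g (F x)) = (LINT x|P. k (F x) - g (F x))"
 by (intro bochner_diff[symmetric] P.bdd_meas_integrable b)
 moreover have "abs (LINT x|P. k (F x) - g (F x)) <= (LINT x|P. e/2)"
 by (rule P.bdd_meas_integral_bound[OF bdd_meas_diff[OF b] k(3) bdd_meas_const])
 ultimately have 1: "abs ((LINT x|P. k (F x)) - (LINT x|P. g (F x))) <= e/2" by (simp add: P.prob_space)
 have i: "integrable lborel (%x. k x*gauss x)" "integrable lborel (%x. g x*gauss x)"
 by (rule lipschitz_growth(1)[OF lipk], rule lipschitz_growth(1)[OF lip])
 have "gauss_mean k - gauss_mean g = (LINT x|lborel. (k x - g x)*gauss x)"
 unfolding left_diff_distrib using i by simp
 moreover have "abs (LINT x|lborel. (k x - g x)*gauss x) <= (LINT x|lborel. e/2*gauss x)"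
 proof (rule order.trans[OF integral_abs_bound], rule integral_mono)
 show "integrable lborel (%x. abs ((k x - g x)*gauss x))" unfolding left_diff_distrib using i by auto
 show "abs ((k x - g x)*gauss x) <= e/2*gauss x" for x
 unfolding abs_mult abs_of_nonneg[OF normal_density_nonneg] by (rule mult_right_mono[OF k(3)]) simp
 qed simp
 ultimately have 2: "abs (gauss_mean k - gauss_mean g) <= e/2" by simp
 show "abs ((LINT x|P. g (F x)) - gauss_mean g) <= ?B + e"
 using 1 2 main[OF k(1,2)] by linarith
 qed
qed

lemma ma_kolmogorov:
 assumes V: "real n*c0^2 <= V" and p3: "3 <= p" "p <= 4"
 shows "kolmogorov_le P F (kol_const A p (K/c0)*n powr (- (p - 2)/4))"
proof -
 interpret smooth_functional_moments N mu n h "K/sqrt V" F al A p "K/c0" by (rule moments[OF V])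
 show ?thesis unfolding kolmogorov_le_def by (intro allI kolmogorov_rate[OF p3])
qed

theorem ma_normal_bounds:
 assumes V: "real n*c0^2 <= V" shows "normal_bounds P F n p (clt_const A p (K/c0))"
 unfolding normal_bounds_def
proof (intro conjI impI)
 show "wasserstein_le P F (clt_const A p (K/c0)*n powr (1 - p/2))" if "p <= 3"
 by (rule distance_le_mono(1)[OF ma_wasserstein[OF V that]]) (simp add: clt_const_def mult_right_mono)
 show "kolmogorov_le P F (clt_const A p (K/c0)*n powr (- (p - 2)/4))" if "3 <= p & p <= 4"
 by (rule distance_le_mono(2)[OF ma_kolmogorov[OF V]]) (use that in \<open>auto simp: clt_const_def intro: mult_right_mono\<close>)
qed

end

section \<open>Fractional moments and characteristic functions\<close>

lemma norm_exp_minus_1_le: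
 fixes z :: complex
 assumes "Re z <= 0" shows "norm (exp z - 1) <= norm z"
proof -
 have "norm (exp z - exp 0) <= 1*norm (z - 0)"
 proof (rule field_differentiable_bound[where S="{w. Re w <= 0}"])
 show "convex {w. Re w <= 0}" by (rule convex_halfspace_Re_le)
 show "(exp has_field_derivative exp w) (at w within {w. Re w <= 0})" for w :: complex
 by (rule DERIV_subset[OF DERIV_exp]) simp
 show "norm (exp w) <= 1" if "w \<in> {w. Re w <= 0}" for w :: complex
 using that by (simp add: norm_exp_eq_Re)
 qed (use assms in auto)
 then show ?thesis by simp
qed

text \<open>The common bound for \<open>\<bar>exp (\<i> * u) - 1 - \<i> * u\<bar>\<close> and \<open>1 - cos u\<close>.\<close>

definition Th :: "real => real" where "Th u = min (2 * abs u) (u^2)"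

lemma Theta_nonneg: "0 <= Th u" by (simp add: Th_def)

lemma Theta_measurable [measurable]: "Th \<in> borel_measurable borel"
 unfolding Th_def[abs_def] by measurable

lemma iexp_second_order: "norm (iexp y - 1 - \<i>*y) <= Th y"
proof -
 have s: "(\<Sum>k\<le>1. (\<i>*complex_of_real y) ^ k/fact k) = 1 + \<i>*y"
 by (simp add: atMost_Suc)
 have "norm (iexp y - (1 + \<i>*y)) <= 2 * abs y" using iexp_approx2[of y 1] unfolding s by simp
 moreover have "norm (iexp y - (1 + \<i>*y)) <= (abs y)\<^sup>2/2"
 using iexp_approx1[of y 1] unfolding s by (simp add: numeral_2_eq_2)
 then have "norm (iexp y - (1 + \<i>*y)) <= y^2"
 using zero_le_power2[of y] unfolding power2_abs by linarith
 ultimately show ?thesis unfolding Th_def by (simp add: diff_diff_eq)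
qed

lemma Theta_le_powr:
 assumes "1 <= q" "q <= 2" shows "Th y <= 2 * abs y powr q"
proof (cases "abs y <= 1")
 case True
 have "Th y <= abs y powr 2" by (cases "y = 0") (auto simp: Th_def powr_numeral)
 also have "... <= abs y powr q" using True assms by (intro powr_mono') auto
 also have "... <= 2 * abs y powr q" by simp
 finally show ?thesis .
next
 case False
 have "Th y <= 2 * abs y powr 1" by (simp add: Th_def)
 also have "... <= 2 * abs y powr q" using False assms by (intro mult_left_mono powr_mono) auto
 finally show ?thesis .
qed

text \<open>By scaling, \<open>\<integral> (1 - cos (u * x)) * u powr (- 1 - q) du\<close> is a constant times
 \<open>\<bar>x\<bar> powr q\<close>. Applied to a random variable this expresses its \<open>q\<close>-th
 moment by its characteristic function.\<close>

definition frac_int :: "real => (real => real) => ennreal" where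
 "frac_int q g = nn_integral lborel (%u. indicator {0<..} u*ennreal (g u*u powr (- 1 - q)))"

lemma frac_int_scale:
 assumes [measurable]: "g \<in> borel_measurable borel" and even: "!!u. g (- u) = g u" and g0: "g 0 = 0"
 and nn: "!!u. 0 <= g u" and q: "0 < q"
 shows "frac_int q (%u. g (u*x)) = ennreal (abs x powr q)*frac_int q g"
proof (cases "x = 0")
 case True
 then show ?thesis by (simp add: frac_int_def g0)
next
 case False
 have gx: "g (u*x) = g (u * abs x)" for u using even[of "u*x"] by (auto simp: abs_if)
 have "frac_int q (%u. g (u*x)) = ennreal (abs (1/abs x)) *
 nn_integral lborel (%v. indicator {0<..} (0 + (1/abs x) * v)*ennreal (g ((0 + (1/abs x) * v) * abs x)*(0 + (1/abs x) * v) powr (- 1 - q)))"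
 unfolding frac_int_def gx by (rule nn_integral_real_affine) (use False in auto)
 also have "... = ennreal (1/abs x)*nn_integral lborel (%v. ennreal (abs x powr (1 + q))*(indicator {0<..} v * ennreal (g v * v powr (- 1 - q))))"
 proof -
 have "indicator {0<..} (0 + (1/abs x) * v)*ennreal (g ((0 + (1/abs x) * v) * abs x)*(0 + (1/abs x) * v) powr (- 1 - q))
 = ennreal (abs x powr (1 + q))*(indicator {0<..} v * ennreal (g v * v powr (- 1 - q)))" for v
 proof (cases "v > 0")
 case True
 then have "(v/abs x) powr (- 1 - q) = abs x powr (1 + q) * v powr (- 1 - q)"
 proof -
 have "abs x powr (- 1 - q) = inverse (abs x powr (1 + q))" by (simp add: powr_minus[symmetric])
 then show ?thesis using True False by (simp add: powr_divide) (simp add: divide_inverse)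
 qed
 then show ?thesis using True False nn[of v] by (simp add: ennreal_mult[symmetric] mult_ac)
 next
 case f: False
 then show ?thesis using False by (simp add: indicator_def zero_less_divide_iff)
 qed
 then show ?thesis using False by simp
 qed
 also have "... = ennreal (1/abs x)*(ennreal (abs x powr (1 + q))*frac_int q g)"
 unfolding frac_int_def by (subst nn_integral_cmult) auto
 also have "... = ennreal (abs x powr q)*frac_int q g"
 using False by (simp add: mult.assoc[symmetric] ennreal_mult[symmetric] powr_add)
 finally show ?thesis .
qed

lemma nn_powr_0_1: "- 1 < a ==> nn_integral lborel (%u. indicator {0..1} u*ennreal (u powr a)) = ennreal (1/(a + 1))"
proof -
 assume "- 1 < a"
 then have "((%x. x powr a) has_integral (1 powr (a + 1)/(a + 1))) {0..1}" by (intro has_integral_powr_from_0) auto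
 from nn_integral_has_integral_lebesgue'[OF _ this] show ?thesis by (simp add: mult.commute)
qed

lemma nn_powr_1_inf: "a < - 1 ==> nn_integral lborel (%u. indicator {1..} u*ennreal (u powr a)) = ennreal (- (1/(a + 1)))"
proof -
 assume "a < - 1"
 then have "((%x. x powr a) has_integral (- (1 powr (a + 1))/(a + 1))) {1..}" by (intro has_integral_powr_to_inf) auto
 from nn_integral_has_integral_lebesgue'[OF _ this] show ?thesis by (simp add: mult.commute)
qed

lemma frac_int_Theta_finite: assumes "1 < q" "q < 2" shows "frac_int q Th < \<infinity>"
proof -
 have "frac_int q Th <= nn_integral lborel (%u. indicator {0..1} u*ennreal (u powr (1 - q)) + 2*(indicator {1..} u*ennreal (u powr (- q))))"
 unfolding frac_int_def
 proof (rule nn_integral_mono)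
 fix u :: real
 show "indicator {0<..} u*ennreal (Th u*u powr (- 1 - q)) <= indicator {0..1} u*ennreal (u powr (1 - q)) + 2*(indicator {1..} u*ennreal (u powr (- q)))"
 proof (cases "u > 0")
 case True
 show ?thesis
 proof (cases "u <= 1")
 case u: True
 have "Th u*u powr (- 1 - q) <= u powr 2*u powr (- 1 - q)"
 using True by (intro mult_right_mono) (auto simp: Th_def powr_numeral)
 also have "... = u powr (1 - q)" by (simp add: powr_add[symmetric])
 finally have "ennreal (Th u*u powr (- 1 - q)) <= ennreal (u powr (1 - q))" by (rule ennreal_leI)
 then show ?thesis using True u by (simp add: indicator_def add_increasing2)
 next
 case u: False
 have "Th u*u powr (- 1 - q) <= (2*u powr 1)*u powr (- 1 - q)"
 using True by (intro mult_right_mono) (auto simp: Th_def)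
 also have "... = 2*u powr (- q)" by (simp only: mult.assoc powr_add[symmetric]) simp
 finally have "ennreal (Th u*u powr (- 1 - q)) <= ennreal (2*u powr (- q))" by (rule ennreal_leI)
 then show ?thesis using True u by (simp add: indicator_def ennreal_mult)
 qed
 qed (simp add: indicator_def)
 qed
 also have "... = nn_integral lborel (%u. indicator {0..1} u*ennreal (u powr (1 - q))) + 2*nn_integral lborel (%u. indicator {1..} u*ennreal (u powr (- q)))"
 by (subst nn_integral_add) (auto simp: nn_integral_cmult)
 also have "... < \<infinity>"
 using assms by (simp add: nn_powr_0_1 nn_powr_1_inf ennreal_mult_less_top)
 finally show ?thesis .
qed

definition cosfun :: "real => real" where "cosfun u = 1 - cos u"

lemma cosfun_nonneg: "0 <= cosfun u" by (simp add: cosfun_def)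

lemma cosfun_measurable [measurable]: "cosfun \<in> borel_measurable borel"
 unfolding cosfun_def[abs_def] by measurable

lemma cosfun_le_Theta: "cosfun u <= Th u"
proof -
 have "cosfun u = - Re (iexp u - 1 - \<i>*u)" by (simp add: cosfun_def Re_exp)
 also have "... <= norm (iexp u - 1 - \<i>*u)" using abs_Re_le_cmod[of "iexp u - 1 - \<i>*u"] by linarith
 finally show ?thesis using iexp_second_order[of u] by linarith
qed

lemma frac_int_cos: assumes "1 < q" "q < 2" shows "0 < frac_int q cosfun" "frac_int q cosfun < \<infinity>"
proof -
 have "frac_int q cosfun <= frac_int q Th"
 unfolding frac_int_def by (intro nn_integral_mono mult_left_mono ennreal_leI mult_right_mono cosfun_le_Theta) auto
 then show "frac_int q cosfun < \<infinity>" using frac_int_Theta_finite[OF assms] by (rule le_less_trans)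
 have "ennreal ((1 - cos 1)*2 powr (- 1 - q))*1 = nn_integral lborel (%u. ennreal ((1 - cos 1)*2 powr (- 1 - q))*indicator {1..2::real} u)"
 by (subst nn_integral_cmult_indicator) auto
 also have "... <= frac_int q cosfun"
 unfolding frac_int_def
 proof (rule nn_integral_mono)
 fix u :: real
 show "ennreal ((1 - cos 1)*2 powr (- 1 - q))*indicator {1..2} u <= indicator {0<..} u*ennreal (cosfun u*u powr (- 1 - q))"
 proof (cases "u \<in> {1..2}")
 case True
 have "cos u <= cos 1" using True pi_gt3 by (intro cos_monotone_0_pi_le) auto
 moreover have "2 powr (- 1 - q) <= u powr (- 1 - q)" using True assms by (intro powr_mono2') auto
 ultimately have "(1 - cos 1)*2 powr (- 1 - q) <= cosfun u*u powr (- 1 - q)"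
 by (intro mult_mono) (auto simp: cosfun_def)
 then show ?thesis using True by (simp add: ennreal_leI)
 qed simp
 qed
 finally have "ennreal ((1 - cos 1)*2 powr (- 1 - q)) <= frac_int q cosfun" by simp
 moreover have "cos 1 < (1::real)" using cos_monotone_0_pi[of 0 1] pi_gt3 by simp
 ultimately show "0 < frac_int q cosfun" by (auto intro: less_le_trans[rotated] simp: ennreal_less_zero_iff)
qed

text \<open>Integrate the scaling identity for \<open>1 - cos (u * x)\<close> over the law of the variable.\<close>

lemma (in prob_space) nn_moment_char:
 assumes [measurable]: "random_variable borel Z" and q: "1 < q" "q < 2"
 shows "frac_int q cosfun*abs_moment M q Z =
 frac_int q (%u. 1 - Re (char (distr M borel Z) u))"
proof -
 have "frac_int q cosfun*abs_moment M q Z = nn_integral M (%w. ennreal (abs (Z w) powr q)*frac_int q cosfun)"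
 by (subst nn_integral_multc) (auto simp: mult.commute)
 also have "... = nn_integral M (%w. nn_integral lborel (%u. indicator {0<..} u*ennreal (cosfun (u*Z w)*u powr (- 1 - q))))"
 proof (rule nn_integral_cong)
 fix w
 show "ennreal (abs (Z w) powr q)*frac_int q cosfun = nn_integral lborel (%u. indicator {0<..} u*ennreal (cosfun (u*Z w)*u powr (- 1 - q)))"
 using frac_int_scale[of cosfun q "Z w"] q cosfun_nonneg by (simp add: frac_int_def) (simp add: cosfun_def)
 qed
 also have "... = nn_integral lborel (%u. nn_integral M (%w. indicator {0<..} u*ennreal (cosfun (u*Z w)*u powr (- 1 - q))))"
 proof -
 interpret pair_sigma_finite M lborel ..
 show ?thesis by (rule Fubini'[symmetric]) measurable
 qed
 also have "... = frac_int q (%u. 1 - Re (char (distr M borel Z) u))"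
 unfolding frac_int_def
 proof (rule nn_integral_cong)
 fix u :: real
 have ic: "integrable M (%w. cosfun (u*Z w))"
 by (rule integrable_const_bound[where B=2]) (auto simp: cosfun_def intro: abs_leI order.trans[OF _ cos_ge_minus_one])
 have ie: "integrable M (%w. iexp (u*Z w))" by (rule integrable_iexp) auto
 have "char (distr M borel Z) u = (LINT w|M. iexp (u*Z w))"
 unfolding char_def by (rule integral_distr) auto
 then have "1 - Re (char (distr M borel Z) u) = 1 - (LINT w|M. Re (iexp (u*Z w)))"
 using ie by (simp only: integral_Re)
 also have "... = (LINT w|M. cosfun (u*Z w))"
 unfolding cosfun_def using integrable_Re[OF ie] by (simp add: prob_space Re_exp)
 finally have e: "1 - Re (char (distr M borel Z) u) = (LINT w|M. cosfun (u*Z w))" .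
 have "nn_integral M (%w. indicator {0<..} u*ennreal (cosfun (u*Z w)*u powr (- 1 - q)))
 = nn_integral M (%w. (indicator {0<..} u*ennreal (u powr (- 1 - q)))*ennreal (cosfun (u*Z w)))"
 by (intro nn_integral_cong) (simp add: ennreal_mult cosfun_nonneg mult_ac)
 also have "... = (indicator {0<..} u*ennreal (u powr (- 1 - q)))*nn_integral M (%w. ennreal (cosfun (u*Z w)))"
 by (rule nn_integral_cmult) measurable
 also have "nn_integral M (%w. ennreal (cosfun (u*Z w))) = ennreal (LINT w|M. cosfun (u*Z w))"
 by (rule nn_integral_eq_integral[OF ic]) (simp add: cosfun_nonneg)
 finally show "nn_integral M (%w. indicator {0<..} u*ennreal (cosfun (u*Z w)*u powr (- 1 - q)))
 = indicator {0<..} u*ennreal ((1 - Re (char (distr M borel Z) u))*u powr (- 1 - q))"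
 unfolding e by (simp add: ennreal_mult[symmetric] bochner_nonneg cosfun_nonneg mult_ac)
 qed
 finally show ?thesis .
qed

section \<open>Jump measures with a moment of order below two\<close>

text \<open>A Levy measure with a moment of order \<open>q < 2\<close>; as \<open>q > 1\<close>, no truncation of small
 or large jumps is needed in the exponent.\<close>

locale jump_measure = sigma_finite_measure \<nu> for \<nu> :: "real measure" +
 fixes q :: real
 assumes sets_nu [measurable_cong]: "sets \<nu> = sets borel"
 and q: "1 < q" "q < 2"
 and moment_fin: "nn_integral \<nu> (%x. ennreal (abs x powr q)) < \<infinity>"
begin

definition Mq :: real where "Mq = (LINT x|\<nu>. abs x powr q)"

definition ps :: "real => complex" where
 "ps u = (LINT x|\<nu>. (iexp (u*x) - 1 - \<i> * of_real (u*x)))"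

lemma integrable_q: "integrable \<nu> (%x. abs x powr q)"
 using moment_fin by (intro integrableI_nonneg) auto

lemma nn_moment: "nn_integral \<nu> (%x. ennreal (abs x powr q)) = ennreal Mq"
 unfolding Mq_def by (rule nn_integral_eq_integral[OF integrable_q]) simp

lemma Mq_nonneg: "0 <= Mq" unfolding Mq_def by simp

lemma integrand_bound: "norm (iexp (u*x) - 1 - \<i> * of_real (u*x)) <= 2 * abs u powr q * abs x powr q"
 using iexp_second_order[of "u*x"] Theta_le_powr[of q "u*x"] q by (simp add: abs_mult powr_mult)

lemma integrand_measurable [measurable]: "(%x. iexp (u*x) - 1 - \<i>*complex_of_real (u*x)) \<in> borel_measurable \<nu>"
 by measurable

lemma integrable_integrand: "integrable \<nu> (%x. iexp (u*x) - 1 - \<i> * of_real (u*x))"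
 by (rule bochner_bound[OF integrable_mult_right[OF integrable_q, of "2 * abs u powr q"]])
 (use integrand_bound in \<open>auto intro!: AE_I2\<close>)

lemma psi_bound: "norm (ps u) <= 2 * abs u powr q*Mq"
proof -
 have "norm (ps u) <= (LINT x|\<nu>. norm (iexp (u*x) - 1 - \<i> * of_real (u*x)))"
 unfolding ps_def by (rule integral_norm_bound)
 also have "... <= (LINT x|\<nu>. 2 * abs u powr q * abs x powr q)"
 by (intro integral_mono integrable_norm integrable_integrand integrable_mult_right integrable_q integrand_bound)
 finally show ?thesis by (simp add: Mq_def)
qed

lemma psi_0: "ps 0 = 0" by (simp add: ps_def)

lemma psi_continuous: "continuous_on UNIV ps"
proof (rule continuous_at_imp_continuous_on, rule ballI)
 fix u :: real
 show "isCont ps u"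
 proof (rule continuous_at_sequentiallyI)
 fix v :: "nat => real" assume v: "v ----> u"
 then obtain B where B: "!!n. abs (v n) <= B" using convergent_imp_Bseq[OF convergentI[OF v]] by (auto simp: Bseq_def)
 have B0: "0 <= B" using B[of 0] by linarith
 show "(%n. ps (v n)) ----> ps u"
 unfolding ps_def
 proof (rule integral_dominated_convergence[where w="%x. 2*B powr q * abs x powr q"])
 show "integrable \<nu> (%x. 2*B powr q * abs x powr q)" by (intro integrable_mult_right integrable_q)
 show "AE x in \<nu>. (%n. iexp (v n*x) - 1 - \<i> * of_real (v n*x)) ----> iexp (u*x) - 1 - \<i> * of_real (u*x)"
 by (intro AE_I2 tendsto_intros v)
 show "AE x in \<nu>. norm (iexp (v n*x) - 1 - \<i> * of_real (v n*x)) <= 2*B powr q * abs x powr q" for n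
 proof (rule AE_I2)
 fix x
 have "2 * abs (v n) powr q * abs x powr q <= 2*B powr q * abs x powr q"
 using B[of n] q by (intro mult_right_mono mult_left_mono powr_mono2) auto
 then show "norm (iexp (v n*x) - 1 - \<i> * of_real (v n*x)) <= 2*B powr q * abs x powr q"
 using integrand_bound[of "v n" x] by linarith
 qed
 qed measurable
 qed
qed

lemma psi_measurable [measurable]: "ps \<in> borel_measurable borel"
 by (rule borel_measurable_continuous_onI[OF psi_continuous])

text \<open>The fractional integral of the exponent is bounded by the moment of the jump measure, by Fubini and scaling.
 This is the only property of the exponent that the moment bounds for integrals use.\<close>

lemma frac_int_psi: "frac_int q (%u. norm (ps (u*y))) <= ennreal (abs y powr q)*(ennreal Mq*frac_int q Th)"
proof -
 have nb: "ennreal (norm (ps w)) <= nn_integral \<nu> (%x. ennreal (Th (w*x)))" for w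
 proof -
 have "ennreal (norm (ps w)) <= nn_integral \<nu> (%x. norm (iexp (w*x) - 1 - \<i> * of_real (w*x)))"
 unfolding ps_def by (rule integral_norm_bound_ennreal[OF integrable_integrand])
 also have "... <= nn_integral \<nu> (%x. ennreal (Th (w*x)))"
 using iexp_second_order by (intro nn_integral_mono ennreal_leI)
 finally show ?thesis .
 qed
 have "frac_int q (%u. norm (ps (u*y))) \<le>
 nn_integral lborel (%u. nn_integral \<nu> (%x. indicator {0<..} u*ennreal (Th (u*(y*x))*u powr (- 1 - q))))"
 unfolding frac_int_def
 proof (rule nn_integral_mono)
 fix u :: real
 have "indicator {0<..} u*ennreal (norm (ps (u*y))*u powr (- 1 - q))
 = (indicator {0<..} u*ennreal (u powr (- 1 - q)))*ennreal (norm (ps (u*y)))"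
 by (simp add: ennreal_mult mult_ac)
 also have "... <= (indicator {0<..} u*ennreal (u powr (- 1 - q)))*nn_integral \<nu> (%x. ennreal (Th (u*y*x)))"
 by (intro mult_left_mono nb) simp
 also have "... = nn_integral \<nu> (%x. (indicator {0<..} u*ennreal (u powr (- 1 - q)))*ennreal (Th (u*y*x)))"
 by (rule nn_integral_cmult[symmetric]) measurable
 also have "... = nn_integral \<nu> (%x. indicator {0<..} u*ennreal (Th (u*(y*x))*u powr (- 1 - q)))"
 by (intro nn_integral_cong) (simp add: ennreal_mult Theta_nonneg mult_ac)
 finally show "indicator {0<..} u*ennreal (norm (ps (u*y))*u powr (- 1 - q))
 <= nn_integral \<nu> (%x. indicator {0<..} u*ennreal (Th (u*(y*x))*u powr (- 1 - q)))" .
 qed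
 also have "... = nn_integral \<nu> (%x. nn_integral lborel (%u. indicator {0<..} u*ennreal (Th (u*(y*x))*u powr (- 1 - q))))"
 proof -
 interpret pair_sigma_finite lborel \<nu> ..
 show ?thesis by (rule Fubini'[symmetric]) measurable
 qed
 also have "... = nn_integral \<nu> (%x. (ennreal (abs y powr q)*frac_int q Th)*ennreal (abs x powr q))"
 proof (rule nn_integral_cong)
 fix x
 have "frac_int q (%u. Th (u*(y*x))) = ennreal (abs (y*x) powr q)*frac_int q Th"
 using q by (intro frac_int_scale) (auto simp: Th_def)
 then show "nn_integral lborel (%u. indicator {0<..} u*ennreal (Th (u*(y*x))*u powr (- 1 - q)))
 = (ennreal (abs y powr q)*frac_int q Th)*ennreal (abs x powr q)"
 unfolding frac_int_def by (simp add: abs_mult powr_mult ennreal_mult mult_ac)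
 qed
 also have "... = (ennreal (abs y powr q)*frac_int q Th)*ennreal Mq"
 unfolding nn_moment[symmetric] by (rule nn_integral_cmult) measurable
 finally show ?thesis by (simp add: mult_ac)
qed

lemma integrable_large: "integrable \<nu> (%x. x*indicator (- {-1..1}) x)"
proof (rule bochner_bound[OF integrable_q])
 show "AE x in \<nu>. norm (x*indicator (- {-1..1}) x) <= norm (abs x powr q)"
 proof (rule AE_I2)
 fix x :: real
 show "norm (x*indicator (- {-1..1}) x) <= norm (abs x powr q)"
 proof (cases "abs x <= 1")
 case True then show ?thesis by (simp add: abs_le_iff)
 next
 case False
 then have "abs x powr 1 <= abs x powr q" using q by (intro powr_mono) auto
 then show ?thesis by (simp add: indicator_def)
 qed
 qed
qed measurable

text \<open>The jumps larger than one are integrable, so the truncated compensator differs from the full one by a drift.\<close>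

lemma levy_exponent_eq:
 "levy_exponent b 0 \<nu> u = \<i> * of_real (u*(b + (LINT x|\<nu>. x*indicator (- {-1..1}) x))) + ps u"
proof -
 let ?l = "%x. x*indicator (- {-1..1}) x :: real"
 have "(LINT x|\<nu>. (iexp (u*x) - 1 - \<i> * of_real (u*x)*indicator {-1..1} x))
 = (LINT x|\<nu>. (iexp (u*x) - 1 - \<i> * of_real (u*x)) + (\<i> * of_real u) * of_real (?l x))"
 by (intro bochner_cong refl) (auto simp: indicator_def)
 also have "... = ps u + (\<i> * of_real u) * of_real (LINT x|\<nu>. ?l x)"
 proof -
 have i: "integrable \<nu> (%x. complex_of_real (?l x))" by (rule integrable_of_real[OF integrable_large])
 have "(LINT x|\<nu>. (iexp (u*x) - 1 - \<i> * of_real (u*x)) + (\<i> * of_real u) * of_real (?l x))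
 = (LINT x|\<nu>. (iexp (u*x) - 1 - \<i> * of_real (u*x))) + (LINT x|\<nu>. (\<i> * of_real u) * of_real (?l x))"
 by (rule bochner_add[OF integrable_integrand integrable_mult_right[OF i]])
 also have "(LINT x|\<nu>. (\<i> * of_real u) * of_real (?l x)) = (\<i> * of_real u)*(LINT x|\<nu>. of_real (?l x))"
 by (rule integral_mult_right_zero)
 also have "(LINT x|\<nu>. complex_of_real (?l x)) = of_real (LINT x|\<nu>. ?l x)" by (rule integral_complex_of_real)
 finally show ?thesis by (simp add: ps_def)
 qed
 finally show ?thesis unfolding levy_exponent_def by (simp add: algebra_simps)
qed

text \<open>The exponent is of order \<open>\<bar>u\<bar> powr q\<close> with \<open>q > 1\<close>.\<close>

lemma psi_has_vector_derivative: "(ps has_vector_derivative 0) (at 0)"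
 unfolding has_vector_derivative_def has_derivative_at
proof
 have "((%h. norm (ps h)/abs h) \<longlongrightarrow> 0) (at 0)"
 proof (rule Lim_null_comparison)
 show "\<forall>\<^sub>F h in at 0. norm (norm (ps h)/abs h) <= 2*Mq * abs h powr (q - 1)"
 unfolding eventually_at_filter
 proof (intro always_eventually allI impI)
 fix h :: real assume "h ~= 0"
 have "norm (ps h)/abs h <= 2 * abs h powr q*Mq/abs h" by (intro divide_right_mono psi_bound) simp
 also have "... = 2*Mq * abs h powr (q - 1)" using \<open>h ~= 0\<close> by (simp add: powr_diff)
 finally show "norm (norm (ps h)/abs h) <= 2*Mq * abs h powr (q - 1)" by simp
 qed
 have "((%h::real. abs h powr (q - 1)) \<longlongrightarrow> 0) (at 0)"
 by (rule tendsto_zero_powrI[OF tendsto_rabs_zero[OF tendsto_ident_at] tendsto_const]) (use q in auto)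
 then show "((%h. 2*Mq * abs h powr (q - 1)) \<longlongrightarrow> 0) (at 0)" by (rule tendsto_mult_right_zero)
 qed
 then show "((%h. norm (ps (0 + h) - ps 0 - h *\<^sub>R 0)/norm h) \<longlongrightarrow> 0) (at 0)" by (simp add: psi_0)
qed (rule bounded_linear_scaleR_left)

text \<open>Compare derivatives at zero: that of the characteristic function is \<open>\<i>\<close> times the mean, and
 the exponent \<open>\<psi>\<close> contributes nothing. The derivative of the characteristic function is
 taken along a sequence, where its second-order remainder tends to zero by dominated convergence.\<close>

lemma centred_exponent:
 assumes "prob_space M" and [measurable]: "Z \<in> borel_measurable M" and iZ: "integrable M Z" and EZ: "(LINT y|M. Z y) = 0"
 and char: "!!u. char (distr M borel Z) u = exp (\<i> * of_real (u*b) + ps u)"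
 shows "b = 0"
proof -
 interpret prob_space M by fact
 interpret D: real_distribution "distr M borel Z" by (rule real_distribution_distr) simp
 let ?D = "distr M borel Z"
 let ?G = "%u. exp (\<i>*complex_of_real (u*b) + ps u)"
 define u where "u n = inverse (real (Suc n))" for n
 have u0: "u ----> 0" unfolding u_def[abs_def] by (rule LIMSEQ_inverse_real_of_nat)
 have un0: "u n > 0" for n by (simp add: u_def)
 have uat: "filterlim u (at 0) sequentially"
 unfolding filterlim_at using u0 un0 by (auto intro!: always_eventually simp: less_imp_neq[symmetric])
 have "((%u. \<i>*complex_of_real (u*b) + ps u) has_vector_derivative \<i> * of_real b + 0) (at 0)"
 by (intro has_vector_derivative_add psi_has_vector_derivative) (auto intro!: derivative_eq_intros simp: has_vector_derivative_def fun_eq_iff scaleR_conv_of_real)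
 from field_vector_diff_chain_at[OF this DERIV_exp]
 have "(?G has_vector_derivative \<i> * of_real b) (at 0)" by (simp add: o_def psi_0)
 then have "((%h. norm (?G h - 1 - h *\<^sub>R (\<i> * of_real b))/abs h) \<longlongrightarrow> 0) (at 0)"
 by (simp add: has_vector_derivative_def has_derivative_at psi_0)
 from filterlim_compose[OF this uat]
 have l1: "(%n. norm (?G (u n) - 1 - u n *\<^sub>R (\<i> * of_real b))/u n) ----> 0" using un0 by (simp add: abs_of_pos)
 have "(%n. LINT x|?D. min (4 * abs x) (u n*x\<^sup>2)) ----> (LINT x|?D. 0)"
 proof (rule integral_dominated_convergence[where w="%x. 4 * abs x"])
 show "integrable ?D (%x. 4 * abs x)" using iZ by (simp add: integrable_distr_eq)
 show "AE x in ?D. norm (min (4 * abs x) (u n*x\<^sup>2)) <= 4 * abs x" for n using less_imp_le[OF un0[of n]] by auto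
 have "(%n. min (4 * abs x) (u n*x\<^sup>2)) ----> min (4 * abs x) (0*x\<^sup>2)" for x by (intro tendsto_intros u0)
 then show "AE x in ?D. (%n. min (4 * abs x) (u n*x\<^sup>2)) ----> 0" by simp
 qed auto
 then have l2: "(%n. LINT x|?D. min (4 * abs x) (u n*x\<^sup>2)) ----> 0" by simp
 have "abs b <= norm (?G (u n) - 1 - u n *\<^sub>R (\<i> * of_real b))/u n + (LINT x|?D. min (4 * abs x) (u n*x\<^sup>2))" for n
 proof -
 have i: "integrable ?D (%x. x ^ k)" if "k <= 1" for k using that iZ by (cases k) (auto simp: integrable_distr_eq)
 have "(\<Sum>k\<le>1. ((\<i>*u n)^k/fact k)*D.expectation (%x. x^k)) = 1"
 using EZ D.prob_space by (simp add: integral_distr prob_space)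
 with D.char_approx2[of 1 "u n", OF i] un0[of n]
 have "norm (?G (u n) - 1) <= u n/2*(LINT x|?D. min (4 * abs x) (u n*x\<^sup>2))" by (simp add: char power2_eq_square)
 also have "... <= u n*(LINT x|?D. min (4 * abs x) (u n*x\<^sup>2))"
 using less_imp_le[OF un0[of n]] by (intro mult_right_mono bochner_nonneg) auto
 finally have "norm (?G (u n) - 1)/u n <= (LINT x|?D. min (4 * abs x) (u n*x\<^sup>2))" using un0[of n] by (simp only: pos_divide_le_eq mult.commute)
 moreover have "norm (u n *\<^sub>R (\<i>*complex_of_real b)) <= norm (?G (u n) - 1) + norm (?G (u n) - 1 - u n *\<^sub>R (\<i> * of_real b))"
 using norm_triangle_ineq4[of "?G (u n) - 1" "?G (u n) - 1 - u n *\<^sub>R (\<i> * of_real b)"] by simp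
 then have "norm (u n *\<^sub>R (\<i>*complex_of_real b))/u n <= (norm (?G (u n) - 1) + norm (?G (u n) - 1 - u n *\<^sub>R (\<i> * of_real b)))/u n"
 using un0[of n] by (intro divide_right_mono) auto
 ultimately show ?thesis using un0[of n] by (simp add: norm_mult add_divide_distrib)
 qed
 then have "abs b <= 0" using tendsto_add_zero[OF l1 l2] by (intro LIMSEQ_le_const) auto
 then show ?thesis by simp
qed

end

section \<open>Convergence in probability and the law of the increments\<close>

context prob_space begin

text \<open>The usual metric for convergence in probability. Working with it replaces tail estimates by the triangle
 inequality.\<close>

definition trunc_norm :: "('a => real) => real" where
 "trunc_norm Z = (LINT w|M. min 1 (abs (Z w)))"

lemma trunc_integrable:
 fixes Z :: "'a => real"
 assumes [measurable]: "Z \<in> borel_measurable M"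
 shows "integrable M (%w. min 1 (abs (Z w)))"
 by (rule integrable_const_bound[where B=1]) auto

lemma trunc_norm_nonneg: "0 <= trunc_norm Z"
 unfolding trunc_norm_def by (rule integral_nonneg_AE) auto

lemma trunc_norm_cong_AE:
 assumes "Z \<in> borel_measurable M" "W \<in> borel_measurable M" "AE w in M. Z w = W w"
 shows "trunc_norm Z = trunc_norm W"
 unfolding trunc_norm_def using assms by (intro integral_cong_AE) auto

lemma trunc_norm_add:
 assumes [measurable]: "Z \<in> borel_measurable M" "W \<in> borel_measurable M"
 shows "trunc_norm (%w. Z w + W w) <= trunc_norm Z + trunc_norm W"
proof -
 have "trunc_norm (%w. Z w + W w) <= (LINT w|M. min 1 (abs (Z w)) + min 1 (abs (W w)))"
 unfolding trunc_norm_def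
 by (intro integral_mono bochner_int_add trunc_integrable) auto
 also have "... = trunc_norm Z + trunc_norm W"
 unfolding trunc_norm_def by (intro bochner_add trunc_integrable) auto
 finally show ?thesis .
qed

lemma trunc_norm_uminus: "trunc_norm (%w. - Z w) = trunc_norm Z"
 by (simp add: trunc_norm_def)

lemma trunc_norm_diff:
 assumes "Z \<in> borel_measurable M" "W \<in> borel_measurable M"
 shows "trunc_norm (%w. Z w - W w) <= trunc_norm Z + trunc_norm W"
 using trunc_norm_add[of Z "%w. - W w"] assms by (simp add: trunc_norm_uminus)

lemma trunc_norm_le_tail:
 assumes [measurable]: "Z \<in> borel_measurable M" and "0 <= e"
 shows "trunc_norm Z <= e + prob {w \<in> space M. abs (Z w) > e}"
proof -
 have ii: "integrable M (indicator {w \<in> space M. abs (Z w) > e} :: _ => real)"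
 by (rule integrable_const_bound[where B=1]) auto
 have "trunc_norm Z <= (LINT w|M. e + indicator {w \<in> space M. abs (Z w) > e} w)"
 unfolding trunc_norm_def using assms(2)
 by (intro integral_mono trunc_integrable bochner_int_add ii) (auto simp: indicator_def min_def)
 also have "... = e + prob {w \<in> space M. abs (Z w) > e}"
 by (subst bochner_add[OF _ ii]) (auto simp: prob_space)
 finally show ?thesis .
qed

lemma tail_le_trunc_norm:
 assumes [measurable]: "Z \<in> borel_measurable M" and e: "0 < e" "e <= 1"
 shows "prob {w \<in> space M. abs (Z w) > e} <= trunc_norm Z/e"
proof -
 have ii: "integrable M (indicator {w \<in> space M. abs (Z w) > e} :: _ => real)"
 by (rule integrable_const_bound[where B=1]) auto
 have "e*prob {w \<in> space M. abs (Z w) > e} = (LINT w|M. e*indicator {w \<in> space M. abs (Z w) > e} w)"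
 by simp
 also have "... <= trunc_norm Z"
 unfolding trunc_norm_def using e
 by (intro integral_mono trunc_integrable integrable_mult_right ii) (auto simp: indicator_def min_def)
 finally show ?thesis using e by (simp add: field_simps)
qed

lemma trunc_norm_tendsto_0:
 assumes "!!n. Z n \<in> borel_measurable M"
 and "!!e. 0 < e ==> (%n. prob {w \<in> space M. abs (Z n w) > e}) ----> 0"
 shows "(%n. trunc_norm (Z n)) ----> 0"
proof (rule LIMSEQ_I)
 fix r :: real assume r: "0 < r"
 have "\<forall>\<^sub>F n in sequentially. prob {w \<in> space M. abs (Z n w) > r/2} < r/2"
 using order_tendstoD(2)[OF assms(2)[of "r/2"], of "r/2"] r by simp
 then have "\<forall>\<^sub>F n in sequentially. norm (trunc_norm (Z n) - 0) < r"
 proof eventually_elim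
 case (elim n)
 then show ?case using trunc_norm_le_tail[OF assms(1)[of n], of "r/2"] trunc_norm_nonneg[of "Z n"] r by simp
 qed
 then show "\<exists>no. \<forall>n\<ge>no. norm (trunc_norm (Z n) - 0) < r" by (simp add: eventually_sequentially)
qed

lemma tendsto_in_prob_trunc_norm:
 assumes "tendsto_in_prob M Z W"
 shows "(%n. trunc_norm (%w. Z n w - W w)) ----> 0"
proof (rule trunc_norm_tendsto_0)
 have [measurable]: "!!n. Z n \<in> borel_measurable M" "W \<in> borel_measurable M" using assms unfolding tendsto_in_prob_def by auto
 show "(%w. Z n w - W w) \<in> borel_measurable M" for n by measurable
qed (use assms in \<open>auto simp: tendsto_in_prob_def\<close>)

lemma trunc_norm_moment:
 assumes [measurable]: "Z \<in> borel_measurable M" and "0 < e" "1 <= q" "0 <= B"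
 and "abs_moment M q Z <= ennreal B"
 shows "trunc_norm Z <= e + B*e powr (1 - q)"
proof -
 have fin: "abs_moment M q Z < \<infinity>" using assms(5) by (rule le_less_trans) simp
 have i: "integrable M (%w. abs (Z w) powr q)" using fin by (intro integrableI_nonneg) auto
 have iB: "(LINT w|M. abs (Z w) powr q) <= B"
 proof -
 have "ennreal (LINT w|M. abs (Z w) powr q) <= ennreal B"
 using nn_integral_eq_integral[OF i] assms(5) by simp
 then show ?thesis using assms(4) by (simp add: ennreal_le_iff)
 qed
 have "min 1 (abs z) <= e + e powr (1 - q) * abs z powr q" for z :: real
 proof (cases "abs z <= e")
 case True
 have "0 <= e powr (1 - q) * abs z powr q" by simp
 then show ?thesis using True by linarith
 next
 case False
 have "abs z = abs z powr (1 - q) * abs z powr q" using False assms(2) by (simp add: powr_add[symmetric])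
 also have "... <= e powr (1 - q) * abs z powr q" using False assms(2,3) by (intro mult_right_mono powr_mono2') auto
 finally show ?thesis using assms(2) by linarith
 qed
 then have "trunc_norm Z <= (LINT w|M. e + e powr (1 - q) * abs (Z w) powr q)"
 unfolding trunc_norm_def using i by (intro integral_mono trunc_integrable) auto
 also have "... = e + e powr (1 - q)*(LINT w|M. abs (Z w) powr q)"
 using i by (simp add: prob_space)
 also have "... <= e + e powr (1 - q)*B" using iB by (intro add_left_mono mult_left_mono) auto
 finally show ?thesis by (simp add: mult.commute)
qed

lemma trunc_norm_tendsto_0_moment:
 assumes "!!n. Z n \<in> borel_measurable M" "1 <= q" "!!n. 0 <= B n" "B ----> 0"
 and "!!n. abs_moment M q (Z n) <= ennreal (B n)"
 shows "(%n. trunc_norm (Z n)) ----> 0"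
proof (rule LIMSEQ_I)
 fix r :: real assume r: "0 < r"
 have "(%n. r/2 + B n*(r/2) powr (1 - q)) ----> r/2 + 0*(r/2) powr (1 - q)"
 by (intro tendsto_intros assms)
 then have "\<forall>\<^sub>F n in sequentially. r/2 + B n*(r/2) powr (1 - q) < r" by (rule order_tendstoD(2)) (use r in simp)
 then have "\<forall>\<^sub>F n in sequentially. norm (trunc_norm (Z n) - 0) < r"
 proof eventually_elim
 case (elim n)
 then show ?case using trunc_norm_moment[OF assms(1)[of n] _ assms(2) assms(3)[of n] assms(5)[of n], of "r/2"] trunc_norm_nonneg[of "Z n"] r by simp
 qed
 then show "\<exists>no. \<forall>n\<ge>no. norm (trunc_norm (Z n) - 0) < r" by (simp add: eventually_sequentially)
qed

lemma expectation_diff_le_trunc_norm: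
 fixes g :: "real => 'c :: {banach, second_countable_topology}"
 assumes [measurable]: "Z \<in> borel_measurable M" "W \<in> borel_measurable M" "g \<in> borel_measurable borel"
 and g: "!!u v. norm (g u - g v) <= C*min 1 (abs (u - v))" and b: "!!u. norm (g u) <= D"
 shows "norm ((LINT w|M. g (Z w)) - (LINT w|M. g (W w))) <= C*trunc_norm (%w. Z w - W w)"
proof -
 have i: "integrable M (%w. g (Z w))" "integrable M (%w. g (W w))"
 by (rule integrable_const_bound[where B=D]; use b in auto)+
 have "norm (LINT w|M. g (Z w) - g (W w)) <= (LINT w|M. norm (g (Z w) - g (W w)))" by (rule integral_norm_bound)
 also have "... <= (LINT w|M. C*min 1 (abs (Z w - W w)))"
 using g by (intro integral_mono integrable_norm bochner_int_diff i integrable_mult_right trunc_integrable) auto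
 finally show ?thesis using i by (simp add: trunc_norm_def)
qed

lemma norm_iexp_diff: "norm (iexp (u*x) - iexp (u*y)) <= (2 + abs u)*min 1 (abs (x - y))"
proof -
 have "iexp (u*x) - iexp (u*y) = iexp (u*y)*(iexp (u*(x - y)) - 1)"
 by (simp add: right_diff_distrib exp_add[symmetric] algebra_simps)
 then have e: "norm (iexp (u*x) - iexp (u*y)) = norm (iexp (u*(x - y)) - 1)" by (simp add: norm_mult)
 have "norm (iexp (u*(x - y)) - 1) <= norm (iexp (u*(x - y))) + norm (1 :: complex)" by (rule norm_triangle_ineq4)
 moreover have "norm (exp (\<i>*complex_of_real (u*(x - y))) - 1) <= norm (\<i>*complex_of_real (u*(x - y)))"
 by (rule norm_exp_minus_1_le) simp
 ultimately have "norm (iexp (u*x) - iexp (u*y)) <= 2" "norm (iexp (u*x) - iexp (u*y)) <= abs u * abs (x - y)"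
 unfolding e by (auto simp only: norm_mult abs_mult norm_ii norm_of_real norm_one norm_exp_i_times mult_1)
 moreover have "abs u * abs (x - y) <= (2 + abs u) * abs (x - y)" by (intro mult_right_mono) auto
 ultimately show ?thesis by (auto simp: min_def)
qed

lemma char_diff_le_trunc_norm:
 assumes [measurable]: "Z \<in> borel_measurable M" "W \<in> borel_measurable M"
 shows "norm (char (distr M borel Z) u - char (distr M borel W) u) <= (2 + abs u)*trunc_norm (%w. Z w - W w)"
proof -
 have "char (distr M borel Z) u = (LINT w|M. iexp (u*Z w))" if [measurable]: "Z \<in> borel_measurable M" for Z
 unfolding char_def by (rule integral_distr) auto
 then show ?thesis
 using expectation_diff_le_trunc_norm[of Z W "%x. iexp (u*x)" "2 + abs u" 1, OF _ _ _ norm_iexp_diff] by simp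
qed

lemma char_tendsto:
 assumes "!!n. Z n \<in> borel_measurable M" "W \<in> borel_measurable M" "(%n. trunc_norm (%w. Z n w - W w)) ----> 0"
 shows "(%n. char (distr M borel (Z n)) u) ----> char (distr M borel W) u"
proof (rule Lim_transform2[OF tendsto_const])
 show "(%n. char (distr M borel W) u - char (distr M borel (Z n)) u) ----> 0"
 proof (rule Lim_null_comparison)
 show "\<forall>\<^sub>F n in sequentially. norm (char (distr M borel W) u - char (distr M borel (Z n)) u) <= (2 + abs u)*trunc_norm (%w. Z n w - W w)"
 using char_diff_le_trunc_norm[OF assms(1) assms(2)] by (simp add: norm_minus_commute)
 show "(%n. (2 + abs u)*trunc_norm (%w. Z n w - W w)) ----> 0"
 using tendsto_mult_right_zero[OF assms(3)] by simp
 qed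
qed

lemma trunc_norm_tendsto_0_AE:
 assumes "!!n. Z n \<in> borel_measurable M" "W \<in> borel_measurable M" "AE w in M. (%n. Z n w) ----> W w"
 shows "(%n. trunc_norm (%w. Z n w - W w)) ----> 0"
proof -
 have "(%n. trunc_norm (%w. Z n w - W w)) ----> (LINT w|M. 0)"
 unfolding trunc_norm_def
 proof (rule integral_dominated_convergence[where w="%_. 1"])
 show "AE w in M. (%n. min 1 (abs (Z n w - W w))) ----> 0"
 using assms(3)
 proof eventually_elim
 case (elim w)
 have "(%n. min 1 (abs (Z n w - W w))) ----> min 1 (abs (W w - W w))" by (intro tendsto_intros elim)
 then show ?case by simp
 qed
 qed (use assms in auto)
 then show ?thesis by simp
qed

end

text \<open>The Levy process enters through its exponent and a bound for the fractional integral of the exponent. The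
 constant in that bound is all that is left of the jump measure.\<close>

locale levy_noise = prob_space M for M :: "'a measure" +
 fixes L :: "real => 'a => real" and ps :: "real => complex" and q Kps :: real
 assumes levy: "two_sided_levy_process M L"
 and char_1: "char (distr M borel (L 1)) u = exp (ps u)"
 and psi_cont: "continuous_on UNIV ps" and psi_0: "ps 0 = 0"
 and q: "1 < q" "q < 2" and Kps: "0 <= Kps"
 and frac_psi: "frac_int q (%u. norm (ps (u*y))) <= ennreal (Kps * abs y powr q)"
begin

lemma L_measurable [measurable]: "L t \<in> borel_measurable M"
 using levy by (simp add: two_sided_levy_process_def)

lemma psi_measurable [measurable]: "ps \<in> borel_measurable borel"
 by (rule borel_measurable_continuous_onI[OF psi_cont])

lemma Re_psi: "Re (ps u) <= 0"
proof -
 interpret D: real_distribution "distr M borel (L 1)" by (rule real_distribution_distr) simp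
 have "norm (exp (ps u)) <= 1" using D.cmod_char_le_1[of u] by (simp add: char_1)
 then show ?thesis by (simp add: norm_exp_eq_Re)
qed

abbreviation incr_char :: "real => real => complex" where
 "incr_char h \<equiv> char (distr M borel (%w. L h w - L 0 w))"

lemma incr_stationary:
 "s <= t ==> distr M borel (%w. L t w - L s w) = distr M borel (%w. L (t - s) w - L 0 w)"
proof -
 assume st: "s <= t"
 have H: "\<forall>s t h. s <= t --> distr M borel (%w. L (t + h) w - L (s + h) w) = distr M borel (%w. L t w - L s w)"
 using levy unfolding two_sided_levy_process_def by simp
 have "distr M borel (%w. L ((t - s) + s) w - L (0 + s) w) = distr M borel (%w. L (t - s) w - L 0 w)"
 using H[rule_format, of 0 "t - s" s] st by simp
 then show ?thesis by simp
qed

lemma incr_char_mult: "0 < h ==> incr_char (real n*h) u = incr_char h u ^ n"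
proof -
 assume h: "0 < h"
 define t where "t i = real i*h" for i
 have "strict_mono t" using h by (auto simp: strict_mono_def t_def)
 then have iv: "indep_vars (%_. borel) (%i w. L (t (Suc i)) w - L (t i) w) {..<n}"
 using levy unfolding two_sided_levy_process_def by blast
 have "(%w. \<Sum>i<n. L (t (Suc i)) w - L (t i) w) = (%w. L (real n*h) w - L 0 w)"
 using sum_lessThan_telescope[of "%i. L (t i) _" n] by (simp add: t_def del: of_nat_Suc)
 moreover have "distr M borel (%w. L (t (Suc i)) w - L (t i) w) = distr M borel (%w. L h w - L 0 w)" for i
 using incr_stationary[of "t i" "t (Suc i)"] h by (simp add: t_def algebra_simps)
 ultimately show ?thesis using char_distr_sum[OF iv, of u] by simp
qed

lemma incr_char_1: "incr_char 1 u = exp (ps u)"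
proof -
 have "AE w in M. L 0 w = 0" using levy by (simp add: two_sided_levy_process_def)
 then have "distr M borel (%w. L 1 w - L 0 w) = distr M borel (L 1)" by (intro distr_cong_AE) auto
 then show ?thesis by (simp add: char_1)
qed

text \<open>An \<open>m\<close>-th root of \<open>exp (\<psi> u)\<close> is determined up to a root of unity. Both
 candidates are continuous in \<open>u\<close> and agree at zero, so the quotient is a continuous function
 into a finite set.\<close>

lemma incr_char_root:
 assumes "0 < m" shows "incr_char (1/real m) u = exp (ps u/of_nat m)"
proof -
 interpret D: real_distribution "distr M borel (%w. L (1/real m) w - L 0 w)" by (rule real_distribution_distr) simp
 define r where "r u = incr_char (1/real m) u*exp (- (ps u/of_nat m))" for u
 have c: "continuous_on UNIV r"
 unfolding r_def using assms
 by (intro continuous_intros psi_cont continuous_at_imp_continuous_on ballI D.isCont_char) auto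
 have rm: "r u ^ m = 1" for u
 proof -
 have "incr_char (1/real m) u ^ m = exp (ps u)"
 using incr_char_mult[of "1/real m" m u] assms incr_char_1[of u] by simp
 moreover have "exp (- (ps u/of_nat m)) ^ m = exp (- ps u)"
 using assms by (simp add: exp_of_nat_mult[symmetric])
 ultimately show ?thesis by (simp add: r_def power_mult_distrib exp_add[symmetric])
 qed
 have "finite (range r)"
 by (rule finite_subset[OF _ finite_roots_unity[of m]]) (use rm assms in auto)
 then have "r constant_on UNIV" using c by (intro continuous_finite_range_constant) auto
 then have "r u = r 0" by (auto simp: constant_on_def)
 also have "r 0 = 1" using D.char_zero by (simp add: r_def psi_0)
 finally show ?thesis by (simp add: r_def exp_minus field_simps)
qed

text \<open>Rational times follow from roots and powers; the general case by stochastic continuity.\<close>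

lemma incr_char: assumes "0 <= h" shows "incr_char h u = exp (of_real h*ps u)"
proof -
 define r where "r k = real (nat \<lfloor>h*real (Suc k)\<rfloor>)/real (Suc k)" for k
 have rh: "abs (r k - h) <= 1/real (Suc k)" for k
 proof -
 have "real (nat \<lfloor>h*real (Suc k)\<rfloor>) = real_of_int \<lfloor>h*real (Suc k)\<rfloor>" using assms by (intro of_nat_nat) (simp add: zero_le_floor)
 then have "abs (real (nat \<lfloor>h*real (Suc k)\<rfloor>) - h*real (Suc k)) <= 1" by linarith
 moreover have "r k - h = (real (nat \<lfloor>h*real (Suc k)\<rfloor>) - h*real (Suc k))/real (Suc k)"
 unfolding r_def by (simp add: diff_divide_distrib del: of_nat_Suc)
 ultimately show ?thesis by (simp add: abs_divide divide_right_mono del: of_nat_Suc)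
 qed
 have r_lim: "r ----> h"
 proof (rule Lim_transform2[OF tendsto_const], rule Lim_null_comparison)
 show "\<forall>\<^sub>F k in sequentially. norm (h - r k) <= 1/real (Suc k)" using rh by (simp add: abs_minus_commute)
 show "(%k. 1/real (Suc k)) ----> 0" by (rule LIMSEQ_Suc[OF lim_1_over_n])
 qed
 have rc: "incr_char (r k) u = exp (of_real (r k)*ps u)" for k
 proof -
 have "incr_char (r k) u = incr_char (1/real (Suc k)) u ^ nat \<lfloor>h*real (Suc k)\<rfloor>"
 using incr_char_mult[of "1/real (Suc k)" "nat \<lfloor>h*real (Suc k)\<rfloor>" u] by (simp add: r_def del: of_nat_Suc)
 also have "... = exp (ps u/of_nat (Suc k)) ^ nat \<lfloor>h*real (Suc k)\<rfloor>"
 by (subst incr_char_root) auto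
 also have "... = exp (of_nat (nat \<lfloor>h*real (Suc k)\<rfloor>)*(ps u/of_nat (Suc k)))" by (rule exp_of_nat_mult[symmetric])
 also have "... = exp (of_real (r k)*ps u)" by (simp add: r_def del: of_nat_Suc)
 finally show ?thesis .
 qed
 have cont: "((%s. prob {w \<in> space M. abs (L s w - L h w) > e}) \<longlongrightarrow> 0) (at h)" if "0 < e" for e
 using levy that unfolding two_sided_levy_process_def by blast
 have "(%k. trunc_norm (%w. (L (r k) w - L 0 w) - (L h w - L 0 w))) ----> 0"
 proof (rule trunc_norm_tendsto_0)
 fix e :: real assume e: "0 < e"
 have "isCont (%s. prob {w \<in> space M. abs (L s w - L h w) > e}) h" using cont[OF e] e by (simp add: isCont_def)
 from isCont_tendsto_compose[OF this r_lim] e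
 show "(%n. prob {w \<in> space M. e < abs (L (r n) w - L 0 w - (L h w - L 0 w))}) ----> 0" by simp
 qed simp
 then have "(%k. incr_char (r k) u) ----> incr_char h u" by (intro char_tendsto) auto
 moreover have "(%k. exp (of_real (r k)*ps u)) ----> exp (of_real h*ps u)" by (intro tendsto_intros r_lim)
 ultimately show ?thesis unfolding rc by (rule LIMSEQ_unique)
qed

end

section \<open>The random measure of a Levy process\<close>

lemma bounded_borel_subset: "A \<in> bounded_borel ==> B \<in> sets borel ==> B \<subseteq> A ==> B \<in> bounded_borel"
 by (auto simp: bounded_borel_def intro: bounded_subset)

lemma bounded_borel_UN: "finite I ==> (!!i. i \<in> I ==> A i \<in> bounded_borel) ==> (\<Union>i\<in>I. A i) \<in> bounded_borel"
 by (auto simp: bounded_borel_def)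

lemma empty_bounded_borel: "{} \<in> bounded_borel"
 by (simp add: bounded_borel_def)

lemma Ioc_bounded_borel: "{a<..b} \<in> bounded_borel"
 by (simp add: bounded_borel_def bounded_Ioc)

lemma bounded_borel_emeasure: "A \<in> bounded_borel ==> emeasure lborel A < \<infinity>"
 using emeasure_bounded_finite[of A] by (simp add: bounded_borel_def)

lemma bounded_borel_Ioc: "A \<in> bounded_borel ==> \<exists>R>0. A \<subseteq> {-R<..R}"
proof -
 assume "A \<in> bounded_borel"
 then obtain b where b: "!!x. x \<in> A ==> abs x <= b" by (auto simp: bounded_borel_def bounded_iff)
 show ?thesis
 by (rule exI[of _ "abs b + 1"]) (use b in \<open>force simp: abs_le_iff\<close>)
qed

text \<open>The class in question is a Dynkin system inside each interval, and the half-open intervals generate the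
 Borel sets.\<close>

lemma bounded_borel_induct [consumes 1, case_names interval diff union]:
 assumes A: "A \<in> bounded_borel"
 and interval: "!!a b. a <= b ==> P {a<..b}"
 and diff: "!!A B. A \<in> bounded_borel ==> B \<in> bounded_borel ==> A \<subseteq> B ==> P A ==> P B ==> P (B - A)"
 and union: "!!A :: nat => real set. disjoint_family A ==> (!!i. A i \<in> bounded_borel) ==> (\<Union>i. A i) \<in> bounded_borel ==> (!!i. P (A i)) ==> P (\<Union>i. A i)"
 shows "P A"
proof -
 obtain R where R: "0 < R" "A \<subseteq> {-R<..R}" using bounded_borel_Ioc[OF A] by auto
 let ?J = "{-R<..R}"
 have bb: "B \<inter> ?J \<in> bounded_borel" if "B \<in> sets borel" for B
 by (rule bounded_borel_subset[OF Ioc_bounded_borel[of "-R" R]]) (use that in auto)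
 have bs: "sets borel = sigma_sets UNIV (range (%(a, b). {a<..b::real}))"
 by (subst borel_sigma_sets_Ioc) (simp add: sets_measure_of)
 have "Int_stable (range (%(a, b). {a<..b::real}))" by (auto simp: Int_stable_def)
 moreover have "A \<in> sigma_sets UNIV (range (%(a, b). {a<..b::real}))" using A by (simp add: bounded_borel_def bs)
 ultimately have "P (A \<inter> ?J)"
 proof (rule_tac sigma_sets_induct_disjoint[where P="%A. P (A \<inter> ?J)" and \<Omega>=UNIV and G="range (%(a, b). {a<..b::real})"])
 fix B assume "B \<in> range (%(a, b). {a<..b::real})"
 then obtain a b where B: "B = {a<..b}" by auto
 show "P (B \<inter> ?J)"
 proof (cases "max a (-R) <= min b R")
 case True
 have "B \<inter> ?J = {max a (-R)<..min b R}" by (auto simp: B)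
 then show ?thesis using interval[OF True] by simp
 next
 case False
 then have "B \<inter> ?J = {0<..0}" by (auto simp: B)
 then show ?thesis using interval[of 0 0] by simp
 qed
 next
 show "P ({} \<inter> ?J)" using interval[of 0 0] by simp
 next
 fix B assume "B \<in> sigma_sets UNIV (range (%(a, b). {a<..b::real}))" and IH: "P (B \<inter> ?J)"
 then have "P (?J - B \<inter> ?J)" using R interval[of "-R" R] by (intro diff bb Ioc_bounded_borel) (auto simp: bs)
 moreover have "?J - B \<inter> ?J = (UNIV - B) \<inter> ?J" by auto
 ultimately show "P ((UNIV - B) \<inter> ?J)" by simp
 next
 fix B :: "nat => real set"
 assume d: "disjoint_family B" and B: "range B \<subseteq> sigma_sets UNIV (range (%(a, b). {a<..b::real}))" and IH: "!!i. P (B i \<inter> ?J)"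
 have "(\<Union>i. B i) \<in> sets borel" using B by (intro sets.countable_UN) (auto simp: bs)
 then have U: "(\<Union>i. B i) \<inter> ?J \<in> bounded_borel" by (rule bb)
 have "P (\<Union>i. B i \<inter> ?J)"
 by (rule union[OF _ bb _ IH]) (use d B U in \<open>auto simp: bs disjoint_family_on_def\<close>)
 then show "P ((\<Union>i. B i) \<inter> ?J)" by simp
 qed auto
 moreover have "A \<inter> ?J = A" using R by auto
 ultimately show ?thesis by simp
qed

text \<open>Independence is stated for sequences of sets; finite families are obtained by reindexing.\<close>

lemma (in prob_space) indep_vars_inj:
 assumes h: "inj_on h I" and ind: "indep_vars (%_. N) X (h ` I)"
 shows "indep_vars (%_. N) (%i. X (h i)) I"
 unfolding indep_vars_def2
proof (intro conjI ballI)
 show "random_variable N (X (h i))" if "i \<in> I" for i using ind that by (simp add: indep_vars_def2)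
 have I: "indep_sets (%i. {X i -` A \<inter> space M |A. A \<in> sets N}) (h ` I)" using ind by (simp add: indep_vars_def2)
 show "indep_sets (%i. {X (h i) -` A \<inter> space M |A. A \<in> sets N}) I"
 proof (rule indep_setsI)
 show "{X (h i) -` A \<inter> space M |A. A \<in> sets N} \<subseteq> events" if "i \<in> I" for i
 using I that by (auto simp: indep_sets_def)
 fix A J assume J: "J ~= {}" "J \<subseteq> I" "finite J" and A: "\<forall>j\<in>J. A j \<in> {X (h j) -` A \<inter> space M |A. A \<in> sets N}"
 have hJ: "inj_on h J" using h J(2) by (rule inj_on_subset)
 have inv: "inv_into J h (h j) = j" if "j \<in> J" for j using hJ that by simp
 have "prob (\<Inter>k\<in>h ` J. A (inv_into J h k)) = (\<Prod>k\<in>h ` J. prob (A (inv_into J h k)))"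
 by (rule indep_setsD[OF I]) (use J A inv in auto)
 then show "prob (\<Inter> (A ` J)) = (\<Prod>j\<in>J. prob (A j))"
 using inv by (simp add: prod.reindex[OF hJ])
 qed
qed

text \<open>The definition of the integral allows any random measure that extends the increments. Fixing one is harmless
 by \<open>Lam_unique\<close>.\<close>

locale levy_noise_measure = levy_noise +
 fixes La :: "real set => 'a => real"
 assumes Lam: "levy_random_measure M L La"
begin

lemma Lam_measurable [measurable]: "A \<in> bounded_borel ==> La A \<in> borel_measurable M"
 using Lam by (simp add: levy_random_measure_def independently_scattered_def)

lemma Lam_Ioc: "s <= t ==> AE w in M. La {s<..t} w = L t w - L s w"
 using Lam by (simp add: levy_random_measure_def)

lemma Lam_empty: "AE w in M. La {} w = 0"
 using Lam_Ioc[of 0 0] by simp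

lemma Lam_sums:
 fixes A :: "nat => real set"
 assumes "!!i. A i \<in> bounded_borel" "disjoint_family A" "(\<Union>i. A i) \<in> bounded_borel"
 shows "AE w in M. (%n. La (A n) w) sums La (\<Union>n. A n) w"
 using Lam assms unfolding levy_random_measure_def independently_scattered_def by blast

lemma Lam_indep_nat:
 fixes A :: "nat => real set"
 assumes "!!i. A i \<in> bounded_borel" "disjoint_family A"
 shows "indep_vars (%_. borel) (%n. La (A n)) UNIV"
 using Lam assms unfolding levy_random_measure_def independently_scattered_def by blast

lemma Lam_indep:
 assumes "finite I" and A: "!!i. i \<in> I ==> A i \<in> bounded_borel" and d: "disjoint_family_on A I"
 shows "indep_vars (%_. borel) (%i. La (A i)) I"
proof -
 obtain h :: "'b => nat" and n where h: "inj_on h I" "h ` I = {i. i < n}"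
 using finite_imp_inj_to_nat_seg[OF \<open>finite I\<close>] by metis
 define A' where "A' k = (if k < n then A (inv_into I h k) else {})" for k
 have inI: "inv_into I h k \<in> I" if "k < n" for k using h(2) that by (intro inv_into_into) auto
 have A'h: "A' (h i) = A i" if "i \<in> I" for i
 using h that by (auto simp: A'_def)
 have "disjoint_family A'"
 unfolding disjoint_family_on_def
 proof (intro ballI impI)
 fix m k :: nat assume mk: "m ~= k"
 show "A' m \<inter> A' k = {}"
 proof (cases "m < n & k < n")
 case True
 then have "inv_into I h m ~= inv_into I h k" using mk h(2) by (metis f_inv_into_f mem_Collect_eq)
 then show ?thesis using d inI True by (auto simp: A'_def disjoint_family_on_def)
 qed (auto simp: A'_def)
 qed
 moreover have "A' k \<in> bounded_borel" for k using A inI by (auto simp: A'_def empty_bounded_borel)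
 ultimately have "indep_vars (%_. borel) (%n. La (A' n)) UNIV" by (rule Lam_indep_nat[rotated])
 then have "indep_vars (%_. borel) (%n. La (A' n)) (h ` I)" by (rule indep_vars_subset) simp
 from indep_vars_inj[OF h(1) this] have "indep_vars (%_. borel) (%i. La (A' (h i))) I" by (simp add: comp_def)
 then show ?thesis by (rule indep_vars_cong[THEN iffD1, rotated -1]) (auto simp: A'h)
qed

lemma Lam_Un:
 assumes AB: "A \<in> bounded_borel" "B \<in> bounded_borel" "A \<inter> B = {}"
 shows "AE w in M. La (A \<union> B) w = La A w + La B w"
proof -
 define A' :: "nat => real set" where "A' k = (if k = 0 then A else if k = 1 then B else {})" for k
 have U: "(\<Union>k. A' k) = A \<union> B" by (auto simp: A'_def split: if_splits)
 have "AE w in M. (%n. La (A' n) w) sums La (\<Union>n. A' n) w"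
 proof (rule Lam_sums)
 show "disjoint_family A'" using AB(3) by (auto simp: disjoint_family_on_def A'_def)
 show "\<Union> (range A') \<in> bounded_borel" unfolding U using AB by (auto simp: bounded_borel_def)
 qed (use AB empty_bounded_borel in \<open>auto simp: A'_def\<close>)
 with Lam_empty show ?thesis
 proof eventually_elim
 case (elim w)
 have "(%n. La (A' n) w) sums (\<Sum>n\<in>{0,1}. La (A' n) w)"
 using elim(1) by (intro sums_finite) (auto simp: A'_def)
 then show ?case using sums_unique2[OF elim(2)] by (simp add: U) (simp add: A'_def)
 qed
qed

lemma Lam_UN:
 assumes "finite I" "!!i. i \<in> I ==> A i \<in> bounded_borel" "disjoint_family_on A I"
 shows "AE w in M. La (\<Union>i\<in>I. A i) w = (\<Sum>i\<in>I. La (A i) w)"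
 using assms
proof (induction I rule: finite_induct)
 case empty then show ?case using Lam_empty by simp
next
 case (insert i I)
 have "AE w in M. La (A i \<union> (\<Union>i\<in>I. A i)) w = La (A i) w + La (\<Union>i\<in>I. A i) w"
 using insert by (intro Lam_Un bounded_borel_UN) (auto simp: disjoint_family_on_def)
 moreover have "AE w in M. La (\<Union>i\<in>I. A i) w = (\<Sum>i\<in>I. La (A i) w)"
 using insert by (intro insert.IH) (auto simp: disjoint_family_on_def)
 ultimately show ?case by eventually_elim (use insert in simp)
qed

lemma char_Lam_Un:
 assumes "A \<in> bounded_borel" "B \<in> bounded_borel" "A \<inter> B = {}"
 shows "char (distr M borel (La (A \<union> B))) u = char (distr M borel (La A)) u*char (distr M borel (La B)) u"
proof -
 have AB: "A \<union> B \<in> bounded_borel" using assms by (auto simp: bounded_borel_def)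
 define A' where "A' i = (if i then A else B)" for i
 have "indep_vars (%_. borel) (%i. La (A' i)) UNIV"
 using assms by (intro Lam_indep) (auto simp: A'_def disjoint_family_on_def)
 from char_distr_sum[OF this, of u]
 have "char (distr M borel (%w. La A w + La B w)) u = char (distr M borel (La A)) u*char (distr M borel (La B)) u"
 by (simp add: UNIV_bool A'_def add.commute mult.commute)
 moreover have "distr M borel (La (A \<union> B)) = distr M borel (%w. La A w + La B w)"
 using assms AB by (intro distr_cong_AE Lam_Un) auto
 ultimately show ?thesis by simp
qed

lemma char_Lam_Ioc:
 assumes "a <= b" shows "char (distr M borel (La {a<..b})) u = exp (of_real (b - a)*ps u)"
proof -
 have "distr M borel (La {a<..b}) = distr M borel (%w. L b w - L a w)"
 using assms Ioc_bounded_borel by (intro distr_cong_AE Lam_Ioc) auto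
 also have "... = distr M borel (%w. L (b - a) w - L 0 w)" by (rule incr_stationary[OF assms])
 finally have "distr M borel (La {a<..b}) = distr M borel (%w. L (b - a) w - L 0 w)" .
 then show ?thesis using incr_char[of "b - a" u] assms by simp
qed

text \<open>The law of the random measure is determined by the intervals, with proper differences handled by
 independence and division by the nonvanishing characteristic function.\<close>

lemma char_Lam:
 assumes "A \<in> bounded_borel"
 shows "char (distr M borel (La A)) u = exp (of_real (measure lborel A)*ps u)"
 using assms
proof (induction A rule: bounded_borel_induct)
 case (interval a b)
 then show ?case by (simp add: char_Lam_Ioc)
next
 case (diff A B)
 have e: "A \<union> (B - A) = B" using diff by auto
 have D: "B - A \<in> bounded_borel" by (rule bounded_borel_subset[OF diff(2)]) (use diff in \<open>auto simp: bounded_borel_def\<close>)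
 have "measure lborel (A \<union> (B - A)) = measure lborel A + measure lborel (B - A)"
 using diff D bounded_borel_emeasure[OF diff(1)] bounded_borel_emeasure[OF D]
 by (intro measure_Union) (auto simp: bounded_borel_def)
 then have "exp (of_real (measure lborel B)*ps u) = exp (of_real (measure lborel A)*ps u)*exp (of_real (measure lborel (B - A))*ps u)"
 unfolding e by (simp add: ring_distribs exp_add[symmetric])
 moreover have "exp (of_real (measure lborel B)*ps u) = exp (of_real (measure lborel A)*ps u)*char (distr M borel (La (B - A))) u"
 using char_Lam_Un[OF diff(1) D, of u] diff unfolding e by simp
 ultimately show ?case by (simp only: mult_cancel_left exp_not_eq_zero simp_thms)
next
 case (union A)
 note [measurable] = Lam_measurable[OF union(2)] Lam_measurable[OF union(3)]
 have "(%n. trunc_norm (%w. (\<Sum>i<n. La (A i) w) - La (\<Union>n. A n) w)) ----> 0"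
 by (rule trunc_norm_tendsto_0_AE) (use Lam_sums[OF union(2,1,3)] in \<open>auto simp: sums_def\<close>)
 then have c: "(%n. char (distr M borel (%w. \<Sum>i<n. La (A i) w)) u) ----> char (distr M borel (La (\<Union>n. A n))) u"
 by (intro char_tendsto) auto
 have e: "char (distr M borel (%w. \<Sum>i<n. La (A i) w)) u = exp (of_real (\<Sum>i<n. measure lborel (A i))*ps u)" for n
 proof -
 have "char (distr M borel (%w. \<Sum>i<n. La (A i) w)) u = (\<Prod>i<n. char (distr M borel (La (A i))) u)"
 using union(1,2) by (intro char_distr_sum Lam_indep) (auto simp: disjoint_family_on_def)
 then show ?thesis unfolding union(4) by (simp add: exp_sum sum_distrib_right)
 qed
 have "(%i. measure lborel (A i)) sums measure lborel (\<Union>i. A i)"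
 using union(1,2) bounded_borel_emeasure[OF union(3)] by (intro measure_UNION) (auto simp: bounded_borel_def)
 then have "(%n. exp (of_real (\<Sum>i<n. measure lborel (A i))*ps u)) ----> exp (of_real (measure lborel (\<Union>i. A i))*ps u)"
 unfolding sums_def by (intro tendsto_intros)
 then show ?case using c unfolding e by (rule LIMSEQ_unique[rotated])
qed

lemma law_Lam:
 assumes "A \<in> bounded_borel" "B \<in> bounded_borel" "measure lborel A = measure lborel B"
 shows "distr M borel (La A) = distr M borel (La B)"
 using assms by (intro Levy_uniqueness real_distribution_distr ext) (auto simp: char_Lam)

text \<open>Any two random measures with the given increments agree almost surely on each bounded Borel set, by the same
 induction; so every choice in the definition of the integral gives the same integrals of simple functions.\<close>

lemma Lam_unique:
 assumes L': "levy_random_measure M L La'" and A: "A \<in> bounded_borel"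
 shows "AE w in M. La A w = La' A w"
proof -
 interpret L': levy_noise_measure M L ps q Kps La' by unfold_locales fact
 show ?thesis using A
 proof (induction A rule: bounded_borel_induct)
 case (interval a b)
 show ?case using Lam_Ioc[OF interval] L'.Lam_Ioc[OF interval] by eventually_elim simp
 next
 case (diff A B)
 have e: "A \<union> (B - A) = B" "A \<inter> (B - A) = {}" using diff by auto
 have D: "B - A \<in> bounded_borel" by (rule bounded_borel_subset[OF diff(2)]) (use diff in \<open>auto simp: bounded_borel_def\<close>)
 show ?case using diff(4,5) Lam_Un[OF diff(1) D e(2)] L'.Lam_Un[OF diff(1) D e(2)] unfolding e(1) by eventually_elim simp
 next
 case (union A)
 have "AE w in M. \<forall>i. La (A i) w = La' (A i) w" using union(4) by (simp add: AE_all_countable)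
 then show ?case using Lam_sums[OF union(2,1,3)] L'.Lam_sums[OF union(2,1,3)]
 by eventually_elim (use sums_unique2 in auto)
 qed
qed

end

section \<open>Integrals of simple functions\<close>

lemma simple_integrandD:
 assumes "simple_integrand ph"
 shows "finite (range ph)" "ph \<in> borel_measurable borel" "!!y. y ~= 0 ==> ph -` {y} \<in> bounded_borel"
proof -
 show "finite (range ph)" using assms by (auto simp: simple_integrand_def simple_function_def)
 show m: "ph \<in> borel_measurable borel" using assms by (auto simp: simple_integrand_def intro: borel_measurable_simple_function)
 show "ph -` {y} \<in> bounded_borel" if "y ~= 0" for y
 proof -
 have "ph -` {y} \<in> sets borel" using measurable_sets[OF m, of "{y}"] by simp
 moreover have "bounded (ph -` {y})" using assms that by (auto simp: simple_integrand_def intro: bounded_subset)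
 ultimately show ?thesis by (simp add: bounded_borel_def)
 qed
qed

lemma simple_integrandI:
 assumes "ph \<in> borel_measurable borel" "finite (range ph)" "bounded {s. ph s ~= 0}"
 shows "simple_integrand ph"
 using assms by (auto simp: simple_integrand_def intro!: simple_function_borel_measurable)

lemma simple_integrand_comp2:
 assumes "simple_integrand ph" "simple_integrand et" "c 0 0 = 0" "(%s. c (ph s) (et s)) \<in> borel_measurable borel"
 shows "simple_integrand (%s. c (ph s) (et s))"
proof (rule simple_integrandI)
 show "finite (range (%s. c (ph s) (et s)))"
 by (rule finite_subset[of _ "(%(x, y). c x y) ` (range ph \<times> range et)"])
 (use simple_integrandD(1)[OF assms(1)] simple_integrandD(1)[OF assms(2)] in auto)
 have "bounded ({s. ph s ~= 0} \<union> {s. et s ~= 0})" using assms by (simp add: simple_integrand_def)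
 then show "bounded {s. c (ph s) (et s) ~= 0}"
 by (rule bounded_subset) (clarsimp, metis assms(3))
qed fact

lemma simple_integrand_lin:
 assumes "simple_integrand ph" "simple_integrand et"
 shows "simple_integrand (%s. a*ph s + b*et s)"
 using simple_integrandD(2)[OF assms(1)] simple_integrandD(2)[OF assms(2)]
 by (intro simple_integrand_comp2[where c="%x y. a*x + b*y"] assms) auto

lemma simple_integrand_diff:
 "simple_integrand ph ==> simple_integrand et ==> simple_integrand (%s. ph s - et s)"
 using simple_integrand_lin[of ph et 1 "-1"] by simp

lemma simple_integrand_indicator:
 assumes "simple_integrand ph" "B \<in> sets borel"
 shows "simple_integrand (%s. ph s*indicator B s)"
proof (rule simple_integrandI)
 show "finite (range (%s. ph s*indicator B s))"
 by (rule finite_subset[of _ "insert 0 (range ph)"])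
 (use simple_integrandD(1)[OF assms(1)] in \<open>auto simp: indicator_def\<close>)
 show "bounded {s. ph s*indicator B s ~= 0}"
 by (rule bounded_subset[of "{s. ph s ~= 0}"]) (use assms in \<open>auto simp: simple_integrand_def\<close>)
 show "(%s. ph s*indicator B s) \<in> borel_measurable borel" using simple_integrandD(2)[OF assms(1)] assms(2) by measurable
qed

lemma simple_integrand_shift:
 assumes "simple_integrand ph" shows "simple_integrand (%s. ph (s - t))"
proof (rule simple_integrandI)
 show "finite (range (%s. ph (s - t)))"
 by (rule finite_subset[of _ "range ph"]) (use simple_integrandD(1)[OF assms(1)] in auto)
 have "bounded ((%s. t + s) ` {s. ph s ~= 0})" using assms by (simp add: simple_integrand_def bounded_translation)
 then show "bounded {s. ph (s - t) ~= 0}"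
 by (rule bounded_subset) (force intro: image_eqI[where x="_ - t"])
 show "(%s. ph (s - t)) \<in> borel_measurable borel" using simple_integrandD(2)[OF assms(1)] by measurable
qed

lemma bounded_borel_Int: "A \<in> bounded_borel ==> B \<in> sets borel ==> B \<inter> A \<in> bounded_borel"
 by (rule bounded_borel_subset) (auto simp: bounded_borel_def)

lemma simple_pair:
 assumes "simple_integrand ph" "simple_integrand et"
 shows "finite (range (%s. (ph s, et s)))" "v ~= (0, 0) ==> (%s. (ph s, et s)) -` {v} \<in> bounded_borel"
proof -
 show "finite (range (%s. (ph s, et s)))"
 by (rule finite_subset[of _ "range ph \<times> range et"])
 (use simple_integrandD(1)[OF assms(1)] simple_integrandD(1)[OF assms(2)] in auto)
 assume "v ~= (0, 0)"
 obtain a b where v: "v = (a, b)" by (cases v)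
 have e: "(%s. (ph s, et s)) -` {v} = ph -` {a} \<inter> et -` {b}" by (auto simp: v)
 have m: "ph -` {a} \<in> sets borel" "et -` {b} \<in> sets borel"
 using measurable_sets[OF simple_integrandD(2)[OF assms(1)], of "{a}"] measurable_sets[OF simple_integrandD(2)[OF assms(2)], of "{b}"] by auto
 show "(%s. (ph s, et s)) -` {v} \<in> bounded_borel"
 proof (cases "a = 0")
 case True
 then have "et -` {b} \<in> bounded_borel" using \<open>v ~= _\<close> v by (intro simple_integrandD(3)[OF assms(2)]) auto
 then show ?thesis unfolding e using m by (intro bounded_borel_Int)
 next
 case False
 then have "ph -` {a} \<in> bounded_borel" by (rule simple_integrandD(3)[OF assms(1)])
 then show ?thesis unfolding e using m by (subst Int_commute) (intro bounded_borel_Int)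
 qed
qed

context levy_noise_measure begin

abbreviation SI :: "real set => (real => real) => 'a => real" where "SI \<equiv> simple_integral La"

lemma SI_measurable [measurable]:
 assumes "simple_integrand ph" "B \<in> sets borel" shows "SI B ph \<in> borel_measurable M"
proof -
 have "La (B \<inter> ph -` {y}) \<in> borel_measurable M" if "y \<in> range ph - {0}" for y
 using that assms by (intro Lam_measurable bounded_borel_Int simple_integrandD(3)[OF assms(1)]) auto
 then show ?thesis unfolding simple_integral_def[abs_def] by (intro borel_measurable_sum borel_measurable_times) auto
qed

text \<open>The simple integral may be computed from any finite partition on which the integrand is constant. The value
 \<open>v0\<close>, where the integrand vanishes, is left out because its set may be unbounded.\<close>

lemma SI_atoms:
 fixes Ph :: "real => 'c" and c :: "'c => real"
 assumes fin: "finite (range Ph)" and bb: "!!v. v ~= v0 ==> Ph -` {v} \<in> bounded_borel" and c0: "c v0 = 0"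
 and B: "B \<in> sets borel"
 shows "AE w in M. SI B (%s. c (Ph s)) w = (\<Sum>v\<in>range Ph - {v0}. c v * La (B \<inter> Ph -` {v}) w)"
proof -
 let ?ph = "%s. c (Ph s)"
 have "AE w in M. \<forall>y\<in>range ?ph - {0}. La (B \<inter> ?ph -` {y}) w = (\<Sum>v\<in>{v \<in> range Ph. c v = y}. La (B \<inter> Ph -` {v}) w)"
 proof (rule AE_finite_allI)
 have "range ?ph = c ` range Ph" by auto
 then show "finite (range ?ph - {0})" using fin by auto
 fix y assume y: "y \<in> range ?ph - {0}"
 have e: "B \<inter> ?ph -` {y} = (\<Union>v\<in>{v \<in> range Ph. c v = y}. B \<inter> Ph -` {v})" by auto
 show "AE w in M. La (B \<inter> ?ph -` {y}) w = (\<Sum>v\<in>{v \<in> range Ph. c v = y}. La (B \<inter> Ph -` {v}) w)"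
 unfolding e
 proof (rule Lam_UN)
 show "finite {v \<in> range Ph. c v = y}" using fin by auto
 show "B \<inter> Ph -` {v} \<in> bounded_borel" if "v \<in> {v \<in> range Ph. c v = y}" for v
 using that y c0 B by (intro bounded_borel_Int bb) auto
 qed (auto simp: disjoint_family_on_def)
 qed
 then show ?thesis
 proof eventually_elim
 case (elim w)
 let ?I = "{v \<in> range Ph - {v0}. c v ~= 0}"
 have "SI B ?ph w = (\<Sum>y\<in>range ?ph - {0}. \<Sum>v\<in>{v \<in> ?I. c v = y}. c v * La (B \<inter> Ph -` {v}) w)"
 unfolding simple_integral_def
 proof (rule sum.cong[OF refl])
 fix y assume y: "y \<in> range ?ph - {0}"
 have e: "{v \<in> range Ph. c v = y} = {v \<in> ?I. c v = y}" using y c0 by auto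
 show "y*La (B \<inter> ?ph -` {y}) w = (\<Sum>v\<in>{v \<in> ?I. c v = y}. c v * La (B \<inter> Ph -` {v}) w)"
 unfolding elim[rule_format, OF y] e sum_distrib_left by (rule sum.cong) auto
 qed
 also have "... = (\<Sum>v\<in>?I. c v * La (B \<inter> Ph -` {v}) w)"
 proof (rule sum.group)
 have "range ?ph = c ` range Ph" by auto
 then show "finite (range ?ph - {0})" using fin by auto
 qed (use fin in auto)
 also have "... = (\<Sum>v\<in>range Ph - {v0}. c v * La (B \<inter> Ph -` {v}) w)"
 by (rule sum.mono_neutral_left) (use fin in auto)
 finally show ?case .
 qed
qed

lemma SI_atoms2:
 assumes "simple_integrand ph" "simple_integrand et" "c (0, 0) = 0" "B \<in> sets borel"
 shows "AE w in M. SI B (%s. c (ph s, et s)) w =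
 (\<Sum>v\<in>range (%s. (ph s, et s)) - {(0, 0)}. c v * La (B \<inter> (%s. (ph s, et s)) -` {v}) w)"
 by (rule SI_atoms[where Ph="%s. (ph s, et s)" and c=c]) (use simple_pair[OF assms(1,2)] assms in auto)

lemma SI_lin:
 assumes "simple_integrand ph" "simple_integrand et" "B \<in> sets borel"
 shows "AE w in M. SI B (%s. a*ph s + b*et s) w = a*SI B ph w + b*SI B et w"
proof -
 let ?S = "%c w. \<Sum>v\<in>range (%s. (ph s, et s)) - {(0, 0)}. c v * La (B \<inter> (%s. (ph s, et s)) -` {v}) w"
 have "AE w in M. SI B (%s. a*ph s + b*et s) w = ?S (%v. a*fst v + b * snd v) w"
 using SI_atoms2[OF assms(1,2) _ assms(3), of "%v. a*fst v + b * snd v"] by (simp only: fst_conv snd_conv)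
 moreover have "AE w in M. SI B ph w = ?S fst w"
 using SI_atoms2[OF assms(1,2) _ assms(3), of fst] by simp
 moreover have "AE w in M. SI B et w = ?S snd w"
 using SI_atoms2[OF assms(1,2) _ assms(3), of snd] by simp
 moreover have "?S (%v. a*fst v + b * snd v) w = a*?S fst w + b*?S snd w" for w
 by (simp add: sum_distrib_left sum.distrib[symmetric] algebra_simps)
 ultimately show ?thesis by (auto elim!: eventually_elim2)
qed

lemma SI_diff:
 assumes "simple_integrand ph" "simple_integrand et" "B \<in> sets borel"
 shows "AE w in M. SI B (%s. ph s - et s) w = SI B ph w - SI B et w"
 using SI_lin[OF assms, of 1 "-1"] by simp

lemma SI_add:
 assumes "simple_integrand ph" "simple_integrand et" "B \<in> sets borel"
 shows "AE w in M. SI B (%s. ph s + et s) w = SI B ph w + SI B et w"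
 using SI_lin[OF assms, of 1 1] by simp

lemma SI_restrict:
 assumes ph: "simple_integrand ph" and B: "B \<in> sets borel"
 shows "AE w in M. SI B ph w = SI UNIV (%s. ph s*indicator B s) w"
proof -
 let ?et = "%s. ph s*indicator B s"
 have et: "simple_integrand ?et" using ph B by (rule simple_integrand_indicator)
 have 1: "AE w in M. SI B ph w = (\<Sum>v\<in>range (%s. (ph s, ?et s)) - {(0, 0)}. fst v * La (B \<inter> (%s. (ph s, ?et s)) -` {v}) w)"
 using SI_atoms2[OF ph et _ B, of fst] by simp
 have 2: "AE w in M. SI UNIV ?et w = (\<Sum>v\<in>range (%s. (ph s, ?et s)) - {(0, 0)}. snd v * La (UNIV \<inter> (%s. (ph s, ?et s)) -` {v}) w)"
 using SI_atoms2[OF ph et _, of snd UNIV] by simp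
 show ?thesis using 1 2 Lam_empty
 proof eventually_elim
 case (elim w)
 show ?case unfolding elim(1,2)
 proof (rule sum.cong[OF refl])
 fix v assume v: "v \<in> range (%s. (ph s, ?et s)) - {(0, 0)}"
 show "fst v * La (B \<inter> (%s. (ph s, ?et s)) -` {v}) w = snd v * La (UNIV \<inter> (%s. (ph s, ?et s)) -` {v}) w"
 proof (cases "snd v = 0")
 case True
 then have "B \<inter> (%s. (ph s, ?et s)) -` {v} = {}" using v by (auto simp: indicator_def split: if_splits)
 then show ?thesis using True elim(3) by simp
 next
 case False
 then have "B \<inter> (%s. (ph s, ?et s)) -` {v} = UNIV \<inter> (%s. (ph s, ?et s)) -` {v}"
 by (auto simp: indicator_def split: if_splits)
 moreover have "fst v = snd v" using v False by (auto simp: indicator_def split: if_splits)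
 ultimately show ?thesis by simp
 qed
 qed
 qed
qed

lemma SI_unique:
 assumes L': "levy_random_measure M L La'" and ph: "simple_integrand ph" and B: "B \<in> sets borel"
 shows "AE w in M. SI B ph w = simple_integral La' B ph w"
proof -
 have "AE w in M. \<forall>y\<in>range ph - {0}. La (B \<inter> ph -` {y}) w = La' (B \<inter> ph -` {y}) w"
 proof (rule AE_finite_allI)
 show "AE w in M. La (B \<inter> ph -` {y}) w = La' (B \<inter> ph -` {y}) w" if "y \<in> range ph - {0}" for y
 by (rule Lam_unique[OF L']) (use that B in \<open>auto intro!: bounded_borel_Int simple_integrandD(3)[OF ph]\<close>)
 qed (use simple_integrandD(1)[OF ph] in auto)
 then show ?thesis by eventually_elim (simp add: simple_integral_def)
qed

text \<open>The values of the random measure on the level sets are independent, so the characteristic functions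
 multiply.\<close>

lemma char_SI:
 assumes ph: "simple_integrand ph"
 shows "char (distr M borel (SI UNIV ph)) u = exp (\<Sum>y\<in>range ph - {0}. of_real (measure lborel (ph -` {y}))*ps (u*y))"
proof -
 let ?I = "range ph - {0}"
 have fin: "finite ?I" using simple_integrandD(1)[OF ph] by simp
 have bb: "ph -` {y} \<in> bounded_borel" if "y \<in> ?I" for y using that by (intro simple_integrandD(3)[OF ph]) auto
 have "indep_vars (%_. borel) (%y. La (ph -` {y})) ?I"
 by (rule Lam_indep[OF fin bb]) (auto simp: disjoint_family_on_def)
 then have iv: "indep_vars (%_. borel) (%y w. y*La (ph -` {y}) w) ?I"
 by (rule indep_vars_compose2[where Y="%y x. y*x"]) auto
 have c: "char (distr M borel (%w. y*La (ph -` {y}) w)) u = exp (of_real (measure lborel (ph -` {y}))*ps (u*y))"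
 if y: "y \<in> ?I" for y
 proof -
 note [measurable] = Lam_measurable[OF bb[OF y]]
 have "char (distr M borel (%w. y*La (ph -` {y}) w)) u = char (distr M borel (La (ph -` {y}))) (u*y)"
 unfolding char_def by (subst (1 2) integral_distr) (auto simp: mult_ac)
 then show ?thesis by (simp add: char_Lam[OF bb[OF y]])
 qed
 have "SI UNIV ph = (%w. \<Sum>y\<in>?I. y*La (ph -` {y}) w)" by (simp add: simple_integral_def[abs_def])
 then show ?thesis using char_distr_sum[OF iv, of u] c fin by (simp add: exp_sum)
qed

text \<open>The constant in the moment bound, from dividing the bound on the exponent by the fractional integral of
 \<open>1 - cos\<close>.\<close>

definition Cq :: real where "Cq = Kps/enn2real (frac_int q cosfun)"

lemma Cq_nonneg: "0 <= Cq" using Kps by (simp add: Cq_def)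

text \<open>The \<open>q\<close>-th moment is the fractional integral of \<open>1 - Re (exp z)\<close>, where
 \<open>z\<close> is the exponent of the integral. As \<open>Re z \<le> 0\<close>, this is at most
 \<open>\<bar>z\<bar>\<close>, which is a sum over the level sets.\<close>

lemma SI_moment_UNIV:
 assumes ph: "simple_integrand ph"
 shows "abs_moment M q (SI UNIV ph) <= ennreal Cq*abs_moment lborel q ph"
proof -
 let ?I = "range ph - {0}"
 let ?l = "%y. measure lborel (ph -` {y})"
 have fin: "finite ?I" using simple_integrandD(1)[OF ph] by simp
 have bb: "ph -` {y} \<in> bounded_borel" if "y \<in> ?I" for y using that by (intro simple_integrandD(3)[OF ph]) auto
 obtain cc where cc: "frac_int q cosfun = ennreal cc" "0 < cc"
 using frac_int_cos[OF q] by (cases "frac_int q cosfun") (auto simp: less_top[symmetric])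
 have "ennreal cc*abs_moment M q (SI UNIV ph) = frac_int q (%u. 1 - Re (char (distr M borel (SI UNIV ph)) u))"
 unfolding cc(1)[symmetric] by (rule nn_moment_char[OF SI_measurable[OF ph] q]) simp
 also have "... <= nn_integral lborel (%u. (\<Sum>y\<in>?I. ennreal (?l y)*(indicator {0<..} u*ennreal (norm (ps (u*y))*u powr (- 1 - q)))))"
 unfolding frac_int_def
 proof (rule nn_integral_mono)
 fix u :: real
 let ?z = "\<Sum>y\<in>?I. of_real (?l y)*ps (u*y)"
 have "Re ?z <= 0" by (simp add: sum_nonpos mult_nonneg_nonpos Re_psi)
 have "1 - Re (exp ?z) = - Re (exp ?z - 1)" by simp
 also have "... <= norm (exp ?z - 1)" using abs_Re_le_cmod[of "exp ?z - 1"] by linarith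
 also have "... <= norm ?z" by (rule norm_exp_minus_1_le[OF \<open>Re ?z <= 0\<close>])
 also have "... <= (\<Sum>y\<in>?I. ?l y*norm (ps (u*y)))" by (rule sum_norm_le) (simp add: norm_mult)
 finally have "1 - Re (char (distr M borel (SI UNIV ph)) u) <= (\<Sum>y\<in>?I. ?l y*norm (ps (u*y)))"
 unfolding char_SI[OF ph] .
 then have "ennreal ((1 - Re (char (distr M borel (SI UNIV ph)) u))*u powr (- 1 - q)) <= ennreal ((\<Sum>y\<in>?I. ?l y*norm (ps (u*y)))*u powr (- 1 - q))"
 by (intro ennreal_leI mult_right_mono) auto
 also have "(\<Sum>y\<in>?I. ?l y*norm (ps (u*y)))*u powr (- 1 - q) = (\<Sum>y\<in>?I. ?l y*(norm (ps (u*y))*u powr (- 1 - q)))"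
 by (simp add: sum_distrib_right sum_distrib_left mult_ac)
 also have "ennreal ... = (\<Sum>y\<in>?I. ennreal (?l y)*ennreal (norm (ps (u*y))*u powr (- 1 - q)))"
 by (subst sum_ennreal[symmetric]) (auto simp: ennreal_mult)
 finally have "indicator {0<..} u*ennreal ((1 - Re (char (distr M borel (SI UNIV ph)) u))*u powr (- 1 - q))
 <= indicator {0<..} u*(\<Sum>y\<in>?I. ennreal (?l y)*ennreal (norm (ps (u*y))*u powr (- 1 - q)))"
 by (rule mult_left_mono) simp
 then show "indicator {0<..} u*ennreal ((1 - Re (char (distr M borel (SI UNIV ph)) u))*u powr (- 1 - q))
 <= (\<Sum>y\<in>?I. ennreal (?l y)*(indicator {0<..} u*ennreal (norm (ps (u*y))*u powr (- 1 - q))))"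
 by (simp add: sum_distrib_left mult_ac)
 qed
 also have "... = (\<Sum>y\<in>?I. ennreal (?l y)*frac_int q (%u. norm (ps (u*y))))"
 unfolding frac_int_def by (subst nn_integral_sum) (auto intro!: sum.cong nn_integral_cmult)
 also have "... <= (\<Sum>y\<in>?I. ennreal (?l y)*ennreal (Kps * abs y powr q))"
 by (intro sum_mono mult_left_mono frac_psi) simp
 also have "... = (\<Sum>y\<in>?I. ennreal Kps*nn_integral lborel (%s. ennreal (abs y powr q)*indicator (ph -` {y}) s))"
 proof (rule sum.cong[OF refl])
 fix y assume y: "y \<in> ?I"
 have f: "emeasure lborel (ph -` {y}) = ennreal (?l y)"
 using bounded_borel_emeasure[OF bb[OF y]] by (intro emeasure_eq_ennreal_measure) auto
 have "ph -` {y} \<in> sets borel" using bb[OF y] by (simp add: bounded_borel_def)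
 then show "ennreal (?l y)*ennreal (Kps * abs y powr q) = ennreal Kps*nn_integral lborel (%s. ennreal (abs y powr q)*indicator (ph -` {y}) s)"
 using Kps by (subst nn_integral_cmult_indicator) (auto simp: f ennreal_mult mult_ac)
 qed
 also have "... = ennreal Kps*nn_integral lborel (%s. (\<Sum>y\<in>?I. ennreal (abs y powr q)*indicator (ph -` {y}) s))"
 proof -
 have "ph -` {y} \<in> sets borel" if "y \<in> ?I" for y using bb[OF that] by (simp add: bounded_borel_def)
 then show ?thesis by (subst nn_integral_sum) (auto simp: sum_distrib_left)
 qed
 also have "(%s. \<Sum>y\<in>?I. ennreal (abs y powr q)*indicator (ph -` {y}) s) = (%s. ennreal (abs (ph s) powr q))"
 proof
 fix s
 have "(\<Sum>y\<in>?I. ennreal (abs y powr q)*indicator (ph -` {y}) s) = (\<Sum>y\<in>?I. if y = ph s then ennreal (abs y powr q) else 0)"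
 by (rule sum.cong) (auto simp: indicator_def)
 also have "... = ennreal (abs (ph s) powr q)" using fin by (subst sum.delta) auto
 finally show "(\<Sum>y\<in>?I. ennreal (abs y powr q)*indicator (ph -` {y}) s) = ennreal (abs (ph s) powr q)" .
 qed
 finally have le: "ennreal cc*abs_moment M q (SI UNIV ph) <= ennreal Kps*abs_moment lborel q ph" .
 have Cq: "Cq = Kps/cc" using cc by (simp add: Cq_def)
 have "abs_moment M q (SI UNIV ph) = ennreal (1/cc)*(ennreal cc*abs_moment M q (SI UNIV ph))"
 using cc by (simp add: mult.assoc[symmetric] ennreal_mult[symmetric])
 also have "... <= ennreal (1/cc)*(ennreal Kps*abs_moment lborel q ph)"
 by (intro mult_left_mono le) simp
 also have "... = ennreal Cq*abs_moment lborel q ph"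
 using cc Kps by (simp add: mult.assoc[symmetric] ennreal_mult[symmetric] Cq)
 finally show ?thesis .
qed

lemma SI_moment:
 assumes ph: "simple_integrand ph" and B: "B \<in> sets borel"
 shows "abs_moment M q (SI B ph) <= ennreal Cq*nn_integral lborel (%s. ennreal (abs (ph s) powr q)*indicator B s)"
proof -
 have "abs_moment M q (SI B ph) = abs_moment M q (SI UNIV (%s. ph s*indicator B s))"
 by (rule nn_integral_cong_AE) (use SI_restrict[OF assms] in eventually_elim, simp)
 also have "... <= ennreal Cq*nn_integral lborel (%s. ennreal (abs (ph s*indicator B s) powr q))"
 by (rule SI_moment_UNIV[OF simple_integrand_indicator[OF assms]])
 also have "(%s. ennreal (abs (ph s*indicator B s) powr q)) = (%s. ennreal (abs (ph s) powr q)*indicator B s)"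
 by (auto simp: fun_eq_iff indicator_def)
 finally show ?thesis .
qed

lemma law_atoms:
 assumes I: "finite I" and A: "!!i. i \<in> I ==> A i \<in> bounded_borel" "disjoint_family_on A I"
 and A': "!!i. i \<in> I ==> A' i \<in> bounded_borel" "disjoint_family_on A' I"
 and eq: "!!i. i \<in> I ==> measure lborel (A i) = measure lborel (A' i)"
 shows "distr M (Pi\<^sub>M I (%_. borel)) (%w. \<lambda>i\<in>I. La (A i) w) = distr M (Pi\<^sub>M I (%_. borel)) (%w. \<lambda>i\<in>I. La (A' i) w)"
proof (cases "I = {}")
 case True then show ?thesis by (simp add: restrict_def)
next
 case False
 have P: "distr M (Pi\<^sub>M I (%_. borel)) (%w. \<lambda>i\<in>I. La (A i) w) = Pi\<^sub>M I (%i. distr M borel (La (A i)))"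
 if "!!i. i \<in> I ==> A i \<in> bounded_borel" "disjoint_family_on A I" for A
 proof -
 have iv: "indep_vars (%_. borel) (%i. La (A i)) I" by (rule Lam_indep[OF I that])
 have rv: "random_variable borel (La (A i))" if "i \<in> I" for i using \<open>!!i. i \<in> I ==> A i \<in> bounded_borel\<close> that by auto
 show ?thesis by (rule indep_vars_iff_distr_eq_PiM'[OF False, THEN iffD1]) (use iv rv in auto)
 qed
 have "Pi\<^sub>M I (%i. distr M borel (La (A i))) = Pi\<^sub>M I (%i. distr M borel (La (A' i)))"
 by (rule PiM_cong[OF refl]) (use A A' eq in \<open>auto intro!: law_Lam\<close>)
 then show ?thesis using P[OF A] P[OF A'] by (rule_tac trans[OF _ trans[OF _ sym]])
qed

text \<open>Joint translation of two integrands moves their common level sets without changing the Lebesgue measures.\<close>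

lemma SI_shift_pair:
 assumes ph: "simple_integrand ph" and et: "simple_integrand et"
 and h [measurable]: "(%z. h (fst z) (snd z)) \<in> borel_measurable (borel :: (real \<times> real) measure)"
 shows "(LINT w|M. h (SI UNIV (%s. ph (s - t)) w) (SI UNIV (%s. et (s - t)) w)) = (\<integral>w. h (SI UNIV ph w) (SI UNIV et w) \<partial>M :: real)"
proof -
 let ?I = "range (%s. (ph s, et s)) - {(0, 0)}"
 let ?H = "%x. h (\<Sum>v\<in>?I. fst v * x v) (\<Sum>v\<in>?I. snd v * x v)"
 have fin: "finite ?I" using simple_pair[OF ph et] by auto
 have Hm [measurable]: "?H \<in> borel_measurable (Pi\<^sub>M ?I (%_. borel))"
 proof -
 have m: "(%x. \<Sum>v\<in>?I. c v * x v) \<in> borel_measurable (Pi\<^sub>M ?I (%_. borel))" for c :: "real \<times> real => real"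
 by (intro borel_measurable_sum borel_measurable_times) auto
 have "(%x. ((\<Sum>v\<in>?I. fst v * x v), (\<Sum>v\<in>?I. snd v * x v))) \<in> borel_measurable (Pi\<^sub>M ?I (%_. borel))"
 by (intro borel_measurable_Pair m)
 from measurable_compose[OF this h] show ?thesis by simp
 qed
 have key: "(LINT w|M. h (SI UNIV ph' w) (SI UNIV et' w)) = (LINT x|distr M (Pi\<^sub>M ?I (%_. borel)) (%w. \<lambda>v\<in>?I. La ((%s. (ph' s, et' s)) -` {v}) w). ?H x)"
 if ph': "simple_integrand ph'" and et': "simple_integrand et'" and r: "range (%s. (ph' s, et' s)) = range (%s. (ph s, et s))" for ph' et'
 proof -
 let ?A = "%v. (%s. (ph' s, et' s)) -` {v}"
 have bb: "v \<in> ?I ==> ?A v \<in> bounded_borel" for v by (rule simple_pair[OF ph' et']) auto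
 have m: "(%w. \<lambda>v\<in>?I. La (?A v) w) \<in> measurable M (Pi\<^sub>M ?I (%_. borel))"
 by (rule measurable_restrict) (use bb in auto)
 have 1: "AE w in M. SI UNIV ph' w = (\<Sum>v\<in>?I. fst v * La (?A v) w)"
 using SI_atoms2[OF ph' et', of fst UNIV] unfolding r by simp
 have 2: "AE w in M. SI UNIV et' w = (\<Sum>v\<in>?I. snd v * La (?A v) w)"
 using SI_atoms2[OF ph' et', of snd UNIV] unfolding r by simp
 have mH: "(%w. ?H (\<lambda>v\<in>?I. La (?A v) w)) \<in> borel_measurable M" by (rule measurable_compose[OF m Hm])
 have mh: "(%w. h (SI UNIV ph' w) (SI UNIV et' w)) \<in> borel_measurable M"
 using measurable_compose[OF borel_measurable_Pair[OF SI_measurable[OF ph'] SI_measurable[OF et']] h] by simp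
 have "(LINT w|M. h (SI UNIV ph' w) (SI UNIV et' w)) = (LINT w|M. ?H (\<lambda>v\<in>?I. La (?A v) w))"
 by (rule integral_cong_AE[OF mh mH]) (use 1 2 in \<open>eventually_elim, simp\<close>)
 also have "... = (LINT x|distr M (Pi\<^sub>M ?I (%_. borel)) (%w. \<lambda>v\<in>?I. La (?A v) w). ?H x)"
 by (rule integral_distr[OF m Hm, symmetric])
 finally show ?thesis .
 qed
 let ?ph' = "%s. ph (s - t)" and ?et' = "%s. et (s - t)"
 have ph': "simple_integrand ?ph'" and et': "simple_integrand ?et'" using ph et by (auto intro: simple_integrand_shift)
 have r: "range (%s. (?ph' s, ?et' s)) = range (%s. (ph s, et s))"
 proof -
 have "(%s. (?ph' s, ?et' s)) = (%s. (ph s, et s)) \<circ> (%s. s - t)" by auto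
 moreover have "range (%s. s - t) = UNIV" by (auto intro!: image_eqI[where x="_ + t"])
 ultimately show ?thesis by (metis image_comp)
 qed
 have l: "distr M (Pi\<^sub>M ?I (%_. borel)) (%w. \<lambda>v\<in>?I. La ((%s. (?ph' s, ?et' s)) -` {v}) w)
 = distr M (Pi\<^sub>M ?I (%_. borel)) (%w. \<lambda>v\<in>?I. La ((%s. (ph s, et s)) -` {v}) w)"
 proof (rule law_atoms[OF fin])
 fix v assume v: "v \<in> ?I"
 let ?A = "(%s. (ph s, et s)) -` {v}"
 show bb: "(%s. (?ph' s, ?et' s)) -` {v} \<in> bounded_borel" "?A \<in> bounded_borel"
 using v by (auto intro!: simple_pair[OF ph' et'] simple_pair[OF ph et])
 have e: "(%s. (?ph' s, ?et' s)) -` {v} = (+) t ` ?A"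
 by (auto intro!: image_eqI[where x="_ - t"])
 show "measure lborel ((%s. (?ph' s, ?et' s)) -` {v}) = measure lborel ?A"
 using measure_translation[of t ?A] bb unfolding e by (simp add: bounded_borel_def)
 qed (auto simp: disjoint_family_on_def)
 show ?thesis unfolding key[OF ph' et' r] key[OF ph et refl] l ..
qed

end

section \<open>Uniqueness of the limit\<close>

lemma simple_integrand_powr_integral:
 assumes ph: "simple_integrand ph"
 shows "nn_integral lborel (%s. ennreal (abs (ph s) powr r)) < \<infinity>"
proof -
 obtain R where R: "!!s. ph s ~= 0 ==> abs s <= R" using ph by (auto simp: simple_integrand_def bounded_iff)
 define B where "B = Max ((%y. abs y powr r) ` range ph)"
 have B: "abs (ph s) powr r <= B" for s
 unfolding B_def using simple_integrandD(1)[OF ph] by (intro Max_ge) auto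
 have "nn_integral lborel (%s. ennreal (abs (ph s) powr r)) <= nn_integral lborel (%s. ennreal B*indicator {-R..R} s)"
 proof (rule nn_integral_mono)
 fix s show "ennreal (abs (ph s) powr r) <= ennreal B*indicator {-R..R} s"
 using B[of s] R[of s] by (cases "ph s = 0") (auto simp: abs_le_iff indicator_def intro!: ennreal_leI)
 qed
 also have "... = ennreal B*emeasure lborel {-R..R}" by (rule nn_integral_cmult_indicator) simp
 also have "... < \<infinity>" using emeasure_bounded_finite[of "{-R..R}"] by (simp add: ennreal_mult_less_top)
 finally show ?thesis .
qed

text \<open>Only Cauchy sequences occur in the uniqueness argument, so no limit has to be named.\<close>

definition (in prob_space) prob_cauchy :: "(nat => 'a => real) => bool" where
 "prob_cauchy Z \<longleftrightarrow> (\<forall>e>0. \<exists>n0. \<forall>m\<ge>n0. \<forall>n\<ge>n0. trunc_norm (%w. Z m w - Z n w) < e)"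

context prob_space begin

lemma prob_cauchyI_tendsto:
 assumes Z: "!!n. Z n \<in> borel_measurable M" and W: "W \<in> borel_measurable M"
 and l: "(%n. trunc_norm (%w. Z n w - W w)) ----> 0"
 shows "prob_cauchy Z"
 unfolding prob_cauchy_def
proof (intro allI impI)
 fix e :: real assume e: "0 < e"
 obtain n0 where n0: "!!n. n >= n0 ==> trunc_norm (%w. Z n w - W w) < e/2"
 using order_tendstoD(2)[OF l, of "e/2"] e by (auto simp: eventually_sequentially)
 show "\<exists>n0. \<forall>m\<ge>n0. \<forall>n\<ge>n0. trunc_norm (%w. Z m w - Z n w) < e"
 proof (intro exI[of _ n0] allI impI)
 fix m n assume "n0 <= m" "n0 <= n"
 have "trunc_norm (%w. (Z m w - W w) - (Z n w - W w)) <= trunc_norm (%w. Z m w - W w) + trunc_norm (%w. Z n w - W w)"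
 by (rule trunc_norm_diff) (use Z W in auto)
 then show "trunc_norm (%w. Z m w - Z n w) < e" using n0[OF \<open>n0 <= m\<close>] n0[OF \<open>n0 <= n\<close>] by simp
 qed
qed

lemma prob_cauchy_diff:
 assumes Z: "!!n. Z n \<in> borel_measurable M" and W: "!!n. W n \<in> borel_measurable M" and U: "!!n. U n \<in> borel_measurable M"
 and c: "prob_cauchy Z" "prob_cauchy W" and eq: "!!n. AE w in M. U n w = Z n w - W n w"
 shows "prob_cauchy U"
 unfolding prob_cauchy_def
proof (intro allI impI)
 fix e :: real assume e: "0 < e"
 then have e2: "0 < e/2" by simp
 obtain n0 where n0: "!!m n. m >= n0 ==> n >= n0 ==> trunc_norm (%w. Z m w - Z n w) < e/2"
 using c(1) e2 unfolding prob_cauchy_def by blast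
 obtain n1 where n1: "!!m n. m >= n1 ==> n >= n1 ==> trunc_norm (%w. W m w - W n w) < e/2"
 using c(2) e2 unfolding prob_cauchy_def by blast
 show "\<exists>n0. \<forall>m\<ge>n0. \<forall>n\<ge>n0. trunc_norm (%w. U m w - U n w) < e"
 proof (intro exI[of _ "max n0 n1"] allI impI)
 fix m n assume mn: "max n0 n1 <= m" "max n0 n1 <= n"
 have "trunc_norm (%w. U m w - U n w) = trunc_norm (%w. (Z m w - Z n w) - (W m w - W n w))"
 proof (rule trunc_norm_cong_AE)
 show "AE w in M. U m w - U n w = (Z m w - Z n w) - (W m w - W n w)"
 using eq[of m] eq[of n] by eventually_elim simp
 qed (use Z W U in auto)
 also have "... <= trunc_norm (%w. Z m w - Z n w) + trunc_norm (%w. W m w - W n w)"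
 by (rule trunc_norm_diff) (use Z W in auto)
 finally show "trunc_norm (%w. U m w - U n w) < e" using n0[of m n] n1[of m n] mn by simp
 qed
qed

end

context levy_noise_measure begin

lemma SI_split:
 assumes ph: "simple_integrand ph" and B: "B \<in> sets borel"
 shows "AE w in M. SI UNIV ph w = SI B ph w + SI (- B) ph w"
proof -
 have B': "- B \<in> sets borel" using B by auto
 have "AE w in M. SI UNIV (%s. ph s*indicator B s + ph s*indicator (- B) s) w =
 SI UNIV (%s. ph s*indicator B s) w + SI UNIV (%s. ph s*indicator (- B) s) w"
 by (intro SI_add simple_integrand_indicator ph B B') simp
 moreover have "(%s. ph s*indicator B s + ph s*indicator (- B) s) = ph" by (auto simp: indicator_def)
 ultimately have "AE w in M. SI UNIV ph w = SI UNIV (%s. ph s*indicator B s) w + SI UNIV (%s. ph s*indicator (- B) s) w" by simp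
 then show ?thesis using SI_restrict[OF ph B] SI_restrict[OF ph B'] by eventually_elim simp
qed

text \<open>A gliding hump. If the integrals did not tend to zero, a subsequence would stay away from zero. On the sets
 \<open>E k\<close>, where all integrands and \<open>\<bar>s\<bar>\<close> are at most \<open>k\<close>,
 dominated convergence and the moment bound make the integrals small for late members; outside a later
 \<open>E k'\<close> they are small because each single integrand is in \<open>L^q\<close>. So, along a
 further subsequence, the mass of the \<open>i\<close>-th integral sits in a shell \<open>D i\<close>, and
 the shells are disjoint. Integrals over the union \<open>B\<close> of the even shells are then large for
 even members and small for odd ones, contradicting the Cauchy property for \<open>B\<close>.\<close>

lemma SI_null:
 assumes h: "!!m. simple_integrand (h m)"
 and lim: "AE s in lborel. (%m. h m s) ----> 0"
 and cauchy: "!!B. B \<in> sets borel ==> prob_cauchy (%m. SI B (h m))"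
 shows "(%m. trunc_norm (SI UNIV (h m))) ----> 0"
proof (rule ccontr)
 assume contra: "\<not> ?thesis"
 note [measurable] = simple_integrandD(2)[OF h]
 define E where "E k = {s. abs s <= real k & (\<forall>m. abs (h m s) <= real k)}" for k :: nat
 have E_eq: "E k = {-real k..real k} \<inter> (\<Inter>m. {s \<in> space borel. abs (h m s) <= real k})" for k
 by (auto simp: E_def)
 have [measurable]: "E k \<in> sets borel" for k unfolding E_eq by measurable
 have E_mono: "E k \<subseteq> E k'" if "k <= k'" for k k' using that unfolding E_def by (auto intro: order.trans)
 define iq where "iq B m = nn_integral lborel (%s. ennreal (abs (h m s) powr q)*indicator B s)" for B m
 have inside: "(%m. iq (E k) m) ----> 0" for k
 proof -
 have "(%m. iq (E k) m) ----> nn_integral ((lborel :: real measure)) (%s. 0)"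
 unfolding iq_def
 proof (rule nn_integral_dominated_convergence[where w="%s. ennreal (real k powr q)*indicator {-real k..real k} s"])
 show "AE s in lborel. ennreal (abs (h j s) powr q)*indicator (E k) s <= ennreal (real k powr q)*indicator {-real k..real k} s" for j
 proof (rule AE_I2)
 fix s show "ennreal (abs (h j s) powr q)*indicator (E k) s <= ennreal (real k powr q)*indicator {-real k..real k} s"
 using q by (auto simp: indicator_def E_def abs_le_iff intro!: ennreal_leI powr_mono2)
 qed
 show "nn_integral lborel (%s. ennreal (real k powr q)*indicator {-real k..real k} s) < \<infinity>"
 using emeasure_bounded_finite[of "{-real k..real k}"] by (subst nn_integral_cmult_indicator) (auto simp: ennreal_mult_less_top)
 show "AE s in lborel. (%j. ennreal (abs (h j s) powr q)*indicator (E k) s) ----> 0"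
 using lim
 proof eventually_elim
 case (elim s)
 have "(%j. abs (h j s) powr q) ----> 0"
 using q tendsto_zero_powrI[OF tendsto_rabs_zero[OF elim] tendsto_const[of q]] by (auto simp: always_eventually)
 then have "(%j. ennreal (abs (h j s) powr q)) ----> ennreal 0" by (rule tendsto_ennrealI)
 then have "(%j. ennreal (abs (h j s) powr q)*indicator (E k) s) ----> ennreal 0*indicator (E k) s"
 by (intro tendsto_mult_ennreal tendsto_const) (auto simp: indicator_def)
 then show ?case by simp
 qed
 qed measurable
 then show ?thesis by simp
 qed
 have outside: "(%k. iq (- E k) m) ----> 0" for m
 proof -
 have "(%k. iq (- E k) m) ----> nn_integral ((lborel :: real measure)) (%s. 0)"
 unfolding iq_def
 proof (rule nn_integral_dominated_convergence[where w="%s. ennreal (abs (h m s) powr q)"])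
 show "abs_moment lborel q (h m) < \<infinity>" by (rule simple_integrand_powr_integral[OF h])
 show "AE s in lborel. (%k. ennreal (abs (h m s) powr q)*indicator (- E k) s) ----> 0"
 using lim
 proof eventually_elim
 case (elim s)
 obtain C where C: "!!j. abs (h j s) <= C" using convergent_imp_Bseq[OF convergentI[OF elim]] by (auto simp: Bseq_def)
 obtain k0 :: nat where k0: "max C (abs s) <= real k0" using real_arch_simple by blast
 have "s \<in> E k" if "k0 <= k" for k
 proof -
 have "max C (abs s) <= real k" using k0 that by (meson of_nat_le_iff order.trans)
 then show ?thesis using C by (auto simp: E_def intro: order.trans)
 qed
 then have "\<forall>\<^sub>F k in sequentially. ennreal (abs (h m s) powr q)*indicator (- E k) s = 0"
 unfolding eventually_sequentially by (intro exI[of _ k0]) auto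
 then show ?case by (rule tendsto_eventually)
 qed
 qed (auto simp: indicator_def)
 then show ?thesis by simp
 qed
 obtain e where e: "0 < e" "!!i. \<exists>m\<ge>i. e <= trunc_norm (SI UNIV (h m))"
 using contra trunc_norm_nonneg unfolding lim_sequentially by (auto simp: dist_real_def not_less)
 have choice: "\<exists>m k'. i <= m & k < k' & e <= trunc_norm (SI UNIV (h m)) & iq (E k) m <= ennreal (1/real (Suc i)) & iq (- E k') m <= ennreal (1/real (Suc i))" for k i
 proof -
 have p: "0 < ennreal (1/real (Suc i))" by (simp add: ennreal_zero_less_divide)
 obtain m0 where m0: "!!m. m >= m0 ==> iq (E k) m < ennreal (1/real (Suc i))"
 using order_tendstoD(2)[OF inside[of k] p] by (auto simp: eventually_sequentially)
 obtain m where m: "m >= max m0 i" "e <= trunc_norm (SI UNIV (h m))" using e(2)[of "max m0 i"] by auto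
 obtain k0 where k0: "!!k. k >= k0 ==> iq (- E k) m < ennreal (1/real (Suc i))"
 using order_tendstoD(2)[OF outside[of m] p] by (auto simp: eventually_sequentially)
 show ?thesis
 using m m0[of m] k0[of "max k0 (Suc k)"]
 by (intro exI[of _ m] exI[of _ "max k0 (Suc k)"]) auto
 qed
 define P where "P k i p \<longleftrightarrow> i <= fst p & k < snd p & e <= trunc_norm (SI UNIV (h (fst p))) & iq (E k) (fst p) <= ennreal (1/real (Suc i)) & iq (- E (snd p)) (fst p) <= ennreal (1/real (Suc i))" for k i p
 define fm fk where "fm k i = fst (SOME p. P k i p)" and "fk k i = snd (SOME p. P k i p)" for k i
 have "\<exists>p. P k i p" for k i using choice[of i k] by (auto simp: P_def)
 then have "P k i (SOME p. P k i p)" for k i by (rule someI_ex)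
 then have f: "!!k i. i <= fm k i" "!!k i. k < fk k i" "!!k i. e <= trunc_norm (SI UNIV (h (fm k i)))"
 "!!k i. iq (E k) (fm k i) <= ennreal (1/real (Suc i))" "!!k i. iq (- E (fk k i)) (fm k i) <= ennreal (1/real (Suc i))"
 by (auto simp: P_def fm_def fk_def)
 define K where "K = rec_nat 0 (%i k. fk k i)"
 have K_Suc: "K (Suc i) = fk (K i) i" for i by (simp add: K_def)
 define mm where "mm i = fm (K i) i" for i
 have K_mono: "K i <= K j" if "i <= j" for i j
 using that by (rule lift_Suc_mono_le[rotated]) (use f(2) in \<open>auto simp: K_Suc less_imp_le\<close>)
 define D where "D i = E (K (Suc i)) - E (K i)" for i
 have [measurable]: "D i \<in> sets borel" for i unfolding D_def by measurable
 have D_disj: "D i \<inter> D j = {}" if "i < j" for i j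
 using E_mono[OF K_mono[of "Suc i" j]] that by (auto simp: D_def)
 \<comment> \<open>odd shells lie in the complement of \<open>B\<close>\<close>
 define B where "B = (\<Union>j. D (2*j))"
 have [measurable]: "B \<in> sets borel" unfolding B_def by measurable
 have iq_le: "iq A (mm i) <= ennreal (2/real (Suc i))" if "A \<inter> D i = {}" and [measurable]: "A \<in> sets borel" for A i
 proof -
 have "iq A (mm i) <= iq (E (K i)) (mm i) + iq (- E (K (Suc i))) (mm i)"
 proof -
 have "iq A (mm i) <= nn_integral lborel (%s. ennreal (abs (h (mm i) s) powr q)*indicator (E (K i)) s + ennreal (abs (h (mm i) s) powr q)*indicator (- E (K (Suc i))) s)"
 unfolding iq_def
 by (rule nn_integral_mono) (use that(1) in \<open>auto simp: indicator_def D_def\<close>)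
 also have "... = iq (E (K i)) (mm i) + iq (- E (K (Suc i))) (mm i)"
 unfolding iq_def by (rule nn_integral_add) measurable
 finally show ?thesis .
 qed
 also have "... <= ennreal (1/real (Suc i)) + ennreal (1/real (Suc i))"
 using f(4)[of "K i" i] f(5)[of "K i" i] by (intro add_mono) (auto simp: mm_def K_Suc)
 also have "... = ennreal (2/real (Suc i))" by (subst ennreal_plus[symmetric]) auto
 finally show ?thesis .
 qed
 have small: "(%j. trunc_norm (SI A (h (mm (i j))))) ----> 0"
 if A[measurable]: "A \<in> sets borel" and d: "!!j. A \<inter> D (i j) = {}" and ij: "!!j. j <= i j" for A and i :: "nat => nat"
 proof (rule trunc_norm_tendsto_0_moment[where q=q and B="%j. Cq*(2/real (Suc j))"])
 show "(%j. Cq*(2/real (Suc j))) ----> 0"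
 by (intro tendsto_mult_right_zero LIMSEQ_Suc[of "%j. 2/real j"] lim_const_over_n)
 fix j
 have "2/real (Suc (i j)) <= 2/real (Suc j)" using ij[of j] by (intro divide_left_mono) auto
 then have "iq A (mm (i j)) <= ennreal (2/real (Suc j))"
 using iq_le[OF d[of j] A] by (meson ennreal_leI order.trans)
 then have "ennreal Cq*iq A (mm (i j)) <= ennreal Cq*ennreal (2/real (Suc j))" by (rule mult_left_mono) simp
 also have "ennreal Cq*ennreal (2/real (Suc j)) = ennreal (Cq*(2/real (Suc j)))"
 by (rule ennreal_mult[symmetric, OF Cq_nonneg]) simp
 finally show "nn_integral M (%w. ennreal (abs (SI A (h (mm (i j))) w) powr q)) <= ennreal (Cq*(2/real (Suc j)))"
 using SI_moment[OF h[of "mm (i j)"] A] unfolding iq_def by (rule order.trans[rotated])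
 qed (use q Cq_nonneg A SI_measurable[OF h A] in auto)
 have even: "(%j. trunc_norm (SI (- B) (h (mm (2*j))))) ----> 0"
 by (rule small) (auto simp: B_def)
 have odd: "(%j. trunc_norm (SI B (h (mm (2*j + 1))))) ----> 0"
 proof (rule small)
 show "B \<inter> D (2*j + 1) = {}" for j
 proof -
 have "D (2*i) \<inter> D (2*j + 1) = {}" for i
 proof (cases "2*i < 2*j + 1")
 case True then show ?thesis by (rule D_disj)
 next
 case False
 then have "2*j + 1 < 2*i" by presburger
 from D_disj[OF this] show ?thesis by (simp only: Int_commute)
 qed
 then show ?thesis unfolding B_def by blast
 qed
 qed auto
 have diff: "(%j. trunc_norm (%w. SI B (h (mm (2*j))) w - SI B (h (mm (2*j + 1))) w)) ----> 0"
 proof (rule LIMSEQ_I)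
 fix r :: real assume "0 < r"
 then obtain n0 where n0: "!!m n. n0 <= m ==> n0 <= n ==> trunc_norm (%w. SI B (h m) w - SI B (h n) w) < r"
 using cauchy[of B] unfolding prob_cauchy_def by (auto, meson)
 have mmi: "i <= mm i" for i using f(1) by (simp add: mm_def)
 show "\<exists>no. \<forall>j\<ge>no. norm (trunc_norm (%w. SI B (h (mm (2*j))) w - SI B (h (mm (2*j + 1))) w) - 0) < r"
 proof (intro exI[of _ n0] allI impI)
 fix j assume "n0 <= j"
 then have "n0 <= mm (2*j)" "n0 <= mm (2*j + 1)" using mmi[of "2*j"] mmi[of "2*j + 1"] by linarith+
 from n0[OF this] show "norm (trunc_norm (%w. SI B (h (mm (2*j))) w - SI B (h (mm (2*j + 1))) w) - 0) < r"
 using trunc_norm_nonneg by simp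
 qed
 qed
 have "e <= trunc_norm (%w. SI B (h (mm (2*j))) w - SI B (h (mm (2*j + 1))) w) + trunc_norm (SI B (h (mm (2*j + 1)))) + trunc_norm (SI (- B) (h (mm (2*j))))" for j
 proof -
 let ?a = "SI B (h (mm (2*j)))" and ?b = "SI B (h (mm (2*j + 1)))" and ?c = "SI (- B) (h (mm (2*j)))"
 have m: "?a \<in> borel_measurable M" "?b \<in> borel_measurable M" "?c \<in> borel_measurable M"
 by (auto intro!: SI_measurable h)
 have "e <= trunc_norm (SI UNIV (h (mm (2*j))))" using f(3) by (simp add: mm_def)
 also have "... = trunc_norm (%w. ?a w + ?c w)"
 by (rule trunc_norm_cong_AE) (use m SI_split[OF h[of "mm (2*j)"], of B] SI_measurable[OF h] in auto)
 also have "... <= trunc_norm ?a + trunc_norm ?c" by (rule trunc_norm_add) (use m in auto)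
 also have "trunc_norm ?a = trunc_norm (%w. (?a w - ?b w) + ?b w)" by simp
 also have "... <= trunc_norm (%w. ?a w - ?b w) + trunc_norm ?b" by (rule trunc_norm_add) (use m in auto)
 finally show ?thesis by simp
 qed
 moreover have "(%j. trunc_norm (%w. SI B (h (mm (2*j))) w - SI B (h (mm (2*j + 1))) w) + trunc_norm (SI B (h (mm (2*j + 1)))) + trunc_norm (SI (- B) (h (mm (2*j))))) ----> 0 + 0 + 0"
 by (intro tendsto_add diff odd even)
 ultimately have "e <= 0" by (intro LIMSEQ_le_const) auto
 then show False using e(1) by simp
qed

end

section \<open>Approximation of the noise\<close>

text \<open>The kernel of \<open>X 0\<close>; the kernel of \<open>X t\<close> is its translate, as the terms of the two
 integrals that do not involve \<open>t\<close> cancel.\<close>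

definition noise_kernel :: "real => real => real" where
 "noise_kernel rh s = pos_powr (- s) (- rh) - pos_powr (- 1 - s) (- rh)"

lemma pos_powr_measurable [measurable]: "(%s. pos_powr s a) \<in> borel_measurable borel"
 unfolding pos_powr_def[abs_def] by measurable

lemma noise_kernel_measurable [measurable]: "noise_kernel rh \<in> borel_measurable borel"
 unfolding noise_kernel_def[abs_def] by measurable

text \<open>Mean value theorem: the difference of two powers decays one order faster than each of them.\<close>

lemma noise_kernel_bound:
 assumes rh: "0 < rh" and s: "s <= - 2"
 shows "noise_kernel rh s <= 0" "abs (noise_kernel rh s) <= rh*(- 1 - s) powr (- 1 - rh)"
proof -
 define x where "x = - 1 - s"
 have e2: "- 1 - rh = - rh - 1" by simp
 have x: "1 <= x" using s by (simp add: x_def)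
 have e: "noise_kernel rh s = (x + 1) powr (- rh) - x powr (- rh)" using s by (simp add: noise_kernel_def pos_powr_def x_def)
 have d: "((%z. z powr (- rh)) has_real_derivative (- rh)*z powr (- rh - 1)) (at z)" if "x <= z" for z
 using that x by (intro has_real_derivative_powr) auto
 obtain z where z: "x < z" "z < x + 1" "(x + 1) powr (- rh) - x powr (- rh) = ((x + 1) - x)*((- rh)*z powr (- rh - 1))"
 using MVT2[of x "x + 1" "%z. z powr (- rh)", OF _ d] by auto
 have "z powr (- rh - 1) <= x powr (- rh - 1)" using z x rh by (intro powr_mono2') auto
 then have "rh*z powr (- rh - 1) <= rh*x powr (- rh - 1)" using rh by (intro mult_left_mono) auto
 moreover have "0 <= rh*z powr (- rh - 1)" using rh by simp
 moreover have "noise_kernel rh s = - (rh*z powr (- rh - 1))" using z(3) e by simp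
 ultimately show "noise_kernel rh s <= 0" "abs (noise_kernel rh s) <= rh*(- 1 - s) powr (- 1 - rh)"
 unfolding x_def[symmetric] e2 by auto
qed

lemma nn_integral_shift:
 assumes [measurable]: "f \<in> borel_measurable borel"
 shows "nn_integral lborel (%s. f (s - t)) = nn_integral ((lborel :: real measure)) (%s. f s)"
 using nn_integral_real_affine[of "%s. f (s - t)" 1 t] by simp

lemma AE_lborel_shift:
 assumes "AE s in lborel. P (s :: real)" shows "AE s in lborel. P (s - t)"
proof -
 have "AE s in distr lborel borel ((+) (- t)). P s" by (subst lborel_distr_plus) fact
 from AE_distrD[OF _ this] show ?thesis by (simp add: add.commute[of "-t"])
qed

lemma kernel_tail_integrable:
 assumes rh: "0 < rh" and q: "1 < (1 + rh) * q" "0 < q"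
 shows "nn_integral lborel (%s. ennreal (abs (noise_kernel rh s) powr q)*indicator {..-2} s) < \<infinity>"
proof -
 have "nn_integral lborel (%s. ennreal (abs (noise_kernel rh s) powr q)*indicator {..-2} s)
 <= nn_integral lborel (%s. ennreal (rh powr q)*(indicator {1..} (- 1 + (- 1) * s)*ennreal ((- 1 + (- 1) * s) powr (- ((1 + rh) * q)))))"
 proof (rule nn_integral_mono)
 fix s :: real
 show "ennreal (abs (noise_kernel rh s) powr q)*indicator {..-2} s <= ennreal (rh powr q)*(indicator {1..} (- 1 + (- 1) * s)*ennreal ((- 1 + (- 1) * s) powr (- ((1 + rh) * q))))"
 proof (cases "s <= - 2")
 case True
 have "abs (noise_kernel rh s) powr q <= (rh*(- 1 - s) powr (- 1 - rh)) powr q"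
 using noise_kernel_bound(2)[OF rh True] q by (intro powr_mono2) auto
 also have "... = rh powr q*(- 1 - s) powr (- ((1 + rh) * q))"
 using rh by (simp add: powr_mult powr_powr) (simp add: algebra_simps)
 finally show ?thesis using True by (simp add: ennreal_mult[symmetric] ennreal_leI)
 qed simp
 qed
 also have "... = ennreal (rh powr q)*nn_integral lborel (%s. indicator {1..} (- 1 + (- 1) * s)*ennreal ((- 1 + (- 1) * s) powr (- ((1 + rh) * q))))"
 by (rule nn_integral_cmult) measurable
 also have "nn_integral lborel (%s. indicator {1..} (- 1 + (- 1) * s)*ennreal ((- 1 + (- 1) * s) powr (- ((1 + rh) * q))))
 = nn_integral lborel (%u. indicator {1..} u*ennreal (u powr (- ((1 + rh) * q))))"
 using nn_integral_real_affine[of "%u. indicator {1..} u*ennreal (u powr (- ((1 + rh) * q)))" "-1" "-1"] by simp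
 also have "... = ennreal (- (1/(- ((1 + rh) * q) + 1)))" by (rule nn_powr_1_inf) (use q in simp)
 finally show ?thesis by (rule le_less_trans) (simp add: ennreal_mult_less_top)
qed

text \<open>On the far part \<open>{..-2}\<close> explicit approximations from below the kernel are available. Their
 domination by the kernel is what gives uniform block weights later; it is not known for the approximating
 sequence in the definition of the integral.\<close>

lemma kernel_tail_approx:
 assumes rh: "0 < rh"
 obtains et :: "nat => real => real" where "!!m. simple_integrand (et m)" "!!m s. abs (et m s) <= abs (noise_kernel rh s)*indicator {..-2} s"
 "!!s. (%m. et m s) ----> - noise_kernel rh s*indicator {..-2} s"
proof -
 let ?g = "%s. - noise_kernel rh s*indicator {..-2} s"
 have "?g \<in> borel_measurable borel" by measurable
 moreover have "0 <= ?g s" for s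
 using noise_kernel_bound(1)[OF rh, of s] by (auto simp: indicator_def)
 ultimately obtain F where F: "incseq F" "!!i. simple_function borel (F i)" "!!x. bdd_above (range (%i. F i x))" "!!i x. 0 <= F i x"
 and S: "?g = Sup (range F)"
 using borel_measurable_implies_simple_function_sequence_real[of ?g borel] by auto
 have inc: "incseq (%i. F i x)" for x using F(1) by (auto simp: incseq_def le_fun_def)
 have F5: "(%i. F i x) ----> ?g x" for x
 using LIMSEQ_incseq_SUP[OF F(3) inc, of x] fun_cong[OF S, of x] by (simp add: Sup_apply image_image)
 have Fle: "F i x <= ?g x" for i x by (rule incseq_le[OF inc F5])
 define et where "et m s = F m s*indicator {- real m<..} s" for m s
 have b: "abs (et m s) <= abs (noise_kernel rh s)*indicator {..-2} s" for m s
 using F(4)[of m s] Fle[of m s] by (auto simp: et_def indicator_def split: if_splits)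
 have "simple_integrand (et m)" for m
 proof (rule simple_integrandI)
 have [measurable]: "F m \<in> borel_measurable borel" by (rule borel_measurable_simple_function[OF F(2)])
 show "et m \<in> borel_measurable borel" unfolding et_def[abs_def] by measurable
 have "finite (range (F m))" using F(2)[of m] by (simp add: simple_function_def)
 then show "finite (range (et m))"
 by (rule_tac finite_subset[of _ "insert 0 (range (F m))"]) (auto simp: et_def indicator_def)
 have "s \<in> {- real m..-2}" if "et m s ~= 0" for s
 using that b[of m s] by (cases "s <= - 2") (auto simp: et_def indicator_def split: if_splits)
 then show "bounded {s. et m s ~= 0}" by (intro bounded_subset[OF bounded_closed_interval]) blast
 qed
 moreover have "(%m. et m s) ----> ?g s" for s
 proof -
 obtain m0 :: nat where m0: "- s < real m0" using reals_Archimedean2 by blast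
 have "\<forall>\<^sub>F m in sequentially. F m s = et m s"
 unfolding eventually_sequentially by (rule exI[of _ m0]) (use m0 in \<open>auto simp: et_def indicator_def\<close>)
 with F5[of s] show ?thesis by (simp add: tendsto_cong)
 qed
 ultimately show ?thesis using that b by blast
qed

context levy_noise_measure begin

lemma SI_indicator:
 assumes ph: "simple_integrand ph" and A: "A \<in> sets borel" and B: "B \<in> sets borel"
 shows "AE w in M. SI B (%s. ph s*indicator A s) w = SI (B \<inter> A) ph w"
proof -
 have "(%s. ph s*indicator A s*indicator B s) = (%s. ph s*indicator (B \<inter> A) s :: real)" by (auto simp: indicator_def)
 then show ?thesis
 using SI_restrict[OF simple_integrand_indicator[OF ph A] B] SI_restrict[OF ph, of "B \<inter> A"] A B by auto
qed

lemma prob_cauchy_cong: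
 assumes "!!n. Z n \<in> borel_measurable M" "!!n. W n \<in> borel_measurable M" "!!n. AE w in M. Z n w = W n w" "prob_cauchy Z"
 shows "prob_cauchy W"
proof -
 have "trunc_norm (%w. W m w - W n w) = trunc_norm (%w. Z m w - Z n w)" for m n
 proof (rule trunc_norm_cong_AE)
 show "AE w in M. W m w - W n w = Z m w - Z n w" using assms(3)[of m] assms(3)[of n] by eventually_elim simp
 qed (use assms in auto)
 then show ?thesis using assms(4) by (simp add: prob_cauchy_def)
qed

text \<open>The property that the definition of the integral demands of an approximating sequence, except for the
 pointwise limit. It is stable under the operations needed to splice and translate sequences.\<close>

definition integrable_seq :: "(nat => real => real) => bool" where
 "integrable_seq h \<longleftrightarrow> (\<forall>m. simple_integrand (h m)) & (\<forall>B\<in>sets borel. prob_cauchy (%m. SI B (h m)))"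

definition SI_tendsto :: "(nat => real => real) => ('a => real) => bool" where
 "SI_tendsto h Z \<longleftrightarrow> Z \<in> borel_measurable M & (%m. trunc_norm (%w. SI UNIV (h m) w - Z w)) ----> 0"

lemma integrable_seqD:
 assumes "integrable_seq h"
 shows "simple_integrand (h m)" "B \<in> sets borel ==> prob_cauchy (%m. SI B (h m))"
 "B \<in> sets borel ==> SI B (h m) \<in> borel_measurable M"
 using assms SI_measurable by (auto simp: integrable_seq_def)

lemma integrable_seq_diff:
 assumes h: "integrable_seq h" and k: "integrable_seq k"
 shows "integrable_seq (%m s. h m s - k m s)"
 unfolding integrable_seq_def
proof (intro conjI ballI allI)
 show s: "simple_integrand (%s. h m s - k m s)" for m by (intro simple_integrand_diff integrable_seqD(1) h k)
 show "prob_cauchy (%m. SI B (%s. h m s - k m s))" if B: "B \<in> sets borel" for B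
 by (rule prob_cauchy_diff[OF integrable_seqD(3)[OF h B] integrable_seqD(3)[OF k B] SI_measurable[OF s B]
 integrable_seqD(2)[OF h B] integrable_seqD(2)[OF k B] SI_diff[OF integrable_seqD(1)[OF h] integrable_seqD(1)[OF k] B]])
qed

lemma integrable_seq_indicator:
 assumes h: "integrable_seq h" and A: "A \<in> sets borel"
 shows "integrable_seq (%m s. h m s*indicator A s)"
 unfolding integrable_seq_def
proof (intro conjI ballI allI)
 note hs = integrable_seqD(1)[OF h]
 show s: "simple_integrand (%s. h m s*indicator A s)" for m by (intro simple_integrand_indicator hs A)
 fix B :: "real set" assume B: "B \<in> sets borel"
 have e: "AE w in M. SI (B \<inter> A) (h m) w = SI B (%s. h m s*indicator A s) w" for m
 using SI_indicator[OF hs[of m] A B] by eventually_elim simp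
 show "prob_cauchy (%m. SI B (%s. h m s*indicator A s))"
 by (rule prob_cauchy_cong[OF _ _ e integrable_seqD(2)[OF h]]) (use A B in \<open>auto intro!: SI_measurable hs s\<close>)
qed

lemma SI_tendsto_diff:
 assumes h: "integrable_seq h" "SI_tendsto h Z" and k: "integrable_seq k" "SI_tendsto k W"
 shows "SI_tendsto (%m s. h m s - k m s) (%w. Z w - W w)"
 unfolding SI_tendsto_def
proof
 note [measurable] = integrable_seqD(3)[OF h(1)] integrable_seqD(3)[OF k(1)] integrable_seqD(3)[OF integrable_seq_diff[OF h(1) k(1)]]
 have [measurable]: "Z \<in> borel_measurable M" "W \<in> borel_measurable M" using h k by (auto simp: SI_tendsto_def)
 show "(%w. Z w - W w) \<in> borel_measurable M" by measurable
 let ?b = "%m. trunc_norm (%w. SI UNIV (h m) w - Z w) + trunc_norm (%w. SI UNIV (k m) w - W w)"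
 show "(%m. trunc_norm (%w. SI UNIV (%s. h m s - k m s) w - (Z w - W w))) ----> 0"
 proof (rule Lim_null_comparison, intro always_eventually allI)
 fix m
 have e: "AE w in M. SI UNIV (%s. h m s - k m s) w - (Z w - W w) = (SI UNIV (h m) w - Z w) - (SI UNIV (k m) w - W w)"
 using SI_diff[OF integrable_seqD(1)[OF h(1), of m] integrable_seqD(1)[OF k(1), of m] sets.top[of borel]] by simp
 have "trunc_norm (%w. SI UNIV (%s. h m s - k m s) w - (Z w - W w)) = trunc_norm (%w. (SI UNIV (h m) w - Z w) - (SI UNIV (k m) w - W w))"
 by (rule trunc_norm_cong_AE[OF _ _ e]) auto
 also have "... <= ?b m" by (rule trunc_norm_diff) auto
 finally show "norm (trunc_norm (%w. SI UNIV (%s. h m s - k m s) w - (Z w - W w))) <= ?b m" by (simp add: trunc_norm_nonneg)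
 next
 have "(%m. trunc_norm (%w. SI UNIV (h m) w - Z w)) ----> 0" "(%m. trunc_norm (%w. SI UNIV (k m) w - W w)) ----> 0"
 using h(2) k(2) by (simp_all only: SI_tendsto_def)
 then show "?b ----> 0" by (rule tendsto_add_zero)
 qed
qed

lemma levy_integral_approx:
 assumes "has_levy_integral M L A g W"
 obtains th where "integrable_seq th" "AE s in lborel. (%m. th m s) ----> g s*indicator A s" "SI_tendsto th W"
proof -
 obtain La' ph where A: "A \<in> sets borel" and L': "levy_random_measure M L La'" and ph: "!!n :: nat. simple_integrand (ph n)"
 and lim: "AE s in lborel. (%n. ph n s) ----> g s"
 and conv: "!!B. B \<in> sets borel ==> \<exists>U. tendsto_in_prob M (%n. simple_integral La' B (ph n)) U"
 and W: "tendsto_in_prob M (%n. simple_integral La' A (ph n)) W"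
 using assms unfolding has_levy_integral_def by blast
 interpret L': levy_noise_measure M L ps q Kps La' by unfold_locales fact
 have eq: "AE w in M. simple_integral La' B (ph m) w = SI B (ph m) w" if "B \<in> sets borel" for B m
 using SI_unique[OF L' ph[of m] that] by auto
 let ?th = "%m s. ph m s*indicator A s"
 have "integrable_seq ph"
 unfolding integrable_seq_def
 proof (intro conjI ballI allI ph)
 fix B :: "real set" assume B: "B \<in> sets borel"
 obtain U where U: "tendsto_in_prob M (%n. simple_integral La' B (ph n)) U" using conv[OF B] by auto
 have "prob_cauchy (%n. simple_integral La' B (ph n))"
 by (rule prob_cauchyI_tendsto[OF _ _ tendsto_in_prob_trunc_norm[OF U]]) (use U in \<open>auto simp: tendsto_in_prob_def\<close>)
 then show "prob_cauchy (%m. SI B (ph m))"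
 by (rule prob_cauchy_cong[rotated -1]) (use eq[OF B] B ph in \<open>auto intro: SI_measurable L'.SI_measurable\<close>)
 qed
 then have th: "integrable_seq ?th" using A by (rule integrable_seq_indicator)
 show thesis
 proof (rule that[OF th])
 show "AE s in lborel. (%m. ?th m s) ----> g s*indicator A s"
 using lim by eventually_elim (auto intro: tendsto_mult_right)
 have "trunc_norm (%w. SI UNIV (?th m) w - W w) = trunc_norm (%w. simple_integral La' A (ph m) w - W w)" for m
 proof (rule trunc_norm_cong_AE)
 show "AE w in M. SI UNIV (?th m) w - W w = simple_integral La' A (ph m) w - W w"
 using eq[OF A, of m] SI_indicator[OF ph[of m] A, of UNIV] by auto
 qed (use W A ph th in \<open>auto simp: tendsto_in_prob_def intro!: borel_measurable_diff integrable_seqD(3) L'.SI_measurable\<close>)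
 then show "SI_tendsto ?th W" using tendsto_in_prob_trunc_norm[OF W] W by (simp add: SI_tendsto_def tendsto_in_prob_def)
 qed
qed

lemma trunc_norm_SI_diff:
 assumes "simple_integrand ph" "simple_integrand et" "B \<in> sets borel"
 shows "trunc_norm (%w. SI B ph w - SI B et w) = trunc_norm (SI B (%s. ph s - et s))"
 by (rule trunc_norm_cong_AE)
 (use SI_diff[OF assms] assms in \<open>auto intro!: borel_measurable_diff SI_measurable simple_integrand_diff\<close>)

text \<open>By the moment bound, convergence in \<open>L^q\<close> implies convergence of all integrals.\<close>

lemma integrable_seq_Lq:
 assumes h: "!!m. simple_integrand (h m)" and g[measurable]: "g \<in> borel_measurable borel"
 and lim: "(%m. \<integral>\<^sup>+s. ennreal (abs (h m s - g s) powr q) \<partial>lborel) ----> 0"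
 shows "integrable_seq h"
 unfolding integrable_seq_def prob_cauchy_def
proof (intro conjI ballI allI impI h)
 fix B :: "real set" and e :: real assume B: "B \<in> sets borel" and e: "0 < e"
 note [measurable] = simple_integrandD(2)[OF h]
 let ?d = "%m. \<integral>\<^sup>+s. ennreal (abs (h m s - g s) powr q) \<partial>lborel"
 define D where "D = Cq*(2 powr q*2)*(e/2) powr (1 - q)"
 define de where "de = e/2/(D + 1)"
 have D: "0 <= D" using Cq_nonneg by (simp add: D_def)
 then have de: "0 < de" "D*de < e/2" using e by (auto simp: de_def field_simps)
 then obtain n0 where n0: "!!n. n >= n0 ==> ?d n < ennreal de"
 using order_tendstoD(2)[OF lim, of "ennreal de"] by (auto simp: eventually_sequentially)
 show "\<exists>n0. \<forall>m\<ge>n0. \<forall>n\<ge>n0. trunc_norm (%w. SI B (h m) w - SI B (h n) w) < e"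
 proof (intro exI[of _ n0] allI impI)
 fix m n assume mn: "n0 <= m" "n0 <= n"
 let ?f = "%s. h m s - h n s"
 have f: "simple_integrand ?f" by (intro simple_integrand_diff h)
 have "nn_integral lborel (%s. ennreal (abs (?f s) powr q)*indicator B s) <= nn_integral lborel (%s. ennreal (2 powr q)*(ennreal (abs (h m s - g s) powr q) + ennreal (abs (h n s - g s) powr q)))"
 proof (rule nn_integral_mono)
 fix s
 let ?a = "abs (h m s - g s)" and ?b = "abs (h n s - g s)"
 have "abs (?f s) <= ?a + ?b" by linarith
 then have mx: "abs (?f s) <= 2*max ?a ?b" by (simp add: max_def split: if_splits)
 have "abs (?f s) powr q <= (2*max ?a ?b) powr q" using q mx by (intro powr_mono2) auto
 also have "... <= 2 powr q*(?a powr q + ?b powr q)" by (simp add: powr_mult max_def)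
 finally have "ennreal (abs (?f s) powr q) <= ennreal (2 powr q)*(ennreal (?a powr q) + ennreal (?b powr q))"
 by (simp add: ennreal_plus[symmetric] ennreal_mult[symmetric] ennreal_leI del: ennreal_plus)
 then show "ennreal (abs (?f s) powr q)*indicator B s <= ennreal (2 powr q)*(ennreal (?a powr q) + ennreal (?b powr q))"
 by (auto simp: indicator_def)
 qed
 also have "... = ennreal (2 powr q)*(?d m + ?d n)"
 by (subst nn_integral_cmult) (auto simp: nn_integral_add)
 also have "... <= ennreal (2 powr q)*(ennreal de + ennreal de)"
 using n0[OF mn(1)] n0[OF mn(2)] by (intro mult_left_mono add_mono) auto
 also have "... = ennreal (2 powr q*(2*de))"
 using de by (simp add: ennreal_plus[symmetric] ennreal_mult[symmetric] del: ennreal_plus)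
 finally have "ennreal Cq*nn_integral lborel (%s. ennreal (abs (?f s) powr q)*indicator B s) <= ennreal Cq*ennreal (2 powr q*(2*de))"
 by (rule mult_left_mono) simp
 also have "... = ennreal (Cq*(2 powr q*(2*de)))" by (rule ennreal_mult[symmetric, OF Cq_nonneg]) (use de in simp)
 finally have m1: "abs_moment M q (SI B ?f) <= ennreal (Cq*(2 powr q*(2*de)))"
 using SI_moment[OF f B] by (rule order.trans[rotated])
 have "trunc_norm (%w. SI B (h m) w - SI B (h n) w) = trunc_norm (SI B ?f)" by (rule trunc_norm_SI_diff[OF h h B])
 also have "... <= e/2 + Cq*(2 powr q*(2*de))*(e/2) powr (1 - q)"
 by (rule trunc_norm_moment[OF SI_measurable[OF f B] _ _ _ m1]) (use e q de Cq_nonneg in auto)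
 also have "... < e" using de(2) by (simp add: D_def mult.assoc mult.left_commute)
 finally show "trunc_norm (%w. SI B (h m) w - SI B (h n) w) < e" .
 qed
qed

lemma trunc_norm_SI_shift:
 assumes ph: "simple_integrand ph" and B: "B \<in> sets borel"
 shows "trunc_norm (SI B (%s. ph (s - t))) = trunc_norm (SI ((%s. s + t) -` B) ph)"
proof -
 let ?B = "(%s. s + t) -` B"
 have B': "?B \<in> sets borel" using measurable_sets[of "%s. s + t" borel borel B] B by simp
 let ?ph = "%s. ph s*indicator ?B s"
 have s: "simple_integrand ?ph" by (rule simple_integrand_indicator[OF ph B'])
 have e: "(%s. ?ph (s - t)) = (%s. ph (s - t)*indicator B s)" by (auto simp: indicator_def)
 have "trunc_norm (SI B (%s. ph (s - t))) = trunc_norm (SI UNIV (%s. ?ph (s - t)))"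
 unfolding e
 by (rule trunc_norm_cong_AE) (use SI_restrict[OF simple_integrand_shift[OF ph] B] in \<open>auto intro!: SI_measurable simple_integrand_indicator simple_integrand_shift ph B\<close>)
 also have "... = trunc_norm (SI UNIV ?ph)"
 unfolding trunc_norm_def
 by (rule SI_shift_pair[OF s s, where h="%x y. min 1 (abs x)"]) (simp add: borel_prod[symmetric])
 also have "... = trunc_norm (SI ?B ph)"
 by (rule trunc_norm_cong_AE) (use SI_restrict[OF ph B'] in \<open>auto intro!: SI_measurable s ph B'\<close>)
 finally show ?thesis .
qed

lemma integrable_seq_shift:
 assumes h: "integrable_seq h" shows "integrable_seq (%m s. h m (s - t))"
 unfolding integrable_seq_def
proof (intro conjI ballI allI)
 note hs = integrable_seqD(1)[OF h]
 show s: "simple_integrand (%s. h m (s - t))" for m by (intro simple_integrand_shift hs)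
 fix B :: "real set" assume B: "B \<in> sets borel"
 let ?B = "(%s. s + t) -` B"
 have B': "?B \<in> sets borel" using measurable_sets[of "%s. s + t" borel borel B] B by simp
 have "trunc_norm (%w. SI B (%s. h m (s - t)) w - SI B (%s. h n (s - t)) w) = trunc_norm (%w. SI ?B (h m) w - SI ?B (h n) w)" for m n
 using trunc_norm_SI_shift[OF simple_integrand_diff[OF hs[of m] hs[of n]] B, of t]
 by (simp only: trunc_norm_SI_diff[OF s s B] trunc_norm_SI_diff[OF hs hs B'])
 then show "prob_cauchy (%m. SI B (%s. h m (s - t)))" using integrable_seqD(2)[OF h B'] by (simp add: prob_cauchy_def)
qed

text \<open>Near the origin, on \<open>{-2<..0}\<close>, take the sequence that comes with the definition of \<open>Y 0
 - Y (- 1)\<close>; further away take the explicit one. The translate by \<open>t\<close> of the spliced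
 sequence and the sequence that comes with \<open>Y t - Y (t - 1)\<close> have the same pointwise limit, so
 by \<open>SI_null\<close> their integrals have the same limit too. Thus a single sequence of kernels works
 for all times, which yields stationarity and the block structure at once.\<close>

theorem noise_approx:
 assumes Y: "linear_fractional_levy_motion M L rh Y" and rh: "0 < rh"
 obtains ph where "!!m::nat. simple_integrand (ph m)" "!!m s. 0 < s ==> ph m s = 0"
 "!!m s. s <= - 2 ==> abs (ph m s) <= abs (noise_kernel rh s)"
 "!!t. (%m. trunc_norm (%w. SI UNIV (%s. ph m (s - t)) w - (Y t w - Y (t - 1) w))) ----> 0"
 "!!t. Y t \<in> borel_measurable M"
proof -
 let ?Kt = "%t s. pos_powr (t - s) (- rh) - pos_powr (- s) (- rh)"
 let ?G = "%s. - noise_kernel rh s*indicator {..-2} s"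
 have Kt: "?Kt t s*indicator {..max t 0} s = ?Kt t s" for t s by (auto simp: indicator_def pos_powr_def)
 have "\<exists>th. integrable_seq th & (AE s in lborel. (%m. th m s) ----> ?Kt t s) & SI_tendsto th (Y t)" for t
 proof -
 have "has_levy_integral M L {..max t 0} (?Kt t) (Y t)" using Y by (simp add: linear_fractional_levy_motion_def)
 then show ?thesis by (rule levy_integral_approx) (unfold Kt, blast)
 qed
 from choice[OF allI[OF this]] obtain thY where
 "\<forall>t. integrable_seq (thY t) & (AE s in lborel. (%m. thY t m s) ----> ?Kt t s) & SI_tendsto (thY t) (Y t)" ..
 then have thY: "integrable_seq (thY t)" "AE s in lborel. (%m. thY t m s) ----> ?Kt t s" "SI_tendsto (thY t) (Y t)" for t by blast+
 define th where "th t m s = thY t m s - thY (t - 1) m s" for t m s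
 have th: "integrable_seq (th t)" "SI_tendsto (th t) (%w. Y t w - Y (t - 1) w)" for t
 unfolding th_def[abs_def] by (intro integrable_seq_diff SI_tendsto_diff thY)+
 have thlim: "AE s in lborel. (%m. th t m s) ----> noise_kernel rh (s - t)" for t
 using thY(2)[of t] thY(2)[of "t - 1"]
 proof eventually_elim
 case (elim s)
 have "noise_kernel rh (s - t) = ?Kt t s - ?Kt (t - 1) s" by (simp add: noise_kernel_def algebra_simps)
 then show ?case unfolding th_def using tendsto_diff[OF elim] by simp
 qed
 obtain et where et: "!!m::nat. simple_integrand (et m)" "!!m s. abs (et m s) <= abs (noise_kernel rh s)*indicator {..-2} s"
 "!!s. (%m. et m s) ----> ?G s" using kernel_tail_approx[OF rh] by blast
 note [measurable] = simple_integrandD(2)[OF et(1)]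
 have q1: "1 < (1 + rh) * q" using q rh by (simp add: less_1_mult)
 let ?b = "%s. ennreal (2 powr q)*(ennreal (abs (noise_kernel rh s) powr q)*indicator {..-2} s)"
 have "(%m. \<integral>\<^sup>+s. ennreal (abs (et m s - ?G s) powr q) \<partial>lborel) ----> nn_integral ((lborel :: real measure)) (%s. 0)" (is "?L ----> _")
 proof (rule nn_integral_dominated_convergence[where w="?b"])
 show "AE s in lborel. ennreal (abs (et j s - ?G s) powr q) <= ?b s" for j
 proof (rule AE_I2)
 fix s
 show "ennreal (abs (et j s - ?G s) powr q) <= ?b s"
 proof (cases "s <= - 2")
 case True
 have "abs (et j s - ?G s) powr q <= (2 * abs (noise_kernel rh s)) powr q"
 using et(2)[of j s] True q by (intro powr_mono2) auto
 then show ?thesis using True by (simp add: powr_mult ennreal_mult[symmetric] ennreal_leI)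
 next
 case False then show ?thesis using et(2)[of j s] by simp
 qed
 qed
 show "nn_integral lborel (%s. ?b s) < \<infinity>"
 using kernel_tail_integrable[OF rh q1] q by (subst nn_integral_cmult) (auto simp: ennreal_mult_less_top)
 show "AE s in lborel. (%j. ennreal (abs (et j s - ?G s) powr q)) ----> 0"
 proof (rule AE_I2)
 fix s
 have "(%j. abs (et j s - ?G s) powr q) ----> 0"
 by (rule tendsto_zero_powrI[OF tendsto_rabs_zero[OF LIM_zero[OF et(3)]] tendsto_const]) (use q in auto)
 then show "(%j. ennreal (abs (et j s - ?G s) powr q)) ----> 0"
 using tendsto_ennrealI[of _ 0] by simp
 qed
 qed measurable
 then have L: "?L ----> 0" by simp
 have etc: "integrable_seq et" by (rule integrable_seq_Lq[OF et(1) _ L]) measurable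
 define ph where "ph m s = th 0 m s*indicator {-2<..0} s - et m s" for m s
 have phc: "integrable_seq ph"
 unfolding ph_def[abs_def] by (intro integrable_seq_diff integrable_seq_indicator th etc) auto
 have phlim: "AE s in lborel. (%m. ph m s) ----> noise_kernel rh s"
 using thlim[of 0]
 proof eventually_elim
 case (elim s)
 have "(%m. ph m s) ----> noise_kernel rh s*indicator {-2<..0} s - ?G s"
 unfolding ph_def using elim by (intro tendsto_diff tendsto_mult_right et(3)) simp
 moreover have "noise_kernel rh s*indicator {-2<..0} s - ?G s = noise_kernel rh s"
 by (auto simp: indicator_def noise_kernel_def pos_powr_def)
 ultimately show ?case by simp
 qed
 show thesis
 proof (rule that)
 show "simple_integrand (ph m)" for m by (rule integrable_seqD(1)[OF phc])
 show "ph m s = 0" if "0 < s" for m s using that et(2)[of m s] by (simp add: ph_def)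
 show "abs (ph m s) <= abs (noise_kernel rh s)" if "s <= - 2" for m s using that et(2)[of m s] by (simp add: ph_def)
 show "Y t \<in> borel_measurable M" for t using thY(3)[of t] by (simp add: SI_tendsto_def)
 fix t
 let ?d = "%m s. th t m s - ph m (s - t)"
 have d: "integrable_seq ?d" by (intro integrable_seq_diff integrable_seq_shift th phc)
 have "AE s in lborel. (%m. ?d m s) ----> 0"
 using AE_lborel_shift[OF phlim, of t] thlim[of t]
 proof eventually_elim
 case (elim s) show ?case using tendsto_diff[OF elim(2) elim(1)] by simp
 qed
 then have "SI_tendsto ?d (%_. 0)"
 using SI_null[OF integrable_seqD(1)[OF d] _ integrable_seqD(2)[OF d]] by (simp add: SI_tendsto_def)
 from SI_tendsto_diff[OF th[of t] d this]
 show "(%m. trunc_norm (%w. SI UNIV (%s. ph m (s - t)) w - (Y t w - Y (t - 1) w))) ----> 0"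
 by (simp add: SI_tendsto_def)
 qed
qed

end

section \<open>The bounds for a simple kernel\<close>

lemma sum_distance_le:
 fixes a :: "nat => real"
 assumes a: "summable a" "!!k. 0 <= a k" and T: "finite T"
 shows "(\<Sum>y\<in>T. a ((y - c) + (c - y))) <= 2 * suminf a"
proof -
 have part: "(\<Sum>y\<in>S. a ((y - c) + (c - y))) <= suminf a" if S: "finite S" "inj_on (%y. (y - c) + (c - y)) S" for S
 proof -
 have "(\<Sum>y\<in>S. a ((y - c) + (c - y))) = sum a ((%y. (y - c) + (c - y)) ` S)"
 using S(2) by (simp add: sum.reindex)
 also have "... <= suminf a" using S(1) a by (intro sum_le_suminf) auto
 finally show ?thesis .
 qed
 have "(\<Sum>y\<in>T. a ((y - c) + (c - y))) = (\<Sum>y\<in>{y\<in>T. y <= c}. a ((y - c) + (c - y))) + (\<Sum>y\<in>{y\<in>T. c < y}. a ((y - c) + (c - y)))"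
 using T by (subst sum.union_disjoint[symmetric]) (auto intro: sum.cong)
 also have "... <= suminf a + suminf a"
 using T by (intro add_mono part) (auto simp: inj_on_def)
 finally show ?thesis by simp
qed

text \<open>Transfer from the product space to an arbitrary probability space: the joint law of the independent vectors
 is the product of their laws, and the sums are the same function of them almost surely.\<close>

lemma (in prob_space) clt_independent_vectors:
 fixes Z :: "nat => 'a => nat => real" and X :: "nat => 'a => real"
 assumes rv: "!!j. Z j \<in> measurable M (Pi\<^sub>M {..<n} (%_. borel))"
 and ind: "indep_vars (%_. Pi\<^sub>M {..<n} (%_. borel)) Z {..<N}" and N: "0 < N"
 and f: "smooth_bounded K f" and pos: "0 < K" "0 < c0" "0 < n" and p: "2 <= p" and q: "0 <= q" "q <= p"
 and alpha: "!!t j. 0 < al t j"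
 and mom: "!!t j. t < n ==> j < N ==> al t j >= 1 | nn_integral M (%w. ennreal (abs (Z j w t) powr q)) <= ennreal (al t j powr p/2 powr (q + 1))"
 and row: "!!t. t < n ==> (\<Sum>j<N. al t j) <= A" and col: "!!j. j < N ==> (\<Sum>t<n. al t j) <= A" and A: "0 <= A"
 and X: "!!t. t < n ==> X t \<in> borel_measurable M" "!!t. t < n ==> AE w in M. X t w = (\<Sum>j<N. Z j w t)"
 and W: "W = (%w. \<Sum>t<n. f (X t w))" and Vn: "real n*c0^2 <= variance W"
 shows "normal_bounds M (%w. (W w - expectation W)/sqrt (variance W)) n p (clt_const A p (K/c0))"
proof -
 define mu where "mu j = distr M (Pi\<^sub>M {..<n} (%_. borel)) (Z j)" for j
 have pm: "prob_space (mu j)" for j unfolding mu_def by (rule prob_space_distr[OF rv])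
 have G: "(%x. x t) \<in> borel_measurable (mu j)" if "t < n" "j < N" for t j unfolding mu_def using that by simp
 have mom': "al t j >= 1 | nn_integral (mu j) (%x. ennreal (abs (x t) powr q)) <= ennreal (al t j powr p/2 powr (q + 1))"
 if t: "t < n" and j: "j < N" for t j
 proof -
 have "nn_integral (mu j) (%x. ennreal (abs (x t) powr q)) = nn_integral M (%w. ennreal (abs (Z j w t) powr q))"
 unfolding mu_def using t by (subst nn_integral_distr[OF rv]) auto
 then show ?thesis using mom[OF t j] by simp
 qed
 interpret MA: moving_average N mu n "%t j x. x t" f K c0 p q A al
 by (intro moving_average.intro indep_coords.intro moving_average_axioms.intro; fact pm G f pos p q alpha mom' row col A)
 let ?T = "%w. \<lambda>j\<in>{..<N}. Z j w"
 have Tm [measurable]: "?T \<in> measurable M (Pi\<^sub>M {..<N} mu)"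
 by (rule measurable_restrict) (use rv in \<open>simp add: mu_def\<close>)
 have law: "distr M (Pi\<^sub>M {..<N} mu) ?T = Pi\<^sub>M {..<N} mu"
 proof -
 have "distr M (Pi\<^sub>M {..<N} (%_. Pi\<^sub>M {..<n} (%_. borel))) ?T = Pi\<^sub>M {..<N} (%j. distr M (Pi\<^sub>M {..<n} (%_. borel)) (Z j))"
 by (rule indep_vars_iff_distr_eq_PiM'[THEN iffD1]) (use ind rv N in auto)
 moreover have "distr M (Pi\<^sub>M {..<N} mu) ?T = distr M (Pi\<^sub>M {..<N} (%_. Pi\<^sub>M {..<n} (%_. borel))) ?T"
 by (rule distr_cong) (auto intro!: sets_PiM_cong simp: mu_def)
 ultimately show ?thesis by (simp add: mu_def[abs_def])
 qed
 have [measurable]: "f \<in> borel_measurable borel"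
 using f unfolding smooth_bounded_def by (intro borel_measurable_continuous_onI) blast
 note [measurable] = X(1)
 have Wm [measurable]: "W \<in> borel_measurable M" unfolding W by (intro borel_measurable_sum) auto
 have MWm [measurable]: "MA.W \<in> borel_measurable (Pi\<^sub>M {..<N} mu)" using MA.bdd_W by (auto simp: bdd_meas_def)
 have WT: "AE w in M. W w = MA.W (?T w)"
 proof -
 have "AE w in M. \<forall>t\<in>{..<n}. X t w = (\<Sum>j<N. Z j w t)" using X(2) by (intro AE_finite_allI) auto
 then show ?thesis by eventually_elim (simp add: W MA.W_def MA.X_def)
 qed
 have E: "(LINT w|M. k (W w)) = (LINT x|Pi\<^sub>M {..<N} mu. k (MA.W x))" if [measurable]: "k \<in> borel_measurable borel" for k :: "real => real"
 proof -
 have "(LINT w|M. k (W w)) = (LINT w|M. k (MA.W (?T w)))"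
 by (rule integral_cong_AE) (use WT in \<open>auto intro: measurable_compose[OF Tm]\<close>)
 also have "... = (LINT x|distr M (Pi\<^sub>M {..<N} mu) ?T. k (MA.W x))"
 by (rule integral_distr[OF Tm, symmetric]) measurable
 finally show ?thesis unfolding law .
 qed
 have m': "expectation W = MA.m" unfolding MA.m_def using E[of "%x. x"] by simp
 have V': "(LINT w|M. (W w - MA.m)^2) = MA.V" unfolding MA.V_def by (rule E) measurable
 have Vn': "real n*c0^2 <= MA.V" using Vn unfolding m' V' .
 show ?thesis
 unfolding m' V'
 proof (rule normal_bounds_transfer[OF _ MA.ma_normal_bounds[OF Vn']])
 fix k :: "real => real" assume [measurable]: "k \<in> borel_measurable borel"
 show "(LINT w|M. k ((W w - MA.m)/sqrt MA.V)) = (LINT x|Pi\<^sub>M {..<N} mu. k (MA.F x))"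
 unfolding MA.F_def by (rule E) measurable
 qed
qed

text \<open>Blocks at distance at most two from the time considered get the weight one, which amounts to no condition;
 near the origin the kernel may be unbounded and its approximations are not controlled.\<close>

definition block_weight :: "real => real => nat => real" where
 "block_weight c r k = (if k <= 2 then 1 else c*real (k - 2) powr (- r))"

lemma block_weight_pos: "0 < c ==> 0 < block_weight c r k"
 by (auto simp: block_weight_def)

lemma block_weight_summable: assumes "1 < r" shows "summable (block_weight c r)"
proof -
 have "summable (%k. real k powr (- r))" using assms by (subst summable_real_powr_iff) auto
 then have "summable (%k. real (k + 1) powr (- r))" by (rule summable_ignore_initial_segment)
 then have "summable (%k. c*real (k + 1) powr (- r))" by (rule summable_mult)
 moreover have "(%k. c*real (k + 1) powr (- r)) = (%k. block_weight c r (k + 3))" by (auto simp: block_weight_def)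
 ultimately have "summable (%k. block_weight c r (k + 3))" by (simp only:)
 then show ?thesis by (rule summable_iff_shift[THEN iffD1])
qed

context levy_noise_measure begin

text \<open>Chosen so that the \<open>p\<close>-th power of the weight is the bound for the \<open>q\<close>-th moment
 of a block, with the factor \<open>2 powr (q + 1)\<close> that symmetrisation costs.\<close>

definition weight_const :: "real => real => real" where
 "weight_const rh p = (2 powr (q + 1)*(Cq*rh powr q + 1)) powr (1/p)"

definition weight_sum :: "real => real => real" where
 "weight_sum rh p = 2 * suminf (block_weight (weight_const rh p) ((1 + rh) * q/p))"

lemma block_integral_bound:
 assumes ph: "simple_integrand ph" and zero: "!!s. 0 < s ==> ph s = 0" and far: "!!s. s <= - 2 ==> abs (ph s) <= abs (noise_kernel rh s)"
 and rh: "0 < rh" and p: "2 <= p"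
 and k: "k = (j - c) + (c - j)"
 shows "block_weight (weight_const rh p) ((1 + rh) * q/p) k >= 1 \<or>
 nn_integral M (%y. ennreal (abs (SI {real j - real J<..real j + 1 - real J} (%s. ph (s - (real c - real J))) y) powr q))
 <= ennreal (block_weight (weight_const rh p) ((1 + rh) * q/p) k powr p/2 powr (q + 1))"
 (is "?w >= 1 | ?I <= ?R")
proof (cases "k <= 2")
 case True then show ?thesis by (simp add: block_weight_def)
next
 case False
 let ?B = "{real j - real J<..real j + 1 - real J}"
 let ?ph = "%s. ph (s - (real c - real J))"
 let ?D = "rh powr q*real (k - 2) powr (- ((1 + rh) * q))"
 have le: "abs (?ph s) powr q <= ?D" if s: "s \<in> ?B" for s
 proof (cases "c <= j")
 case True
 then have "real c <= real j" by simp
 then have "0 < s - (real c - real J)" using s by auto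
 then show ?thesis using zero by simp
 next
 case F: False
 then have jc: "k = c - j" using k by simp
 have kr: "real (k - 2) = real c - real j - 2" using jc False by (simp add: of_nat_diff)
 have k3: "1 <= real (k - 2)" using False by simp
 let ?s = "s - (real c - real J)"
 have s1: "real (k - 2) <= - 1 - ?s" using s kr by auto
 then have s2: "?s <= - 2" using k3 by linarith
 have "abs (?ph s) <= rh*(- 1 - ?s) powr (- 1 - rh)" using far[OF s2] noise_kernel_bound(2)[OF rh s2] by linarith
 also have "... <= rh*real (k - 2) powr (- 1 - rh)"
 using s1 k3 rh by (intro mult_left_mono powr_mono2') auto
 finally have "abs (?ph s) powr q <= (rh*real (k - 2) powr (- 1 - rh)) powr q" using q by (intro powr_mono2) auto
 also have "... = ?D" using rh by (simp add: powr_mult powr_powr) (simp add: algebra_simps)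
 finally show ?thesis .
 qed
 have "nn_integral lborel (%s. ennreal (abs (?ph s) powr q)*indicator ?B s) <= nn_integral lborel (%s. ennreal ?D*indicator ?B s)"
 by (rule nn_integral_mono) (use le in \<open>auto simp: indicator_def intro!: ennreal_leI\<close>)
 also have "... = ennreal ?D" by (subst nn_integral_cmult_indicator) auto
 finally have "ennreal Cq*nn_integral lborel (%s. ennreal (abs (?ph s) powr q)*indicator ?B s) <= ennreal Cq*ennreal ?D"
 by (rule mult_left_mono) simp
 then have "?I <= ennreal Cq*ennreal ?D"
 using SI_moment[OF simple_integrand_shift[OF ph, of "real c - real J"], of ?B] by (rule_tac order.trans) auto
 also have "... = ennreal (Cq*?D)" by (rule ennreal_mult[symmetric, OF Cq_nonneg]) simp
 also have "... <= ?R"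
 proof (rule ennreal_leI)
 have w: "?w powr p = 2 powr (q + 1)*(Cq*rh powr q + 1)*real (k - 2) powr (- ((1 + rh) * q))"
 using False p Cq_nonneg by (simp add: block_weight_def weight_const_def powr_mult powr_powr)
 have cancel: "P*Y*D/P = Y*D" if "P ~= 0" for P Y D :: real using that by simp
 have "?w powr p/2 powr (q + 1) = (Cq*rh powr q + 1)*real (k - 2) powr (- ((1 + rh) * q))"
 unfolding w by (rule cancel) simp
 moreover have "(Cq*Y + 1)*D = Cq*(Y*D) + D" for Y D :: real by (simp add: algebra_simps)
 ultimately show "Cq*?D <= ?w powr p/2 powr (q + 1)" by (simp only:) simp
 qed
 finally show ?thesis by simp
qed

text \<open>For a simple kernel with support in \<open>{- J..0}\<close> only the first \<open>J + n\<close> blocks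
 contribute. The vector of a block collects its contributions to all \<open>n\<close> times; it is a linear
 function of the values of the random measure on the joint level sets of the translated kernels within the
 block, so the vectors of different blocks are independent.\<close>

theorem noise_clt_simple:
 assumes ph: "simple_integrand ph" and zero: "!!s. 0 < s ==> ph s = 0" and far: "!!s. s <= - 2 ==> abs (ph s) <= abs (noise_kernel rh s)"
 and rh: "0 < rh" and p: "2 <= p" "p < (1 + rh) * q"
 and f: "smooth_bounded K f" and pos: "0 < K" "0 < c0" "0 < n"
 and X: "!!t. X t = SI UNIV (%s. ph (s - real (Suc t)))"
 and W: "W = (%w. \<Sum>t<n. f (X t w))" and Vn: "real n*c0^2 <= variance W"
 shows "normal_bounds M (%w. (W w - expectation W)/sqrt (variance W)) n p (clt_const (weight_sum rh p) p (K/c0))"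
proof -
 obtain R where R: "!!s. ph s ~= 0 ==> abs s <= R" using ph by (auto simp: simple_integrand_def bounded_iff)
 obtain J :: nat where J: "R < real J" using reals_Archimedean2 by blast
 define N where "N = J + n"
 define B where "B j = {real j - real J<..real j + 1 - real J}" for j
 have Bb: "B j \<in> sets borel" for j by (simp add: B_def)
 have Bd: "B i \<inter> B j = {}" if "i ~= j" for i j
 using that by (cases "i < j") (auto simp: B_def nat_neq_iff)
 let ?ph = "%t s. ph (s - real (Suc t))"
 define Ph where "Ph s = (\<lambda>t\<in>{..<n}. ?ph t s)" for s
 define v0 where "v0 = (\<lambda>t\<in>{..<n}. 0 :: real)"
 define S where "S = range Ph - {v0}"
 have finS: "finite (range Ph)"
 proof (rule finite_subset)
 show "finite (PiE {..<n} (%_. range ph))" using simple_integrandD(1)[OF ph] by (intro finite_PiE) auto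
 show "range Ph \<subseteq> PiE {..<n} (%_. range ph)" by (auto simp: Ph_def PiE_def extensional_def)
 qed
 have supp: "s \<in> {- real J<..real n}" if "Ph s ~= v0" for s
 proof -
 obtain t where t: "t < n" "ph (s - real (Suc t)) ~= 0" using \<open>Ph s ~= v0\<close> by (auto simp: Ph_def v0_def restrict_def fun_eq_iff split: if_splits)
 have "abs (s - real (Suc t)) <= R" using R[OF t(2)] .
 moreover have "s - real (Suc t) <= 0" using t(2) zero[of "s - real (Suc t)"] by (meson not_le)
 moreover have "real (Suc t) <= real n" using t(1) by simp
 moreover have "0 < real (Suc t)" by simp
 ultimately show ?thesis using J by (auto simp del: of_nat_Suc)
 qed
 have Phm: "Ph -` {v} \<in> sets borel" if v: "v \<in> range Ph" for v
 proof -
 have "Ph -` {v} = (\<Inter>t\<in>{..<n}. {s \<in> space borel. ?ph t s = v t})"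
 proof (intro set_eqI iffI)
 fix s assume "s \<in> (\<Inter>t\<in>{..<n}. {s \<in> space borel. ?ph t s = v t})"
 then have "!!t. t < n ==> ?ph t s = v t" by auto
 moreover obtain s' where "v = Ph s'" using v by auto
 ultimately have "Ph s = v" by (auto simp: Ph_def restrict_def fun_eq_iff)
 then show "s \<in> Ph -` {v}" by simp
 qed (auto simp: Ph_def)
 moreover have "(\<Inter>t\<in>{..<n}. {s \<in> space borel. ?ph t s = v t}) \<in> sets borel"
 proof (rule sets.countable_INT'')
 have [measurable]: "ph \<in> borel_measurable borel" by (rule simple_integrandD(2)[OF ph])
 show "{s \<in> space borel. ?ph t s = v t} \<in> sets borel" for t by measurable
 qed auto
 ultimately show ?thesis by simp
 qed
 have Phb: "Ph -` {v} \<in> bounded_borel" if "v ~= v0" for v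
 proof (cases "v \<in> range Ph")
 case True
 have "Ph -` {v} \<subseteq> {- real J<..real n}" using supp that by auto
 then show ?thesis by (rule bounded_borel_subset[OF Ioc_bounded_borel Phm[OF True]])
 next
 case False
 then have "Ph -` {v} = {}" by auto
 then show ?thesis by (simp add: empty_bounded_borel)
 qed
 have Ab: "B j \<inter> Ph -` {v} \<in> bounded_borel" if "v \<in> S" for j v
 using that by (intro bounded_borel_Int Phb Bb) (auto simp: S_def)
 define Z where "Z j w = (\<lambda>t\<in>{..<n}. \<Sum>v\<in>S. v t*La (B j \<inter> Ph -` {v}) w)" for j w
 have rv: "Z j \<in> measurable M (Pi\<^sub>M {..<n} (%_. borel))" for j
 unfolding Z_def[abs_def] by (intro measurable_restrict borel_measurable_sum borel_measurable_times Lam_measurable Ab) auto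
 have ind: "indep_vars (%_. Pi\<^sub>M {..<n} (%_. borel)) Z {..<N}"
 proof -
 have "indep_vars (%_. borel) (%i. La (B (fst i) \<inter> Ph -` {snd i})) ({..<N} \<times> S)"
 proof (rule Lam_indep)
 show "finite ({..<N} \<times> S)" using finS by (simp add: S_def)
 show "B (fst i) \<inter> Ph -` {snd i} \<in> bounded_borel" if "i \<in> {..<N} \<times> S" for i using that by (intro Ab) auto
 show "disjoint_family_on (%i. B (fst i) \<inter> Ph -` {snd i}) ({..<N} \<times> S)"
 unfolding disjoint_family_on_def
 proof (intro ballI impI)
 fix i i' :: "nat \<times> (nat => real)" assume "i ~= i'"
 then show "(B (fst i) \<inter> Ph -` {snd i}) \<inter> (B (fst i') \<inter> Ph -` {snd i'}) = {}"
 using Bd[of "fst i" "fst i'"] by (cases "fst i = fst i'") (auto simp: prod_eq_iff)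
 qed
 qed
 then have "indep_vars (%j. Pi\<^sub>M ({j} \<times> S) (%_. borel)) (%j w. restrict (%i. La (B (fst i) \<inter> Ph -` {snd i}) w) ({j} \<times> S)) {..<N}"
 by (rule indep_vars_restrict) (auto simp: disjoint_family_on_def)
 then have "indep_vars (%_. Pi\<^sub>M {..<n} (%_. borel)) (%j w. (%x. \<lambda>t\<in>{..<n}. \<Sum>v\<in>S. v t*x (j, v)) (restrict (%i. La (B (fst i) \<inter> Ph -` {snd i}) w) ({j} \<times> S))) {..<N}"
 proof (rule indep_vars_compose2)
 show "(%x. \<lambda>t\<in>{..<n}. \<Sum>v\<in>S. v t*x (j, v)) \<in> measurable (Pi\<^sub>M ({j} \<times> S) (%_. borel)) (Pi\<^sub>M {..<n} (%_. borel))" for j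
 by (intro measurable_restrict borel_measurable_sum borel_measurable_times) auto
 qed
 then show ?thesis by (simp add: Z_def[abs_def])
 qed
 let ?a = "block_weight (weight_const rh p) ((1 + rh) * q/p)"
 have wc: "0 < weight_const rh p"
 proof -
 have "0 < Cq*rh powr q + 1" by (intro add_nonneg_pos mult_nonneg_nonneg Cq_nonneg) auto
 then show ?thesis by (simp add: weight_const_def)
 qed
 have apos: "0 < ?a k" for k by (rule block_weight_pos[OF wc])
 have asum: "summable ?a" using p by (intro block_weight_summable) auto
 define al where "al t j = ?a ((j - (Suc t + J)) + ((Suc t + J) - j))" for t j
 have ZI: "AE w in M. Z j w t = SI (B j) (?ph t) w" if "t < n" for t j
 proof -
 have e: "?ph t = (%s. (%v. v t) (Ph s))" using that by (auto simp: Ph_def)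
 have "AE w in M. SI (B j) (%s. (%v. v t) (Ph s)) w = (\<Sum>v\<in>range Ph - {v0}. (%v. v t) v * La (B j \<inter> Ph -` {v}) w)"
 by (rule SI_atoms[OF finS Phb _ Bb]) (use that in \<open>auto simp: v0_def\<close>)
 then show ?thesis unfolding e by eventually_elim (use that in \<open>simp add: Z_def S_def\<close>)
 qed
 have mom: "al t j >= 1 | nn_integral M (%w. ennreal (abs (Z j w t) powr q)) <= ennreal (al t j powr p/2 powr (q + 1))" if t: "t < n" for t j
 proof -
 have "real (Suc t) = real (Suc t + J) - real J" by simp
 then have "al t j >= 1 | abs_moment M q (SI (B j) (?ph t)) <= ennreal (al t j powr p/2 powr (q + 1))"
 unfolding al_def B_def using block_integral_bound[OF ph zero far rh p(1) refl, of j "Suc t + J" J] by simp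
 moreover have "nn_integral M (%w. ennreal (abs (Z j w t) powr q)) = abs_moment M q (SI (B j) (?ph t))"
 by (rule nn_integral_cong_AE) (use ZI[OF t, of j] in eventually_elim, simp)
 ultimately show ?thesis by simp
 qed
 have row: "(\<Sum>j<N. al t j) <= weight_sum rh p" for t
 unfolding al_def weight_sum_def by (rule sum_distance_le[OF asum less_imp_le[OF apos]]) simp
 have col: "(\<Sum>t<n. al t j) <= weight_sum rh p" for j
 proof -
 have "(\<Sum>t<n. al t j) = (\<Sum>y\<in>(%t. Suc t + J) ` {..<n}. ?a ((y - j) + (j - y)))"
 by (subst sum.reindex) (auto simp: inj_on_def al_def add.commute)
 also have "... <= weight_sum rh p"
 unfolding weight_sum_def by (rule sum_distance_le[OF asum less_imp_le[OF apos]]) simp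
 finally show ?thesis .
 qed
 have A0: "0 <= weight_sum rh p" using suminf_nonneg[OF asum less_imp_le[OF apos]] by (simp add: weight_sum_def)
 have XZ: "AE w in M. X t w = (\<Sum>j<N. Z j w t)" if t: "t < n" for t
 proof -
 have e: "?ph t = (%s. (%v. v t) (Ph s))" using t by (auto simp: Ph_def)
 have 1: "AE w in M. SI UNIV (%s. (%v. v t) (Ph s)) w = (\<Sum>v\<in>range Ph - {v0}. (%v. v t) v * La (UNIV \<inter> Ph -` {v}) w)"
 by (rule SI_atoms[OF finS Phb]) (use t in \<open>auto simp: v0_def\<close>)
 have 2: "AE w in M. \<forall>v\<in>S. La (Ph -` {v}) w = (\<Sum>j<N. La (B j \<inter> Ph -` {v}) w)"
 proof (rule AE_finite_allI)
 show "finite S" using finS by (simp add: S_def)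
 fix v assume v: "v \<in> S"
 have "Ph -` {v} = (\<Union>j\<in>{..<N}. B j \<inter> Ph -` {v})"
 proof (intro set_eqI iffI)
 fix s assume s: "s \<in> Ph -` {v}"
 then have sJ: "- real J < s" "s <= real n" using supp[of s] v by (auto simp: S_def)
 define j where "j = nat (\<lceil>s + real J\<rceil> - 1)"
 have c1: "1 <= \<lceil>s + real J\<rceil>" using sJ by (simp add: one_le_ceiling)
 have jr: "real j = real_of_int \<lceil>s + real J\<rceil> - 1" using c1 by (simp add: j_def)
 have "\<lceil>s + real J\<rceil> <= int (n + J)" using sJ by (simp add: ceiling_le_iff)
 then have "j < N" using c1 unfolding j_def N_def by linarith
 moreover have "s \<in> B j" unfolding B_def jr using ceiling_correct[of "s + real J"] by (simp only: greaterThanAtMost_iff) linarith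
 ultimately show "s \<in> (\<Union>j\<in>{..<N}. B j \<inter> Ph -` {v})" using s by auto
 qed auto
 moreover have "AE w in M. La (\<Union>j\<in>{..<N}. B j \<inter> Ph -` {v}) w = (\<Sum>j<N. La (B j \<inter> Ph -` {v}) w)"
 by (rule Lam_UN) (use Ab[OF v] Bd in \<open>auto simp: disjoint_family_on_def\<close>)
 ultimately show "AE w in M. La (Ph -` {v}) w = (\<Sum>j<N. La (B j \<inter> Ph -` {v}) w)" by (simp only:)
 qed
 show ?thesis using 1 2
 proof eventually_elim
 case (elim w)
 have "X t w = (\<Sum>v\<in>S. v t*(\<Sum>j<N. La (B j \<inter> Ph -` {v}) w))"
 unfolding X e elim(1) S_def[symmetric] by (rule sum.cong) (use elim(2) in auto)
 also have "... = (\<Sum>j<N. \<Sum>v\<in>S. v t*La (B j \<inter> Ph -` {v}) w)"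
 unfolding sum_distrib_left by (rule sum.swap)
 finally show ?case using t by (simp add: Z_def)
 qed
 qed
 have Xm: "X t \<in> borel_measurable M" for t unfolding X by (intro SI_measurable simple_integrand_shift ph) simp
 have N: "0 < N" using pos by (simp add: N_def)
 have q': "0 <= q" "q <= p" using q p by auto
 show ?thesis
 by (rule clt_independent_vectors[OF rv ind N f pos p(1) q' _ mom row col A0 Xm XZ W Vn]) (use apos in \<open>auto simp: al_def\<close>)
qed

end

section \<open>Passage to the limit\<close>

lemma smooth_boundedD:
 assumes "smooth_bounded K f"
 shows "f \<in> borel_measurable borel" "abs (f u) <= K" "abs (f u - f v) <= K*min 1 (abs (u - v))"
 using assms unfolding smooth_bounded_def by (auto intro: borel_measurable_continuous_onI)

lemma gauss_facts: "integrable lborel gauss" "(LINT x|lborel. gauss x) = 1"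
 by (auto simp: integral_normal_density)

lemma upper_tail_gauss_complement: "(LINT x|lborel. indicator {..v} x*gauss x) = 1 - upper_tail gauss v"
proof -
 have i: "integrable lborel (%x. indicator A x*gauss x)" if "A \<in> sets borel" for A
 using integrable_real_mult_indicator[OF _ gauss_facts(1), of A] that by (simp add: mult.commute)
 have "(LINT x|lborel. gauss x) = (LINT x|lborel. indicator {..v} x*gauss x + indicator {v<..} x*gauss x)"
 by (rule bochner_cong) (auto simp: indicator_def)
 also have "... = (LINT x|lborel. indicator {..v} x*gauss x) + upper_tail gauss v"
 unfolding upper_tail_def by (rule bochner_add) (intro i; simp)+
 finally show ?thesis using gauss_facts(2) by simp
qed

lemma upper_tail_gauss_lipschitz: "x <= y ==> upper_tail gauss x - upper_tail gauss y <= y - x"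
proof -
 assume xy: "x <= y"
 have i: "integrable lborel gauss" by (rule integrable_normal_density) simp
 have "upper_tail gauss x - upper_tail gauss y = (LINT z|lborel. indicator {x<..} z*gauss z - indicator {y<..} z*gauss z)"
 unfolding upper_tail_def
 by (subst bochner_diff) (auto intro!: integrable_real_mult_indicator[OF _ i, simplified mult.commute] simp: set_lebesgue_integral_def)
 also have "... <= (LINT z|lborel. indicator {x<..y} z)"
 proof (rule integral_mono')
 show "integrable lborel (%z. indicator {x<..y} z :: real)" by (rule integrable_real_indicator) (use xy in auto)
 fix z :: real
 have "gauss z <= 1"
 proof -
 have "1/sqrt (2*pi) <= 1" using pi_gt3 by (simp add: real_le_rsqrt)
 moreover have "exp (- z\<^sup>2/2) <= 1" by simp
 ultimately have "1/sqrt (2*pi)*exp (- z\<^sup>2/2) <= 1*1" by (intro mult_mono) auto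
 then show ?thesis by (simp add: std_normal_density_def)
 qed
 then show "indicator {x<..} z*gauss z - indicator {y<..} z*gauss z <= indicator {x<..y} z"
 using xy by (auto simp: indicator_def)
 qed simp
 also have "... = y - x" using xy by simp
 finally show ?thesis .
qed

definition ramp :: "real => real => real => real" where
 "ramp de a y = min 1 (max 0 ((a - y)/de))"

lemma ramp:
 assumes de: "0 < de"
 shows "abs (ramp de a y) <= 1" "0 <= ramp de a y" "indicator {..a} y <= ramp de (a + de) y" "ramp de a y <= indicator {..a} y"
 "continuous_on UNIV (ramp de a)" "abs (de*ramp de a y - de*ramp de a z) <= abs (y - z)"
proof -
 show "abs (ramp de a y) <= 1" "0 <= ramp de a y" by (auto simp: ramp_def)
 show "indicator {..a} y <= ramp de (a + de) y" "ramp de a y <= indicator {..a} y"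
 using de by (auto simp: ramp_def indicator_def field_simps divide_le_0_iff)
 show "continuous_on UNIV (ramp de a)" unfolding ramp_def[abs_def] using de by (intro continuous_intros) auto
 have "de*ramp de a y = min de (max 0 (a - y))" for y
 using de by (auto simp: ramp_def min_def max_def field_simps)
 then show "abs (de*ramp de a y - de*ramp de a z) <= abs (y - z)" by (auto simp: min_def max_def)
qed

context prob_space begin

text \<open>A ramp of width \<open>\<delta>\<close> lies between two indicators at distance \<open>\<delta>\<close>.
 This connects indicators with the continuous functions for which limits and the Wasserstein distance are
 available.\<close>

lemma ramp_expectation:
 assumes [measurable]: "F \<in> borel_measurable M" and de: "0 < de"
 shows "(LINT w|M. indicator {..x} (F w)) <= (LINT w|M. ramp de (x + de) (F w))"
 "(LINT w|M. ramp de x (F w)) <= (LINT w|M. indicator {..x} (F w))"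
proof -
 have [measurable]: "ramp de a \<in> borel_measurable borel" for a by (rule borel_measurable_continuous_onI[OF ramp(5)[OF de]])
 have i: "integrable M (%w. ramp de a (F w))" "integrable M (%w. indicator {..x} (F w) :: real)" for a
 by (rule integrable_const_bound[where B=1]; use ramp(1)[OF de] in auto)+
 show "(LINT w|M. indicator {..x} (F w)) <= (LINT w|M. ramp de (x + de) (F w))"
 "(LINT w|M. ramp de x (F w)) <= (LINT w|M. indicator {..x} (F w))"
 by (intro integral_mono i ramp(3,4)[OF de])+
qed

text \<open>A ramp of width \<open>\<delta>\<close> has slope \<open>1 / \<delta>\<close>, which gives the first term;
 the normal law of an interval of length \<open>\<delta>\<close> gives the second.\<close>

lemma kolmogorov_le_wasserstein:
 assumes F: "F \<in> borel_measurable M" and de: "0 < de" and b: "wasserstein_le M F B"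
 shows "kolmogorov_le M F (B/de + de)"
 unfolding kolmogorov_le_def
proof
 fix x
 let ?h = "ramp de"
 have close: "abs ((LINT w|M. ?h a (F w)) - (LINT x|lborel. ?h a x*gauss x)) <= B/de" for a
 proof -
 have "abs (de*((LINT w|M. ?h a (F w)) - (LINT x|lborel. ?h a x*gauss x))) <= B"
 using b[unfolded wasserstein_le_def, rule_format, of "%y. de*?h a y", OF ramp(6)[OF de]] by (simp add: right_diff_distrib mult.assoc)
 then have "de * abs ((LINT w|M. ?h a (F w)) - (LINT x|lborel. ?h a x*gauss x)) <= B" using de by (simp only: abs_mult abs_of_pos)
 then show ?thesis using de by (simp only: pos_le_divide_eq mult.commute)
 qed
 have ig: "integrable lborel (%y. k y*gauss y)" if [measurable]: "k \<in> borel_measurable borel" and "!!y. abs (k y) <= 1" for k :: "real => real"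
 by (rule bochner_bound[OF gauss_facts(1)]) (use that in \<open>auto simp: abs_mult intro!: mult_left_le_one_le\<close>)
 have ir: "integrable lborel (%y. ?h a y*gauss y)" "integrable lborel (%y. indicator {..a} y*gauss y)" for a
 by (rule ig[OF borel_measurable_continuous_onI[OF ramp(5)[OF de]] ramp(1)[OF de]], rule ig, auto)
 have "(LINT y|lborel. ?h (x + de) y*gauss y) <= (LINT y|lborel. indicator {..x + de} y*gauss y)"
 by (intro integral_mono ir mult_right_mono ramp(4)[OF de]) simp
 moreover have "(LINT y|lborel. indicator {..x - de} y*gauss y) <= (LINT y|lborel. ?h x y*gauss y)"
 using ramp(3)[OF de, of "x - de"] by (intro integral_mono ir mult_right_mono) auto
 moreover have "upper_tail gauss x - upper_tail gauss (x + de) <= de" "upper_tail gauss (x - de) - upper_tail gauss x <= de"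
 using upper_tail_gauss_lipschitz[of x "x + de"] upper_tail_gauss_lipschitz[of "x - de" x] de by simp_all
 ultimately show "abs ((LINT w|M. indicator {..x} (F w)) - (1 - upper_tail gauss x)) <= B/de + de"
 using ramp_expectation[OF F de, of x] close[of "x + de"] close[of x] unfolding upper_tail_gauss_complement abs_le_iff by linarith
qed

text \<open>Lipschitz functions are bounded on the common range, so bounded convergence applies. For the Kolmogorov
 distance let ramps replace the indicators and then let their width tend to zero; the continuity of the
 normal distribution function absorbs the error.\<close>

lemma normal_bounds_limit:
 assumes F [measurable]: "!!k. F k \<in> borel_measurable M" and G [measurable]: "G \<in> borel_measurable M"
 and lim: "AE w in M. (%k. F k w) ----> G w" and D: "!!k w. abs (F k w) <= D"
 and b: "!!k :: nat. normal_bounds M (F k) n p C"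
 shows "normal_bounds M G n p C"
proof -
 have L: "(%k. LINT w|M. g (F k w)) ----> (LINT w|M. g (G w))"
 if c: "continuous_on UNIV g" and g: "!!y. abs y <= D ==> abs (g y) <= D'" for g :: "real => real" and D'
 proof (rule integral_dominated_convergence[where w="%_. D'"])
 have [measurable]: "g \<in> borel_measurable borel" by (rule borel_measurable_continuous_onI[OF c])
 show "(%w. g (G w)) \<in> borel_measurable M" "(%w. g (F k w)) \<in> borel_measurable M" for k by measurable
 show "AE w in M. (%k. g (F k w)) ----> g (G w)"
 using lim by eventually_elim (use continuous_on_tendsto_compose[OF c] in auto)
 qed (use D g in auto)
 have 1: "wasserstein_le M G B" if B: "!!k. wasserstein_le M (F k) B" for B
 unfolding wasserstein_le_def
 proof (intro allI impI)
 fix g :: "real => real" assume lip: "\<forall>x y. abs (g x - g y) <= abs (x - y)"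
 have "abs (g y) <= abs (g 0) + D" if "abs y <= D" for y using lip[rule_format, of y 0] that by simp
 moreover have "continuous_on UNIV g" by (rule lipschitz_growth(3)) (use lip in blast)
 ultimately have "(%k. abs ((LINT w|M. g (F k w)) - c)) ----> abs ((LINT w|M. g (G w)) - c)" for c
 by (intro tendsto_intros L)
 then show "abs ((LINT w|M. g (G w)) - gauss_mean g) <= B"
 by (rule tendsto_upperbound) (use B lip in \<open>auto simp: wasserstein_le_def\<close>)
 qed
 have 2: "kolmogorov_le M G B" if B: "!!k. kolmogorov_le M (F k) B" for B
 unfolding kolmogorov_le_def
 proof
 fix x
 have "abs ((LINT w|M. indicator {..x} (G w)) - (1 - upper_tail gauss x)) <= B + de" if de: "0 < de" for de
 proof -
 have l: "(%k. LINT w|M. ramp de a (F k w)) ----> (LINT w|M. ramp de a (G w))" for a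
 by (rule L[OF ramp(5)[OF de] ramp(1)[OF de]])
 have "(LINT w|M. ramp de (x + de) (F k w)) <= 1 - upper_tail gauss (x + de) + B" for k
 using B[of k, unfolded kolmogorov_le_def, rule_format, of "x + de"] ramp_expectation(2)[OF F[of k] de, of "x + de"] by linarith
 then have "(LINT w|M. ramp de (x + de) (G w)) <= 1 - upper_tail gauss (x + de) + B" by (intro LIMSEQ_le_const2[OF l]) auto
 moreover have "1 - upper_tail gauss (x - de) - B <= (LINT w|M. ramp de x (F k w))" for k
 using B[of k, unfolded kolmogorov_le_def, rule_format, of "x - de"] ramp_expectation(1)[OF F[of k] de, of "x - de"] by (simp add: abs_le_iff)
 then have "1 - upper_tail gauss (x - de) - B <= (LINT w|M. ramp de x (G w))" by (intro LIMSEQ_le_const[OF l]) auto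
 moreover have "upper_tail gauss x - upper_tail gauss (x + de) <= de" "upper_tail gauss (x - de) - upper_tail gauss x <= de"
 using upper_tail_gauss_lipschitz[of x "x + de"] upper_tail_gauss_lipschitz[of "x - de" x] de by simp_all
 ultimately show ?thesis using ramp_expectation[OF G de, of x] unfolding abs_le_iff by linarith
 qed
 then show "abs ((LINT w|M. indicator {..x} (G w)) - (1 - upper_tail gauss x)) <= B" by (rule field_le_epsilon)
 qed
 show ?thesis using b 1 2 by (simp add: normal_bounds_def)
qed

text \<open>For finitely many sequences at once: the sum of the truncated differences tends to zero in
 \<open>L^1\<close>.\<close>

lemma AE_subseq_of_trunc_norm:
 fixes Z :: "nat => 'i => 'a => real"
 assumes I: "finite I" and [measurable]: "!!k t. Z k t \<in> borel_measurable M" "!!t. X t \<in> borel_measurable M"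
 and lim: "!!t. t \<in> I ==> (%k. trunc_norm (%w. Z k t w - X t w)) ----> 0"
 obtains r :: "nat => nat" where "AE w in M. \<forall>t\<in>I. (%k. Z (r k) t w) ----> X t w"
proof -
 let ?d = "%k t w. min 1 (abs (Z k t w - X t w))"
 have i: "integrable M (?d k t)" for k t by (rule trunc_integrable) measurable
 have "(LINT w|M. norm (\<Sum>t\<in>I. ?d k t w)) = (\<Sum>t\<in>I. trunc_norm (%w. Z k t w - X t w))" for k
 proof -
 have "norm (\<Sum>t\<in>I. ?d k t w) = (\<Sum>t\<in>I. ?d k t w)" for w by (simp add: sum_nonneg)
 then show ?thesis unfolding trunc_norm_def by (simp only: bochner_sum[OF i])
 qed
 then have "(%k. LINT w|M. norm (\<Sum>t\<in>I. ?d k t w)) ----> 0" by (simp only:) (rule tendsto_null_sum[OF lim])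
 from tendsto_L1_AE_subseq[OF bochner_int_sum[OF i] this]
 obtain r :: "nat => nat" where r: "AE w in M. (%k. \<Sum>t\<in>I. ?d (r k) t w) ----> 0" by blast
 show thesis
 proof (rule that, use r in eventually_elim, rule ballI)
 fix w t assume s: "(%k. \<Sum>t\<in>I. ?d (r k) t w) ----> 0" and t: "t \<in> I"
 have "(%k. ?d (r k) t w) ----> 0"
 by (rule tendsto_sandwich[OF _ _ tendsto_const s]) (use t I in \<open>auto intro!: always_eventually member_le_sum\<close>)
 moreover from order_tendstoD(2)[OF this, of 1] have "\<forall>\<^sub>F k in sequentially. ?d (r k) t w = abs (Z (r k) t w - X t w)"
 by (auto elim!: eventually_mono)
 ultimately have "(%k. abs (Z (r k) t w - X t w)) ----> 0" by (rule Lim_transform_eventually)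
 then show "(%k. Z (r k) t w) ----> X t w" by (simp add: tendsto_rabs_zero_iff LIM_zero_cancel)
 qed
qed

text \<open>Mean, variance and hence the standardised sum are continuous under almost sure convergence of the summands,
 by bounded convergence.\<close>

lemma normalised_sum_limit:
 fixes Z :: "nat => nat => 'a => real" and f :: "real => real"
 assumes f: "smooth_bounded K f" and [measurable]: "!!k t. Z k t \<in> borel_measurable M" "!!t. X t \<in> borel_measurable M"
 and lim: "AE w in M. \<forall>t\<in>{..<n}. (%k. Z k t w) ----> X t w"
 and S: "!!k. S k = (%w. \<Sum>t<n. f (Z k t w))" "T = (%w. \<Sum>t<n. f (X t w))"
 shows "(%k. variance (S k)) ----> variance T" "abs (S k w - expectation (S k)) <= 2*(n*K)"
 "0 < variance T ==> AE w in M. (%k. (S k w - expectation (S k))/sqrt (variance (S k))) ----> (T w - expectation T)/sqrt (variance T)"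
proof -
 note [measurable] = smooth_boundedD(1)[OF f]
 have Sm [measurable]: "S k \<in> borel_measurable M" "T \<in> borel_measurable M" for k unfolding S by measurable
 have fc: "continuous_on UNIV f" using f by (simp add: smooth_bounded_def)
 have Sl: "AE w in M. (%k. S k w) ----> T w"
 using lim by eventually_elim (auto simp: S intro!: tendsto_sum continuous_on_tendsto_compose[OF fc])
 have Sb: "abs (S k w) <= n*K" for k w
 proof -
 have "abs (S k w) <= (\<Sum>t<n. abs (f (Z k t w)))" unfolding S by (rule sum_abs)
 also have "... <= (\<Sum>t<n. K)" by (intro sum_mono smooth_boundedD(2)[OF f])
 finally show ?thesis by simp
 qed
 have m: "(%k. expectation (S k)) ----> expectation T"
 by (rule integral_dominated_convergence[where w="%_. n*K"]) (use Sl Sb in auto)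
 have mb: "abs (expectation (S k)) <= n*K" for k
 proof -
 have "abs (expectation (S k)) <= (LINT w|M. abs (S k w))" by (rule integral_abs_bound)
 also have "... <= (LINT w|M. n*K)"
 by (intro integral_mono integrable_abs Sb integrable_const_bound[of "S k" "n*K"]) (use Sb[of k] in auto)
 finally show ?thesis by (simp add: prob_space)
 qed
 show b: "abs (S k w - expectation (S k)) <= 2*(n*K)" for k w using Sb[of k w] mb[of k] by linarith
 show v: "(%k. variance (S k)) ----> variance T"
 proof (rule integral_dominated_convergence[where w="%_. (2*(n*K))^2"])
 show "AE w in M. (%k. (S k w - expectation (S k))^2) ----> (T w - expectation T)^2"
 using Sl by eventually_elim (intro tendsto_intros m)
 show "AE w in M. norm ((S k w - expectation (S k))^2) <= (2*(n*K))^2" for k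
 by (intro AE_I2) (use power_mono[OF b abs_ge_zero, of k _ 2] in \<open>simp only: real_norm_def power2_abs abs_power2\<close>)
 qed auto
 show "AE w in M. (%k. (S k w - expectation (S k))/sqrt (variance (S k))) ----> (T w - expectation T)/sqrt (variance T)" if "0 < variance T"
 using Sl by eventually_elim (intro tendsto_intros m v, use that in auto)
qed

end

section \<open>Stationarity and the growth of the variance\<close>

abbreviation (input) autocov_sum :: "(int => real) => nat => real" where
 "autocov_sum c n == \<Sum>s<n. \<Sum>t<n. c (int t - int s)"

text \<open>Passing from \<open>n\<close> to \<open>n + 1\<close> adds one row, one column and the diagonal entry, which
 together form a symmetric partial sum.\<close>

lemma sum_telescope_symmetric:
 fixes \<gamma> :: "int => real"
 shows "autocov_sum \<gamma> n = (\<Sum>j<n. \<Sum>k\<in>{- int j..int j}. \<gamma> k)"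
proof (induction n)
 case (Suc n)
 let ?A = "(%i. int n - int i) ` {..<n}" and ?B = "(%i. int i - int n) ` {..<n}"
 have e: "{- int n..int n} = insert 0 (?A \<union> ?B)"
 proof (intro set_eqI iffI)
 fix k assume k: "k \<in> {- int n..int n}"
 show "k \<in> insert 0 (?A \<union> ?B)"
 proof (cases "k = 0")
 case False
 show ?thesis
 proof (cases "0 < k")
 case True
 then have "k = int n - int (nat (int n - k))" "nat (int n - k) < n" using k by auto
 then have "k \<in> ?A" by (rule image_eqI[OF _ lessThan_iff[THEN iffD2]])
 then show ?thesis by simp
 next
 case F: False
 then have "k = int (nat (int n + k)) - int n" "nat (int n + k) < n" using k False by auto
 then have "k \<in> ?B" by (rule image_eqI[OF _ lessThan_iff[THEN iffD2]])
 then show ?thesis by simp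
 qed
 qed simp
 qed auto
 have "(\<Sum>k\<in>{- int n..int n}. \<gamma> k) = \<gamma> 0 + ((\<Sum>k\<in>?A. \<gamma> k) + (\<Sum>k\<in>?B. \<gamma> k))"
 unfolding e by (subst sum.insert, simp, force, subst sum.union_disjoint) auto
 also have "(\<Sum>k\<in>?A. \<gamma> k) = (\<Sum>s<n. \<gamma> (int n - int s))" by (subst sum.reindex) (auto simp: inj_on_def)
 also have "(\<Sum>k\<in>?B. \<gamma> k) = (\<Sum>t<n. \<gamma> (int t - int n))" by (subst sum.reindex) (auto simp: inj_on_def)
 finally have S: "(\<Sum>k\<in>{- int n..int n}. \<gamma> k) = \<gamma> 0 + ((\<Sum>s<n. \<gamma> (int n - int s)) + (\<Sum>t<n. \<gamma> (int t - int n)))" .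
 have "autocov_sum \<gamma> (Suc n) = autocov_sum \<gamma> n + (\<Sum>s<n. \<gamma> (int n - int s)) + ((\<Sum>t<n. \<gamma> (int t - int n)) + \<gamma> 0)"
 by (simp add: sum.distrib)
 then show ?case using Suc S by simp
qed simp

lemma sum_lower_linear:
 fixes S :: "nat => real"
 assumes lim: "S ----> l" and l: "0 < l"
 shows "\<exists>c>0. \<exists>n0. \<forall>n\<ge>n0. real n*c <= (\<Sum>j<n. S j)"
proof -
 obtain J where J: "!!j. j >= J ==> l/2 < S j"
 using order_tendstoD(1)[OF lim, of "l/2"] l by (auto simp: eventually_sequentially)
 define D where "D = (\<Sum>j<J. S j)"
 have low: "D + real (n - J)*(l/2) <= (\<Sum>j<n. S j)" if "J <= n" for n
 using that
 proof (induction n rule: dec_induct)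
 case base then show ?case by (simp add: D_def)
 next
 case (step n)
 have "real (Suc n - J) = real (n - J) + 1" using step.hyps by (simp add: Suc_diff_le)
 then have "real (Suc n - J)*(l/2) = real (n - J)*(l/2) + l/2" by (simp only: distrib_right mult_1)
 moreover have "l/2 < S n" using J[of n] step.hyps by simp
 ultimately show ?case using step.IH unfolding sum.lessThan_Suc by linarith
 qed
 obtain n1 :: nat where n1: "4/l*(abs D + real J*(l/2)) <= real n1" using real_arch_simple by blast
 have "real n*(l/4) <= (\<Sum>j<n. S j)" if n: "max J n1 <= n" for n
 proof -
 have "4/l*(abs D + real J*(l/2)) <= real n" using n1 n by (meson max.boundedE of_nat_le_iff order.trans)
 then have "abs D + real J*(l/2) <= real n*(l/4)" using l by (simp add: field_simps)
 moreover have "real (n - J)*(l/2) = real n*(l/4) + real n*(l/4) - real J*(l/2)" using n by (simp add: of_nat_diff field_simps)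
 moreover have "D + real (n - J)*(l/2) <= (\<Sum>j<n. S j)" using low[of n] n by simp
 ultimately show ?thesis by linarith
 qed
 then show ?thesis using l by (intro exI[of _ "l/4"] conjI exI[of _ "max J n1"] allI impI) simp_all
qed

text \<open>The symmetric partial sums converge to a positive limit, so their sums grow linearly. The finitely many
 remaining \<open>n\<close> with positive variance only change the constant.\<close>

lemma sum_variance_lower:
 fixes \<gamma> :: "int => real"
 assumes pos: "0 < (\<Sum>\<^sub>\<infinity>k. \<gamma> k)"
 shows "\<exists>c>0. \<forall>n. 0 < autocov_sum \<gamma> n --> real n*c^2 <= autocov_sum \<gamma> n"
proof -
 define T where "T n = autocov_sum \<gamma> n" for n
 have "\<gamma> summable_on UNIV" using pos infsum_not_exists by fastforce
 then have "(\<gamma> has_sum (\<Sum>\<^sub>\<infinity>k. \<gamma> k)) UNIV" by (rule has_sum_infsum)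
 then have l: "(sum \<gamma> \<longlongrightarrow> (\<Sum>\<^sub>\<infinity>k. \<gamma> k)) (finite_subsets_at_top UNIV)" by (simp add: has_sum_def)
 have "filterlim (%j. {- int j..int j}) (finite_subsets_at_top UNIV) sequentially"
 unfolding filterlim_finite_subsets_at_top
 proof (intro allI impI)
 fix A :: "int set" assume A: "finite A & A \<subseteq> UNIV"
 have B: "!!k. k \<in> A ==> abs k <= Max (abs ` A)" using A by (intro Max_ge) auto
 define B where "B = Max (abs ` A)"
 show "\<forall>\<^sub>F j in sequentially. finite {- int j..int j} & A \<subseteq> {- int j..int j} & {- int j..int j} \<subseteq> UNIV"
 unfolding eventually_sequentially
 proof (intro exI[of _ "nat B"] allI impI conjI)
 fix j assume "nat B <= j"
 then have "B <= int j" by simp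
 then show "A \<subseteq> {- int j..int j}" using B unfolding B_def[symmetric] by fastforce
 qed auto
 qed
 from filterlim_compose[OF l this] have "(%j. \<Sum>k\<in>{- int j..int j}. \<gamma> k) ----> (\<Sum>\<^sub>\<infinity>k. \<gamma> k)" .
 from sum_lower_linear[OF this pos] obtain c n0 where c: "0 < c" "!!n. n >= n0 ==> real n*c <= T n"
 unfolding T_def sum_telescope_symmetric by blast
 have T0: "T 0 = 0" by (simp add: T_def)
 define S where "S = insert c ((%n. T n/real n) ` {n. n < n0 & 0 < T n})"
 have fin: "finite S" by (simp add: S_def)
 have Spos: "0 < x" if x: "x \<in> S" for x
 proof (cases "x = c")
 case False
 then obtain n where n: "0 < T n" "x = T n/real n" using x unfolding S_def by blast
 moreover have "0 < n" using n(1) T0 by (cases n) auto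
 ultimately show ?thesis by simp
 qed (use c in simp)
 define d where "d = Min S"
 have ne: "S ~= {}" unfolding S_def by (rule insert_not_empty)
 have d: "0 < d" unfolding d_def Min_gr_iff[OF fin ne] by (intro ballI Spos)
 show ?thesis
 unfolding T_def[symmetric]
 proof (intro exI[of _ "sqrt d"] conjI allI impI)
 show "0 < sqrt d" using d by simp
 fix n assume Tn: "0 < T n"
 then have n: "0 < real n" using T0 by (cases n) auto
 have "real n*d <= T n"
 proof (cases "n0 <= n")
 case True
 have "d <= c" unfolding d_def by (rule Min_le[OF fin]) (simp add: S_def)
 then have "real n*d <= real n*c" using n by simp
 then show ?thesis using c(2)[OF True] by linarith
 next
 case False
 have "d <= T n/real n" unfolding d_def by (rule Min_le[OF fin]) (use False Tn in \<open>auto simp: S_def\<close>)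
 then show ?thesis using n by (simp add: field_simps)
 qed
 then show "real n*(sqrt d)^2 <= T n" using d by simp
 qed
qed

locale fractional_noise = levy_noise_measure +
 fixes rh :: real and Y :: "real => 'a => real" and f :: "real => real" and K :: real
 assumes Y: "linear_fractional_levy_motion M L rh Y" and rh: "0 < rh" and f: "smooth_bounded K f" and K: "0 < K"
begin

definition X :: "real => 'a => real" where "X t w = Y t w - Y (t - 1) w"

definition is_approximant :: "(nat => real => real) => bool" where
 "is_approximant ph \<longleftrightarrow> (\<forall>k. simple_integrand (ph k)) & (\<forall>k s. 0 < s --> ph k s = 0) \<and>
 (\<forall>k s. s <= - 2 --> abs (ph k s) <= abs (noise_kernel rh s)) \<and>
 (\<forall>t. (%k. trunc_norm (%w. SI UNIV (%s. ph k (s - t)) w - X t w)) ----> 0)"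

text \<open>One sequence is fixed for all times, since translates of the same kernels are compared.\<close>

definition approximant :: "nat => real => real" where "approximant = (SOME ph. is_approximant ph)"

lemma approximant:
 "simple_integrand (approximant k)" "0 < s ==> approximant k s = 0"
 "s <= - 2 ==> abs (approximant k s) <= abs (noise_kernel rh s)"
 "(%k. trunc_norm (%w. SI UNIV (%s. approximant k (s - t)) w - X t w)) ----> 0"
proof -
 have "\<exists>ph. is_approximant ph"
 proof (rule noise_approx[OF Y rh])
 fix ph assume "!!m::nat. simple_integrand (ph m)" "!!m s. 0 < s ==> ph m s = 0"
 "!!m s. s <= - 2 ==> abs (ph m s) <= abs (noise_kernel rh s)"
 "!!t. (%m. trunc_norm (%w. SI UNIV (%s. ph m (s - t)) w - (Y t w - Y (t - 1) w))) ----> 0"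
 then have "is_approximant ph" unfolding is_approximant_def X_def by simp
 then show "\<exists>ph. is_approximant ph" by (rule exI[of is_approximant])
 qed
 from someI_ex[OF this] have "is_approximant approximant" unfolding approximant_def .
 then show "simple_integrand (approximant k)" "0 < s ==> approximant k s = 0"
 "s <= - 2 ==> abs (approximant k s) <= abs (noise_kernel rh s)"
 "(%k. trunc_norm (%w. SI UNIV (%s. approximant k (s - t)) w - X t w)) ----> 0"
 unfolding is_approximant_def by simp_all
qed

lemma X_meas [measurable]: "X t \<in> borel_measurable M"
proof (rule noise_approx[OF Y rh])
 assume "!!t. Y t \<in> borel_measurable M"
 then show ?thesis unfolding X_def[abs_def] by (intro borel_measurable_diff)
qed

lemmas fD = smooth_boundedD[OF f]
lemmas [measurable] = fD(1)

text \<open>The integrals of translated simple kernels have the translated joint law; continuous bounded functions pass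
 to the limit.\<close>

lemma X_stationary:
 fixes h :: "real => real => real"
 assumes h: "continuous_on UNIV (%z. h (fst z) (snd z))" and hb: "!!x y. abs (h x y) <= D"
 shows "(LINT w|M. h (X s w) (X t w)) = (LINT w|M. h (X 0 w) (X (t - s) w))"
proof -
 let ?Z = "%k t. SI UNIV (%s. approximant k (s - t))"
 note ph = approximant(1)
 have m [measurable]: "?Z k t \<in> borel_measurable M" for k t by (intro SI_measurable simple_integrand_shift ph) simp
 have hm [measurable]: "(%z. h (fst z) (snd z)) \<in> borel_measurable (borel :: (real \<times> real) measure)"
 by (rule borel_measurable_continuous_onI[OF h])
 have hM: "(%w. h (A w) (B w)) \<in> borel_measurable M" if "A \<in> borel_measurable M" "B \<in> borel_measurable M" for A B
 using measurable_compose[OF borel_measurable_Pair[OF that] hm] by simp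
 obtain r :: "nat => nat" where r: "AE w in M. \<forall>u\<in>{s, t, 0, t - s}. (%k. ?Z (r k) u w) ----> X u w"
 by (rule AE_subseq_of_trunc_norm[of "{s, t, 0, t - s}" ?Z X]) (use approximant(4) m in auto)
 have l: "(%k. LINT w|M. h (?Z (r k) u w) (?Z (r k) v w)) ----> (LINT w|M. h (X u w) (X v w))"
 if "u \<in> {s, t, 0, t - s}" "v \<in> {s, t, 0, t - s}" for u v
 proof (rule integral_dominated_convergence[where w="%_. D"])
 show "AE w in M. (%k. h (?Z (r k) u w) (?Z (r k) v w)) ----> h (X u w) (X v w)"
 using r
 proof eventually_elim
 case (elim w)
 have "(%k. (?Z (r k) u w, ?Z (r k) v w)) ----> (X u w, X v w)" using elim that by (intro tendsto_Pair) blast+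
 from continuous_on_tendsto_compose[OF h this] show ?case by simp
 qed
 qed (use hb in \<open>auto intro!: hM\<close>)
 have "(LINT w|M. h (?Z k s w) (?Z k t w)) = (LINT w|M. h (?Z k 0 w) (?Z k (t - s) w))" for k
 proof -
 have "r - s - (t - s) = r - t" for r by simp
 then show ?thesis using SI_shift_pair[OF ph[of k] simple_integrand_shift[OF ph[of k], of "t - s"] hm, of s] by (simp only: diff_zero)
 qed
 with l[of s t] have "(%k. LINT w|M. h (?Z (r k) 0 w) (?Z (r k) (t - s) w)) ----> (LINT w|M. h (X s w) (X t w))" by simp
 from LIMSEQ_unique[OF this l] show ?thesis by simp
qed

lemma fX_int: "integrable M (%w. f (X t w))"
 by (rule integrable_const_bound[where B=K]) (use fD(2) in auto)

lemma f_cont: "continuous_on UNIV f" using f by (simp add: smooth_bounded_def)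

lemma fX_mean: "(LINT w|M. f (X t w)) = (LINT w|M. f (X 0 w))"
 by (rule X_stationary[where h="%x y. f x" and D=K and t=t])
 (auto intro!: continuous_on_compose2[OF f_cont] continuous_intros fD)

lemma covariance_eq: "covariance M (%w. f (X s w)) (%w. f (X t w)) = (LINT w|M. f (X s w)*f (X t w)) - (LINT w|M. f (X 0 w))^2"
proof -
 let ?c = "LINT w|M. f (X 0 w)"
 have i: "integrable M (%w. f (X s w)*f (X t w))"
 by (rule integrable_const_bound[where B="K*K"]) (use fD(2) K in \<open>auto simp: abs_mult intro!: mult_mono\<close>)
 have "covariance M (%w. f (X s w)) (%w. f (X t w)) = (LINT w|M. f (X s w)*f (X t w) - ?c*f (X s w) - ?c*f (X t w) + ?c*?c)"
 unfolding covariance_def fX_mean[of s] fX_mean[of t] by (simp add: algebra_simps)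
 also have "... = (LINT w|M. f (X s w)*f (X t w)) - ?c*(LINT w|M. f (X s w)) - ?c*(LINT w|M. f (X t w)) + ?c*?c"
 using i fX_int by (simp add: prob_space)
 finally show ?thesis unfolding fX_mean[of s] fX_mean[of t] by (simp add: power2_eq_square)
qed

lemma covariance_stationary:
 "covariance M (%w. f (X s w)) (%w. f (X t w)) = covariance M (%w. f (X 0 w)) (%w. f (X (t - s) w))"
 unfolding covariance_eq
proof -
 have "(LINT w|M. f (X s w)*f (X t w)) = (LINT w|M. f (X 0 w)*f (X (t - s) w))"
 proof (rule X_stationary[where h="%x y. f x*f y" and D="K*K"])
 show "abs (f x*f y) <= K*K" for x y using fD(2) K by (auto simp: abs_mult intro!: mult_mono)
 qed (intro continuous_on_compose2[OF f_cont] continuous_intros; simp)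
 then show "(LINT w|M. f (X s w)*f (X t w)) - (LINT w|M. f (X 0 w))^2 = (LINT w|M. f (X 0 w)*f (X (t - s) w)) - (LINT w|M. f (X 0 w))^2" by simp
qed

definition \<gamma> :: "int => real" where "\<gamma> k = covariance M (%w. f (X 0 w)) (%w. f (X (of_int k) w))"

definition W :: "nat => 'a => real" where "W n w = (\<Sum>t<n. f (X (real (Suc t)) w))"
definition mW :: "nat => real" where "mW n = (LINT w|M. W n w)"
definition VW :: "nat => real" where "VW n = (LINT w|M. (W n w - mW n)^2)"

lemma mW: "mW n = real n*(LINT w|M. f (X 1 w))"
proof -
 have "mW n = (\<Sum>t<n. LINT w|M. f (X (real (Suc t)) w))"
 unfolding mW_def W_def by (rule bochner_sum) (rule fX_int)
 also have "... = (\<Sum>t<n. LINT w|M. f (X 1 w))"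
 by (rule sum.cong[OF refl]) (rule trans[OF fX_mean fX_mean[symmetric]])
 finally show ?thesis by simp
qed

lemma VW: "VW n = autocov_sum \<gamma> n"
proof -
 let ?c = "LINT w|M. f (X 0 w)"
 let ?d = "%s w. f (X (real (Suc s)) w) - ?c"
 have c: "abs ?c <= K"
 proof -
 have "abs ?c <= (LINT w|M. abs (f (X 0 w)))" by (rule integral_abs_bound)
 also have "... <= (LINT w|M. K)" by (intro integral_mono integrable_abs fX_int fD(2)) auto
 finally show ?thesis by (simp add: prob_space)
 qed
 have db: "abs (?d s w) <= 2*K" for s w using fD(2)[of "X (real (Suc s)) w"] c by linarith
 have i: "integrable M (%w. ?d s w*?d t w)" for s t
 proof (rule integrable_const_bound[where B="(2*K)*(2*K)"])
 show "AE w in M. norm (?d s w*?d t w) <= (2*K)*(2*K)"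
 unfolding real_norm_def abs_mult using K by (intro AE_I2 mult_mono db) auto
 qed measurable
 have "W n w - mW n = (\<Sum>s<n. ?d s w)" for w
 unfolding W_def mW fX_mean[of 1] by (simp add: sum_subtractf)
 then have "VW n = (LINT w|M. (\<Sum>s<n. \<Sum>t<n. ?d s w*?d t w))"
 unfolding VW_def by (simp only: power2_eq_square sum_product)
 also have "... = (\<Sum>s<n. \<Sum>t<n. LINT w|M. ?d s w*?d t w)"
 by (subst bochner_sum, intro bochner_int_sum i, rule sum.cong[OF refl],
 rule bochner_sum, rule i)
 also have "... = autocov_sum \<gamma> n"
 proof (intro sum.cong refl)
 fix s t
 have "(LINT w|M. ?d s w*?d t w) = covariance M (%w. f (X (real (Suc s)) w)) (%w. f (X (real (Suc t)) w))"
 unfolding covariance_def fX_mean[of "real (Suc s)"] fX_mean[of "real (Suc t)"] ..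
 also have "... = \<gamma> (int t - int s)" unfolding \<gamma>_def covariance_stationary[of "real (Suc s)" "real (Suc t)"] by simp
 finally show "(LINT w|M. ?d s w*?d t w) = \<gamma> (int t - int s)" .
 qed
 finally show ?thesis .
qed

theorem variance_lower:
 assumes "0 < (\<Sum>\<^sub>\<infinity>k. \<gamma> k)"
 shows "\<exists>c>0. \<forall>n. 0 < VW n --> real n*c^2 <= VW n"
 unfolding VW by (rule sum_variance_lower[OF assms])

text \<open>The variances of the approximating sums converge, so eventually they satisfy the lower bound with \<open>c /
 2\<close> in place of \<open>c\<close>; the bounds for simple kernels then hold with constants that do not
 depend on the approximation, and pass to the limit.\<close>

theorem noise_clt:
 assumes p: "2 <= p" "p < (1 + rh) * q" and pos: "0 < c" "0 < n" and Vn: "real n*c^2 <= VW n"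
 shows "normal_bounds M (%w. (W n w - mW n)/sqrt (VW n)) n p (clt_const (weight_sum rh p) p (K/(c/2)))"
proof -
 note ph = approximant
 define Z where "Z k t = SI UNIV (%s. approximant k (s - real (Suc t)))" for k t
 have Zm: "Z k t \<in> borel_measurable M" for k t unfolding Z_def by (rule SI_measurable[OF simple_integrand_shift[OF ph(1)]]) simp
 obtain r where r: "AE w in M. \<forall>t\<in>{..<n}. (%k. Z (r k) t w) ----> X (real (Suc t)) w"
 by (rule AE_subseq_of_trunc_norm[of "{..<n}" Z "%t. X (real (Suc t))"]) (use Zm ph(4) X_meas in \<open>auto simp: Z_def\<close>)
 define S where "S k = (%w. \<Sum>t<n. f (Z (r k) t w))" for k
 have Wn: "W n = (%w. \<Sum>t<n. f (X (real (Suc t)) w))" by (simp add: fun_eq_iff W_def)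
 have VE: "VW n = variance (W n)" by (simp add: VW_def mW_def)
 note lim = normalised_sum_limit[OF f Zm X_meas r S_def Wn, folded VE mW_def]
 have nc: "0 < real n*c^2" using pos by simp
 then have V: "0 < VW n" "real n*(c/2)^2 < VW n" using Vn by (auto simp: power_divide)
 from order_tendstoD(1)[OF lim(1) V(2)] obtain k0 where k0: "!!k. k0 <= k ==> real n*(c/2)^2 < variance (S k)"
 by (auto simp: eventually_sequentially)
 let ?F = "%k w. (S (k + k0) w - expectation (S (k + k0)))/sqrt (variance (S (k + k0)))"
 have Sm: "S k \<in> borel_measurable M" for k
 unfolding S_def by (intro borel_measurable_sum measurable_compose[OF Zm fD(1)])
 show ?thesis
 proof (rule normal_bounds_limit[where F="?F" and D="2*(n*K)/sqrt (real n*(c/2)^2)"])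
 show "?F k \<in> borel_measurable M" for k using Sm by (intro borel_measurable_divide borel_measurable_diff) auto
 show "(%w. (W n w - mW n)/sqrt (VW n)) \<in> borel_measurable M"
 unfolding Wn by (intro borel_measurable_divide borel_measurable_diff borel_measurable_sum measurable_compose[OF X_meas fD(1)]) auto
 show "AE w in M. (%k. ?F k w) ----> (W n w - mW n)/sqrt (VW n)"
 using lim(3)[OF V(1)] by eventually_elim (rule LIMSEQ_ignore_initial_segment)
 show "abs (?F k w) <= 2*(n*K)/sqrt (real n*(c/2)^2)" for k w
 unfolding abs_divide using lim(2)[of "k + k0" w] less_imp_le[OF k0[of "k + k0"]] pos K by (intro frac_le) (auto intro: order.trans[OF _ abs_ge_self])
 show "normal_bounds M (?F k) n p (clt_const (weight_sum rh p) p (K/(c/2)))" for k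
 by (rule noise_clt_simple[OF ph(1)[of "r (k + k0)"] ph(2) ph(3) rh p f K _ pos(2) Z_def[of "r (k + k0)"] S_def])
 (use pos less_imp_le[OF k0[of "k + k0"]] in auto)
 qed
qed

end

section \<open>The fractional Levy noise\<close>

text \<open>Near the origin \<open>\<bar>x\<bar> powr (q - 1 - \<zeta>)\<close> is integrable as \<open>q >
 \<zeta>\<close>, and at infinity \<open>\<bar>x\<bar> powr (q - 3)\<close> is as \<open>q < 2\<close>.\<close>

lemma jump_measure_density:
 assumes \<zeta>: "0 <= \<zeta>" "\<zeta> < q" and q: "1 < q" "q < 2"
 and \<kappa> [measurable]: "\<kappa> \<in> borel_measurable borel" and nn: "!!x. \<kappa> x >= 0"
 and small: "!!x. x \<in> {-1..1} ==> x ~= 0 ==> \<kappa> x <= abs x powr (- 1 - \<zeta>)"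
 and large: "!!x. abs x > 1 ==> \<kappa> x <= abs x powr (- 3)"
 shows "jump_measure (density lborel (%x. ennreal (\<kappa> x))) q"
proof -
 let ?\<nu> = "density lborel (%x. ennreal (\<kappa> x))"
 have sf: "sigma_finite_measure ?\<nu>"
 by (subst sigma_finite_measure.sigma_finite_iff_density_finite[OF sigma_finite_lborel]) auto
 let ?a = "%x. indicator {0..1} x*ennreal (x powr (q - 1 - \<zeta>))" and ?b = "%x. indicator {1..} x*ennreal (x powr (q - 3))"
 have "nn_integral ?\<nu> (%x. ennreal (abs x powr q)) = nn_integral lborel (%x. ennreal (\<kappa> x)*ennreal (abs x powr q))"
 by (rule nn_integral_density) measurable
 also have "... <= nn_integral lborel (%x. (?a x + ?a (0 + (- 1)*x)) + (?b x + ?b (0 + (- 1)*x)))"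
 proof (rule nn_integral_mono)
 fix x :: real
 have e: "ennreal (\<kappa> x)*ennreal (abs x powr q) = ennreal (\<kappa> x * abs x powr q)" by (rule ennreal_mult[symmetric]) (use nn in auto)
 consider "x = 0" | "x ~= 0" "abs x <= 1" | "abs x > 1" by linarith
 then show "ennreal (\<kappa> x)*ennreal (abs x powr q) <= (?a x + ?a (0 + (- 1)*x)) + (?b x + ?b (0 + (- 1)*x))"
 proof cases
 case 2
 have "\<kappa> x * abs x powr q <= abs x powr (- 1 - \<zeta>) * abs x powr q" using small[of x] 2 by (intro mult_right_mono) (auto simp: abs_le_iff)
 also have "... = abs x powr (q - 1 - \<zeta>)" by (simp add: powr_add[symmetric] algebra_simps)
 finally have "ennreal (\<kappa> x)*ennreal (abs x powr q) <= ennreal (abs x powr (q - 1 - \<zeta>))" unfolding e by (rule ennreal_leI)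
 also have "... <= ?a x + ?a (0 + (- 1)*x)" using 2 by (cases "0 <= x") (auto simp: abs_if)
 finally show ?thesis by (rule order.trans) simp
 next
 case 3
 have "\<kappa> x * abs x powr q <= abs x powr (- 3) * abs x powr q" using large[of x] 3 by (intro mult_right_mono) auto
 also have "... = abs x powr (q - 3)" by (simp add: powr_add[symmetric])
 finally have "ennreal (\<kappa> x)*ennreal (abs x powr q) <= ennreal (abs x powr (q - 3))" unfolding e by (rule ennreal_leI)
 also have "... <= ?b x + ?b (0 + (- 1)*x)" using 3 by (cases "0 <= x") (auto simp: abs_if)
 finally show ?thesis by (rule order.trans) simp
 qed simp
 qed
 also have "... = (nn_integral lborel (%x. ?a x) + nn_integral lborel (%x. ?a (0 + (- 1)*x))) + (nn_integral lborel (%x. ?b x) + nn_integral lborel (%x. ?b (0 + (- 1)*x)))"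
 by (subst nn_integral_add, measurable, subst nn_integral_add, measurable, subst nn_integral_add) measurable
 also have "nn_integral lborel (%x. ?a (0 + (- 1)*x)) = nn_integral lborel (%x. ?a x)"
 using nn_integral_real_affine[of ?a "-1" 0] by simp
 also have "nn_integral lborel (%x. ?b (0 + (- 1)*x)) = nn_integral lborel (%x. ?b x)"
 using nn_integral_real_affine[of ?b "-1" 0] by simp
 also have "nn_integral lborel (%x. ?a x) = ennreal (1/(q - 1 - \<zeta> + 1))" by (rule nn_powr_0_1) (use \<zeta> in simp)
 also have "nn_integral lborel (%x. ?b x) = ennreal (- (1/(q - 3 + 1)))" by (rule nn_powr_1_inf) (use q in simp)
 finally have fin: "nn_integral ?\<nu> (%x. ennreal (abs x powr q)) < \<infinity>" by (rule le_less_trans) simp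
 show ?thesis
 by (rule jump_measure.intro[OF sf jump_measure_axioms.intro]) (use q fin in auto)
qed

lemma lipschitz_of_bounded_derivative:
 assumes d: "!!x. (g has_real_derivative g' x) (at x)" and b: "!!x. abs (g' x) <= B"
 shows "abs (g x - g y) <= B * abs (x - y :: real)"
 using field_differentiable_bound[of UNIV g g' B x y] d b by simp

text \<open>For small increments the derivatives bound the differences, for large ones the function itself does; the
 mixed cases of the second difference use the first derivative.\<close>

lemma C2_bounded_smooth_bounded:
 assumes "C2_bounded f"
 obtains K where "0 < K" "smooth_bounded K f"
proof -
 obtain f' f'' where d: "!!x. (f has_real_derivative f' x) (at x)" "!!x. (f' has_real_derivative f'' x) (at x)"
 and b: "bounded (range f)" "bounded (range f')" "bounded (range f'')" using assms unfolding C2_bounded_def by blast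
 obtain B0 where B0: "!!x. abs (f x) <= B0" using b(1) by (auto simp: bounded_iff)
 obtain B1 where B1: "!!x. abs (f' x) <= B1" using b(2) by (auto simp: bounded_iff)
 obtain B2 where B2: "!!x. abs (f'' x) <= B2" using b(3) by (auto simp: bounded_iff)
 have nn: "0 <= B0" "0 <= B1" "0 <= B2" using B0[of 0] B1[of 0] B2[of 0] by linarith+
 define K where "K = 4*B0 + 2*B1 + B2 + 1"
 have l1: "abs (f x - f y) <= B1 * abs (x - y)" for x y by (rule lipschitz_of_bounded_derivative[OF d(1) B1])
 have l2: "abs (f' x - f' y) <= B2 * abs (x - y)" for x y by (rule lipschitz_of_bounded_derivative[OF d(2) B2])
 have l3: "abs (f z - f (z + u) - (f (z + v) - f (z + u + v))) <= B2 * abs v * abs u" for z u v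
 proof -
 have "((%x. f x - f (x + v)) has_real_derivative f' x - f' (x + v)) (at x)" for x
 by (intro DERIV_diff d(1) DERIV_shift[THEN iffD1, OF d(1)])
 moreover have "abs (f' x - f' (x + v)) <= B2 * abs v" for x using l2[of x "x + v"] by simp
 ultimately have "abs ((f z - f (z + v)) - (f (z + u) - f (z + u + v))) <= B2 * abs v * abs (z - (z + u))"
 by (rule lipschitz_of_bounded_derivative)
 moreover have "f z - f (z + u) - (f (z + v) - f (z + u + v)) = (f z - f (z + v)) - (f (z + u) - f (z + u + v))" by simp
 ultimately show ?thesis by simp
 qed
 have s: "smooth_bounded K f"
 unfolding smooth_bounded_def
 proof (intro conjI allI)
 show "continuous_on UNIV f" using d(1) by (intro continuous_at_imp_continuous_on) (auto intro: DERIV_isCont)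
 show "abs (f u) <= K" for u using B0[of u] nn by (simp add: K_def)
 show "abs (f u - f v) <= K*min 1 (abs (u - v))" for u v
 proof (cases "abs (u - v) <= 1")
 case True
 have "B1 * abs (u - v) <= K * abs (u - v)" using nn by (intro mult_right_mono) (auto simp: K_def)
 then show ?thesis using True l1[of u v] by simp
 next
 case False then show ?thesis using B0[of u] B0[of v] nn by (simp add: K_def)
 qed
 fix z u v
 let ?D = "abs (f z - f (z + u) - (f (z + v) - f (z + u + v)))"
 have D0: "?D <= 4*B0" using B0[of z] B0[of "z + u"] B0[of "z + v"] B0[of "z + u + v"] by linarith
 have Du: "?D <= 2*B1 * abs u" using l1[of z "z + u"] l1[of "z + v" "z + u + v"] by (simp add: algebra_simps)
 have Dv: "?D <= 2*B1 * abs v" using l1[of z "z + v"] l1[of "z + u" "z + u + v"] by (simp add: algebra_simps)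
 have up: "c*x <= K*x" if "c <= K" "0 <= x" for c x using that by (rule mult_right_mono)
 have K: "4*B0 <= K" "2*B1 <= K" "B2 <= K" using nn by (auto simp: K_def)
 show "?D <= K*(min 1 (abs u)*min 1 (abs v))"
 proof (cases "abs u <= 1"; cases "abs v <= 1")
 assume "abs u <= 1" "abs v <= 1"
 then show ?thesis using l3[of z u v] up[OF K(3), of "abs u * abs v"] by (simp add: mult_ac)
 next
 assume "abs u <= 1" "\<not> abs v <= 1"
 then show ?thesis using Du up[OF K(2), of "abs u"] by simp
 next
 assume "\<not> abs u <= 1" "abs v <= 1"
 then show ?thesis using Dv up[OF K(2), of "abs v"] by simp
 next
 assume "\<not> abs u <= 1" "\<not> abs v <= 1"
 then show ?thesis using D0 K(1) by simp
 qed
 qed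
 have "0 < K" using nn by (simp add: K_def)
 from this s show thesis by (rule that)
qed

lemma distributed_gauss_cdf:
 assumes Z: "distributed N lborel Z gauss"
 shows "(LINT w|N. indicator {..x} (Z w)) = 1 - upper_tail gauss x"
proof -
 have "(LINT w|N. indicator {..x} (Z w)) = (LINT z|lborel. gauss z*indicator {..x} z)"
 by (rule distributed_integral[OF Z, symmetric]) auto
 then show ?thesis using upper_tail_gauss_complement[of x] by (simp add: mult.commute)
qed

lemma wasserstein_dist_le:
 assumes Z: "distributed N lborel Z gauss"
 and b: "wasserstein_le M F B"
 shows "wasserstein_dist M F N Z <= ennreal B"
 unfolding wasserstein_dist_def
proof (rule SUP_least)
 fix h :: "real => real" assume "h \<in> {h. 1-lipschitz_on UNIV h}"
 then have h: "1-lipschitz_on UNIV h" by simp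
 then have lip: "abs (h x - h y) <= abs (x - y)" for x y by (auto simp: lipschitz_on_def dist_real_def)
 have "h \<in> borel_measurable borel" using lipschitz_on_continuous_on[OF h] by (rule borel_measurable_continuous_onI)
 then have "(LINT x|lborel. gauss x*h x) = (LINT w|N. h (Z w))" by (intro distributed_integral[OF Z]) auto
 then have "(LINT w|N. h (Z w)) = gauss_mean h" by (simp add: mult.commute)
 then show "ennreal (abs ((LINT w|M. h (F w)) - (LINT w|N. h (Z w)))) <= ennreal B" using b lip by (intro ennreal_leI) (simp add: wasserstein_le_def)
qed

lemma measure_le_eq_integral:
 assumes "prob_space M" and [measurable]: "F \<in> borel_measurable M"
 shows "measure M {w \<in> space M. F w <= x} = (LINT w|M. indicator {..x} (F w))"
proof -
 have "(LINT w|M. indicator {..x} (F w)) = (LINT w|M. indicator {w \<in> space M. F w <= x} w :: real)"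
 by (rule bochner_cong) (auto simp: indicator_def)
 moreover have "{w \<in> space M. F w <= x} \<inter> space M = {w \<in> space M. F w <= x}" by auto
 ultimately show ?thesis by simp
qed

lemma kolmogorov_dist_le:
 assumes M: "prob_space M" "F \<in> borel_measurable M" and N: "prob_space N" and Z: "distributed N lborel Z gauss"
 and b: "kolmogorov_le M F B"
 shows "kolmogorov_dist M F N Z <= B"
proof -
 have Zm: "Z \<in> borel_measurable N" using distributed_measurable[OF Z] by simp
 show ?thesis
 unfolding kolmogorov_dist_def measure_le_eq_integral[OF M] measure_le_eq_integral[OF N Zm] distributed_gauss_cdf[OF Z]
 using b by (intro cSUP_least) (auto simp: kolmogorov_le_def)
qed

text \<open>An exponent \<open>q < 2\<close> above \<open>1\<close>, \<open>\<zeta>\<close> and \<open>p / (1 +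
 \<rho>)\<close> exists because \<open>p < 2 + 2 * \<rho>\<close>. It provides the moments of the jump
 measure as well as summable weights.\<close>

lemma normal_approximation_rate:
 fixes M :: "'a measure" and L Y X :: "real => 'a => real" and V :: "nat => 'a => real" and v :: "nat => real"
 assumes \<zeta>: "0 <= \<zeta>" "\<zeta> < 2" and \<rho>: "0 < \<rho>"
 and L: "two_sided_levy_process M L"
 and mean_zero: "!!t. integrable M (L t) & (LINT w|M. L t w) = 0"
 and \<kappa>: "\<kappa> \<in> borel_measurable borel" "!!x. \<kappa> x >= 0"
 and triplet: "has_levy_triplet M L b 0 (density lborel (%x. ennreal (\<kappa> x)))"
 and \<kappa>_small: "!!x. x \<in> {-1..1} ==> x ~= 0 ==> \<kappa> x <= abs x powr (- 1 - \<zeta>)"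
 and \<kappa>_large: "!!x. abs x > 1 ==> \<kappa> x <= abs x powr (- 3)"
 and Y: "linear_fractional_levy_motion M L \<rho> Y"
 and X: "!!t w. X t w = Y t w - Y (t - 1) w"
 and f: "C2_bounded f"
 and V: "!!n w. V n w =
 real n powr (- 1/2)*(\<Sum>t = 1..n. (f (X (real t) w) - (LINT w'|M. f (X 1 w'))))"
 and v: "!!n. v n = sqrt (prob_space.variance M (V n))"
 and v2_pos: "(\<Sum>\<^sub>\<infinity>j \<in> (UNIV :: int set).
 covariance M (%w. f (X 0 w)) (%w. f (X (of_int j) w))) > 0"
 and p: "2 <= p" "p < 2 + 2*\<rho>"
 shows "\<exists>C. \<forall>n\<ge>1. 0 < v n --> (%w. inverse (v n)*V n w) \<in> borel_measurable M & normal_bounds M (%w. inverse (v n)*V n w) n p C"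
proof -
 interpret prob_space M using L by (simp add: two_sided_levy_process_def)
 let ?\<nu> = "density lborel (%x. ennreal (\<kappa> x))"
 obtain K where K: "0 < K" "smooth_bounded K f" using C2_bounded_smooth_bounded[OF f] .
 have "max (max 1 \<zeta>) (p/(1 + \<rho>)) < 2" using \<zeta> p \<rho> by (simp add: field_simps)
 then obtain q where q: "max (max 1 \<zeta>) (p/(1 + \<rho>)) < q" "q < 2" using dense by blast
 have q1: "1 < q" "\<zeta> < q" "p < (1 + \<rho>) * q" using q \<rho> by (auto simp: field_simps)
 interpret J: jump_measure ?\<nu> q
 by (rule jump_measure_density[OF \<zeta>(1) q1(2,1) q(2) \<kappa> \<kappa>_small \<kappa>_large])
 have char0: "char (distr M borel (L 1)) u = exp (\<i> * of_real (u*(b + (LINT x|?\<nu>. x*indicator (- {-1..1}) x))) + J.ps u)" for u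
 using triplet unfolding has_levy_triplet_def J.levy_exponent_eq by simp
 have Lm: "L 1 \<in> borel_measurable M" using L by (simp add: two_sided_levy_process_def)
 have "b + (LINT x|?\<nu>. x*indicator (- {-1..1}) x) = 0"
 by (rule J.centred_exponent[OF prob_space_axioms Lm _ _ char0]) (use mean_zero in auto)
 then have char1: "char (distr M borel (L 1)) u = exp (J.ps u)" for u using char0[of u] by simp
 define Kps where "Kps = J.Mq*enn2real (frac_int q Th)"
 have Kps: "0 <= Kps" using J.Mq_nonneg by (simp add: Kps_def)
 have fr: "frac_int q (%u. norm (J.ps (u*y))) <= ennreal (Kps * abs y powr q)" for y
 proof -
 obtain c where c: "frac_int q Th = ennreal c" "0 <= c"
 using frac_int_Theta_finite[OF q1(1) q(2)] by (cases "frac_int q Th") auto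
 have "ennreal (abs y powr q)*(ennreal J.Mq*frac_int q Th) = ennreal (Kps * abs y powr q)"
 using c J.Mq_nonneg by (simp add: Kps_def ennreal_mult[symmetric] mult_ac)
 then show ?thesis using J.frac_int_psi[of y] by simp
 qed
 have ln: "levy_noise M L J.ps q Kps"
 by (rule levy_noise.intro[OF prob_space_axioms levy_noise_axioms.intro[OF L char1 J.psi_continuous J.psi_0 q1(1) q(2) Kps fr]])
 obtain La where Lam: "levy_random_measure M L La"
 using Y unfolding linear_fractional_levy_motion_def has_levy_integral_def by blast
 interpret FN: fractional_noise M L J.ps q Kps La \<rho> Y f K
 by (rule fractional_noise.intro[OF levy_noise_measure.intro[OF ln levy_noise_measure_axioms.intro[OF Lam]] fractional_noise_axioms.intro[OF Y \<rho> K(2,1)]])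
 have XF: "X = FN.X" by (simp add: fun_eq_iff X FN.X_def)
 have Vn: "V n w = real n powr (- 1/2)*(FN.W n w - FN.mW n)" for n w
 proof -
 have "(\<Sum>t = 1..n. (f (X (real t) w) - (LINT w'|M. f (X 1 w')))) = (\<Sum>t<n. f (X (real (Suc t)) w) - (LINT w'|M. f (X 1 w')))"
 using sum.atLeast1_atMost_eq[of "%t. f (X (real t) w) - (LINT w'|M. f (X 1 w'))" n] by simp
 also have "... = FN.W n w - FN.mW n" by (simp add: sum_subtractf FN.W_def FN.mW XF)
 finally show ?thesis by (simp add: V)
 qed
 have Wi: "integrable M (FN.W n)" for n
 unfolding FN.W_def[abs_def] by (intro bochner_int_sum FN.fX_int)
 have Vm: "V n \<in> borel_measurable M" for n
 proof -
 have "FN.W n \<in> borel_measurable M" using Wi by (rule borel_measurable_integrable)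
 then show ?thesis unfolding Vn[abs_def] by measurable
 qed
 have vn: "v n = sqrt (FN.VW n/real n)" for n
 proof -
 have EV: "(LINT w|M. V n w) = 0"
 unfolding Vn using Wi by (simp add: prob_space FN.mW_def)
 have "variance (V n) = (LINT w|M. (V n w)^2)" by (simp add: EV)
 also have "... = (LINT w|M. (real n powr (- 1/2))^2*(FN.W n w - FN.mW n)^2)"
 unfolding Vn power_mult_distrib ..
 also have "... = (real n powr (- 1/2))^2*FN.VW n" unfolding FN.VW_def by simp
 also have "(real n powr (- 1/2))^2 = 1/real n"
 by (cases "n = 0") (auto simp: power2_eq_square powr_add[symmetric] powr_minus_divide)
 finally show ?thesis unfolding v by simp
 qed
 obtain c where c: "0 < c" "!!n. 0 < FN.VW n ==> real n*c^2 <= FN.VW n"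
 using FN.variance_lower v2_pos unfolding FN.\<gamma>_def XF by blast
 show ?thesis
 proof (intro exI allI impI conjI)
 fix n :: nat assume n: "1 <= n" and vpos: "0 < v n"
 have n0: "0 < n" using n by simp
 have VW: "0 < FN.VW n" using vpos n unfolding vn by (simp add: zero_less_divide_iff)
 have Fe: "inverse (v n)*V n w = (FN.W n w - FN.mW n)/sqrt (FN.VW n)" for w
 proof -
 have "real n powr (- 1/2) = 1/sqrt (real n)" by (simp add: powr_minus_divide powr_half_sqrt)
 then show ?thesis using n VW unfolding vn Vn by (simp only: real_sqrt_divide) simp
 qed
 show "(%w. inverse (v n)*V n w) \<in> borel_measurable M" using Vm[of n] by measurable
 show "normal_bounds M (%w. inverse (v n)*V n w) n p (clt_const (FN.weight_sum \<rho> p) p (K/(c/2)))"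
 unfolding Fe by (rule FN.noise_clt[OF p(1) q1(3) c(1) n0 c(2)[OF VW]])
 qed
qed

theorem corollary1p4:
 fixes M :: "'a measure" and N :: "'b measure"
 and L Y X :: "real \<Rightarrow> 'a \<Rightarrow> real" and Z :: "'b \<Rightarrow> real"
 and \<zeta> \<rho> b :: real and \<kappa> f :: "real \<Rightarrow> real"
 and V :: "nat \<Rightarrow> 'a \<Rightarrow> real" and v :: "nat \<Rightarrow> real"
 assumes \<zeta>: "0 \<le> \<zeta>" "\<zeta> < 2"
 and \<rho>: "0 < \<rho>" "\<zeta> > 0 \<longrightarrow> \<rho> < 1 / \<zeta>"
 and L: "two_sided_levy_process M L"
 and mean_zero: "\<And>t. integrable M (L t) \<and> (\<integral>\<omega>. L t \<omega> \<partial>M) = 0"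
 and \<kappa>: "\<kappa> \<in> borel_measurable borel" "\<And>x. \<kappa> x \<ge> 0"
 and triplet: "has_levy_triplet M L b 0 (density lborel (\<lambda>x. ennreal (\<kappa> x)))"
 and \<kappa>_small: "\<And>x. x \<in> {-1..1} \<Longrightarrow> x \<noteq> 0 \<Longrightarrow> \<kappa> x \<le> \<bar>x\<bar> powr (- 1 - \<zeta>)"
 and \<kappa>_large: "\<And>x. \<bar>x\<bar> > 1 \<Longrightarrow> \<kappa> x \<le> \<bar>x\<bar> powr (- 3)"
 and Y: "linear_fractional_levy_motion M L \<rho> Y"
 and X: "\<And>t \<omega>. X t \<omega> = Y t \<omega> - Y (t - 1) \<omega>"
 and f: "C2_bounded f"
 and V: "\<And>n \<omega>. V n \<omega> =
 real n powr (- 1 / 2) * (\<Sum>t = 1..n. (f (X (real t) \<omega>) - (\<integral>\<omega>'. f (X 1 \<omega>') \<partial>M)))"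
 and v: "\<And>n. v n = sqrt (prob_space.variance M (V n))"
 and v2_pos: "(\<Sum>\<^sub>\<infinity>j \<in> (UNIV :: int set).
 covariance M (\<lambda>\<omega>. f (X 0 \<omega>)) (\<lambda>\<omega>. f (X (of_int j) \<omega>))) > 0"
 and N: "prob_space N"
 and Z: "distributed N lborel Z std_normal_density"
 shows "\<forall>\<epsilon>>0. \<exists>C>0. \<forall>n::nat. n \<ge> 1 \<and> v n > 0 \<longrightarrow>
 wasserstein_dist M (\<lambda>\<omega>. inverse (v n) * V n \<omega>) N Z
 \<le> ennreal (C * (if \<rho> > 1 / 2 then real n powr (- 1 / 2)
 else real n powr (- \<rho> + \<epsilon>))) \<and>
 kolmogorov_dist M (\<lambda>\<omega>. inverse (v n) * V n \<omega>) N Z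
 \<le> C * (if \<rho> > 1 then real n powr (- 1 / 2)
 else real n powr (- \<rho> / 2 + \<epsilon>))"
proof (intro allI impI)
 fix \<epsilon> :: real assume \<epsilon>: "0 < \<epsilon>"
 interpret prob_space M using L by (simp add: two_sided_levy_process_def)
 let ?F = "%n w. inverse (v n)*V n w"
 have rate: "\<exists>C. \<forall>n\<ge>1. 0 < v n --> ?F n \<in> borel_measurable M & normal_bounds M (?F n) n p C" if p: "2 <= p" "p < 2 + 2*\<rho>" for p
 by (rule normal_approximation_rate[OF \<zeta> \<rho>(1) L mean_zero \<kappa> triplet _ _ Y X f V v v2_pos p]) (fact \<kappa>_small \<kappa>_large)+
 have mono: "C*real n powr a <= abs C*real n powr a'" if "1 <= n" "a <= a'" for C a a' and n :: nat
 proof -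
 have "C*real n powr a <= abs C*real n powr a" by (rule mult_right_mono) auto
 also have "... <= abs C*real n powr a'" using that by (intro mult_left_mono powr_mono) auto
 finally show ?thesis .
 qed
 let ?rW = "%n::nat. if \<rho> > 1/2 then real n powr (- 1/2) else real n powr (- \<rho> + \<epsilon>)"
 let ?rK = "%n::nat. if \<rho> > 1 then real n powr (- 1/2) else real n powr (- \<rho>/2 + \<epsilon>)"
 obtain CW where CW: "0 <= CW" "!!n. 1 <= n ==> 0 < v n ==> wasserstein_dist M (?F n) N Z <= ennreal (CW*?rW n)"
 proof -
 \<comment> \<open>the largest admissible exponent is \<open>3\<close> or just below \<open>2 + 2 * \<rho>\<close>; the minimum with \<open>\<rho> / 2\<close> keeps \<open>p \<ge> 2\<close>\<close>
 define p where "p = (if \<rho> > 1/2 then 3 else 2 + 2*\<rho> - 2*min \<epsilon> (\<rho>/2))"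
 have p: "2 <= p" "p < 2 + 2*\<rho>" "p <= 3" using \<rho>(1) \<epsilon> by (auto simp: p_def min_def)
 obtain C where C: "!!n. 1 <= n ==> 0 < v n ==> wasserstein_le M (?F n) (C*real n powr (1 - p/2))"
 using rate[OF p(1,2)] p(3) unfolding normal_bounds_def by meson
 have "wasserstein_dist M (?F n) N Z <= ennreal (abs C*?rW n)" if n: "1 <= n" "0 < v n" for n
 proof -
 have "wasserstein_dist M (?F n) N Z <= ennreal (C*real n powr (1 - p/2))"
 by (rule wasserstein_dist_le[OF Z C[OF n]])
 also have "C*real n powr (1 - p/2) <= abs C*?rW n"
 proof (cases "\<rho> > 1/2")
 case True then show ?thesis using mono[OF n(1), of "1 - p/2" "- 1/2" C] by (simp add: p_def)
 next
 case False then show ?thesis using mono[OF n(1), of "1 - p/2" "- \<rho> + \<epsilon>" C] by (simp add: p_def field_simps)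
 qed
 finally show ?thesis by (simp add: ennreal_leI)
 qed
 then show thesis by (intro that[of "abs C"]) auto
 qed
 obtain CK where CK: "0 <= CK" "!!n. 1 <= n ==> 0 < v n ==> kolmogorov_dist M (?F n) N Z <= CK*?rK n"
 proof (cases "\<rho> > 1/2")
 case True
 \<comment> \<open>the loss in the exponent is a quarter of that in \<open>p\<close>; the minimum keeps \<open>p \<ge> 3\<close>\<close>
 define p where "p = (if \<rho> > 1 then 4 else 2 + 2*\<rho> - 4*min \<epsilon> ((\<rho> - 1/2)/4))"
 have p: "2 <= p" "p < 2 + 2*\<rho>" "3 <= p" "p <= 4" using \<rho>(1) \<epsilon> True by (auto simp: p_def min_def field_simps)
 obtain C where C: "!!n. 1 <= n ==> 0 < v n ==> kolmogorov_le M (?F n) (C*real n powr (- (p - 2)/4))"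
 and Fm: "!!n. 1 <= n ==> 0 < v n ==> ?F n \<in> borel_measurable M"
 using rate[OF p(1,2)] p(3,4) unfolding normal_bounds_def by meson
 have "kolmogorov_dist M (?F n) N Z <= abs C*?rK n" if n: "1 <= n" "0 < v n" for n
 proof -
 have "kolmogorov_dist M (?F n) N Z <= C*real n powr (- (p - 2)/4)"
 by (rule kolmogorov_dist_le[OF prob_space_axioms Fm[OF n] N Z C[OF n]])
 also have "C*real n powr (- (p - 2)/4) <= abs C*?rK n"
 proof (cases "\<rho> > 1")
 case True then show ?thesis using mono[OF n(1), of "- (p - 2)/4" "- 1/2" C] by (simp add: p_def)
 next
 case False then show ?thesis using mono[OF n(1), of "- (p - 2)/4" "- \<rho>/2 + \<epsilon>" C] by (simp add: p_def field_simps)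
 qed
 finally show ?thesis .
 qed
 then show thesis by (intro that[of "abs C"]) auto
 next
 case False
 define e where "e = min \<epsilon> (\<rho>/2)"
 have e: "0 < e" "e <= \<epsilon>" "e <= \<rho>/2" using \<epsilon> \<rho>(1) by (auto simp: e_def)
 define p where "p = 2 + 2*\<rho> - 2*e"
 have p: "2 <= p" "p < 2 + 2*\<rho>" "p <= 3" using \<rho>(1) e False by (auto simp: p_def)
 obtain C where C: "!!n. 1 <= n ==> 0 < v n ==> wasserstein_le M (?F n) (C*real n powr (1 - p/2))"
 and Fm: "!!n. 1 <= n ==> 0 < v n ==> ?F n \<in> borel_measurable M"
 using rate[OF p(1,2)] p(3) unfolding normal_bounds_def by meson
 have "kolmogorov_dist M (?F n) N Z <= (abs C + 1)*?rK n" if n: "1 <= n" "0 < v n" for n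
 proof -
 \<comment> \<open>the width that balances \<open>d\<close> with the Wasserstein rate \<open>d * d\<close> divided by \<open>d\<close>\<close>
 define d where "d = real n powr ((- \<rho> + e)/2)"
 have d: "0 < d" using n by (simp add: d_def)
 have "1 - p/2 = (- \<rho> + e)/2 + (- \<rho> + e)/2" by (simp add: p_def field_simps)
 then have d2: "real n powr (1 - p/2) = d*d" unfolding d_def by (simp only: powr_add)
 have "kolmogorov_dist M (?F n) N Z <= C*real n powr (1 - p/2)/d + d"
 by (rule kolmogorov_dist_le[OF prob_space_axioms Fm[OF n] N Z kolmogorov_le_wasserstein[OF Fm[OF n] d C[OF n]]])
 also have "... = (C + 1)*d" unfolding d2 using d by (simp add: field_simps)
 also have "... <= (abs C + 1)*d" using d by (intro mult_right_mono) auto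
 also have "... <= (abs C + 1)*real n powr (- \<rho>/2 + \<epsilon>)"
 unfolding d_def using n e by (intro mult_left_mono powr_mono) (auto simp: field_simps)
 finally show ?thesis using False by simp
 qed
 then show thesis by (intro that[of "abs C + 1"]) auto
 qed
 have rn: "0 <= ?rW n" "0 <= ?rK n" for n by auto
 show "\<exists>C>0. \<forall>n::nat. n >= 1 & v n > 0 -->
 wasserstein_dist M (?F n) N Z <= ennreal (C*?rW n) & kolmogorov_dist M (?F n) N Z <= C*?rK n"
 proof (intro exI[of _ "CW + CK + 1"] conjI allI impI)
 show "0 < CW + CK + 1" using CW(1) CK(1) by simp
 fix n :: nat assume n: "1 <= n & 0 < v n"
 have "CW*?rW n <= (CW + CK + 1)*?rW n" using CK(1) rn by (intro mult_right_mono) auto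
 then show "wasserstein_dist M (?F n) N Z <= ennreal ((CW + CK + 1)*?rW n)"
 using CW(2)[of n] n by (meson ennreal_leI order.trans)
 have "CK*?rK n <= (CW + CK + 1)*?rK n" using CW(1) rn by (intro mult_right_mono) auto
 then show "kolmogorov_dist M (?F n) N Z <= (CW + CK + 1)*?rK n"
 using CK(2)[of n] n by linarith
 qed
qed

end
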